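(* Let $d\geq 3$ and let $V\geq 0$ be a locally integrable function on $\mathbb R^d$ such that $$\Delta^{-1}V(x)=-c_d\int_{\mathbb R^d}\frac{V(y)}{|x-y|^{d-2}}\,dy\in L^\infty(\mathbb R^d).$$ Let $L=-\Delta+V$. Then the mapping $f\mapsto (-\Delta)^{1/2}L^{-1/2}f$ is an isomorphism of $H^1_L$ onto the classical Hardy space $H^1(\mathbb R^d)$, with inverse $L^{1/2}(-\Delta)^{-1/2}$; that is, there is a constant $C>0$ such that $$\|(-\Delta)^{1/2}L^{-1/2}f\|_{H^1(\mathbb R^d)}\leq C\|f\|_{H^1_L}\quad\text{for } f\in H^1_L,$$ $$\|L^{1/2}(-\Delta)^{-1/2}f\|_{H^1_L}\leq C\|f\|_{H^1(\mathbb R^d)}\quad\text{for } f\in H^1(\mathbb R^d).$$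
   Context: $c_d>0$ is the constant for which $\int_0^\infty P_t(x)\,dt=c_d|x|^{2-d}$, where $P_t(x)=(4\pi t)^{-d/2}e^{-|x|^2/4t}$ is the heat kernel. $\{K_t\}_{t>0}$ denotes the semigroup generated by $-L=\Delta-V$, with integral kernels $K_t(x,y)$, $0\le K_t(x,y)\le P_t(x-y)$. The Hardy space $H^1_L$ is the set of $f\in L^1(\mathbb R^d)$ such that $\mathcal M_Lf(x)=\sup_{t>0}|K_tf(x)|$ belongs to $L^1(\mathbb R^d)$, with norm $\|f\|_{H^1_L}=\|\mathcal M_Lf\|_{L^1}$. The operators are defined by $L^{-1/2}f=c_1\int_0^\infty K_tf\,\frac{dt}{\sqrt t}$, $(-\Delta)^{-1/2}f=c_1\int_0^\infty P_tf\,\frac{dt}{\sqrt t}$ with $c_1=\Gamma(1/2)^{-1}$, and (in the sense of distributions) $(-\Delta)^{1/2}f=c_2\int_0^\infty(P_tf-f)\frac{dt}{t^{3/2}}$, $L^{1/2}f=c_2\int_0^\infty (K_tf-f)\frac{dt}{t^{3/2}}$ with $c_2=\Gamma(-1/2)^{-1}$; the compositions $(-\Delta)^{1/2}L^{-1/2}$ and $L^{1/2}(-\Delta)^{-1/2}$ extend to bounded operators on $L^1(\mathbb R^d)$. *)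

theory Defs
  imports "HOL-Analysis.Analysis"
begin

definition heat :: "real \<Rightarrow> 'a::euclidean_space \<Rightarrow> real" where
  "heat t x = (4 * pi * t) powr (- real DIM('a) / 2) * exp (- (norm x)\<^sup>2 / (4 * t))"

text \<open>c_d with int_0^infty P_t(x) dt = c_d |x|^(2-d); explicitly Gamma(d/2-1)/(4 pi^(d/2)).\<close>
definition c_dim :: "'a::euclidean_space itself \<Rightarrow> real" where
  "c_dim _ = Gamma (real DIM('a) / 2 - 1) / (4 * pi powr (real DIM('a) / 2))"

definition c1 :: real where "c1 = inverse (Gamma (1/2))"
definition c2 :: real where "c2 = inverse (Gamma (-1/2))"

text \<open>For a bounded potential W >= 0, the kernel of exp(t(Delta - W)) is the unique measurable
  solution of the Duhamel equation with 0 <= K_t(x,y) <= P_t(x-y).\<close>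
definition duhamel_kernel :: "('a::euclidean_space \<Rightarrow> real) \<Rightarrow> (real \<Rightarrow> 'a \<Rightarrow> 'a \<Rightarrow> real) \<Rightarrow> bool" where
  "duhamel_kernel W K \<longleftrightarrow>
     (\<forall>t x y. t \<le> 0 \<longrightarrow> K t x y = 0) \<and>
     (\<forall>y. (\<lambda>p. K (fst p) (snd p) y) \<in> borel_measurable (borel :: (real \<times> 'a) measure)) \<and>
     (\<forall>t>0. \<forall>x y. 0 \<le> K t x y \<and> K t x y \<le> heat t (x - y) \<and>
        K t x y = heat t (x - y)
          - (LINT s:{0<..<t}|lborel. LINT z|lborel. heat (t - s) (x - z) * W z * K s z y))"

definition bdd_schr_kernel :: "('a::euclidean_space \<Rightarrow> real) \<Rightarrow> real \<Rightarrow> 'a \<Rightarrow> 'a \<Rightarrow> real" where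
  "bdd_schr_kernel W = (THE K. duhamel_kernel W K)"

text \<open>For V >= 0 locally integrable, K_t(x,y) of the semigroup generated by Delta - V is the
  (monotone) limit of the kernels for the truncated potentials min(V,n).\<close>
definition schr_kernel :: "('a::euclidean_space \<Rightarrow> real) \<Rightarrow> real \<Rightarrow> 'a \<Rightarrow> 'a \<Rightarrow> real" where
  "schr_kernel V t x y = lim (\<lambda>n. bdd_schr_kernel (\<lambda>z. min (V z) (real n)) t x y)"

definition heat_kernel :: "real \<Rightarrow> 'a::euclidean_space \<Rightarrow> 'a \<Rightarrow> real" where
  "heat_kernel t x y = heat t (x - y)"

definition kop :: "(real \<Rightarrow> 'a::euclidean_space \<Rightarrow> 'a \<Rightarrow> real) \<Rightarrow> real \<Rightarrow> ('a \<Rightarrow> real) \<Rightarrow> 'a \<Rightarrow> real" where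
  "kop k t f x = (LINT y|lborel. k t x y * f y)"

definition max_fun :: "(real \<Rightarrow> 'a::euclidean_space \<Rightarrow> 'a \<Rightarrow> real) \<Rightarrow> ('a \<Rightarrow> real) \<Rightarrow> 'a \<Rightarrow> ennreal" where
  "max_fun k f x = (SUP t\<in>{0<..}. ennreal \<bar>kop k t f x\<bar>)"

definition hardy_norm :: "(real \<Rightarrow> 'a::euclidean_space \<Rightarrow> 'a \<Rightarrow> real) \<Rightarrow> ('a \<Rightarrow> real) \<Rightarrow> ennreal" where
  "hardy_norm k f = (\<integral>\<^sup>+ x. max_fun k f x \<partial>lborel)"

definition hardy_space :: "(real \<Rightarrow> 'a::euclidean_space \<Rightarrow> 'a \<Rightarrow> real) \<Rightarrow> ('a \<Rightarrow> real) set" where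
  "hardy_space k = {f. integrable lborel f \<and> hardy_norm k f < \<infinity>}"

abbreviation H1L where "H1L V \<equiv> hardy_space (schr_kernel V)"
abbreviation H1 where "H1 \<equiv> hardy_space heat_kernel"

fun iter_deriv :: "'a::euclidean_space list \<Rightarrow> ('a \<Rightarrow> real) \<Rightarrow> 'a \<Rightarrow> real" where
  "iter_deriv [] f = f"
| "iter_deriv (v # vs) f = (\<lambda>x. frechet_derivative (iter_deriv vs f) (at x) v)"

definition smooth_fun :: "('a::euclidean_space \<Rightarrow> real) \<Rightarrow> bool" where
  "smooth_fun f \<longleftrightarrow> (\<forall>vs x. iter_deriv vs f differentiable (at x))"

definition test_fun :: "('a::euclidean_space \<Rightarrow> real) \<Rightarrow> bool" where
  "test_fun \<phi> \<longleftrightarrow> smooth_fun \<phi> \<and> compact (closure {x. \<phi> x \<noteq> 0})"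

definition represents :: "(('a::euclidean_space \<Rightarrow> real) \<Rightarrow> real) \<Rightarrow> ('a \<Rightarrow> real) \<Rightarrow> bool" where
  "represents \<Lambda> h \<longleftrightarrow> (\<forall>\<phi>. test_fun \<phi> \<longrightarrow> (LINT x|lborel. h x * \<phi> x) = \<Lambda> \<phi>)"

definition neg_half :: "(real \<Rightarrow> 'a::euclidean_space \<Rightarrow> 'a \<Rightarrow> real) \<Rightarrow> ('a \<Rightarrow> real) \<Rightarrow> 'a \<Rightarrow> real" where
  "neg_half k f x = c1 * (LINT t:{0<..}|lborel. kop k t f x / sqrt t)"

definition pos_half_distr :: "(real \<Rightarrow> 'a::euclidean_space \<Rightarrow> 'a \<Rightarrow> real) \<Rightarrow> ('a \<Rightarrow> real) \<Rightarrow> ('a \<Rightarrow> real) \<Rightarrow> real" where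
  "pos_half_distr k g \<phi> =
     c2 * (LINT t:{0<..}|lborel. (LINT x|lborel. (kop k t g x - g x) * \<phi> x) / t powr (3/2))"

text \<open>The composition k1^(1/2) k2^(-1/2), defined on test functions f (as an L^1 function
  representing the distribution) and extended to L^1 by continuity.\<close>
definition comp_op :: "(real \<Rightarrow> 'a::euclidean_space \<Rightarrow> 'a \<Rightarrow> real) \<Rightarrow> (real \<Rightarrow> 'a \<Rightarrow> 'a \<Rightarrow> real)
                        \<Rightarrow> ('a \<Rightarrow> real) \<Rightarrow> 'a \<Rightarrow> real" where
  "comp_op k1 k2 f = (SOME h. integrable lborel h \<and>
     (\<exists>fs hs. (\<forall>n. test_fun (fs n) \<and> integrable lborel (hs n) \<and>
                    represents (pos_half_distr k1 (neg_half k2 (fs n))) (hs n)) \<and>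
             (\<lambda>n. LINT x|lborel. \<bar>fs n x - f x\<bar>) \<longlonglongrightarrow> 0 \<and>
             (\<lambda>n. LINT x|lborel. \<bar>hs n x - h x\<bar>) \<longlonglongrightarrow> 0))"

definition RL :: "('a::euclidean_space \<Rightarrow> real) \<Rightarrow> ('a \<Rightarrow> real) \<Rightarrow> 'a \<Rightarrow> real" where
  "RL V = comp_op heat_kernel (schr_kernel V)"

definition LR :: "('a::euclidean_space \<Rightarrow> real) \<Rightarrow> ('a \<Rightarrow> real) \<Rightarrow> 'a \<Rightarrow> real" where
  "LR V = comp_op (schr_kernel V) heat_kernel"

end

theory Submission
 imports Defs "HOL-Probability.Distributions" "HOL-Real_Asymp.Real_Asymp"
begin

text \<open>Let \<open>P\<close> and \<open>K\<close> be the heat and Schroedinger semigroups, \<open>k(s,v) = (v/s)\<^bsup>1/2\<^esup> / (\<pi> (s + v))\<close> (this is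
 \<open>kw\<close>) and \<open>T(A,B) = \<integral>\<integral> k(s,v) A\<^sub>s V B\<^sub>v ds dv\<close> (\<open>TT A B\<close>). Duhamel's formula \<open>P = K + PVK = K + KVP\<close> turns
 the definitions of the square roots into \<open>(-\<Delta>)\<^bsup>1/2\<^esup>L\<^bsup>-1/2\<^esup> = I - T(P,K)\<close> and \<open>L\<^bsup>1/2\<^esup>(-\<Delta>)\<^bsup>-1/2\<^esup> = I + T(K,P)\<close>.
 Both kernels have bounded column integrals, since \<open>\<integral> k(s,v) ds = 1\<close> and the Newton potential of \<open>V\<close> is
 bounded. The operators are inverse to each other by
 \<open>\<integral>\<^sub>0\<^sup>b k(a,v) k(b-v,c) dv = k(a,b+c) - k(a+b,c)\<close> and the semigroup property. The difference
 \<open>P\<^sub>t (I - T(P,K)) - K\<^sub>t\<close> is dominated, for all \<open>t\<close> at once, by one kernel with bounded column integrals; so the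
 maximal functions of \<open>f\<close> and of its image differ by a function of norm at most \<open>C \<parallel>f\<parallel>\<^sub>1\<close>, and \<open>\<parallel>f\<parallel>\<^sub>1\<close> is at most
 either Hardy norm.\<close>

section \<open>One-dimensional kernels and the heat kernel\<close>

text \<open>Kernels are handled as functions with values in [0, \<infinity>], so that Tonelli
  reorders every multiple integral; identities between them are stated as sums, and terms are
  cancelled only where they are finite. The weight \<open>kw\<close> comes from the definitions:
  composing (A V B)_t with the integral of r^(-1/2) B_r dr gives A_a V B_u with a = t - s and u = s
  + r, and integrating t^(-3/2) r^(-1/2) over s leaves 2 \<pi> \<open>kw a u\<close>. The obstacle
  in the maximal comparison is that K is controlled only by 0 \<le> K \<le> P, with no regularity.
  All cancellation is therefore taken from the heat kernel to the left of V: since k(s,u) has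
  integral 1 in s, (P V K)_t and P_t T(P,K) become integrals of P_{t-u} V K_u and P_{t+s} V K_u
  against the same weight. For u < t/2 the difference P_{t-u} - P_{t+s} has a bound independent of
  t; for t/2 \<le> u < t no cancellation is left, and the convolution itself is bounded uniformly in
  t. The powers 1/4 and -1/4 of time used there lie in the range |p| < 1/2 in which
  \<open>kw\<close> has finite moments.\<close>

abbreviation nn_lborel :: "('a::euclidean_space \<Rightarrow> ennreal) \<Rightarrow> ennreal" (binder "NN " 10)
 where "nn_lborel f \<equiv> integral\<^sup>N lborel f"


text \<open>Nonnegativity of the integrand turns the existence of the two one-sided limits of
  \<open>F\<close> into integrability, so that endpoint singularities and unbounded intervals are
  covered at once.\<close>

lemma nn_integral_FTC_ereal:
 fixes f F :: "real \<Rightarrow> real" and a b :: ereal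
 assumes "a < b"
  and F: "\<And>x. a < ereal x \<Longrightarrow> ereal x < b \<Longrightarrow> DERIV F x :> f x"
  and f: "\<And>x. a < ereal x \<Longrightarrow> ereal x < b \<Longrightarrow> isCont f x"
  and nn: "\<And>x. a < ereal x \<Longrightarrow> ereal x < b \<Longrightarrow> 0 \<le> f x"
  and A: "((F \<circ> real_of_ereal) \<longlongrightarrow> A) (at_right a)"
  and B: "((F \<circ> real_of_ereal) \<longlongrightarrow> B) (at_left b)"
 shows "(NN x. ennreal (f x) * indicator (einterval a b) x) = ennreal (B - A)"
proof -
 have si: "set_integrable lborel (einterval a b) f"
  and v: "(LBINT x=a..b. f x) = B - A"
  using interval_integral_FTC_nonneg[OF assms(1) F f _ A B] nn by auto
 have "(NN x. ennreal (f x) * indicator (einterval a b) x)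
   = (NN x. ennreal (indicator (einterval a b) x * f x))"
  by (intro nn_integral_cong) (auto simp: indicator_def)
 also have "\<dots> = ennreal (LINT x|lborel. indicator (einterval a b) x * f x)"
  using si nn unfolding set_integrable_def
  by (intro nn_integral_eq_integral) (auto simp: einterval_def indicator_def)
 also have "(LINT x|lborel. indicator (einterval a b) x * f x) = B - A"
  using v \<open>a < b\<close> by (simp add: interval_lebesgue_integral_def less_imp_le) (simp add: set_lebesgue_integral_def)
 finally show ?thesis .
qed

lemma nn_integral_FTC_greaterThan:
 fixes f F :: "real \<Rightarrow> real"
 assumes "\<And>x. a < x \<Longrightarrow> DERIV F x :> f x"
  and "\<And>x. a < x \<Longrightarrow> isCont f x"
  and "\<And>x. a < x \<Longrightarrow> 0 \<le> f x"
  and "(F \<longlongrightarrow> A) (at_right a)" and "(F \<longlongrightarrow> B) at_top"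
 shows "(NN x. ennreal (f x) * indicator {a<..} x) = ennreal (B - A)"
 using nn_integral_FTC_ereal[of "ereal a" \<infinity> F f A B] assms
 by (simp add: ereal_tendsto_simps)

lemma nn_integral_FTC_greaterThanLessThan:
 fixes f F :: "real \<Rightarrow> real"
 assumes "a < b"
  and "\<And>x. a < x \<Longrightarrow> x < b \<Longrightarrow> DERIV F x :> f x"
  and "\<And>x. a < x \<Longrightarrow> x < b \<Longrightarrow> isCont f x"
  and "\<And>x. a < x \<Longrightarrow> x < b \<Longrightarrow> 0 \<le> f x"
  and "(F \<longlongrightarrow> A) (at_right a)" and "(F \<longlongrightarrow> B) (at_left b)"
 shows "(NN x. ennreal (f x) * indicator {a<..<b} x) = ennreal (B - A)"
 using nn_integral_FTC_ereal[of "ereal a" "ereal b" F f A B] assms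
 by (simp add: ereal_tendsto_simps)

lemma nn_integral_powr_0:
 fixes c b :: real
 assumes "c > -1" "b > 0"
 shows "(NN x. ennreal (x powr c) * indicator {0<..<b} x) = ennreal (b powr (c+1) / (c+1))"
proof -
 have "(NN x. ennreal (x powr c) * indicator {0<..<b} x) = ennreal (b powr (c+1) / (c+1) - 0)"
 proof (rule nn_integral_FTC_greaterThanLessThan[where F = "\<lambda>x. x powr (c+1) / (c+1)"])
  show "((\<lambda>x. x powr (c+1) / (c+1)) \<longlongrightarrow> 0) (at_right 0)"
  proof -
   have "eventually (\<lambda>x::real. 0 \<le> x) (at_right 0)"
    by (rule eventually_mono[OF eventually_at_right_less[of 0]]) simp
   then have "((\<lambda>x::real. x powr (c+1)) \<longlongrightarrow> 0 powr (c+1)) (at_right 0)"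
    using assms by (intro tendsto_powr') (auto intro!: tendsto_eq_intros)
   then show ?thesis by (intro tendsto_divide_zero) simp
  qed
  show "((\<lambda>x. x powr (c+1) / (c+1)) \<longlongrightarrow> b powr (c+1) / (c+1)) (at_left b)"
   using assms by (auto intro!: tendsto_eq_intros)
 next
  fix x assume x: "0 < x" "x < b"
  then have "((\<lambda>x. x powr (c+1)) has_real_derivative (c+1) * x powr c) (at x)"
   by (auto intro!: derivative_eq_intros)
  from DERIV_cdivide[OF this, of "c+1"] show "((\<lambda>x. x powr (c+1) / (c+1)) has_real_derivative x powr c) (at x)"
   using assms by simp
 qed (use assms in \<open>auto intro!: continuous_intros\<close>)
 then show ?thesis by simp
qed

lemma nn_integral_powr_inf:
 fixes c b :: real
 assumes "c < -1" "b > 0"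
 shows "(NN x. ennreal (x powr c) * indicator {b<..} x) = ennreal (b powr (c+1) / (- c - 1))"
proof -
 have "(NN x. ennreal (x powr c) * indicator {b<..} x) = ennreal (0 - b powr (c+1) / (c+1))"
 proof (rule nn_integral_FTC_greaterThan[where F = "\<lambda>x. x powr (c+1) / (c+1)"])
  have "((\<lambda>x::real. x powr (c+1)) \<longlongrightarrow> 0) at_top"
   by (rule tendsto_neg_powr) (use assms in \<open>auto simp: filterlim_ident\<close>)
  then show "((\<lambda>x. x powr (c+1) / (c+1)) \<longlongrightarrow> 0) at_top"
   by (rule tendsto_divide_zero)
  show "((\<lambda>x. x powr (c+1) / (c+1)) \<longlongrightarrow> b powr (c+1) / (c+1)) (at_right b)"
   using assms by (auto intro!: tendsto_eq_intros)
 next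
  fix x assume "b < x"
  then have "((\<lambda>x. x powr (c+1)) has_real_derivative (c+1) * x powr c) (at x)"
   using assms by (auto intro!: derivative_eq_intros)
  from DERIV_cdivide[OF this, of "c+1"] show "((\<lambda>x. x powr (c+1) / (c+1)) has_real_derivative x powr c) (at x)"
   using assms by simp
 qed (use assms in \<open>auto intro!: continuous_intros\<close>)
 moreover have "0 - b powr (c+1) / (c+1) = b powr (c+1) / (- c - 1)"
  using assms by (simp add: field_simps)
 ultimately show ?thesis by simp
qed

text \<open>The extension by 0 lets every time integral run over the whole line, so that shifts and
  reflections of time change no domain of integration.\<close>

definition kw :: "real \<Rightarrow> real \<Rightarrow> real" where
 "kw s v = (if 0 < s \<and> 0 < v then sqrt (v / s) / (pi * (s + v)) else 0)"

lemma kw_nonneg [simp]: "0 \<le> kw s v"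
 by (simp add: kw_def)

lemma kw_measurable [measurable]:
 assumes [measurable]: "f \<in> borel_measurable M" "g \<in> borel_measurable M"
 shows "(\<lambda>x. kw (f x) (g x)) \<in> borel_measurable M"
 unfolding kw_def by measurable

text \<open>Under s = v tan^2 \<theta> the density becomes the constant 2/\<pi> on (0, \<pi>/2); the
  antiderivative below is this substitution.\<close>

lemma kw_integral:
 assumes v: "v > 0"
 shows "(NN s. ennreal (kw s v)) = 1"
proof -
 have "(NN s. ennreal (kw s v))
   = (NN s. ennreal (sqrt (v / s) / (pi * (s + v))) * indicator {0<..} s)"
  using v by (intro nn_integral_cong) (auto simp: kw_def indicator_def)
 also have "\<dots> = ennreal (2 / pi * (pi/2) - 0)"
 proof (rule nn_integral_FTC_greaterThan[where F = "\<lambda>s. 2 / pi * arctan (sqrt (s / v))"])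
  fix s :: real assume s: "0 < s"
  have r: "sqrt (s/v) * sqrt (v/s) = 1"
   using s v by (simp flip: real_sqrt_mult)
  have "((\<lambda>s. 2 / pi * arctan (sqrt (s / v))) has_real_derivative
     2 / pi * ((inverse (sqrt (s/v)) / 2 * (1/v)) * inverse (1 + (sqrt (s/v))\<^sup>2))) (at s)"
  proof -
   have "((\<lambda>s. s / v) has_real_derivative 1 / v) (at s)"
    using v by (auto intro!: derivative_eq_intros)
   then have "((\<lambda>s. sqrt (s / v)) has_real_derivative inverse (sqrt (s/v)) / 2 * (1/v)) (at s)"
    using s v by (intro DERIV_chain2[OF DERIV_real_sqrt]) auto
   from DERIV_chain2[OF DERIV_arctan this] show ?thesis
    by (intro DERIV_cmult) (simp add: mult.commute)
  qed
  also have "2 / pi * ((inverse (sqrt (s/v)) / 2 * (1/v)) * inverse (1 + (sqrt (s/v))\<^sup>2))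
    = sqrt (v / s) / (pi * (s + v))"
  proof -
   have "inverse (sqrt (s/v)) = sqrt (v/s)" using r by (metis inverse_unique)
   moreover have "(sqrt (s/v))\<^sup>2 = s/v" using s v by simp
   moreover have "inverse (1 + s / v) = v / (s + v)" using s v by (simp add: field_simps)
   moreover have "2 / pi * ((R / 2 * (1 / v)) * (v / w)) = R / (pi * w)" for R w :: real
    using v by simp
   ultimately show ?thesis by (simp add: mult.commute)
  qed
  finally show "((\<lambda>s. 2 / pi * arctan (sqrt (s / v))) has_real_derivative sqrt (v / s) / (pi * (s + v))) (at s)" .
  show "isCont (\<lambda>s. sqrt (v / s) / (pi * (s + v))) s" using s v by (auto intro!: continuous_intros)
  show "0 \<le> sqrt (v / s) / (pi * (s + v))" using s v by simp
 next
  show "((\<lambda>s. 2 / pi * arctan (sqrt (s / v))) \<longlongrightarrow> 0) (at_right 0)"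
   using v by (auto intro!: tendsto_eq_intros)
  have "filterlim (\<lambda>s::real. sqrt (s / v)) at_top at_top"
   using filterlim_compose[OF sqrt_at_top filterlim_tendsto_pos_mult_at_top[OF tendsto_const[of "1/v"] _ filterlim_ident]] v
   by simp
  then have "((\<lambda>s. arctan (sqrt (s / v))) \<longlongrightarrow> pi / 2) at_top"
   by (rule filterlim_compose[OF tendsto_arctan_at_top])
  then show "((\<lambda>s. 2 / pi * arctan (sqrt (s / v))) \<longlongrightarrow> 2 / pi * (pi/2)) at_top"
   by (intro tendsto_intros)
 qed
 finally show ?thesis by simp
qed

text \<open>The substitution u = sqrt (v / (b - v)) maps (0, b) onto the half line and turns the
  integrand into 2 / (1 + \<gamma>^2 u^2). The free parameter \<gamma> serves both partial fractions
  in \<open>kw_conv\<close>, and \<gamma> = 1 is the arcsine integral.\<close>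

lemma arctan_integral:
 assumes b: "b > 0" and g: "\<gamma> > 0"
 shows "(NN v. ennreal (b / (sqrt v * sqrt (b - v) * (b - v + \<gamma>\<^sup>2 * v))) * indicator {0<..<b} v) = ennreal (pi / \<gamma>)"
proof -
 let ?u = "\<lambda>v. sqrt v / sqrt (b - v)"
 let ?F = "\<lambda>v. 2 / \<gamma> * arctan (\<gamma> * ?u v)"
 have "(NN v. ennreal (b / (sqrt v * sqrt (b - v) * (b - v + \<gamma>\<^sup>2 * v))) * indicator {0<..<b} v) = ennreal (2 / \<gamma> * (pi / 2) - 0)"
 proof (rule nn_integral_FTC_greaterThanLessThan[where F = ?F])
  fix v assume v: "0 < v" "v < b"
  let ?S = "sqrt v" and ?R = "sqrt (b - v)"
  have SR: "?S > 0" "?R > 0" using v by auto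
  have "((\<lambda>v. sqrt (b - v)) has_real_derivative inverse ?R / 2 * (- 1)) (at v)"
   using v by (intro DERIV_chain2[OF DERIV_real_sqrt]) (auto intro!: derivative_eq_intros)
  then have "(?F has_real_derivative 2 / \<gamma> * (inverse (1 + (\<gamma> * ?u v)\<^sup>2) *
    (\<gamma> * ((inverse ?S / 2 * ?R - ?S * (inverse ?R / 2 * (- 1))) / (?R * ?R))))) (at v)"
   using v by (intro DERIV_cmult DERIV_chain2[OF DERIV_arctan] DERIV_divide DERIV_real_sqrt) auto
  moreover have "2 / \<gamma> * (inverse (1 + (\<gamma> * (S / R))\<^sup>2) * (\<gamma> * ((inverse S / 2 * R - S * (inverse R / 2 * (- 1))) / (R * R))))
    = (R\<^sup>2 + S\<^sup>2) / (S * R * (R\<^sup>2 + \<gamma>\<^sup>2 * S\<^sup>2))" if "S > 0" "R > 0" for S R :: real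
  proof -
   have "R\<^sup>2 + \<gamma>\<^sup>2 * S\<^sup>2 \<noteq> 0" using that by (metis add_pos_nonneg less_irrefl zero_less_power mult_nonneg_nonneg zero_le_power2)
   moreover have "inverse (1 + (\<gamma> * (S / R))\<^sup>2) = R\<^sup>2 / (R\<^sup>2 + \<gamma>\<^sup>2 * S\<^sup>2)"
    using that by (simp add: power_mult_distrib power_divide field_simps)
   moreover have "2 / \<gamma> * (R\<^sup>2 / D * (\<gamma> * ((inverse S / 2 * R - S * (inverse R / 2 * (- 1))) / (R * R)))) = (R\<^sup>2 + S\<^sup>2) / (S * R * D)"
    if "D \<noteq> 0" for D using that g \<open>S > 0\<close> \<open>R > 0\<close> by (simp add: field_simps power2_eq_square)
   ultimately show ?thesis by simp
  qed
  from this[OF SR] have "2 / \<gamma> * (inverse (1 + (\<gamma> * ?u v)\<^sup>2) * (\<gamma> * ((inverse ?S / 2 * ?R - ?S * (inverse ?R / 2 * (- 1))) / (?R * ?R))))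
    = b / (?S * ?R * (b - v + \<gamma>\<^sup>2 * v))" using v by simp
  ultimately show "(?F has_real_derivative b / (?S * ?R * (b - v + \<gamma>\<^sup>2 * v))) (at v)" by simp
  have "0 < b - v + \<gamma>\<^sup>2 * v" using v by (simp add: add_pos_nonneg)
  then show "isCont (\<lambda>v. b / (sqrt v * sqrt (b - v) * (b - v + \<gamma>\<^sup>2 * v))) v" "0 \<le> b / (?S * ?R * (b - v + \<gamma>\<^sup>2 * v))"
   using v by (auto intro!: continuous_intros)
 next
  show "(?F \<longlongrightarrow> 0) (at_right 0)" using b g by (auto intro!: tendsto_eq_intros)
  have "filterlim ?u at_top (at_left b)"
   by (rule filterlim_at_top_mult_tendsto_pos[where c = "sqrt b" and f = sqrt and g = "\<lambda>v. 1 / sqrt (b - v)", simplified])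
    (use b in \<open>auto intro!: tendsto_eq_intros filterlim_inverse_at_top simp: eventually_at_filter divide_inverse\<close>)
  then have "((\<lambda>v. arctan (\<gamma> * ?u v)) \<longlongrightarrow> pi / 2) (at_left b)"
   by (intro filterlim_compose[OF tendsto_arctan_at_top] filterlim_tendsto_pos_mult_at_top[OF tendsto_const g])
  then show "(?F \<longlongrightarrow> 2 / \<gamma> * (pi / 2)) (at_left b)" by (intro tendsto_intros)
 qed (use b in auto)
 then show ?thesis by simp
qed

lemma arcsine_integral:
 assumes s: "0 < s"
 shows "(NN r. ennreal (1 / (sqrt r * sqrt (s - r))) * indicator {0<..<s} r) = ennreal pi"
 using arctan_integral[OF s, of 1] s by simp

text \<open>Up to the factor 1 / (sqrt v * sqrt (b - v)) the integrand is rational in v, and each of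
  its two partial fractions is an instance of \<open>arctan_integral\<close>. The negative fraction
  is moved to the left so that no difference occurs in [0, \<infinity>].\<close>

lemma kw_conv:
 assumes a: "a > 0" and b: "b > 0" and c: "c > 0"
 shows "ennreal (kw (a + b) c) + (NN v. ennreal (kw a v) * ennreal (kw (b - v) c)) = ennreal (kw a (b + c))"
proof -
 define q where "q = sqrt c / (sqrt a * pi\<^sup>2) / (a + b + c)"
 \<comment> \<open>Chosen so that b - v + \<alpha>^2 v = b (b + c - v) / (b + c) and b - v +
   \<beta>^2 v = b (a + v) / a, the denominators of the two partial fractions.\<close>
 define \<alpha> \<beta> where "\<alpha> = sqrt c / sqrt (b + c)" and "\<beta> = sqrt (a + b) / sqrt a"
 let ?f = "\<lambda>\<gamma> v. b / (sqrt v * sqrt (b - v) * (b - v + \<gamma>\<^sup>2 * v))"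
 have q: "q > 0" and ab: "\<alpha> > 0" "\<beta> > 0" "\<alpha>\<^sup>2 = c / (b + c)" "\<beta>\<^sup>2 = (a + b) / a"
  using a b c by (simp_all add: q_def \<alpha>_def \<beta>_def power_divide add_pos_pos)
 have I: "(NN v. ennreal (q * ?f \<gamma> v) * indicator {0<..<b} v) = ennreal (q * (pi / \<gamma>))" if "\<gamma> > 0" for \<gamma>
 proof -
  have "(NN v. ennreal (q * ?f \<gamma> v) * indicator {0<..<b} v) = (NN v. ennreal q * (ennreal (?f \<gamma> v) * indicator {0<..<b} v))"
   by (simp only: ennreal_mult'[OF less_imp_le[OF q]] mult.assoc)
  also have "\<dots> = ennreal q * ennreal (pi / \<gamma>)" unfolding arctan_integral[OF b that, symmetric] by (rule nn_integral_cmult) measurable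
  finally show ?thesis by (simp only: ennreal_mult'[OF less_imp_le[OF q]])
 qed
 have eq: "q * ?f \<beta> v + kw a v * kw (b - v) c = q * ?f \<alpha> v" and nn: "0 \<le> ?f \<beta> v" if v: "0 < v" "v < b" for v
 proof -
  have 1: "?f \<alpha> v = (b + c) / (b + c - v) / (sqrt v * sqrt (b - v))"
  proof -
   have "b - v + \<alpha>\<^sup>2 * v = b * (b + c - v) / (b + c)" using b c by (simp add: ab field_simps)
   then show ?thesis using b by simp
  qed
  have 2: "?f \<beta> v = a / (a + v) / (sqrt v * sqrt (b - v))"
  proof -
   have "b - v + \<beta>\<^sup>2 * v = b * (a + v) / a" using a by (simp add: ab field_simps)
   then show ?thesis using b by simp
  qed
  have "kw a v * kw (b - v) c = sqrt c / (sqrt a * pi\<^sup>2) * (v / ((a + v) * (b + c - v))) / (sqrt v * sqrt (b - v))"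
  proof -
   have "S / A / (pi * p) * (C / R / (pi * r)) = C / (A * pi\<^sup>2) * (S * S / (p * r)) / (S * R)" if "S > 0" for S A C R p r :: real
    using that by (simp add: power2_eq_square mult_ac)
   from this[of "sqrt v" "sqrt a" "a + v" "sqrt c" "sqrt (b - v)" "b - v + c"] show ?thesis
    using v a c by (simp add: kw_def real_sqrt_divide diff_add_eq)
  qed
  also have "v / ((a + v) * (b + c - v)) = ((b + c) / (b + c - v) - a / (a + v)) / (a + b + c)"
  proof -
   have "(D + v) / D - (A - v) / A = v * (A + D) / (A * D)" if "D > 0" "A > 0" for A D :: real
    using that by (simp add: field_simps)
   from this[of "b + c - v" "a + v"] show ?thesis using v a c by (simp add: add_ac)
  qed
  finally have k: "kw a v * kw (b - v) c = sqrt c / (sqrt a * pi\<^sup>2) * (((b + c) / (b + c - v) - a / (a + v)) / (a + b + c)) / (sqrt v * sqrt (b - v))" .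
  have "k / N * (y / w) + k * ((x - y) / N) / w = k / N * (x / w)" for k N x y w :: real
   by (simp add: right_diff_distrib diff_divide_distrib)
  then show "q * ?f \<beta> v + kw a v * kw (b - v) c = q * ?f \<alpha> v" unfolding 1 2 q_def k by (simp only:)
  show "0 \<le> ?f \<beta> v" unfolding 2 using v a by simp
 qed
 have "ennreal (q * (pi / \<beta>)) + (NN v. ennreal (kw a v) * ennreal (kw (b - v) c))
   = (NN v. ennreal (q * ?f \<beta> v) * indicator {0<..<b} v + ennreal (kw a v) * ennreal (kw (b - v) c))"
  unfolding I[OF ab(2), symmetric] by (rule nn_integral_add[symmetric]) measurable
 also have "\<dots> = (NN v. ennreal (q * ?f \<alpha> v) * indicator {0<..<b} v)"
 proof (intro nn_integral_cong)
  fix v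
  show "ennreal (q * ?f \<beta> v) * indicator {0<..<b} v + ennreal (kw a v) * ennreal (kw (b - v) c) = ennreal (q * ?f \<alpha> v) * indicator {0<..<b} v"
  proof (cases "0 < v \<and> v < b")
   case True
   then have "0 \<le> q * ?f \<beta> v" using nn[of v] q by (intro mult_nonneg_nonneg) auto
   then show ?thesis using True eq[of v, symmetric] by (simp only:) (simp add: ennreal_mult)
  qed (auto simp: kw_def)
 qed
 also have "\<dots> = ennreal (q * (pi / \<alpha>))" by (rule I[OF ab(1)])
 finally have "ennreal (q * (pi / \<beta>)) + (NN v. ennreal (kw a v) * ennreal (kw (b - v) c)) = ennreal (q * (pi / \<alpha>))" .
 moreover have "q * (pi / \<alpha>) = kw a (b + c)" "q * (pi / \<beta>) = kw (a + b) c"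
  using a b c by (simp_all add: q_def \<alpha>_def \<beta>_def kw_def real_sqrt_divide power2_eq_square add_ac)
 ultimately show ?thesis by simp
qed

text \<open>This is the origin of \<open>kw\<close>: the weights t^(-3/2) of the half derivative and
  r^(-1/2) of the inverse half power, taken at t = a + u and r = v - u, are integrated over the
  intermediate time u. The antiderivative is a multiple of sqrt ((v - u) / (a + u)).\<close>

lemma kw_eq_beta_integral:
 assumes a: "a > 0" and v: "v > 0"
 shows "(NN u. ennreal (1 / ((a + u) * sqrt (a + u) * sqrt (v - u))) * indicator {0<..<v} u)
    = ennreal (2 * pi * kw a v)"
proof -
 have "(NN u. ennreal (1 / ((a + u) * sqrt (a + u) * sqrt (v - u))) * indicator {0<..<v} u)
   = ennreal (0 - (- (2 / (a + v)) * sqrt ((v - 0) / (a + 0))))"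
 proof (rule nn_integral_FTC_greaterThanLessThan[where F = "\<lambda>u. - (2 / (a + v)) * sqrt ((v - u) / (a + u))"])
  fix u assume u: "0 < u" "u < v"
  have "((\<lambda>u. (v - u) / (a + u)) has_real_derivative - (a + v) / (a + u)\<^sup>2) (at u)"
   using u a by (auto intro!: derivative_eq_intros simp: power2_eq_square)
  moreover have "(v - u) / (a + u) > 0" using u a by simp
  ultimately have "((\<lambda>u. sqrt ((v - u) / (a + u))) has_real_derivative
    (inverse (sqrt ((v - u) / (a + u))) / 2) * (- (a + v) / (a + u)\<^sup>2)) (at u)"
   by (rule DERIV_chain2[OF DERIV_real_sqrt, rotated])
  from DERIV_cmult[OF this, of "- (2 / (a + v))"]
  have "((\<lambda>u. - (2 / (a + v)) * sqrt ((v - u) / (a + u))) has_real_derivative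
    - (2 / (a + v)) * ((inverse (sqrt ((v - u) / (a + u))) / 2) * (- (a + v) / (a + u)\<^sup>2))) (at u)" .
  also have "- (2 / (a + v)) * ((inverse (sqrt ((v - u) / (a + u))) / 2) * (- (a + v) / (a + u)\<^sup>2))
    = sqrt (a + u) / ((a + u)\<^sup>2 * sqrt (v - u))"
  proof -
   have "inverse (sqrt ((v - u) / (a + u))) = sqrt (a + u) / sqrt (v - u)"
    by (simp add: real_sqrt_divide)
   moreover have "- (2 / (a + v)) * ((w / 2) * (- (a + v) / z)) = w / z" for w z :: real
   proof -
    have "- (2 / p) * ((w / 2) * (- p / z)) = w / z" if "p > 0" for p :: real
     using that by (cases "z = 0") (simp_all add: field_simps)
    from this[of "a + v"] show ?thesis using a v by simp
   qed
   ultimately have "- (2 / (a + v)) * ((inverse (sqrt ((v - u) / (a + u))) / 2) * (- (a + v) / (a + u)\<^sup>2))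
     = sqrt (a + u) / sqrt (v - u) / (a + u)\<^sup>2" by (simp only:)
   moreover have "S / R / z = S / (z * R)" for S R z :: real by simp
   ultimately show ?thesis by (rule trans)
  qed
  also have "\<dots> = 1 / ((a + u) * sqrt (a + u) * sqrt (v - u))"
  proof -
   have "S / ((S * S)\<^sup>2 * R) = 1 / (S * S * S * R)" if "S > 0" for S R :: real
    using that by (cases "R = 0") (simp_all add: field_simps power2_eq_square)
   from this[of "sqrt (a + u)" "sqrt (v - u)"] show ?thesis using a u by simp
  qed
  finally show "((\<lambda>u. - (2 / (a + v)) * sqrt ((v - u) / (a + u))) has_real_derivative
    1 / ((a + u) * sqrt (a + u) * sqrt (v - u))) (at u)" .
  show "isCont (\<lambda>u. 1 / ((a + u) * sqrt (a + u) * sqrt (v - u))) u"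
   using u a by (auto intro!: continuous_intros)
 next
  show "((\<lambda>u. - (2 / (a + v)) * sqrt ((v - u) / (a + u))) \<longlongrightarrow> - (2 / (a + v)) * sqrt ((v - 0) / (a + 0))) (at_right 0)"
   using a by (intro tendsto_intros) auto
  have "((\<lambda>u. - (2 / (a + v)) * sqrt ((v - u) / (a + u))) \<longlongrightarrow> - (2 / (a + v)) * sqrt ((v - v) / (a + v))) (at_left v)"
   using a v by (intro tendsto_intros) auto
  then show "((\<lambda>u. - (2 / (a + v)) * sqrt ((v - u) / (a + u))) \<longlongrightarrow> 0) (at_left v)" by simp
 qed (use a v in auto)
 also have "0 - (- (2 / (a + v)) * sqrt ((v - 0) / (a + 0))) = 2 * pi * kw a v"
  using a v by (simp add: kw_def)
 finally show ?thesis .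
qed

section \<open>The heat kernel: mass, semigroup law and pointwise bounds\<close>

lemma heat_nonneg [simp]: "0 \<le> heat t x"
 by (simp add: heat_def)

lemma heat_commute: "heat t (x - y) = heat t (y - x)"
 by (simp add: heat_def norm_minus_commute)

lemma heat_uminus [simp]: "heat t (- x) = heat t x"
 by (simp add: heat_def)

lemma heat_measurable [measurable]:
 fixes g :: "_ \<Rightarrow> 'a::euclidean_space"
 assumes [measurable]: "f \<in> borel_measurable M" "g \<in> borel_measurable M"
 shows "(\<lambda>x. heat (f x) (g x)) \<in> borel_measurable M"
 unfolding heat_def by measurable

text \<open>The value 0 for nonpositive times makes a convolution over the whole time line equal to
  the integral over 0 < s < t.\<close>

definition hk :: "real \<Rightarrow> 'a::euclidean_space \<Rightarrow> 'a \<Rightarrow> ennreal" where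
 "hk t x y = (if 0 < t then ennreal (heat t (x - y)) else 0)"

lemma hk_measurable [measurable]:
 fixes g :: "_ \<Rightarrow> 'a::euclidean_space"
 assumes [measurable]: "f \<in> borel_measurable M" "g \<in> borel_measurable M" "h \<in> borel_measurable M"
 shows "(\<lambda>x. hk (f x) (g x) (h x)) \<in> borel_measurable M"
 unfolding hk_def by measurable

lemma hk_commute: "hk t x y = hk t y x"
 by (simp add: hk_def heat_commute[of t x y])

text \<open>In one variable this is the normalisation of the normal density with variance 1/(2c);
  the general case is the product over an orthonormal basis.\<close>

lemma nn_integral_gaussian:
 fixes m :: "'a::euclidean_space"
 assumes c: "c > 0"
 shows "(NN z. ennreal (exp (- c * (norm (z - m))\<^sup>2))) = ennreal ((pi / c) powr (real DIM('a) / 2))"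
proof -
 have one: "(NN x. ennreal (exp (- c * (x - a)\<^sup>2))) = ennreal (sqrt (pi / c))" for a :: real
 proof -
  define \<sigma> where "\<sigma> = sqrt (1 / (2 * c))"
  have \<sigma>: "\<sigma> > 0" "2 * \<sigma>\<^sup>2 = 1 / c" using c by (auto simp: \<sigma>_def)
  interpret prob_space "density lborel (normal_density a \<sigma>)"
   using \<sigma> by (intro prob_space_normal_density)
  have "1 = (NN x. ennreal (normal_density a \<sigma> x))"
   using emeasure_space_1 by (simp add: emeasure_density)
  also have "\<dots> = (NN x. ennreal (1 / sqrt (pi / c)) * ennreal (exp (- c * (x - a)\<^sup>2)))"
  proof (intro nn_integral_cong)
   fix x
   have "2 * pi * \<sigma>\<^sup>2 = pi / c" using \<sigma>(2) by (simp add: mult.assoc[of pi] field_simps)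
   then have "normal_density a \<sigma> x = 1 / sqrt (pi / c) * exp (- c * (x - a)\<^sup>2)"
    using c by (simp add: normal_density_def \<sigma>(2) mult.commute)
   then show "ennreal (normal_density a \<sigma> x) = ennreal (1 / sqrt (pi / c)) * ennreal (exp (- c * (x - a)\<^sup>2))"
    by (metis ennreal_mult'' exp_ge_zero)
  qed
  also have "\<dots> = ennreal (1 / sqrt (pi / c)) * (NN x. ennreal (exp (- c * (x - a)\<^sup>2)))"
   by (intro nn_integral_cmult) measurable
  finally have "ennreal (sqrt (pi / c)) * 1 = ennreal (sqrt (pi / c)) * (ennreal (1 / sqrt (pi / c)) * (NN x. ennreal (exp (- c * (x - a)\<^sup>2))))"
   by simp
  also have "\<dots> = (NN x. ennreal (exp (- c * (x - a)\<^sup>2)))"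
   using c by (simp add: mult.assoc[symmetric] flip: ennreal_mult)
  finally show ?thesis by simp
 qed
 have eq: "ennreal (exp (- c * (norm (z - m))\<^sup>2)) = (\<Prod>b\<in>Basis. ennreal (exp (- c * (z \<bullet> b - m \<bullet> b)\<^sup>2)))" for z :: 'a
 proof -
  have "(norm (z - m))\<^sup>2 = (\<Sum>b\<in>Basis. (z \<bullet> b - m \<bullet> b)\<^sup>2)"
   unfolding power2_norm_eq_inner by (subst euclidean_inner) (simp add: inner_diff_left power2_eq_square)
  then have "exp (- c * (norm (z - m))\<^sup>2) = (\<Prod>b\<in>Basis. exp (- c * (z \<bullet> b - m \<bullet> b)\<^sup>2))"
   by (simp add: sum_distrib_left exp_sum flip: sum_negf)
  then show ?thesis by (simp add: prod_ennreal)
 qed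
 have "(NN z. ennreal (exp (- c * (norm (z - m))\<^sup>2))) = (\<Prod>b\<in>(Basis::'a set). NN x. ennreal (exp (- c * (x - m \<bullet> b)\<^sup>2)))"
  unfolding eq by (subst nn_integral_lborel_prod[where f = "\<lambda>b x. ennreal (exp (- c * (x - m \<bullet> b)\<^sup>2))"]) auto
 also have "\<dots> = ennreal (sqrt (pi / c)) ^ DIM('a)" by (simp only: one prod_constant)
 also have "\<dots> = ennreal ((pi / c) powr (real DIM('a) / 2))"
 proof -
  have "sqrt (pi / c) ^ DIM('a) = (pi / c) powr (real DIM('a) / 2)"
   using c by (simp add: powr_half_sqrt[symmetric] powr_realpow[symmetric] powr_powr)
  then show ?thesis using c by (simp add: ennreal_power)
 qed
 finally show ?thesis .
qed

lemma nn_integral_heat: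
 fixes y :: "'a::euclidean_space"
 assumes t: "t > 0"
 shows "(NN x. ennreal (heat t (x - y))) = 1"
proof -
 have "(NN x. ennreal (heat t (x - y)))
   = (NN x. ennreal ((4 * pi * t) powr (- real DIM('a) / 2)) * ennreal (exp (- (1 / (4 * t)) * (norm (x - y))\<^sup>2)))"
  by (intro nn_integral_cong) (simp add: heat_def ennreal_mult')
 also have "\<dots> = ennreal ((4 * pi * t) powr (- real DIM('a) / 2)) * ennreal ((pi / (1 / (4 * t))) powr (real DIM('a) / 2))"
  using t by (subst nn_integral_cmult) (measurable, subst nn_integral_gaussian, auto)
 also have "\<dots> = ennreal ((4 * pi * t) powr (- real DIM('a) / 2) * (4 * pi * t) powr (real DIM('a) / 2))"
  by (simp add: ennreal_mult' mult_ac)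
 also have "(4 * pi * t) powr (- real DIM('a) / 2) * (4 * pi * t) powr (real DIM('a) / 2) = 1"
  using t by (simp only: powr_add[symmetric]) simp
 finally show ?thesis by simp
qed

lemma nn_integral_hk:
 fixes y :: "'a::euclidean_space"
 assumes t: "t > 0"
 shows "(NN x. hk t x y) = 1" "(NN x. hk t y x) = 1"
 using nn_integral_heat[OF t, of y] t by (simp_all add: hk_def heat_commute[of t y])

text \<open>Completing the square in z: the product of two Gaussians is a Gaussian in z, centred at
  a weighted mean of x and y and with time a b / (a + b), times a factor free of z. Integrating over
  z then gives the semigroup law.\<close>

lemma heat_mult_heat:
 fixes x y z :: "'a::euclidean_space"
 assumes a: "a > 0" and b: "b > 0"
 shows "heat a (x - z) * heat b (z - y)
   = heat (a + b) (x - y) * heat (a * b / (a + b)) (z - (1 / (a + b)) *\<^sub>R (b *\<^sub>R x + a *\<^sub>R y))"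
proof -
 define X where "X = x - z"
 define Y where "Y = z - y"
 define m where "m = (1 / (a + b)) *\<^sub>R (b *\<^sub>R x + a *\<^sub>R y)"
 have zm: "z - m = (1 / (a + b)) *\<^sub>R (a *\<^sub>R Y - b *\<^sub>R X)"
 proof -
  have "z = (1 / (a + b)) *\<^sub>R ((a + b) *\<^sub>R z)" using a b by simp
  then have "z - m = (1 / (a + b)) *\<^sub>R ((a + b) *\<^sub>R z - (b *\<^sub>R x + a *\<^sub>R y))"
   by (metis m_def scaleR_diff_right)
  then show ?thesis by (simp add: X_def Y_def algebra_simps)
 qed
 define p q r where "p = X \<bullet> X" and "q = Y \<bullet> Y" and "r = X \<bullet> Y"
 have n1: "(norm (x - z))\<^sup>2 = p" "(norm (z - y))\<^sup>2 = q" by (simp_all add: p_def q_def X_def Y_def power2_norm_eq_inner)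
 have xy: "x - y = X + Y" by (simp add: X_def Y_def)
 have n2: "(norm (x - y))\<^sup>2 = p + q + 2 * r"
  unfolding xy power2_norm_eq_inner by (simp add: inner_add inner_commute p_def q_def r_def)
 have "(norm (a *\<^sub>R Y - b *\<^sub>R X))\<^sup>2 = a\<^sup>2 * q - 2 * a * b * r + b\<^sup>2 * p"
  unfolding power2_norm_eq_inner
  by (simp add: inner_diff inner_commute p_def q_def r_def power2_eq_square algebra_simps)
 then have n3: "(norm (z - m))\<^sup>2 = (a\<^sup>2 * q - 2 * a * b * r + b\<^sup>2 * p) / (a + b)\<^sup>2"
  unfolding zm using a b by (simp add: power_mult_distrib power_divide)
 have "p / (4 * a) + q / (4 * b) = (p + q + 2 * r) / (4 * (a + b)) + (a\<^sup>2 * q - 2 * a * b * r + b\<^sup>2 * p) / (4 * a * b * (a + b))"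
 proof -
  have "(p + q + 2 * r) / (4 * (a + b)) = a * b * (p + q + 2 * r) / (4 * a * b * (a + b))"
   using a b by simp
  moreover have "p / (4 * a) + q / (4 * b) = (a + b) * (b * p + a * q) / (4 * a * b * (a + b))"
  proof -
   have "(a + b) * (b * p + a * q) / (4 * a * b * (a + b)) = (b * p + a * q) / (4 * a * b)"
    using a b by simp
   then show ?thesis using a b by (simp add: add_divide_distrib)
  qed
  moreover have "(a + b) * (b * p + a * q) = a * b * (p + q + 2 * r) + (a\<^sup>2 * q - 2 * a * b * r + b\<^sup>2 * p)"
   by (simp add: power2_eq_square algebra_simps)
  ultimately show ?thesis by (simp add: add_divide_distrib)
 qed
 moreover have "(a\<^sup>2 * q - 2 * a * b * r + b\<^sup>2 * p) / (4 * a * b * (a + b)) = (norm (z - m))\<^sup>2 / (4 * (a * b / (a + b)))"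
 proof -
  have "N / (4 * a * b * w) = N / w\<^sup>2 / (4 * (a * b / w))" if "w > 0" for N w :: real
   using that a b by (simp add: power2_eq_square)
  from this[of "a + b"] show ?thesis unfolding n3 using a b by simp
 qed
 ultimately have E: "exp (- (norm (x - z))\<^sup>2 / (4 * a)) * exp (- (norm (z - y))\<^sup>2 / (4 * b))
   = exp (- (norm (x - y))\<^sup>2 / (4 * (a + b))) * exp (- (norm (z - m))\<^sup>2 / (4 * (a * b / (a + b))))"
  unfolding n1 n2 by (simp only: mult_exp_exp minus_divide_left[symmetric] minus_add_distrib[symmetric])
 have "(4 * pi * a) powr c * (4 * pi * b) powr c = (4 * pi * (a + b)) powr c * (4 * pi * (a * b / (a + b))) powr c" for c
 proof -
  have "(4 * pi * a) powr c * (4 * pi * b) powr c = (4 * pi * a * (4 * pi * b)) powr c"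
   by (rule powr_mult[symmetric])
  also have "4 * pi * a * (4 * pi * b) = (4 * pi * (a + b)) * (4 * pi * (a * b / (a + b)))"
   using a b by simp
  also have "\<dots> powr c = (4 * pi * (a + b)) powr c * (4 * pi * (a * b / (a + b))) powr c"
   by (rule powr_mult)
  finally show ?thesis .
 qed
 moreover have "A1 * E1 * (A2 * E2) = B1 * F1 * (B2 * F2)" if "A1 * A2 = B1 * B2" "E1 * E2 = F1 * F2"
  for A1 A2 B1 B2 E1 E2 F1 F2 :: real
 proof -
  have "A1 * E1 * (A2 * E2) = (A1 * A2) * (E1 * E2)" by (simp only: mult_ac)
  also have "\<dots> = B1 * F1 * (B2 * F2)" unfolding that by (simp only: mult_ac)
  finally show ?thesis .
 qed
 ultimately show ?thesis unfolding heat_def m_def[symmetric] using E by blast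
qed

lemma hk_semigroup:
 fixes x y :: "'a::euclidean_space"
 assumes a: "a > 0" and b: "b > 0"
 shows "(NN z. hk a x z * hk b z y) = hk (a + b) x y"
proof -
 define m where "m = (1 / (a + b)) *\<^sub>R (b *\<^sub>R x + a *\<^sub>R y)"
 have "(NN z. hk a x z * hk b z y)
   = (NN z. ennreal (heat (a + b) (x - y)) * ennreal (heat (a * b / (a + b)) (z - m)))"
  using a b by (intro nn_integral_cong) (simp add: hk_def heat_mult_heat m_def flip: ennreal_mult)
 also have "\<dots> = ennreal (heat (a + b) (x - y))"
  using a b by (subst nn_integral_cmult) (auto simp: nn_integral_heat)
 finally show ?thesis using a b by (simp add: hk_def)
qed

lemma exp_minus_le_powr:
 fixes p :: real
 assumes "0 \<le> p"
 obtains C where "C > 0" "\<And>r. 0 < r \<Longrightarrow> exp (- r) \<le> C * r powr (- p)"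
proof
 let ?n = "nat \<lceil>p\<rceil>"
 show "(fact ?n :: real) > 0" by simp
 fix r :: real assume r: "0 < r"
 show "exp (- r) \<le> fact ?n * r powr (- p)"
 proof (cases "r \<ge> 1")
  case True
  have "r powr p \<le> r powr real ?n" using True assms by (intro powr_mono) linarith+
  also have "\<dots> = r ^ ?n" using r by (simp add: powr_realpow)
  also have "\<dots> \<le> fact ?n * exp r"
  proof -
   have "r ^ ?n / fact ?n \<le> exp r"
   proof -
    have "summable (\<lambda>n. r ^ n /\<^sub>R fact n)" by (rule sums_summable[OF exp_converges])
    then have "sum (\<lambda>n. r ^ n /\<^sub>R fact n) {?n} \<le> (\<Sum>n. r ^ n /\<^sub>R fact n)"
     using r by (intro sum_le_suminf) auto
    then have "r ^ ?n /\<^sub>R fact ?n \<le> exp r" by (simp add: exp_def)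
    then show ?thesis by (simp add: divide_inverse mult.commute)
   qed
   then show ?thesis by (simp add: divide_le_eq mult.commute)
  qed
  finally show ?thesis using r by (simp add: exp_minus powr_minus field_simps)
 next
  case False
  have "exp (- r) \<le> 1" using r by simp
  also have "1 \<le> r powr (- p)"
   using powr_mono2'[of "- p" r 1] assms r False by simp
  also have "\<dots> \<le> fact ?n * r powr (- p)" using fact_ge_1[of ?n] r
   by (metis mult_right_mono mult_1 powr_ge_zero)
  finally show ?thesis .
 qed
qed

text \<open>Gaussian decay is traded for any power of |x|, and parabolic scaling fixes the power of
  t. The later arguments differ mainly in the choice of \<alpha>: \<alpha> = d removes t, smaller
  values give decay for large t, larger values give smallness for small t.\<close>

lemma heat_le_powr:
 fixes \<alpha> :: real
 assumes "0 \<le> \<alpha>"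
 obtains C where "C > 0" "\<And>t x::'a::euclidean_space. 0 < t \<Longrightarrow> x \<noteq> 0 \<Longrightarrow>
   heat t x \<le> C * norm x powr (- \<alpha>) * t powr ((\<alpha> - real DIM('a)) / 2)"
proof -
 obtain C where C: "C > 0" "\<And>r. 0 < r \<Longrightarrow> exp (- r) \<le> C * r powr (- (\<alpha> / 2))"
  using exp_minus_le_powr[of "\<alpha>/2"] assms by auto
 let ?d = "real DIM('a)"
 show ?thesis
 proof
  show "(4 * pi) powr (- ?d / 2) * C * 4 powr (\<alpha> / 2) > 0" using C by simp
  fix t :: real and x :: 'a assume t: "0 < t" and x: "x \<noteq> 0"
  have "exp (- ((norm x)\<^sup>2 / (4 * t))) \<le> C * ((norm x)\<^sup>2 / (4 * t)) powr (- (\<alpha> / 2))"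
   using t x by (intro C) auto
  also have "((norm x)\<^sup>2 / (4 * t)) powr (- (\<alpha> / 2)) = norm x powr (- \<alpha>) * (4 powr (\<alpha> / 2) * t powr (\<alpha> / 2))"
  proof -
   have "((norm x)\<^sup>2 / (4 * t)) powr (- (\<alpha> / 2)) = (norm x powr 2) powr (- (\<alpha> / 2)) / (4 * t) powr (- (\<alpha> / 2))"
    using t x by (simp add: powr_divide)
   also have "\<dots> = norm x powr (- \<alpha>) * (4 * t) powr (\<alpha> / 2)"
   proof -
    have "(norm x powr 2) powr (- (\<alpha> / 2)) = norm x powr (- \<alpha>)" by (simp only: powr_powr) simp
    moreover have "(4 * t) powr (- (\<alpha> / 2)) = inverse ((4 * t) powr (\<alpha> / 2))" by (rule powr_minus)
    ultimately show ?thesis by (simp only: divide_inverse inverse_inverse_eq)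
   qed
   finally show ?thesis using t by (simp add: powr_mult)
  qed
  finally have 1: "exp (- ((norm x)\<^sup>2 / (4 * t))) \<le> C * (norm x powr (- \<alpha>) * (4 powr (\<alpha> / 2) * t powr (\<alpha> / 2)))" .
  have "heat t x = (4 * pi) powr (- ?d / 2) * t powr (- ?d / 2) * exp (- ((norm x)\<^sup>2 / (4 * t)))"
   using t by (simp add: heat_def powr_mult)
  also have "\<dots> \<le> (4 * pi) powr (- ?d / 2) * t powr (- ?d / 2) * (C * (norm x powr (- \<alpha>) * (4 powr (\<alpha> / 2) * t powr (\<alpha> / 2))))"
   by (intro mult_left_mono 1) auto
  also have "\<dots> = (4 * pi) powr (- ?d / 2) * C * 4 powr (\<alpha> / 2) * norm x powr (- \<alpha>) * (t powr (\<alpha> / 2) * t powr (- ?d / 2))"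
   by (simp add: mult_ac)
  also have "t powr (\<alpha> / 2) * t powr (- ?d / 2) = t powr ((\<alpha> - ?d) / 2)"
   by (simp add: diff_divide_distrib flip: powr_add)
  finally show "heat t x \<le> (4 * pi) powr (- ?d / 2) * C * 4 powr (\<alpha> / 2) * norm x powr (- \<alpha>) * t powr ((\<alpha> - ?d) / 2)" .
 qed
qed

text \<open>In the parabolic region, where t is comparable to |x|^2, the exponential is bounded
  below. This is the source of all lower bounds in the proof.\<close>

lemma heat_ge_powr:
 obtains c where "c > 0" "\<And>t x::'a::euclidean_space. x \<noteq> 0 \<Longrightarrow> (norm x)\<^sup>2 \<le> t \<Longrightarrow> t \<le> 2 * (norm x)\<^sup>2 \<Longrightarrow>
   c * norm x powr (- real DIM('a)) \<le> heat t x"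
proof
 let ?d = "real DIM('a)"
 show "(8 * pi) powr (- ?d / 2) * exp (- 1 / 4) > 0" by simp
 fix t and x :: 'a assume x: "x \<noteq> 0" and t: "(norm x)\<^sup>2 \<le> t" "t \<le> 2 * (norm x)\<^sup>2"
 have t0: "t > 0" using x t by (meson less_le_trans zero_less_norm_iff zero_less_power)
 have "(8 * pi) powr (- ?d / 2) * norm x powr (- ?d) = (8 * pi * (norm x)\<^sup>2) powr (- ?d / 2)"
 proof -
  have "norm x powr (- ?d) = (norm x powr 2) powr (- ?d / 2)" by (simp only: powr_powr) simp
  moreover have "norm x powr 2 = (norm x)\<^sup>2" using x by simp
  ultimately show ?thesis by (simp only: powr_mult)
 qed
 also have "\<dots> \<le> (4 * pi * t) powr (- ?d / 2)"
  using t t0 by (intro powr_mono2') auto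
 finally have 1: "(8 * pi) powr (- ?d / 2) * norm x powr (- ?d) \<le> (4 * pi * t) powr (- ?d / 2)" .
 have "(norm x)\<^sup>2 / (4 * t) \<le> 1 / 4" using t t0 by (simp add: divide_le_eq)
 then have 2: "exp (- 1 / 4) \<le> exp (- (norm x)\<^sup>2 / (4 * t))" by simp
 have "((8 * pi) powr (- ?d / 2) * norm x powr (- ?d)) * exp (- 1 / 4) \<le> heat t x"
  unfolding heat_def by (intro mult_mono 1 2) auto
 then show "(8 * pi) powr (- ?d / 2) * exp (- 1 / 4) * norm x powr (- ?d) \<le> heat t x" by (simp add: mult_ac)
qed

lemma powr_add_le:
 fixes x y p :: real
 assumes "0 < x" "0 < y" "0 \<le> p" "p \<le> 1"
 shows "(x + y) powr p \<le> x powr p + y powr p"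
proof -
 have a: "u / (x + y) \<le> (u / (x + y)) powr p" if "0 < u" "u \<le> x + y" for u
  using powr_mono'[of p 1 "u / (x + y)"] that assms by simp
 have "1 = x / (x + y) + y / (x + y)" using assms by (simp flip: add_divide_distrib)
 also have "\<dots> \<le> (x / (x + y)) powr p + (y / (x + y)) powr p"
  using assms by (intro add_mono a) auto
 also have "\<dots> = (x powr p + y powr p) / (x + y) powr p"
  using assms by (simp add: powr_divide add_divide_distrib)
 finally show ?thesis using assms by (simp add: le_divide_eq)
qed

text \<open>Hoelder continuity in time of exponent 1/4, obtained from a bound of the time derivative
  by a multiple of \<tau>^(-3/4). The exponent is small enough for the resulting power of s + v to
  be integrable against \<open>kw\<close>.\<close>

lemma heat_diff_le:
 obtains C where "C > 0" "\<And>a b x::'a::euclidean_space. 0 < a \<Longrightarrow> a < b \<Longrightarrow> x \<noteq> 0 \<Longrightarrow>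
   \<bar>heat a x - heat b x\<bar> \<le> C * norm x powr (- real DIM('a) - 1/2) * (b - a) powr (1/4)"
proof -
 let ?d = "real DIM('a)"
 \<comment> \<open>The exponents d + 5/2 and d + 1/2 are chosen so that the two terms of the time
   derivative get the same bound, a multiple of |x|^(-d - 1/2) \<tau>^(-3/4).\<close>
 obtain C1 where C1: "C1 > 0" "\<And>t x::'a. 0 < t \<Longrightarrow> x \<noteq> 0 \<Longrightarrow>
   heat t x \<le> C1 * norm x powr (- (?d + 5/2)) * t powr ((?d + 5/2 - ?d) / 2)"
  using heat_le_powr[of "?d + 5/2", where 'a = 'a] by auto
 obtain C2 where C2: "C2 > 0" "\<And>t x::'a. 0 < t \<Longrightarrow> x \<noteq> 0 \<Longrightarrow>
   heat t x \<le> C2 * norm x powr (- (?d + 1/2)) * t powr ((?d + 1/2 - ?d) / 2)"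
  using heat_le_powr[of "?d + 1/2", where 'a = 'a] by auto
 define C where "C = C1 / 4 + C2 * ?d / 2"
 have C: "C > 0" using C1 C2 by (simp add: C_def add_pos_nonneg)
 show ?thesis
 proof
  show "4 * C > 0" using C by simp
  fix a b :: real and x :: 'a assume a: "0 < a" "a < b" and x: "x \<noteq> 0"
  define D where "D \<tau> = heat \<tau> x * ((norm x)\<^sup>2 / (4 * \<tau>\<^sup>2) - ?d / (2 * \<tau>))" for \<tau>
  define B where "B = C * norm x powr (- ?d - 1/2)"
  have D: "((\<lambda>\<tau>. heat \<tau> x) has_real_derivative D \<tau>) (at \<tau>)" if "\<tau> > 0" for \<tau>
  proof -
   have "((\<lambda>\<tau>. (4 * pi * \<tau>) powr (- ?d / 2)) has_real_derivative (4 * pi * \<tau>) powr (- ?d / 2) * (- ?d / (2 * \<tau>))) (at \<tau>)"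
   proof -
    have "((\<lambda>\<tau>. (4 * pi * \<tau>) powr (- ?d / 2)) has_real_derivative (4 * pi * \<tau>) powr (- ?d / 2) * ((4 * pi) * (- ?d / 2) / (4 * pi * \<tau>))) (at \<tau>)"
    proof -
     have u: "((\<lambda>\<tau>. 4 * pi * \<tau>) has_real_derivative 4 * pi) (at \<tau>)"
      by (auto intro!: derivative_eq_intros)
     have "((\<lambda>\<tau>. (4 * pi * \<tau>) powr (- ?d / 2)) has_real_derivative (- ?d / 2 * (4 * pi * \<tau>) powr (- ?d / 2 - 1)) * (4 * pi)) (at \<tau>)"
      using that by (intro DERIV_chain2[OF has_real_derivative_powr u]) simp
     moreover have "(4 * pi * \<tau>) powr (- ?d / 2 - 1) = (4 * pi * \<tau>) powr (- ?d / 2) / (4 * pi * \<tau>)"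
      using that by (simp add: powr_diff)
     moreover have "(r * (X / W)) * k = X * (k * r / W)" for r X W k :: real by simp
     ultimately show ?thesis by (simp only:)
    qed
    moreover have "(4 * pi) * (- ?d / 2) / (4 * pi * \<tau>) = - ?d / (2 * \<tau>)" by simp
    ultimately show ?thesis by simp
   qed
   moreover have "((\<lambda>\<tau>. exp (- (norm x)\<^sup>2 / (4 * \<tau>))) has_real_derivative exp (- (norm x)\<^sup>2 / (4 * \<tau>)) * ((norm x)\<^sup>2 / (4 * \<tau>\<^sup>2))) (at \<tau>)"
   proof -
    have "((\<lambda>\<tau>. - (norm x)\<^sup>2 / (4 * \<tau>)) has_real_derivative ((norm x)\<^sup>2 / (4 * \<tau>\<^sup>2))) (at \<tau>)"
     using that by (auto intro!: derivative_eq_intros simp: field_simps power2_eq_square)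
    from DERIV_chain2[OF DERIV_exp this] show ?thesis .
   qed
   ultimately have "((\<lambda>\<tau>. heat \<tau> x) has_real_derivative
    (4 * pi * \<tau>) powr (- ?d / 2) * (- ?d / (2 * \<tau>)) * exp (- (norm x)\<^sup>2 / (4 * \<tau>))
     + exp (- (norm x)\<^sup>2 / (4 * \<tau>)) * ((norm x)\<^sup>2 / (4 * \<tau>\<^sup>2)) * (4 * pi * \<tau>) powr (- ?d / 2)) (at \<tau>)"
    unfolding heat_def by (rule DERIV_mult)
   then show ?thesis by (simp add: D_def heat_def algebra_simps)
  qed
  have Dle: "\<bar>D \<tau>\<bar> \<le> B * \<tau> powr (- 3/4)" if t: "\<tau> > 0" for \<tau>
  proof -
   have "\<bar>D \<tau>\<bar> \<le> heat \<tau> x * ((norm x)\<^sup>2 / (4 * \<tau>\<^sup>2)) + heat \<tau> x * (?d / (2 * \<tau>))"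
   proof -
    have "\<bar>(norm x)\<^sup>2 / (4 * \<tau>\<^sup>2) - ?d / (2 * \<tau>)\<bar> \<le> (norm x)\<^sup>2 / (4 * \<tau>\<^sup>2) + ?d / (2 * \<tau>)"
     using t by (intro order_trans[OF abs_triangle_ineq4]) simp
    from mult_left_mono[OF this heat_nonneg[of \<tau> x]] show ?thesis
     unfolding D_def abs_mult by (simp only: distrib_left abs_of_nonneg[OF heat_nonneg])
   qed
   also have "heat \<tau> x * ((norm x)\<^sup>2 / (4 * \<tau>\<^sup>2)) \<le> (C1 * norm x powr (- (?d + 5/2)) * \<tau> powr ((?d + 5/2 - ?d) / 2)) * ((norm x)\<^sup>2 / (4 * \<tau>\<^sup>2))"
    using C1(2)[OF t x] t by (intro mult_right_mono) auto
   also have "\<dots> = C1 / 4 * (norm x powr (- (?d + 5/2)) * norm x powr 2) * (\<tau> powr (5/4) * \<tau> powr (-2))"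
   proof -
    have "norm x powr 2 = (norm x)\<^sup>2" using x by simp
    moreover have "\<tau> powr (-2) = 1 / \<tau>\<^sup>2" using t by (simp add: powr_minus divide_inverse)
    moreover have "(?d + 5/2 - ?d) / 2 = 5/4" by simp
    moreover have "C1 * Y * Z * (n / (4 * q)) = C1 / 4 * (Y * n) * (Z * (1 / q))" for Y Z n q :: real by simp
    ultimately show ?thesis by (simp only:)
   qed
   also have "norm x powr (- (?d + 5/2)) * norm x powr 2 = norm x powr (- ?d - 1/2)"
    by (simp only: powr_add[symmetric]) (rule arg_cong[where f = "\<lambda>z. norm x powr z"], simp)
   also have "\<tau> powr (5/4) * \<tau> powr (-2) = \<tau> powr (-3/4)" by (simp only: powr_add[symmetric]) simp
   also have "heat \<tau> x * (?d / (2 * \<tau>)) \<le> (C2 * norm x powr (- (?d + 1/2)) * \<tau> powr ((?d + 1/2 - ?d) / 2)) * (?d / (2 * \<tau>))"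
    using C2(2)[OF t x] t by (intro mult_right_mono) auto
   also have "\<dots> = C2 * ?d / 2 * norm x powr (- ?d - 1/2) * (\<tau> powr (1/4) * \<tau> powr (-1))"
   proof -
    have "\<tau> powr (-1) = 1 / \<tau>" using t by (simp add: powr_minus divide_inverse)
    moreover have "(?d + 1/2 - ?d) / 2 = 1/4" "- (?d + 1/2) = - ?d - 1/2" by simp_all
    moreover have "C2 * Y * Z * (n / (2 * q)) = C2 * n / 2 * Y * (Z * (1 / q))" for Y Z n q :: real by simp
    ultimately show ?thesis by (simp only:)
   qed
   also have "\<tau> powr (1/4) * \<tau> powr (-1) = \<tau> powr (-3/4)" by (simp only: powr_add[symmetric]) simp
   finally show ?thesis by (simp add: B_def C_def algebra_simps)
  qed
  have Q: "((\<lambda>\<tau>. 4 * B * \<tau> powr (1/4)) has_real_derivative B * \<tau> powr (- 3/4)) (at \<tau>)" if "\<tau> > 0" for \<tau>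
  proof -
   have p: "\<tau> powr (1/4 - 1) = \<tau> powr (- 3/4)" by simp
   from DERIV_cmult[OF has_real_derivative_powr[OF that, of "1/4"], of "4 * B"] show ?thesis
    unfolding p by simp
  qed
  \<comment> \<open>The function 4 B \<tau>^(1/4) has derivative B \<tau>^(-3/4), so adding or
    subtracting the heat kernel leaves it increasing; the two monotonicities together bound the
    absolute difference without integrating the derivative.\<close>
  have "4 * B * a powr (1/4) - heat a x \<le> 4 * B * b powr (1/4) - heat b x"
  proof (rule DERIV_nonneg_imp_nondecreasing[where f = "\<lambda>\<tau>. 4 * B * \<tau> powr (1/4) - heat \<tau> x"])
   fix \<tau> assume "a \<le> \<tau>"
   then have "\<tau> > 0" using a by simp
   from DERIV_diff[OF Q[OF this] D[OF this]] Dle[OF this]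
   show "\<exists>y. ((\<lambda>\<tau>. 4 * B * \<tau> powr (1/4) - heat \<tau> x) has_real_derivative y) (at \<tau>) \<and> 0 \<le> y"
    by (intro exI conjI) (assumption, linarith)
  qed (use a in simp)
  moreover have "4 * B * a powr (1/4) + heat a x \<le> 4 * B * b powr (1/4) + heat b x"
  proof (rule DERIV_nonneg_imp_nondecreasing[where f = "\<lambda>\<tau>. 4 * B * \<tau> powr (1/4) + heat \<tau> x"])
   fix \<tau> assume "a \<le> \<tau>"
   then have "\<tau> > 0" using a by simp
   from DERIV_add[OF Q[OF this] D[OF this]] Dle[OF this]
   show "\<exists>y. ((\<lambda>\<tau>. 4 * B * \<tau> powr (1/4) + heat \<tau> x) has_real_derivative y) (at \<tau>) \<and> 0 \<le> y"
    by (intro exI conjI) (assumption, linarith)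
  qed (use a in simp)
  ultimately have "\<bar>heat a x - heat b x\<bar> \<le> 4 * B * (b powr (1/4) - a powr (1/4))"
   by (simp add: right_diff_distrib)
  also have "\<dots> \<le> 4 * B * (b - a) powr (1/4)"
  proof -
   have "b powr (1/4) \<le> a powr (1/4) + (b - a) powr (1/4)"
    using powr_add_le[of a "b - a" "1/4"] a by simp
   moreover have "B \<ge> 0" using C by (simp add: B_def)
   ultimately show ?thesis by (intro mult_left_mono) auto
  qed
  finally show "\<bar>heat a x - heat b x\<bar> \<le> 4 * C * norm x powr (- ?d - 1/2) * (b - a) powr (1/4)"
   by (simp add: B_def mult_ac)
 qed
qed

section \<open>Uniform estimates for the heat kernel\<close>

text \<open>With q = |x|^2 / v this is |x|^(-d) min (q^(1/4), q^(-1/4)), a profile invariant under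
  parabolic scaling. The minimum repairs the divergence of |x|^(-d) both at 0 and at
  infinity.\<close>

definition GG :: "real \<Rightarrow> 'a::euclidean_space \<Rightarrow> real" where
 "GG v x = norm x powr (- real DIM('a)) * min (norm x powr (1/2) * v powr (- (1/4))) (norm x powr (- (1/2)) * v powr (1/4))"

lemma GG_nonneg [simp]: "0 \<le> GG v x"
 by (simp add: GG_def)

lemma GG_measurable [measurable]:
 fixes g :: "_ \<Rightarrow> 'a::euclidean_space"
 assumes [measurable]: "f \<in> borel_measurable M" "g \<in> borel_measurable M"
 shows "(\<lambda>x. GG (f x) (g x)) \<in> borel_measurable M"
 unfolding GG_def by measurable

lemma AE_neq_lborel: "AE x in lborel. x \<noteq> (c :: 'a::euclidean_space)"
 by (rule AE_I'[of "{c}"]) (auto simp: null_sets_def)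

lemma nn_integral_lborel_plus:
 fixes c :: "'a::euclidean_space"
 assumes [measurable]: "f \<in> borel_measurable borel"
 shows "(NN x. f (x + c)) = (NN x. f x)"
proof -
 have "(NN x. f x) = (\<integral>\<^sup>+x. f x \<partial>(distr lborel borel ((+) c)))"
  by (simp add: lborel_distr_plus)
 then show ?thesis by (simp add: nn_integral_distr add.commute)
qed

text \<open>The radial profile of \<open>GG\<close> seen in the time variable: \<open>GG v x\<close>
  is |x|^(2-d) times \<open>wt v\<close> at |x|^2, for x \<noteq> 0.\<close>

definition wt :: "real \<Rightarrow> real \<Rightarrow> real" where
 "wt v t = t powr (-1) * min (t powr (1/4) * v powr (-(1/4))) (t powr (-(1/4)) * v powr (1/4))"

lemma powr_weight_integral:
 assumes v: "v > 0"
 shows "(NN \<tau>. ennreal (wt v \<tau>) * indicator {0<..} \<tau>) \<le> 8"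
proof -
 have "(NN \<tau>. ennreal (wt v \<tau>) * indicator {0<..} \<tau>)
   \<le> (NN \<tau>. ennreal (v powr (-(1/4))) * (ennreal (\<tau> powr (-3/4)) * indicator {0<..<v} \<tau>)
     + ennreal (v powr (1/4)) * (ennreal (\<tau> powr (-5/4)) * indicator {v<..} \<tau>))"
 proof (rule nn_integral_mono_AE, use AE_neq_lborel[of v] in eventually_elim)
  fix \<tau> assume ne: "\<tau> \<noteq> v"
  have e: "\<tau> powr (-1) * \<tau> powr (1/4) = \<tau> powr (-3/4)" "\<tau> powr (-1) * \<tau> powr (-(1/4)) = \<tau> powr (-5/4)"
   by (simp_all only: powr_add[symmetric]) simp_all
  consider "\<tau> \<le> 0" | "0 < \<tau>" "\<tau> < v" | "v < \<tau>" using ne by linarith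
  then show "ennreal (wt v \<tau>) * indicator {0<..} \<tau>
    \<le> ennreal (v powr (-(1/4))) * (ennreal (\<tau> powr (-3/4)) * indicator {0<..<v} \<tau>)
     + ennreal (v powr (1/4)) * (ennreal (\<tau> powr (-5/4)) * indicator {v<..} \<tau>)"
  proof cases
   case 2
   have "wt v \<tau> \<le> \<tau> powr (-1) * (\<tau> powr (1/4) * v powr (-(1/4)))"
    unfolding wt_def by (intro mult_left_mono) auto
   also have "\<dots> = v powr (-(1/4)) * \<tau> powr (-3/4)" unfolding e[symmetric] by (simp only: mult_ac)
   finally show ?thesis using 2 by (simp add: ennreal_leI flip: ennreal_mult')
  next
   case 3
   have "wt v \<tau> \<le> \<tau> powr (-1) * (\<tau> powr (-(1/4)) * v powr (1/4))"
    unfolding wt_def by (intro mult_left_mono) auto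
   also have "\<dots> = v powr (1/4) * \<tau> powr (-5/4)" unfolding e[symmetric] by (simp only: mult_ac)
   finally show ?thesis using 3 v by (simp add: ennreal_leI flip: ennreal_mult')
  qed simp
 qed
 also have "\<dots> = ennreal (v powr (-(1/4))) * ennreal (v powr (-3/4 + 1) / (-3/4 + 1)) + ennreal (v powr (1/4)) * ennreal (v powr (-5/4 + 1) / (- (-5/4) - 1))"
  using v by (subst nn_integral_add; (subst nn_integral_cmult)?; (subst nn_integral_cmult)?)
    (measurable, subst nn_integral_powr_0, simp, simp, subst nn_integral_powr_inf, simp, simp, rule refl)
 also have "\<dots> = ennreal (v powr (-(1/4)) * (4 * v powr (1/4)) + v powr (1/4) * (4 * v powr (-(1/4))))"
  by (simp add: ennreal_mult'[symmetric] ennreal_plus[symmetric] mult.commute del: ennreal_plus)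
 also have "v powr (-(1/4)) * (4 * v powr (1/4)) + v powr (1/4) * (4 * v powr (-(1/4))) = 8"
 proof -
  have "v powr (-(1/4)) * v powr (1/4) = 1" using v by (simp only: powr_add[symmetric]) simp
  then show ?thesis by (simp add: mult.commute mult.left_commute)
 qed
 finally show ?thesis by simp
qed

text \<open>A substitute for polar coordinates: \<open>GG\<close> is dominated by an average of heat
  kernels, each of mass 1. With r = |x|^2 the times in [r, 2r] suffice, since there the weight and
  the heat kernel are bounded below by constants times their natural size, and the interval has
  length r.\<close>

lemma GG_le_heat:
 obtains C where "C > 0" "\<And>v x::'a::euclidean_space. 0 < v \<Longrightarrow> x \<noteq> 0 \<Longrightarrow> ennreal (GG v x) \<le>
   ennreal C * (NN \<tau>. ennreal (wt v \<tau>) * indicator {0<..} \<tau> * ennreal (heat \<tau> x))"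
proof -
 let ?d = "real DIM('a)"
 obtain c where c: "c > 0" "\<And>t x::'a::euclidean_space. x \<noteq> 0 \<Longrightarrow> (norm x)\<^sup>2 \<le> t \<Longrightarrow> t \<le> 2 * (norm x)\<^sup>2 \<Longrightarrow>
   c * norm x powr (- ?d) \<le> heat t x"
  using heat_ge_powr[where 'a = 'a] by auto
 show ?thesis
 proof
  \<comment> \<open>A factor 2 comes from 1/\<tau> \<ge> 1/(2r), another from the minimum in the
    weight, and 1/c from the lower bound of the heat kernel.\<close>
  show "4 / c > 0" using c by simp
  fix v :: real and x :: 'a assume v: "0 < v" and x: "x \<noteq> 0"
  define r where "r = (norm x)\<^sup>2"
  have r: "r > 0" using x by (simp add: r_def)
  have r4: "r powr (1/4) = norm x powr (1/2)" "r powr (-(1/4)) = norm x powr (-(1/2))"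
  proof -
   have r2: "r = norm x powr 2" using x by (simp add: r_def)
   have "r powr (1/4) = norm x powr (2 * (1/4))" "r powr (-(1/4)) = norm x powr (2 * (-(1/4)))"
    unfolding r2 by (rule powr_powr)+
   then show "r powr (1/4) = norm x powr (1/2)" "r powr (-(1/4)) = norm x powr (-(1/2))"
    by simp_all
  qed
  have wle: "c / 4 * GG v x / r \<le> wt v \<tau> * heat \<tau> x" if t: "r \<le> \<tau>" "\<tau> \<le> 2 * r" for \<tau>
  proof -
   have t0: "\<tau> > 0" using t r by simp
   have a: "1 / (2 * r) \<le> \<tau> powr (-1)" unfolding powr_neg_one[OF t0] using t t0 r by (intro divide_left_mono) auto
   have b: "r powr (1/4) \<le> \<tau> powr (1/4)" using t r by (intro powr_mono2) auto
   have b': "1/2 * r powr (-(1/4)) \<le> \<tau> powr (-(1/4))"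
   proof -
    have "(2 * r) powr (-(1/4)) \<le> \<tau> powr (-(1/4))" using t t0 by (intro powr_mono2') auto
    moreover have "1/2 * r powr (-(1/4)) \<le> 2 powr (-(1/4)) * r powr (-(1/4))"
    proof (intro mult_right_mono)
     have "(2::real) powr (-1) \<le> 2 powr (-(1/4))" by (intro powr_mono) auto
     then show "1/2 \<le> (2::real) powr (-(1/4))" by (simp add: powr_minus)
    qed simp
    ultimately show ?thesis by (simp add: powr_mult)
   qed
   have m: "1/2 * min (r powr (1/4) * v powr (-(1/4))) (r powr (-(1/4)) * v powr (1/4)) \<le> min (\<tau> powr (1/4) * v powr (-(1/4))) (\<tau> powr (-(1/4)) * v powr (1/4))"
   proof (rule min.boundedI)
    have "1/2 * min (r powr (1/4) * v powr (-(1/4))) (r powr (-(1/4)) * v powr (1/4)) \<le> 1 * (r powr (1/4) * v powr (-(1/4)))"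
     by (intro mult_mono) auto
    also have "\<dots> \<le> \<tau> powr (1/4) * v powr (-(1/4))" using b by (simp add: mult_right_mono)
    finally show "1/2 * min (r powr (1/4) * v powr (-(1/4))) (r powr (-(1/4)) * v powr (1/4)) \<le> \<tau> powr (1/4) * v powr (-(1/4))" .
    have "1/2 * min (r powr (1/4) * v powr (-(1/4))) (r powr (-(1/4)) * v powr (1/4)) \<le> 1/2 * (r powr (-(1/4)) * v powr (1/4))"
     by (intro mult_mono) auto
    also have "\<dots> = (1/2 * r powr (-(1/4))) * v powr (1/4)" by simp
    also have "\<dots> \<le> \<tau> powr (-(1/4)) * v powr (1/4)" using b' by (intro mult_right_mono) auto
    finally show "1/2 * min (r powr (1/4) * v powr (-(1/4))) (r powr (-(1/4)) * v powr (1/4)) \<le> \<tau> powr (-(1/4)) * v powr (1/4)" .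
   qed
   have "c / 4 * GG v x / r = (1 / (2 * r) * (1/2 * min (r powr (1/4) * v powr (-(1/4))) (r powr (-(1/4)) * v powr (1/4)))) * (c * norm x powr (- ?d))"
    unfolding GG_def r4[symmetric] by simp
   also have "\<dots> \<le> wt v \<tau> * heat \<tau> x"
    unfolding wt_def using c t x r v by (intro mult_mono a m c(2)) (auto simp: r_def)
   finally show ?thesis .
  qed
  have "ennreal (GG v x) = ennreal (4 / c) * (ennreal (c / 4 * GG v x / r) * ennreal r)"
   using c r by (simp flip: ennreal_mult)
  also have "ennreal (c / 4 * GG v x / r) * ennreal r = (NN \<tau>. ennreal (c / 4 * GG v x / r) * indicator {r..2*r} \<tau>)"
   using r by (subst nn_integral_cmult_indicator) auto
  also have "\<dots> \<le> (NN \<tau>. ennreal (wt v \<tau>) * indicator {0<..} \<tau> * ennreal (heat \<tau> x))"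
  proof (intro nn_integral_mono)
   fix \<tau>
   show "ennreal (c / 4 * GG v x / r) * indicator {r..2*r} \<tau> \<le> ennreal (wt v \<tau>) * indicator {0<..} \<tau> * ennreal (heat \<tau> x)"
    using wle[of \<tau>] r by (auto simp: indicator_def ennreal_leI simp flip: ennreal_mult'')
  qed
  finally show "ennreal (GG v x) \<le>
   ennreal (4 / c) * (NN \<tau>. ennreal (wt v \<tau>) * indicator {0<..} \<tau> * ennreal (heat \<tau> x))"
   by (simp add: mult_left_mono)
 qed
qed

lemma GG_integral:
 obtains C where "C > 0" "\<And>v. 0 < v \<Longrightarrow> (NN x. ennreal (GG v (x::'a::euclidean_space))) \<le> ennreal C"
proof -
 obtain C where C: "C > 0" "\<And>v x::'a::euclidean_space. 0 < v \<Longrightarrow> x \<noteq> 0 \<Longrightarrow> ennreal (GG v x) \<le>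
   ennreal C * (NN \<tau>. ennreal (wt v \<tau>) * indicator {0<..} \<tau> * ennreal (heat \<tau> x))"
  using GG_le_heat[where 'a = 'a] by auto
 show ?thesis
 proof
  show "C * 8 > 0" using C by simp
  fix v :: real assume v: "0 < v"
  define w where "w \<tau> = ennreal (wt v \<tau>) * indicator {0<..} \<tau>" for \<tau>
  have [measurable]: "w \<in> borel_measurable borel" unfolding w_def wt_def by measurable
  have "(NN x. ennreal (GG v (x::'a))) \<le> (NN x. ennreal C * (NN \<tau>. w \<tau> * ennreal (heat \<tau> (x::'a))))"
   by (rule nn_integral_mono_AE, use AE_neq_lborel[of "0::'a"] in eventually_elim) (use C(2)[OF v] in \<open>auto simp: w_def\<close>)
  also have "\<dots> = ennreal C * (NN x. (NN \<tau>. w \<tau> * ennreal (heat \<tau> (x::'a))))"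
   by (intro nn_integral_cmult) measurable
  also have "(NN x. (NN \<tau>. w \<tau> * ennreal (heat \<tau> (x::'a)))) = (NN \<tau>. (NN x. w \<tau> * ennreal (heat \<tau> (x::'a))))"
   by (intro lborel_pair.Fubini') measurable
  also have "\<dots> = (NN \<tau>. w \<tau>)"
  proof (intro nn_integral_cong)
   fix \<tau>
   show "(NN x. w \<tau> * ennreal (heat \<tau> (x::'a))) = w \<tau>"
    using nn_integral_heat[of \<tau> "0::'a"] by (cases "\<tau> > 0") (simp_all add: nn_integral_cmult w_def)
  qed
  also have "\<dots> \<le> 8" unfolding w_def by (rule powr_weight_integral[OF v])
  finally show "(NN x. ennreal (GG v (x::'a))) \<le> ennreal (C * 8)"
   using C by (simp add: ennreal_mult' mult_left_mono)
 qed
qed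

text \<open>\<open>HH s v\<close> bounds \<open>P\<^bsub>t-v\<^esub> - P\<^bsub>t+s\<^esub>\<close> uniformly in \<open>t\<close>, and its average in \<open>s\<close> with the weight \<open>kw s v\<close>
 is at most \<open>7 * GG v\<close>.\<close>
definition HH :: "real \<Rightarrow> real \<Rightarrow> 'a::euclidean_space \<Rightarrow> real" where
 "HH s v x = norm x powr (- real DIM('a)) * min (norm x powr (1/2) * (v powr (-(1/4)) + s powr (-(1/4)))) (norm x powr (-(1/2)) * (s + v) powr (1/4))"

lemma HH_measurable [measurable]:
 fixes g :: "_ \<Rightarrow> 'a::euclidean_space"
 assumes [measurable]: "f \<in> borel_measurable M" "h \<in> borel_measurable M" "g \<in> borel_measurable M"
 shows "(\<lambda>x. HH (f x) (h x) (g x)) \<in> borel_measurable M"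
 unfolding HH_def by measurable

lemma HH_nonneg [simp]: "0 \<le> HH s v x" by (simp add: HH_def)

text \<open>For t > 2v both times exceed v, so the size of either kernel gives the first entry of
  the minimum, and Hoelder continuity over the gap s + v gives the second. For t \<le> 2v the kernel
  at t + s needs no cancellation, because s \<le> t + s \<le> 2 (s + v).\<close>

lemma heat_HH:
 obtains C where "C > 0"
  "\<And>t s v x::'a::euclidean_space. 0 < v \<Longrightarrow> 0 < s \<Longrightarrow> 2 * v < t \<Longrightarrow> x \<noteq> 0 \<Longrightarrow> \<bar>heat (t - v) x - heat (t + s) x\<bar> \<le> C * HH s v x"
  "\<And>t s v x::'a::euclidean_space. 0 < t \<Longrightarrow> 0 < s \<Longrightarrow> t \<le> 2 * v \<Longrightarrow> x \<noteq> 0 \<Longrightarrow> heat (t + s) x \<le> C * HH s v x"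
proof -
 let ?d = "real DIM('a)"
 have d: "?d \<ge> 1" by (simp add: Suc_leI)
 obtain C1 where C1: "C1 > 0" "\<And>t x::'a. 0 < t \<Longrightarrow> x \<noteq> 0 \<Longrightarrow>
   heat t x \<le> C1 * norm x powr (- (?d - 1/2)) * t powr ((?d - 1/2 - ?d) / 2)"
  using heat_le_powr[of "?d - 1/2", where 'a = 'a] d by auto
 obtain C2 where C2: "C2 > 0" "\<And>t x::'a. 0 < t \<Longrightarrow> x \<noteq> 0 \<Longrightarrow>
   heat t x \<le> C2 * norm x powr (- (?d + 1/2)) * t powr ((?d + 1/2 - ?d) / 2)"
  using heat_le_powr[of "?d + 1/2", where 'a = 'a] by auto
 obtain C3 where C3: "C3 > 0" "\<And>a b x::'a::euclidean_space. 0 < a \<Longrightarrow> a < b \<Longrightarrow> x \<noteq> 0 \<Longrightarrow>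
   \<bar>heat a x - heat b x\<bar> \<le> C3 * norm x powr (- real DIM('a) - 1/2) * (b - a) powr (1/4)"
  using heat_diff_le[where 'a = 'a] by auto
 have e1: "norm x powr (- (?d - 1/2)) = norm x powr (- ?d) * norm x powr (1/2)" for x :: 'a
  by (simp only: powr_add[symmetric]) simp
 have e2: "norm x powr (- ?d - 1/2) = norm x powr (- ?d) * norm x powr (-(1/2))" for x :: 'a
  by (simp only: powr_add[symmetric]) simp
 have e2': "- (?d + 1/2) = - ?d - 1/2" by simp
 have B1: "heat t x \<le> C1 * norm x powr (- ?d) * (norm x powr (1/2) * t powr (-(1/4)))" if "0 < t" "x \<noteq> 0" for t and x :: 'a
  using C1(2)[OF that] unfolding e1 by (simp add: mult_ac)
 have B2: "heat t x \<le> C2 * norm x powr (- ?d) * (norm x powr (-(1/2)) * t powr (1/4))" if "0 < t" "x \<noteq> 0" for t and x :: 'a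
  using C2(2)[OF that] unfolding e2' e2 by (simp add: mult_ac)
 define C where "C = C1 + 2 * C2 + C3"
 have C: "C > 0" "C1 \<le> C" "2 * C2 \<le> C" "C3 \<le> C" using C1 C2 C3 by (auto simp: C_def)
 have minI: "y \<le> C * HH s v x" if "y \<le> C * norm x powr (- ?d) * (norm x powr (1/2) * (v powr (-(1/4)) + s powr (-(1/4))))"
  "y \<le> C * norm x powr (- ?d) * (norm x powr (-(1/2)) * (s + v) powr (1/4))" for y s v and x :: 'a
  unfolding HH_def using that by (simp add: min_def mult.assoc)
 show ?thesis
 proof
  show "C > 0" by fact
  fix t s v :: real and x :: 'a assume v: "0 < v" "0 < s" "2 * v < t" and x: "x \<noteq> 0"
  show "\<bar>heat (t - v) x - heat (t + s) x\<bar> \<le> C * HH s v x"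
  proof (rule minI)
   have a: "heat \<tau> x \<le> C1 * norm x powr (- ?d) * (norm x powr (1/2) * v powr (-(1/4)))" if "v \<le> \<tau>" for \<tau>
   proof -
    have "heat \<tau> x \<le> C1 * norm x powr (- ?d) * (norm x powr (1/2) * \<tau> powr (-(1/4)))"
     using that v x by (intro B1) auto
    also have "\<dots> \<le> C1 * norm x powr (- ?d) * (norm x powr (1/2) * v powr (-(1/4)))"
     using that v C1 by (intro mult_left_mono powr_mono2') auto
    finally show ?thesis .
   qed
   have "\<bar>heat (t - v) x - heat (t + s) x\<bar> \<le> max (heat (t - v) x) (heat (t + s) x)"
    using heat_nonneg[of "t - v" x] heat_nonneg[of "t + s" x] by linarith
   also have "\<dots> \<le> C1 * norm x powr (- ?d) * (norm x powr (1/2) * v powr (-(1/4)))"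
    using a[of "t - v"] a[of "t + s"] v by auto
   also have "\<dots> \<le> C * norm x powr (- ?d) * (norm x powr (1/2) * (v powr (-(1/4)) + s powr (-(1/4))))"
    using C C1 by (intro mult_mono mult_right_mono) auto
   finally show "\<bar>heat (t - v) x - heat (t + s) x\<bar> \<le> C * norm x powr (- ?d) * (norm x powr (1/2) * (v powr (-(1/4)) + s powr (-(1/4))))" .
   have "\<bar>heat (t - v) x - heat (t + s) x\<bar> \<le> C3 * norm x powr (- ?d - 1/2) * (t + s - (t - v)) powr (1/4)"
    using v x by (intro C3(2)) auto
   also have "\<dots> = C3 * norm x powr (- ?d) * (norm x powr (-(1/2)) * (s + v) powr (1/4))" unfolding e2 by (simp add: mult_ac add.commute)
   also have "\<dots> \<le> C * norm x powr (- ?d) * (norm x powr (-(1/2)) * (s + v) powr (1/4))"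
    using C by (intro mult_right_mono) auto
   finally show "\<bar>heat (t - v) x - heat (t + s) x\<bar> \<le> C * norm x powr (- ?d) * (norm x powr (-(1/2)) * (s + v) powr (1/4))" .
  qed
 next
  fix t s v :: real and x :: 'a assume v: "0 < t" "0 < s" "t \<le> 2 * v" and x: "x \<noteq> 0"
  show "heat (t + s) x \<le> C * HH s v x"
  proof (rule minI)
   have "heat (t + s) x \<le> C1 * norm x powr (- ?d) * (norm x powr (1/2) * (t + s) powr (-(1/4)))"
    using v x by (intro B1) auto
   also have "\<dots> \<le> C * norm x powr (- ?d) * (norm x powr (1/2) * (v powr (-(1/4)) + s powr (-(1/4))))"
   proof (intro mult_mono)
    have "(t + s) powr (-(1/4)) \<le> s powr (-(1/4))" using v by (intro powr_mono2') auto
    then show "(t + s) powr (-(1/4)) \<le> v powr (-(1/4)) + s powr (-(1/4))"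
     using powr_ge_zero[of v "-(1/4)"] by linarith
   qed (use C C1 in auto)
   finally show "heat (t + s) x \<le> C * norm x powr (- ?d) * (norm x powr (1/2) * (v powr (-(1/4)) + s powr (-(1/4))))" .
   have "heat (t + s) x \<le> C2 * norm x powr (- ?d) * (norm x powr (-(1/2)) * (t + s) powr (1/4))"
    using v x by (intro B2) auto
   also have "\<dots> \<le> C2 * norm x powr (- ?d) * (norm x powr (-(1/2)) * (2 * (s + v) powr (1/4)))"
   proof (intro mult_left_mono)
    have "(t + s) powr (1/4) \<le> (2 * (s + v)) powr (1/4)" using v by (intro powr_mono2) auto
    also have "\<dots> = 2 powr (1/4) * (s + v) powr (1/4)" by (rule powr_mult)
    also have "\<dots> \<le> 2 * (s + v) powr (1/4)"
    proof (intro mult_right_mono)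
     have "(2::real) powr (1/4) \<le> 2 powr 1" by (intro powr_mono) auto
     then show "(2::real) powr (1/4) \<le> 2" by simp
    qed simp
    finally show "(t + s) powr (1/4) \<le> 2 * (s + v) powr (1/4)" .
   qed (use C2 in auto)
   also have "\<dots> = 2 * C2 * norm x powr (- ?d) * (norm x powr (-(1/2)) * (s + v) powr (1/4))" by simp
   also have "\<dots> \<le> C * norm x powr (- ?d) * (norm x powr (-(1/2)) * (s + v) powr (1/4))"
    using C by (intro mult_right_mono) auto
   finally show "heat (t + s) x \<le> C * norm x powr (- ?d) * (norm x powr (-(1/2)) * (s + v) powr (1/4))" .
  qed
 qed
qed

text \<open>\<open>kw s v\<close> is at most v^(-1/2) s^(-1/2) for s < v and v^(1/2) s^(-3/2) for s
  > v. The power s^p keeps the first integrable at 0 and the second at infinity exactly for |p| <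
  1/2, and scaling gives v^p.\<close>

lemma kw_powr_integral:
 fixes p v :: real
 assumes p: "-1/2 < p" "p < 1/2" and v: "v > 0"
 shows "(NN s. ennreal (kw s v) * ennreal (s powr p)) \<le> ennreal ((1 / (1/2 + p) + 1 / (1/2 - p)) * v powr p)"
proof -
 have "(NN s. ennreal (kw s v) * ennreal (s powr p))
   \<le> (NN s. ennreal (v powr (-(1/2))) * (ennreal (s powr (p - 1/2)) * indicator {0<..<v} s)
     + ennreal (v powr (1/2)) * (ennreal (s powr (p - 3/2)) * indicator {v<..} s))"
 proof (rule nn_integral_mono_AE, use AE_neq_lborel[of v] in eventually_elim)
  fix s assume ne: "s \<noteq> v"
  have kw: "kw s v \<le> v powr (1/2) * s powr (-(1/2)) * (1 / u)" if "0 < s" "0 < u" "u \<le> s + v" for u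
  proof -
   have "kw s v = sqrt (v / s) * (1 / (pi * (s + v)))" using v that by (simp add: kw_def)
   also have "\<dots> \<le> sqrt (v / s) * (1 / u)"
   proof (intro mult_left_mono)
    have "1 * u \<le> pi * (s + v)" using that v pi_gt3 by (intro mult_mono) auto
    then show "1 / (pi * (s + v)) \<le> 1 / u" using that by (intro divide_left_mono) auto
   qed (use v that in auto)
   also have "sqrt (v / s) = v powr (1/2) * s powr (-(1/2))"
   proof -
    have "v powr (1/2) = sqrt v" using v by (intro powr_half_sqrt) simp
    moreover have "s powr (-(1/2)) = inverse (sqrt s)"
     using that by (simp only: powr_minus powr_half_sqrt[OF less_imp_le])
    ultimately show ?thesis by (simp only: divide_inverse real_sqrt_mult real_sqrt_inverse)
   qed
   finally show ?thesis .
  qed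
  consider "s \<le> 0" | "0 < s" "s < v" | "v < s" using ne by linarith
  then show "ennreal (kw s v) * ennreal (s powr p)
    \<le> ennreal (v powr (-(1/2))) * (ennreal (s powr (p - 1/2)) * indicator {0<..<v} s)
     + ennreal (v powr (1/2)) * (ennreal (s powr (p - 3/2)) * indicator {v<..} s)"
  proof cases
   case 1 then show ?thesis by (simp add: kw_def)
  next
   case 2
   have "kw s v * s powr p \<le> (v powr (1/2) * s powr (-(1/2)) * (1 / v)) * s powr p"
    using 2 v by (intro mult_right_mono kw) auto
   also have "\<dots> = (v powr (1/2) * v powr (-1)) * (s powr (-(1/2)) * s powr p)"
    unfolding powr_neg_one[OF v] by (simp only: mult_ac)
   also have "\<dots> = v powr (-(1/2)) * s powr (p - 1/2)"
    by (simp only: powr_add[symmetric]) simp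
   finally show ?thesis using 2 by (simp add: ennreal_leI flip: ennreal_mult')
  next
   case 3
   have "kw s v * s powr p \<le> (v powr (1/2) * s powr (-(1/2)) * (1 / s)) * s powr p"
    using 3 v by (intro mult_right_mono kw) auto
   also have "\<dots> = v powr (1/2) * (s powr (-(1/2)) * s powr (-1) * s powr p)"
    unfolding powr_neg_one[OF order_less_trans[OF v 3]] by (simp only: mult_ac)
   also have "\<dots> = v powr (1/2) * s powr (p - 3/2)"
    by (simp only: powr_add[symmetric]) simp
   finally show ?thesis using 3 v by (simp add: ennreal_leI flip: ennreal_mult')
  qed
 qed
 also have "\<dots> = ennreal (v powr (-(1/2))) * ennreal (v powr (p - 1/2 + 1) / (p - 1/2 + 1)) + ennreal (v powr (1/2)) * ennreal (v powr (p - 3/2 + 1) / (- (p - 3/2) - 1))"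
  using v p by (subst nn_integral_add; (subst nn_integral_cmult)?; (subst nn_integral_cmult)?)
    (measurable, subst nn_integral_powr_0, simp, simp, subst nn_integral_powr_inf, simp, simp, rule refl)
 also have "\<dots> = ennreal (v powr (-(1/2)) * (v powr (p + 1/2) / (1/2 + p)) + v powr (1/2) * (v powr (p - 1/2) / (1/2 - p)))"
  using p by (simp add: ennreal_mult'[symmetric] ennreal_plus[symmetric] add.commute del: ennreal_plus)
 also have "v powr (-(1/2)) * (v powr (p + 1/2) / (1/2 + p)) + v powr (1/2) * (v powr (p - 1/2) / (1/2 - p)) = (1 / (1/2 + p) + 1 / (1/2 - p)) * v powr p"
 proof -
  have "v powr (-(1/2)) * v powr (p + 1/2) = v powr p" "v powr (1/2) * v powr (p - 1/2) = v powr p" by (simp_all only: powr_add[symmetric]) simp_all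
  then show ?thesis by (simp add: add_divide_distrib distrib_right)
 qed
 finally show ?thesis by simp
qed

text \<open>Each entry of the minimum in \<open>HH\<close> is averaged separately. The moments of
  order 1/4 and -1/4 both cost at most 16/3, the term free of s costs 1, and 19/3 is rounded up to
  7.\<close>

lemma kw_HH_integral:
 fixes x :: "'a::euclidean_space"
 assumes v: "v > 0"
 shows "(NN s. ennreal (kw s v) * ennreal (HH s v x)) \<le> ennreal (7 * GG v x)"
proof -
 let ?d = "real DIM('a)"
 have k1: "(NN s. ennreal (kw s v) * ennreal (v powr (-(1/4)) + s powr (-(1/4)))) \<le> ennreal (7 * v powr (-(1/4)))"
 proof -
  have "(NN s. ennreal (kw s v) * ennreal (v powr (-(1/4)) + s powr (-(1/4))))
    = (NN s. ennreal (kw s v) * ennreal (v powr (-(1/4))) + ennreal (kw s v) * ennreal (s powr (-(1/4))))"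
   by (intro nn_integral_cong) (simp add: distrib_left)
  also have "\<dots> = (NN s. ennreal (kw s v)) * ennreal (v powr (-(1/4))) + (NN s. ennreal (kw s v) * ennreal (s powr (-(1/4))))"
   by (subst nn_integral_add) (auto simp: nn_integral_multc)
  also have "\<dots> \<le> 1 * ennreal (v powr (-(1/4))) + ennreal ((1 / (1/2 + (-(1/4))) + 1 / (1/2 - (-(1/4)))) * v powr (-(1/4)))"
   unfolding kw_integral[OF v] by (intro add_mono kw_powr_integral v order_refl) auto
  also have "\<dots> \<le> ennreal (7 * v powr (-(1/4)))" by (simp add: ennreal_plus[symmetric] ennreal_leI del: ennreal_plus)
  finally show ?thesis .
 qed
 have k2: "(NN s. ennreal (kw s v) * ennreal ((s + v) powr (1/4))) \<le> ennreal (7 * v powr (1/4))"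
 proof -
  have "(NN s. ennreal (kw s v) * ennreal ((s + v) powr (1/4)))
    \<le> (NN s. ennreal (kw s v) * ennreal (v powr (1/4)) + ennreal (kw s v) * ennreal (s powr (1/4)))"
  proof (intro nn_integral_mono)
   fix s
   show "ennreal (kw s v) * ennreal ((s + v) powr (1/4)) \<le> ennreal (kw s v) * ennreal (v powr (1/4)) + ennreal (kw s v) * ennreal (s powr (1/4))"
   proof (cases "s > 0")
    case True
    then have "(s + v) powr (1/4) \<le> v powr (1/4) + s powr (1/4)" using powr_add_le[of s v "1/4"] v by simp
    then show ?thesis by (simp add: mult_left_mono ennreal_leI flip: distrib_left ennreal_plus)
   qed (simp add: kw_def)
  qed
  also have "\<dots> = (NN s. ennreal (kw s v)) * ennreal (v powr (1/4)) + (NN s. ennreal (kw s v) * ennreal (s powr (1/4)))"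
   by (subst nn_integral_add) (auto simp: nn_integral_multc)
  also have "\<dots> \<le> 1 * ennreal (v powr (1/4)) + ennreal ((1 / (1/2 + 1/4) + 1 / (1/2 - 1/4)) * v powr (1/4))"
   unfolding kw_integral[OF v] by (intro add_mono kw_powr_integral v order_refl) auto
  also have "\<dots> \<le> ennreal (7 * v powr (1/4))" by (simp add: ennreal_plus[symmetric] ennreal_leI del: ennreal_plus)
  finally show ?thesis .
 qed
 have "(NN s. ennreal (kw s v) * ennreal (HH s v x)) \<le> ennreal (norm x powr (- ?d) * (norm x powr (1/2) * (7 * v powr (-(1/4)))))"
 proof -
  have "(NN s. ennreal (kw s v) * ennreal (HH s v x))
    \<le> (NN s. ennreal (norm x powr (- ?d) * norm x powr (1/2)) * (ennreal (kw s v) * ennreal (v powr (-(1/4)) + s powr (-(1/4)))))"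
  proof (intro nn_integral_mono)
   fix s
   have "kw s v * HH s v x \<le> (norm x powr (- ?d) * norm x powr (1/2)) * (kw s v * (v powr (-(1/4)) + s powr (-(1/4))))"
   proof -
    have "kw s v * HH s v x \<le> kw s v * (norm x powr (- ?d) * (norm x powr (1/2) * (v powr (-(1/4)) + s powr (-(1/4)))))"
     unfolding HH_def by (intro mult_left_mono) auto
    then show ?thesis by (simp add: mult_ac)
   qed
   from ennreal_leI[OF this] show "ennreal (kw s v) * ennreal (HH s v x) \<le> ennreal (norm x powr (- ?d) * norm x powr (1/2)) * (ennreal (kw s v) * ennreal (v powr (-(1/4)) + s powr (-(1/4))))"
    by (simp add: ennreal_mult)
  qed
  also have "\<dots> = ennreal (norm x powr (- ?d) * norm x powr (1/2)) * (NN s. ennreal (kw s v) * ennreal (v powr (-(1/4)) + s powr (-(1/4))))"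
   by (intro nn_integral_cmult) measurable
  also have "\<dots> \<le> ennreal (norm x powr (- ?d) * norm x powr (1/2)) * ennreal (7 * v powr (-(1/4)))"
   by (intro mult_left_mono k1) auto
  finally show ?thesis by (simp add: mult.assoc flip: ennreal_mult')
 qed
 moreover have "(NN s. ennreal (kw s v) * ennreal (HH s v x)) \<le> ennreal (norm x powr (- ?d) * (norm x powr (-(1/2)) * (7 * v powr (1/4))))"
 proof -
  have "(NN s. ennreal (kw s v) * ennreal (HH s v x))
    \<le> (NN s. ennreal (norm x powr (- ?d) * norm x powr (-(1/2))) * (ennreal (kw s v) * ennreal ((s + v) powr (1/4))))"
  proof (intro nn_integral_mono)
   fix s
   have "kw s v * HH s v x \<le> (norm x powr (- ?d) * norm x powr (-(1/2))) * (kw s v * ((s + v) powr (1/4)))"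
   proof -
    have "kw s v * HH s v x \<le> kw s v * (norm x powr (- ?d) * (norm x powr (-(1/2)) * ((s + v) powr (1/4))))"
     unfolding HH_def by (intro mult_left_mono) auto
    then show ?thesis by (simp add: mult_ac)
   qed
   from ennreal_leI[OF this] show "ennreal (kw s v) * ennreal (HH s v x) \<le> ennreal (norm x powr (- ?d) * norm x powr (-(1/2))) * (ennreal (kw s v) * ennreal ((s + v) powr (1/4)))"
    by (simp add: ennreal_mult)
  qed
  also have "\<dots> = ennreal (norm x powr (- ?d) * norm x powr (-(1/2))) * (NN s. ennreal (kw s v) * ennreal ((s + v) powr (1/4)))"
   by (intro nn_integral_cmult) measurable
  also have "\<dots> \<le> ennreal (norm x powr (- ?d) * norm x powr (-(1/2))) * ennreal (7 * v powr (1/4))"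
   by (intro mult_left_mono k2) auto
  finally show ?thesis by (simp add: mult.assoc flip: ennreal_mult')
 qed
 ultimately show ?thesis
  unfolding GG_def by (auto simp: min_def mult_ac)
qed

section \<open>Time integrals: the Newton kernel and the late part of a convolution\<close>

lemma ennreal_lincomb:
 "0 \<le> a \<Longrightarrow> 0 \<le> b \<Longrightarrow> 0 \<le> c \<Longrightarrow> 0 \<le> e \<Longrightarrow> ennreal a * ennreal b + ennreal c * ennreal e = ennreal (a * b + c * e)"
 by (simp add: ennreal_mult)

text \<open>Split at t = |x - y|^2: below it the bound |x - y|^(-d) is integrated over an interval
  of that length, above it the bound t^(-d/2), which is integrable at infinity because d >
  2.\<close>

lemma hk_time_integral_upper:
 assumes dim: "DIM('a::euclidean_space) \<ge> 3"
 obtains C where "C > 0" "\<And>x y::'a. x \<noteq> y \<Longrightarrow> (NN t. hk t x y) \<le> ennreal (C * norm (x - y) powr (2 - real DIM('a)))"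
proof -
 let ?d = "real DIM('a)"
 have d: "?d \<ge> 3" using dim by simp
 obtain C1 where C1: "C1 > 0" "\<And>t x::'a. 0 < t \<Longrightarrow> x \<noteq> 0 \<Longrightarrow>
   heat t x \<le> C1 * norm x powr (- ?d) * t powr ((?d - ?d) / 2)"
  using heat_le_powr[of "?d", where 'a = 'a] by auto
 obtain C2 where C2: "C2 > 0" "\<And>t x::'a. 0 < t \<Longrightarrow> x \<noteq> 0 \<Longrightarrow>
   heat t x \<le> C2 * norm x powr (- 0) * t powr ((0 - ?d) / 2)"
  using heat_le_powr[of 0, where 'a = 'a] by auto
 show ?thesis
 proof
  show "C1 + C2 / (?d / 2 - 1) > 0" using C1 C2 d by (intro add_pos_pos divide_pos_pos) auto
  fix x y :: 'a assume xy: "x \<noteq> y"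
  define r where "r = norm (x - y)"
  have r: "r > 0" "x - y \<noteq> 0" using xy by (auto simp: r_def)
  have "(NN t. hk t x y) \<le> (NN t. ennreal (C1 * r powr (- ?d)) * indicator {0..r\<^sup>2} t + ennreal C2 * (ennreal (t powr (- ?d / 2)) * indicator {r\<^sup>2<..} t))"
  proof (intro nn_integral_mono)
   fix t
   consider "t \<le> 0" | "0 < t" "t \<le> r\<^sup>2" | "0 < t" "r\<^sup>2 < t" by linarith
   then show "hk t x y \<le> ennreal (C1 * r powr (- ?d)) * indicator {0..r\<^sup>2} t + ennreal C2 * (ennreal (t powr (- ?d / 2)) * indicator {r\<^sup>2<..} t)"
   proof cases
    case 2
    then show ?thesis using C1(2)[of t "x - y"] r by (simp add: hk_def r_def ennreal_leI)
   next
    case 3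
    then show ?thesis using C2(2)[of t "x - y"] r C2(1) by (simp add: hk_def r_def[symmetric] ennreal_leI flip: ennreal_mult')
   qed (simp add: hk_def)
  qed
  also have "\<dots> = ennreal (C1 * r powr (- ?d)) * ennreal (r\<^sup>2) + ennreal C2 * ennreal ((r\<^sup>2) powr (- ?d / 2 + 1) / (- (- ?d / 2) - 1))"
  proof -
   have "(NN t. ennreal (C1 * r powr (- ?d)) * indicator {0..r\<^sup>2} t) = ennreal (C1 * r powr (- ?d)) * ennreal (r\<^sup>2)"
    by (subst nn_integral_cmult_indicator) auto
   moreover have "(NN t. ennreal (t powr (- ?d / 2)) * indicator {r\<^sup>2<..} t) = ennreal ((r\<^sup>2) powr (- ?d / 2 + 1) / (- (- ?d / 2) - 1))"
    using r d by (intro nn_integral_powr_inf) auto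
   ultimately show ?thesis by (subst nn_integral_add) (auto simp: nn_integral_cmult)
  qed
  also have "\<dots> = ennreal (C1 * r powr (- ?d) * r\<^sup>2 + C2 * ((r\<^sup>2) powr (- ?d / 2 + 1) / (- (- ?d / 2) - 1)))"
   using C1 C2 d by (intro ennreal_lincomb) auto
  also have "C1 * r powr (- ?d) * r\<^sup>2 + C2 * ((r\<^sup>2) powr (- ?d / 2 + 1) / (- (- ?d / 2) - 1)) = (C1 + C2 / (?d / 2 - 1)) * r powr (2 - ?d)"
  proof -
   have r2: "r\<^sup>2 = r powr 2" using r by simp
   have a: "r powr (- ?d) * r\<^sup>2 = r powr (2 - ?d)" unfolding r2 powr_add[symmetric] by (simp add: add.commute)
   have b: "(r\<^sup>2) powr (- ?d / 2 + 1) = r powr (2 - ?d)" unfolding r2 powr_powr by (rule arg_cong[where f = "\<lambda>z. r powr z"]) simp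
   have "C1 * r powr (- ?d) * r\<^sup>2 = C1 * r powr (2 - ?d)" using a by simp
   then show ?thesis unfolding b by (simp add: distrib_right)
  qed
  finally show "(NN t. hk t x y) \<le> ennreal ((C1 + C2 / (?d / 2 - 1)) * norm (x - y) powr (2 - ?d))"
   by (simp add: r_def)
 qed
qed

lemma hk_time_integral_lower:
 obtains c where "c > 0" "\<And>x y::'a::euclidean_space. x \<noteq> y \<Longrightarrow> ennreal (c * norm (x - y) powr (2 - real DIM('a))) \<le> (NN t. hk t x y)"
proof -
 let ?d = "real DIM('a)"
 obtain c where c: "c > 0" "\<And>t x::'a::euclidean_space. x \<noteq> 0 \<Longrightarrow> (norm x)\<^sup>2 \<le> t \<Longrightarrow> t \<le> 2 * (norm x)\<^sup>2 \<Longrightarrow>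
   c * norm x powr (- ?d) \<le> heat t x"
  using heat_ge_powr[where 'a = 'a] by auto
 show ?thesis
 proof
  show "c > 0" by fact
  fix x y :: 'a assume xy: "x \<noteq> y"
  define r where "r = norm (x - y)"
  have r: "r > 0" "x - y \<noteq> 0" using xy by (auto simp: r_def)
  have r2: "r\<^sup>2 = r powr 2" using r by simp
  have "r powr (- ?d) * r\<^sup>2 = r powr (2 - ?d)" unfolding r2 powr_add[symmetric] by (simp add: add.commute)
  then have "ennreal (c * r powr (2 - ?d)) = ennreal (c * r powr (- ?d)) * ennreal (r\<^sup>2)"
   using c by (simp flip: ennreal_mult')
  also have "\<dots> = (NN t. ennreal (c * r powr (- ?d)) * indicator {r\<^sup>2..2*r\<^sup>2} t)"
   by (subst nn_integral_cmult_indicator) auto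
  also have "\<dots> \<le> (NN t. hk t x y)"
  proof (intro nn_integral_mono)
   fix t
   show "ennreal (c * r powr (- ?d)) * indicator {r\<^sup>2..2*r\<^sup>2} t \<le> hk t x y"
   proof (cases "r\<^sup>2 \<le> t \<and> t \<le> 2 * r\<^sup>2")
    case True
    moreover have "t > 0" using True r by (meson less_le_trans zero_less_power)
    ultimately show ?thesis using c(2)[of "x - y" t] r by (simp add: hk_def r_def ennreal_leI)
   qed auto
  qed
  finally show "ennreal (c * norm (x - y) powr (2 - ?d)) \<le> (NN t. hk t x y)" by (simp add: r_def)
 qed
qed

lemma nn_integral_reflect:
 fixes t :: real
 assumes [measurable]: "f \<in> borel_measurable borel"
 shows "(NN s. f (t - s)) = (NN s. f s)"
 using nn_integral_real_affine[of f "-1" t] by simp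

lemma nn_integral_shift:
 fixes t :: real
 assumes [measurable]: "f \<in> borel_measurable borel"
 shows "(NN s. f (s - t)) = (NN s. f s)" "(NN s. f (s + t)) = (NN s. f s)"
 using nn_integral_real_affine[of f "1" "- t"] nn_integral_real_affine[of f "1" "t"] by (simp_all add: add.commute)

text \<open>For times in [t/2, t) there is no cancellation to exploit, so the convolution must be
  bounded on its own, uniformly in t. Two estimates, good for |x| \<le> |y| and |x| \<ge> |y|
  respectively, combine to the profile \<open>GG\<close> at the scale |y|^2.\<close>

lemma heat_conv_late:
 assumes dim: "DIM('a::euclidean_space) \<ge> 3"
 obtains C where "C > 0" "\<And>t (x::'a) (y::'a). 0 < t \<Longrightarrow> x \<noteq> 0 \<Longrightarrow> y \<noteq> 0 \<Longrightarrow>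
  (NN v. ennreal (heat (t - v) x) * ennreal (heat v y) * indicator {t/2..<t} v)
   \<le> ennreal (C * norm y powr (2 - real DIM('a)) * GG ((norm y)\<^sup>2) x)"
proof -
 let ?d = "real DIM('a)"
 have d: "?d \<ge> 3" using dim by simp
 obtain C0 where C0: "C0 > 0" "\<And>x y::'a. x \<noteq> y \<Longrightarrow> (NN t. hk t x y) \<le> ennreal (C0 * norm (x - y) powr (2 - real DIM('a)))"
  using hk_time_integral_upper[OF dim] by auto
 obtain C1 where C1: "C1 > 0" "\<And>t x::'a. 0 < t \<Longrightarrow> x \<noteq> 0 \<Longrightarrow>
   heat t x \<le> C1 * norm x powr (- ?d) * t powr ((?d - ?d) / 2)"
  using heat_le_powr[of "?d", where 'a = 'a] by auto
 obtain C2 where C2: "C2 > 0" "\<And>t x::'a. 0 < t \<Longrightarrow> x \<noteq> 0 \<Longrightarrow>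
   heat t x \<le> C2 * norm x powr (- (?d - 3)) * t powr ((?d - 3 - ?d) / 2)"
  using heat_le_powr[of "?d - 3", where 'a = 'a] d by auto
 obtain C3 where C3: "C3 > 0" "\<And>t x::'a. 0 < t \<Longrightarrow> x \<noteq> 0 \<Longrightarrow>
   heat t x \<le> C3 * norm x powr (- (?d + 1)) * t powr ((?d + 1 - ?d) / 2)"
  using heat_le_powr[of "?d + 1", where 'a = 'a] d by auto
 define C where "C = C1 * C0 + C2 * C3 * 2"
 show ?thesis
 proof
  show "C > 0" using C0 C1 C2 C3 by (simp add: C_def add_pos_pos)
  fix t :: real and x y :: 'a assume t: "0 < t" and x: "x \<noteq> 0" and y: "y \<noteq> 0"
  define \<rho> \<eta> where "\<rho> = norm x" and "\<eta> = norm y"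
  have p: "\<rho> > 0" "\<eta> > 0" using x y by (auto simp: \<rho>_def \<eta>_def)
  define u where "u = \<rho> / \<eta>"
  have u: "u > 0" using p by (simp add: u_def)
  define B where "B = \<eta> powr (2 - ?d) * \<rho> powr (- ?d)"
  let ?I = "(NN v. ennreal (heat (t - v) x) * ennreal (heat v y) * indicator {t/2..<t} v)"
  have G: "\<eta> powr (2 - ?d) * GG (\<eta>\<^sup>2) x = B * min (u powr (1/2)) (u powr (-(1/2)))"
  proof -
   have e: "\<eta>\<^sup>2 = \<eta> powr 2" using p by simp
   have "(\<eta>\<^sup>2) powr (-(1/4)) = \<eta> powr (-(1/2))" "(\<eta>\<^sup>2) powr (1/4) = \<eta> powr (1/2)"
    unfolding e powr_powr by simp_all
   moreover have "u powr (1/2) = \<rho> powr (1/2) * \<eta> powr (-(1/2))" "u powr (-(1/2)) = \<rho> powr (-(1/2)) * \<eta> powr (1/2)"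
    using p by (simp_all add: u_def powr_divide powr_minus field_simps)
   ultimately show ?thesis by (simp add: GG_def B_def \<rho>_def mult.assoc)
  qed
  \<comment> \<open>Here the kernel at y is bounded by its supremum over time, a multiple of
    |y|^(-d), and the kernel at x is integrated to the Newton kernel. With u = |x|/|y| this gives a
    multiple of u^2.\<close>
  have i: "?I \<le> ennreal (C1 * C0 * B * u\<^sup>2)"
  proof -
   have "?I \<le> (NN v. ennreal (C1 * \<eta> powr (- ?d)) * hk (t - v) x 0)"
   proof (intro nn_integral_mono)
    fix v
    show "ennreal (heat (t - v) x) * ennreal (heat v y) * indicator {t/2..<t} v \<le> ennreal (C1 * \<eta> powr (- ?d)) * hk (t - v) x 0"
    proof (cases "t / 2 \<le> v \<and> v < t")
     case True
     then have "heat v y \<le> C1 * \<eta> powr (- ?d)" using C1(2)[of v y] t y by (simp add: \<eta>_def)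
     then have "ennreal (heat (t - v) x) * ennreal (heat v y) \<le> ennreal (C1 * \<eta> powr (- ?d)) * ennreal (heat (t - v) x)"
      by (subst mult.commute) (intro mult_right_mono ennreal_leI, auto)
     then show ?thesis using True by (simp add: hk_def)
    qed auto
   qed
   also have "\<dots> = ennreal (C1 * \<eta> powr (- ?d)) * (NN v. hk (t - v) x 0)"
    by (intro nn_integral_cmult) measurable
   also have "(NN v. hk (t - v) x 0) = (NN v. hk v x 0)"
    by (intro nn_integral_reflect[where f = "\<lambda>v. hk v x 0"]) measurable
   also have "\<dots> \<le> ennreal (C0 * \<rho> powr (2 - ?d))"
    using C0(2)[OF x] by (simp add: \<rho>_def)
   finally have "?I \<le> ennreal (C1 * \<eta> powr (- ?d)) * ennreal (C0 * \<rho> powr (2 - ?d))" by (simp add: mult_left_mono)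
   also have "\<dots> = ennreal (C1 * \<eta> powr (- ?d) * (C0 * \<rho> powr (2 - ?d)))"
    using C1 by (simp flip: ennreal_mult')
   also have "C1 * \<eta> powr (- ?d) * (C0 * \<rho> powr (2 - ?d)) = C1 * C0 * B * u\<^sup>2"
   proof -
    have "\<eta> powr (2 - ?d) = \<eta> powr (- ?d) * \<eta>\<^sup>2" "\<rho> powr (2 - ?d) = \<rho> powr (- ?d) * \<rho>\<^sup>2"
     using p powr_add[of \<eta> "- ?d" 2] powr_add[of \<rho> "- ?d" 2] by simp_all
    then show ?thesis using p by (simp add: B_def u_def power_divide)
   qed
   finally show ?thesis .
  qed
  let ?X = "C3 * \<rho> powr (- ?d - 1) * t powr (1/2)" and ?Y = "C2 * \<eta> powr (3 - ?d) * (t/2) powr (-3/2)"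
  \<comment> \<open>Here the kernel at x contributes |x|^(-d-1) t^(1/2), the kernel at y contributes
    |y|^(3-d) t^(-3/2) because v \<ge> t/2, and the interval has length t/2. The powers of t cancel
    and 1/u is left.\<close>
  have ii: "?I \<le> ennreal (C2 * C3 * 2 * B * (1 / u))"
  proof -
   have "?I \<le> (NN v. ennreal (?X * ?Y) * indicator {t/2..t} v)"
   proof (intro nn_integral_mono)
    fix v
    show "ennreal (heat (t - v) x) * ennreal (heat v y) * indicator {t/2..<t} v \<le> ennreal (?X * ?Y) * indicator {t/2..t} v"
    proof (cases "t / 2 \<le> v \<and> v < t")
     case True
     have a: "heat (t - v) x \<le> C3 * \<rho> powr (- ?d - 1) * t powr (1/2)"
     proof -
      have "heat (t - v) x \<le> C3 * norm x powr (- (?d + 1)) * (t - v) powr ((?d + 1 - ?d) / 2)"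
       using True x by (intro C3(2)) auto
      also have "\<dots> = C3 * \<rho> powr (- ?d - 1) * (t - v) powr (1/2)" by (simp add: \<rho>_def)
      also have "\<dots> \<le> C3 * \<rho> powr (- ?d - 1) * t powr (1/2)"
       using True t C3(1) by (intro mult_left_mono powr_mono2) auto
      finally show ?thesis .
     qed
     have b: "heat v y \<le> C2 * \<eta> powr (3 - ?d) * (t/2) powr (-3/2)"
     proof -
      have "heat v y \<le> C2 * norm y powr (- (?d - 3)) * v powr ((?d - 3 - ?d) / 2)"
       using True t y by (intro C2(2)) auto
      also have "\<dots> = C2 * \<eta> powr (3 - ?d) * v powr (-3/2)" by (simp add: \<eta>_def)
      also have "\<dots> \<le> C2 * \<eta> powr (3 - ?d) * (t/2) powr (-3/2)"
       using True t C2(1) by (intro mult_left_mono powr_mono2') auto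
      finally show ?thesis .
     qed
     have "heat (t - v) x * heat v y \<le> ?X * ?Y"
      using C3(1) by (intro mult_mono a b) auto
     then show ?thesis using True by (simp add: ennreal_leI flip: ennreal_mult)
    qed auto
   qed
   also have "\<dots> = ennreal (?X * ?Y) * ennreal (t/2)"
    using t by (subst nn_integral_cmult_indicator) auto
   also have "\<dots> = ennreal (?X * ?Y * (t/2))"
    using C3 C2 t by (intro ennreal_mult[symmetric]) auto
   also have "\<dots> \<le> ennreal (C2 * C3 * 2 * B * (1 / u))"
   proof (intro ennreal_leI)
    have "t powr (1/2) * ((t/2) powr (-3/2) * (t/2)) \<le> 2"
    proof -
     have "(t/2) powr (-3/2) * (t/2) = (t/2) powr (-(1/2))"
      using powr_add[of "t/2" "-3/2" 1] t by simp
     moreover have "t powr (1/2) = 2 powr (1/2) * (t/2) powr (1/2)"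
      using powr_mult[of 2 "t/2" "1/2"] by simp
     moreover have "(t/2) powr (1/2) * (t/2) powr (-(1/2)) = 1"
      using powr_add[of "t/2" "1/2" "-(1/2)"] t by simp
     ultimately have "t powr (1/2) * ((t/2) powr (-3/2) * (t/2)) = 2 powr (1/2)"
      by (simp only: mult.assoc mult_1_right)
     also have "\<dots> \<le> 2 powr 1" by (intro powr_mono) auto
     finally show ?thesis by simp
    qed
    note f1 = this
    have f2: "\<rho> powr (- ?d - 1) * \<eta> powr (3 - ?d) = B * (1 / u)"
    proof -
     have "\<eta> powr (3 - ?d) = \<eta> powr (2 - ?d) * \<eta>" using powr_add[of \<eta> "2 - ?d" 1] p by simp
     moreover have "\<rho> powr (- ?d - 1) = \<rho> powr (- ?d) * (1 / \<rho>)"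
      using powr_add[of \<rho> "- ?d" "-1"] powr_neg_one[of \<rho>] p by simp
     ultimately show ?thesis by (simp add: B_def u_def)
    qed
    have f3: "C2 * C3 * (B * (1 / u)) \<ge> 0" using u C2 C3 by (simp add: B_def)
    have f4: "?X * ?Y * (t/2)
      = (C2 * C3 * (\<rho> powr (- ?d - 1) * \<eta> powr (3 - ?d))) * (t powr (1/2) * ((t/2) powr (-3/2) * (t/2)))"
     by (simp only: mult_ac)
    have "?X * ?Y * (t/2)
      \<le> (C2 * C3 * (B * (1 / u))) * 2"
     unfolding f4 f2 by (rule mult_left_mono[OF f1 f3])
    then show "?X * ?Y * (t/2) \<le> C2 * C3 * 2 * B * (1 / u)"
     by (simp only: mult_ac)
   qed
   finally show ?thesis .
  qed
  have B: "B \<ge> 0" by (simp add: B_def)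
  have "?I \<le> ennreal (C * (B * min (u powr (1/2)) (u powr (-(1/2)))))"
  proof (cases "u \<le> 1")
   case True
   have "u\<^sup>2 \<le> u powr (1/2)" using powr_mono'[of "1/2" 2 u] u True by simp
   moreover have "u powr (1/2) \<le> u powr (-(1/2))" using powr_mono'[of "-(1/2)" "1/2" u] u True by simp
   ultimately have "C1 * C0 * B * u\<^sup>2 \<le> C * (B * min (u powr (1/2)) (u powr (-(1/2))))"
    using B C0 C1 C2 C3 unfolding mult.assoc[of _ B]
    by (intro mult_mono) (auto simp: C_def)
   then show ?thesis using i by (meson ennreal_leI order_trans)
  next
   case False
   have "1 / u \<le> u powr (-(1/2))" using powr_mono[of "-1" "-(1/2)" u] powr_neg_one[of u] u False by simp
   moreover have "u powr (-(1/2)) \<le> u powr (1/2)" using powr_mono[of "-(1/2)" "1/2" u] u False by simp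
   ultimately have "C2 * C3 * 2 * B * (1 / u) \<le> C * (B * min (u powr (1/2)) (u powr (-(1/2))))"
    using B C0 C1 C2 C3 u unfolding mult.assoc[of _ B]
    by (intro mult_mono) (auto simp: C_def)
   then show ?thesis using ii by (meson ennreal_leI order_trans)
  qed
  then show "?I \<le> ennreal (C * norm y powr (2 - ?d) * GG ((norm y)\<^sup>2) x)"
   using G by (simp add: \<eta>_def mult.assoc)
 qed
qed

section \<open>Duhamel equations for bounded potentials\<close>

lemma nn_integral_swap:
 assumes "case_prod f \<in> borel_measurable (lborel \<Otimes>\<^sub>M lborel)"
 shows "(NN x. NN y. f x y) = (NN y. NN x. f x y)"
 using lborel_pair.Fubini'[OF assms] by simp

lemma nn_integral_swap4:
 fixes F :: "real \<Rightarrow> 'a::euclidean_space \<Rightarrow> real \<Rightarrow> 'a \<Rightarrow> ennreal"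
 assumes F: "(\<lambda>(s,z,r,y). F s z r y) \<in> borel_measurable (borel \<Otimes>\<^sub>M borel \<Otimes>\<^sub>M borel \<Otimes>\<^sub>M borel)"
 shows "(NN s. NN z. NN r. NN y. F s z r y)
    = (NN r. NN y. NN s. NN z. F s z r y)"
proof -
 have [measurable (raw)]: "(\<lambda>w. F (f w) (g w) (h w) (k w)) \<in> borel_measurable M"
  if "f \<in> borel_measurable M" "g \<in> borel_measurable M" "h \<in> borel_measurable M" "k \<in> borel_measurable M"
  for f g h k and M :: "'c measure"
 proof -
  have "(\<lambda>w. (f w, g w, h w, k w)) \<in> M \<rightarrow>\<^sub>M (borel \<Otimes>\<^sub>M borel \<Otimes>\<^sub>M borel \<Otimes>\<^sub>M borel)"
   using that by measurable
  from measurable_compose[OF this F] show ?thesis by simp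
 qed
 have "(NN s. NN z. NN r. NN y. F s z r y)
  = (NN s. NN r. NN z. NN y. F s z r y)"
  by (intro nn_integral_cong nn_integral_swap) measurable
 also have "\<dots> = (NN r. NN s. NN z. NN y. F s z r y)"
  by (intro nn_integral_swap) measurable
 also have "\<dots> = (NN r. NN s. NN y. NN z. F s z r y)"
  by (intro nn_integral_cong nn_integral_swap) measurable
 also have "\<dots> = (NN r. NN y. NN s. NN z. F s z r y)"
  by (intro nn_integral_cong nn_integral_swap) measurable
 finally show ?thesis .
qed

type_synonym 'a kernel = "real \<Rightarrow> 'a \<Rightarrow> 'a \<Rightarrow> ennreal"

definition kmeas :: "('a::euclidean_space) kernel \<Rightarrow> bool" where
 "kmeas A \<longleftrightarrow> (\<lambda>(t,x,y). A t x y) \<in> borel_measurable (borel \<Otimes>\<^sub>M borel \<Otimes>\<^sub>M borel)"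

lemma kmeasD:
 fixes A :: "('a::euclidean_space) kernel"
 assumes "kmeas A" "f \<in> borel_measurable M" "g \<in> borel_measurable M" "h \<in> borel_measurable M"
 shows "(\<lambda>w. A (f w) (g w) (h w)) \<in> borel_measurable M"
proof -
 have "(\<lambda>w. (f w, g w, h w)) \<in> M \<rightarrow>\<^sub>M (borel \<Otimes>\<^sub>M borel \<Otimes>\<^sub>M borel)"
  using assms by measurable
 from measurable_compose[OF this assms(1)[unfolded kmeas_def]] show ?thesis by simp
qed

lemma kmeasI:
 fixes A :: "('a::euclidean_space) kernel"
 shows "(\<lambda>w. A (fst w) (fst (snd w)) (snd (snd w))) \<in> borel_measurable (borel \<Otimes>\<^sub>M borel \<Otimes>\<^sub>M borel) \<Longrightarrow> kmeas A"
 by (simp add: kmeas_def case_prod_unfold)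

text \<open>Families with the second argument of the kernel frozen. Measurability in this sense is
  all that \<open>duhamel_kernel\<close> grants a competing solution, so uniqueness is proved at
  this level.\<close>

definition fmeas :: "(real \<Rightarrow> 'a::euclidean_space \<Rightarrow> ennreal) \<Rightarrow> bool" where
 "fmeas X \<longleftrightarrow> (\<lambda>(t,x). X t x) \<in> borel_measurable (borel \<Otimes>\<^sub>M borel)"

lemma fmeasD:
 fixes X :: "real \<Rightarrow> 'a::euclidean_space \<Rightarrow> ennreal"
 assumes "fmeas X" "f \<in> borel_measurable M" "g \<in> borel_measurable M"
 shows "(\<lambda>w. X (f w) (g w)) \<in> borel_measurable M"
proof -
 have "(\<lambda>w. (f w, g w)) \<in> M \<rightarrow>\<^sub>M (borel \<Otimes>\<^sub>M borel)"
  using assms by measurable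
 from measurable_compose[OF this assms(1)[unfolded fmeas_def]] show ?thesis by simp
qed

lemma fmeasI:
 fixes X :: "real \<Rightarrow> 'a::euclidean_space \<Rightarrow> ennreal"
 shows "(\<lambda>w. X (fst w) (snd w)) \<in> borel_measurable (borel \<Otimes>\<^sub>M borel) \<Longrightarrow> fmeas X"
 by (simp add: fmeas_def case_prod_unfold)

lemma fmeas_slice: "kmeas A \<Longrightarrow> fmeas (\<lambda>t x. A t x y)"
 by (rule fmeasI) (rule kmeasD, auto)

lemma kmeas_hk: "kmeas hk"
 by (rule kmeasI) measurable

text \<open>The Duhamel integral applied to a family \<open>X\<close>. For kernels that vanish at
  nonpositive times only 0 < s < t contributes, although both integrals are unrestricted.\<close>

definition cv :: "('a::euclidean_space) kernel \<Rightarrow> ('a \<Rightarrow> ennreal) \<Rightarrow> (real \<Rightarrow> 'a \<Rightarrow> ennreal) \<Rightarrow> real \<Rightarrow> 'a \<Rightarrow> ennreal" where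
 "cv A w X t x = (NN s. NN z. A (t - s) x z * (w z * X s z))"

definition ck :: "('a::euclidean_space) kernel \<Rightarrow> ('a \<Rightarrow> ennreal) \<Rightarrow> 'a kernel \<Rightarrow> 'a kernel" where
 "ck A w B t x y = cv A w (\<lambda>s z. B s z y) t x"

lemma kmeas_ck:
 assumes A: "kmeas A" and B: "kmeas B" and [measurable]: "w \<in> borel_measurable borel"
 shows "kmeas (ck A w B)"
proof (rule kmeasI)
 note [measurable] = kmeasD[OF A] kmeasD[OF B]
 show "(\<lambda>p. ck A w B (fst p) (fst (snd p)) (snd (snd p))) \<in> borel_measurable (borel \<Otimes>\<^sub>M borel \<Otimes>\<^sub>M borel)"
  unfolding ck_def cv_def by measurable
qed

lemma cv_mono:
 assumes "\<And>t x z. A t x z \<le> A' t x z" "\<And>z. w z \<le> w' z" "\<And>t z. X t z \<le> X' t z"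
 shows "cv A w X t x \<le> cv A' w' X' t x"
 unfolding cv_def by (intro nn_integral_mono mult_mono assms) auto

lemma cv_add_right:
 assumes A: "kmeas A" and X: "fmeas X" and Y: "fmeas Y" and [measurable]: "w \<in> borel_measurable borel"
 shows "cv A w (\<lambda>s z. X s z + Y s z) t x = cv A w X t x + cv A w Y t x"
proof -
 note [measurable] = kmeasD[OF A] fmeasD[OF X] fmeasD[OF Y]
 show ?thesis unfolding cv_def
  by (simp add: distrib_left nn_integral_add)
qed

lemma cv_add_left:
 assumes A: "kmeas A" and B: "kmeas B" and X: "fmeas X" and [measurable]: "w \<in> borel_measurable borel"
 shows "cv (\<lambda>t x y. A t x y + B t x y) w X t x = cv A w X t x + cv B w X t x"
proof -
 note [measurable] = kmeasD[OF A] kmeasD[OF B] fmeasD[OF X]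
 show ?thesis unfolding cv_def
  by (simp add: distrib_right nn_integral_add)
qed

lemma cv_add_weight:
 assumes A: "kmeas A" and X: "fmeas X" and [measurable]: "w \<in> borel_measurable borel" "u \<in> borel_measurable borel"
 shows "cv A (\<lambda>z. w z + u z) X t x = cv A w X t x + cv A u X t x"
proof -
 note [measurable] = kmeasD[OF A] fmeasD[OF X]
 show ?thesis unfolding cv_def
  by (simp add: distrib_left distrib_right nn_integral_add)
qed

text \<open>Tonelli moves the inner pair of variables outside, and translating time by r identifies
  the inner integral with \<open>ck\<close> at t - r; no restriction of the time domain has to be
  tracked.\<close>

lemma cv_assoc:
 assumes A: "kmeas A" and B: "kmeas B" and X: "fmeas X"
  and [measurable]: "w \<in> borel_measurable borel" "u \<in> borel_measurable borel"
 shows "cv A w (cv B u X) t x = cv (ck A w B) u X t x"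
proof -
 note [measurable] = kmeasD[OF A] kmeasD[OF B] fmeasD[OF X]
 have "cv A w (cv B u X) t x
   = (NN s. NN z. NN r. NN y. A (t - s) x z * (w z * (B (s - r) z y * (u y * X r y))))"
  unfolding cv_def by (simp add: nn_integral_cmult)
 also have "\<dots> = (NN r. NN y. NN s. NN z. A (t - s) x z * (w z * (B (s - r) z y * (u y * X r y))))"
  by (rule nn_integral_swap4) measurable
 also have "\<dots> = (NN r. NN y. (NN s. NN z. A (t - s) x z * (w z * B (s - r) z y)) * (u y * X r y))"
  by (simp add: nn_integral_multc[symmetric] mult.assoc)
 also have "\<dots> = cv (ck A w B) u X t x"
 proof -
  have "(NN s. NN z. A (t - s) x z * (w z * B (s - r) z y)) = ck A w B (t - r) x y" for r y
  proof -
   have "(NN s. (\<lambda>s. NN z. A (t - r - s) x z * (w z * B s z y)) (s - r))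
     = (NN s. NN z. A (t - r - s) x z * (w z * B s z y))"
    by (rule nn_integral_shift) measurable
   then show ?thesis unfolding ck_def cv_def by simp
  qed
  then show ?thesis by (simp add: cv_def)
 qed
 finally show ?thesis .
qed

section \<open>Uniqueness for Duhamel equations with bounded weight\<close>

lemma exp_time_integral:
 assumes a: "a > 0" and t: "t > 0"
 shows "(NN s. ennreal (exp (a * s)) * indicator {0<..<t} s) = ennreal ((exp (a * t) - 1) / a)"
proof -
 have "(NN s. ennreal (exp (a * s)) * indicator {0<..<t} s) = ennreal (exp (a * t) / a - exp (a * 0) / a)"
 proof (rule nn_integral_FTC_greaterThanLessThan[where F = "\<lambda>s. exp (a * s) / a"])
  show "((\<lambda>s. exp (a * s) / a) \<longlongrightarrow> exp (a * 0) / a) (at_right 0)" using a by (intro tendsto_intros) auto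
  show "((\<lambda>s. exp (a * s) / a) \<longlongrightarrow> exp (a * t) / a) (at_left t)" using a by (intro tendsto_intros) auto
  show "((\<lambda>s. exp (a * s) / a) has_real_derivative exp (a * s)) (at s)" for s
   using a by (auto intro!: derivative_eq_intros)
 qed (use t in \<open>auto intro!: continuous_intros\<close>)
 then show ?thesis by (simp add: diff_divide_distrib)
qed

text \<open>\<open>excessive G\<close>: the family is dominated along the heat flow; instances are heat kernels with a fixed
 pole, possibly shifted in time.\<close>
definition excessive :: "(real \<Rightarrow> 'a::euclidean_space \<Rightarrow> ennreal) \<Rightarrow> bool" where
 "excessive G \<longleftrightarrow> fmeas G \<and> (\<forall>t\<le>0. \<forall>x. G t x = 0) \<and> (\<forall>t x. G t x < \<infinity>)
   \<and> (\<forall>s>0. \<forall>t>s. \<forall>x. (NN z. hk (t - s) x z * G s z) \<le> G t x)"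

text \<open>The contraction step: the weight exp (2 n t) is chosen because n times its integral over
  (0, t) is at most half of it, while \<open>excessive\<close> absorbs the space integral.
  Convolution with a weight below n thus halves the constant c.\<close>

lemma cv_exp_bound:
 fixes X :: "real \<Rightarrow> 'a::euclidean_space \<Rightarrow> ennreal"
 assumes G: "excessive G" and n: "n > 0" and w: "\<And>z. w z \<le> ennreal n" and c: "c \<ge> 0"
  and X: "\<And>t x. X t x \<le> ennreal (c * exp (2 * n * t)) * G t x"
 shows "cv hk w X t x \<le> ennreal (c / 2 * exp (2 * n * t)) * G t x"
proof (cases "t > 0")
 case False
 have "hk (t - s) x z * (w z * X s z) = 0" for s z
 proof (cases "s > 0")
  case True then show ?thesis using False by (simp add: hk_def)
 next
  case s: False
  then have "G s z = 0" using G by (simp add: excessive_def)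
  then have "X s z = 0" using X[of s z] by simp
  then show ?thesis by simp
 qed
 then have "cv hk w X t x = 0" unfolding cv_def by (simp only:) simp
 then show ?thesis by simp
next
 case t: True
 have Gm: "fmeas G" using G by (simp add: excessive_def)
 note [measurable] = fmeasD[OF Gm]
 have "cv hk w X t x \<le> (NN s. (ennreal (n * c) * G t x) * (ennreal (exp (2 * n * s)) * indicator {0<..<t} s))"
  unfolding cv_def
 proof (intro nn_integral_mono)
  fix s
  have "(NN z. hk (t - s) x z * (w z * X s z)) \<le> (NN z. ennreal (n * c * exp (2 * n * s)) * (hk (t - s) x z * G s z))"
  proof (intro nn_integral_mono)
   fix z
   have "w z * X s z \<le> ennreal n * (ennreal (c * exp (2 * n * s)) * G s z)"
    by (intro mult_mono w X) auto
   also have "\<dots> = ennreal (n * c * exp (2 * n * s)) * G s z"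
    using n c by (simp add: ennreal_mult mult.assoc)
   finally show "hk (t - s) x z * (w z * X s z) \<le> ennreal (n * c * exp (2 * n * s)) * (hk (t - s) x z * G s z)"
    by (subst mult.left_commute[of "ennreal (n * c * exp (2 * n * s))"]) (rule mult_left_mono, auto)
  qed
  also have "\<dots> = ennreal (n * c * exp (2 * n * s)) * (NN z. hk (t - s) x z * G s z)"
   by (intro nn_integral_cmult) measurable
  also have "\<dots> \<le> (ennreal (n * c) * G t x) * (ennreal (exp (2 * n * s)) * indicator {0<..<t} s)"
  proof (cases "0 < s \<and> s < t")
   case True
   then have "(NN z. hk (t - s) x z * G s z) \<le> G t x" using G by (simp add: excessive_def)
   then have "ennreal (n * c * exp (2 * n * s)) * (NN z. hk (t - s) x z * G s z) \<le> ennreal (n * c * exp (2 * n * s)) * G t x"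
    by (rule mult_left_mono) simp
   also have "\<dots> = (ennreal (n * c) * G t x) * (ennreal (exp (2 * n * s)) * indicator {0<..<t} s)"
    using True n c by (simp add: ennreal_mult mult_ac)
   finally show ?thesis .
  next
   case False
   then have "hk (t - s) x z * G s z = 0" for z
    using G by (cases "s > 0") (simp_all add: excessive_def hk_def)
   then have "(NN z. hk (t - s) x z * G s z) = 0" by (simp only:) simp
   then show ?thesis by simp
  qed
  finally show "(NN z. hk (t - s) x z * (w z * X s z)) \<le> (ennreal (n * c) * G t x) * (ennreal (exp (2 * n * s)) * indicator {0<..<t} s)" .
 qed
 also have "\<dots> = (ennreal (n * c) * G t x) * ennreal ((exp (2 * n * t) - 1) / (2 * n))"
  using exp_time_integral[of "2 * n" t] n t by (subst nn_integral_cmult) auto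
 also have "\<dots> = ennreal (n * c * ((exp (2 * n * t) - 1) / (2 * n))) * G t x"
 proof -
  have "ennreal (n * c) * ennreal ((exp (2 * n * t) - 1) / (2 * n)) = ennreal (n * c * ((exp (2 * n * t) - 1) / (2 * n)))"
   using n t c by (intro ennreal_mult[symmetric]) auto
  then show ?thesis by (metis mult.assoc mult.commute)
 qed
 also have "\<dots> \<le> ennreal (c / 2 * exp (2 * n * t)) * G t x"
 proof (intro mult_right_mono ennreal_leI)
  have "n * c * ((exp (2 * n * t) - 1) / (2 * n)) = c / 2 * (exp (2 * n * t) - 1)" using n by simp
  also have "\<dots> \<le> c / 2 * exp (2 * n * t)" using c by (intro mult_left_mono) auto
  finally show "n * c * ((exp (2 * n * t) - 1) / (2 * n)) \<le> c / 2 * exp (2 * n * t)" .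
 qed simp
 finally show ?thesis .
qed

text \<open>Iterating the halving of \<open>cv_exp_bound\<close> gives constants c / 2^k for every
  k, and the majorant \<open>G\<close> is finite.\<close>

lemma excessive_imp_zero:
 fixes D :: "real \<Rightarrow> 'a::euclidean_space \<Rightarrow> ennreal"
 assumes G: "excessive G" and n: "n > 0" and w: "\<And>z. w z \<le> ennreal n" and c: "c \<ge> 0"
  and D: "\<And>t x. D t x \<le> ennreal (c * exp (2 * n * t)) * G t x"
  and le: "\<And>t x. D t x \<le> cv hk w D t x"
 shows "D t x = 0"
proof -
 have b: "\<forall>t x. D t x \<le> ennreal (c / 2 ^ k * exp (2 * n * t)) * G t x" for k
 proof (induction k)
  case 0 then show ?case using D by simp
 next
  case (Suc k)
  show ?case
  proof (intro allI)
   fix t x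
   have "D t x \<le> ennreal (c / 2 ^ k / 2 * exp (2 * n * t)) * G t x"
    using Suc c by (intro order_trans[OF le cv_exp_bound[OF G n w]]) auto
   then show "D t x \<le> ennreal (c / 2 ^ Suc k * exp (2 * n * t)) * G t x" by (simp add: mult.commute)
  qed
 qed
 obtain g where g: "G t x = ennreal g" "g \<ge> 0"
  using G unfolding excessive_def by (metis ennreal_cases infinity_ennreal_def less_irrefl)
 have "(\<lambda>k. c / 2 ^ k * exp (2 * n * t) * g) \<longlonglongrightarrow> 0"
 proof -
  have "(\<lambda>k. (1/2) ^ k) \<longlonglongrightarrow> (0::real)" by (rule LIMSEQ_realpow_zero) auto
  from tendsto_mult_right_zero[OF this, of "c * exp (2 * n * t) * g"] show ?thesis
   by (simp add: power_divide mult_ac)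
 qed
 then have "(\<lambda>k. ennreal (c / 2 ^ k * exp (2 * n * t) * g)) \<longlonglongrightarrow> ennreal 0"
  by (intro tendsto_ennrealI)
 moreover have "D t x \<le> ennreal (c / 2 ^ k * exp (2 * n * t) * g)" for k
 proof -
  have "ennreal (c / 2 ^ k * exp (2 * n * t)) * ennreal g = ennreal (c / 2 ^ k * exp (2 * n * t) * g)"
   using c g by (intro ennreal_mult[symmetric]) auto
  then show ?thesis using b[of k, rule_format, of t x] unfolding g(1) by (simp only:)
 qed
 ultimately have "D t x \<le> ennreal 0" by (intro LIMSEQ_le_const) auto
 then show ?thesis by simp
qed

lemma ennreal_le_add_diff: "(a::ennreal) \<le> b + (a - b)"
 using ennreal_minus_le_iff[of a b "a - b"] by simp

text \<open>The difference of two solutions satisfies the hypothesis of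
  \<open>excessive_imp_zero\<close>. The exponential bounds also make the convolutions finite, so
  that they can be cancelled from both sides.\<close>

lemma cv_unique_add:
 fixes X Y :: "real \<Rightarrow> 'a::euclidean_space \<Rightarrow> ennreal"
 assumes G: "excessive G" and n: "n > 0" and w: "\<And>z. w z \<le> ennreal n" and wm [measurable]: "w \<in> borel_measurable borel" and c: "c \<ge> 0"
  and X: "fmeas X" "\<And>t x. X t x \<le> ennreal (c * exp (2 * n * t)) * G t x"
  and Y: "fmeas Y" "\<And>t x. Y t x \<le> ennreal (c * exp (2 * n * t)) * G t x"
  and eq: "\<And>t x. X t x + cv hk w X t x = Y t x + cv hk w Y t x"
 shows "X t x = Y t x"
proof -
 note [measurable] = fmeasD[OF X(1)] fmeasD[OF Y(1)]
 \<comment> \<open>Subtraction in [0, \<infinity>] is truncated at 0; the maximum of the two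
   truncated differences plays the role of |X - Y|.\<close>
 define D where "D t x = max (X t x - Y t x) (Y t x - X t x)" for t x
 have Dm: "fmeas D" unfolding D_def by (rule fmeasI) measurable
 have half: "U t x - U' t x \<le> cv hk w D t x"
  if U: "fmeas U" "\<And>t x. U t x \<le> ennreal (c * exp (2 * n * t)) * G t x"
   "fmeas U'" "\<And>t x. U' t x \<le> U t x + D t x" "\<And>t x. U t x + cv hk w U t x = U' t x + cv hk w U' t x" for U U' t x
 proof -
  have "U t x + cv hk w U t x \<le> U' t x + cv hk w (\<lambda>t x. U t x + D t x) t x"
   unfolding U(5) by (intro add_left_mono cv_mono U(4)) auto
  also have "cv hk w (\<lambda>t x. U t x + D t x) t x = cv hk w U t x + cv hk w D t x"
   by (intro cv_add_right kmeas_hk U Dm wm)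
  finally have "cv hk w U t x + U t x \<le> cv hk w U t x + (U' t x + cv hk w D t x)"
   by (simp add: add_ac)
  moreover have "cv hk w U t x \<noteq> top"
  proof -
   have "cv hk w U t x \<le> ennreal (c / 2 * exp (2 * n * t)) * G t x"
    by (rule cv_exp_bound[OF G n w c U(2)])
   also have "\<dots> < top" using G by (simp add: excessive_def ennreal_mult_less_top)
   finally show ?thesis by simp
  qed
  ultimately have "U t x \<le> U' t x + cv hk w D t x" by (simp add: ennreal_add_left_cancel_le)
  moreover have "U t x \<noteq> top"
  proof -
   have "U t x \<le> ennreal (c * exp (2 * n * t)) * G t x" by (rule U(2))
   also have "\<dots> < top" using G by (simp add: excessive_def ennreal_mult_less_top)
   finally show ?thesis by simp
  qed
  ultimately show ?thesis by (simp add: ennreal_minus_le_iff)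
 qed
 have "D t x = 0" for t x
 proof (rule excessive_imp_zero[OF G n w c])
  fix t x
  show "D t x \<le> ennreal (c * exp (2 * n * t)) * G t x"
   unfolding D_def using X(2)[of t x] Y(2)[of t x] by (auto intro: order_trans[OF diff_le_self_ennreal])
  have "X t x - Y t x \<le> cv hk w D t x"
  proof (rule half[OF X Y(1) _ eq])
   show "Y t x \<le> X t x + D t x" for t x
    by (rule order_trans[OF ennreal_le_add_diff[of _ "X t x"]]) (auto simp: D_def intro!: add_left_mono)
  qed
  moreover have "Y t x - X t x \<le> cv hk w D t x"
  proof (rule half[OF Y X(1) _ eq[symmetric]])
   show "X t x \<le> Y t x + D t x" for t x
    by (rule order_trans[OF ennreal_le_add_diff[of _ "Y t x"]]) (auto simp: D_def intro!: add_left_mono)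
  qed
  ultimately show "D t x \<le> cv hk w D t x" by (simp add: D_def)
 qed
 from this[of t x] have "X t x - Y t x = 0" "Y t x - X t x = 0" unfolding D_def
  by (metis max.cobounded1 max.cobounded2 le_zero_eq)+
 then show ?thesis
  by (metis add.right_neutral antisym ennreal_le_add_diff)
qed

lemma hk_finite [simp]: "hk t x y < top" "hk t x y \<noteq> top"
 by (simp_all add: hk_def)

lemma hk_exp_le:
 assumes "n \<ge> 0" "c \<ge> 1"
 shows "hk t x y \<le> ennreal (c * exp (2 * n * t)) * hk t x y"
proof (cases "t > 0")
 case True
 have "1 \<le> c * exp (2 * n * t)" using assms True mult_mono[of 1 c 1 "exp (2 * n * t)"] by simp
 then have "1 * hk t x y \<le> ennreal (c * exp (2 * n * t)) * hk t x y"
  by (intro mult_right_mono) auto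
 then show ?thesis by simp
qed (simp add: hk_def)

lemma excessive_hk: "excessive (\<lambda>t x. hk t x y)"
 unfolding excessive_def
proof (intro conjI allI impI)
 show "fmeas (\<lambda>t x. hk t x y)" by (intro fmeas_slice kmeas_hk)
 show "hk t x y = 0" if "t \<le> 0" for t x using that by (simp add: hk_def)
qed (auto simp: hk_semigroup)

text \<open>The majorant for the semigroup property, where K_{t+s} and K_t K_s are compared as
  functions of t > 0 with s fixed.\<close>

lemma excessive_hk_shift:
 assumes s: "s > 0"
 shows "excessive (\<lambda>t x. if t > 0 then hk (t + s) x y else 0)"
 unfolding excessive_def
proof (intro conjI allI impI)
 show "fmeas (\<lambda>t x. if t > 0 then hk (t + s) x y else 0)"
  by (rule fmeasI) measurable
 fix r t x assume "0 < r" "(r::real) < t"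
 then show "(NN z. hk (t - r) x z * (if r > 0 then hk (r + s) z y else 0)) \<le> (if t > 0 then hk (t + s) x y else 0)"
  using s hk_semigroup[of "t - r" "r + s" x y] by simp
qed auto

section \<open>Existence of the kernel for a bounded potential\<close>

definition En :: "real \<Rightarrow> ('a::euclidean_space) kernel" where
 "En n t x y = ennreal (exp (- n * t)) * hk t x y"

lemma kmeas_En: "kmeas (En n)"
 unfolding En_def by (rule kmeasI) measurable

lemma En_le: "n \<ge> 0 \<Longrightarrow> En n t x y \<le> hk t x y"
proof (cases "t > 0")
 case True
 assume "n \<ge> 0"
 then have "ennreal (exp (- n * t)) * hk t x y \<le> 1 * hk t x y"
  using True by (intro mult_right_mono) (auto simp: ennreal_le_1)
 then show ?thesis by (simp add: En_def)
qed (simp add: En_def hk_def)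

text \<open>Duhamel's formula for the constant potential n. By the semigroup law the space integral
  is a multiple of P_t, and integrating n exp (-n (t - s)) over 0 < s < t gives 1 - exp (-n
  t).\<close>

lemma hk_En:
 assumes n: "n > 0"
 shows "hk t x y = En n t x y + ck (En n) (\<lambda>_. ennreal n) hk t x y"
proof (cases "t > 0")
 case False
 have "En n (t - s) x z * (ennreal n * hk s z y) = 0" for s z
  using False by (auto simp: En_def hk_def)
 then have "ck (En n) (\<lambda>_. ennreal n) hk t x y = 0" unfolding ck_def cv_def by (simp only:) simp
 then show ?thesis using False by (simp add: hk_def En_def)
next
 case t: True
 have "ck (En n) (\<lambda>_. ennreal n) hk t x y = (NN s. (ennreal (n * exp (- n * t)) * hk t x y) * (ennreal (exp (n * s)) * indicator {0<..<t} s))"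
  unfolding ck_def cv_def
 proof (intro nn_integral_cong)
  fix s
  show "(NN z. En n (t - s) x z * (ennreal n * hk s z y)) = (ennreal (n * exp (- n * t)) * hk t x y) * (ennreal (exp (n * s)) * indicator {0<..<t} s)"
  proof (cases "0 < s \<and> s < t")
   case True
   have "(NN z. En n (t - s) x z * (ennreal n * hk s z y))
     = (NN z. (ennreal (exp (- n * (t - s))) * ennreal n) * (hk (t - s) x z * hk s z y))"
    by (intro nn_integral_cong) (simp add: En_def mult_ac)
   also have "\<dots> = (ennreal (exp (- n * (t - s))) * ennreal n) * (NN z. hk (t - s) x z * hk s z y)"
    by (intro nn_integral_cmult) measurable
   also have "(NN z. hk (t - s) x z * hk s z y) = hk t x y"
    using hk_semigroup[of "t - s" s x y] True by simp
   also have "ennreal (exp (- n * (t - s))) * ennreal n = ennreal (n * exp (- n * t)) * ennreal (exp (n * s))"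
   proof -
    have "exp (- n * (t - s)) = exp (- n * t) * exp (n * s)" by (simp add: algebra_simps flip: exp_add)
    then show ?thesis using n by (simp add: ennreal_mult mult_ac)
   qed
   finally show ?thesis using True by (simp add: mult_ac)
  next
   case False
   then have "En n (t - s) x z * (ennreal n * hk s z y) = 0" for z by (auto simp: En_def hk_def)
   then have "(NN z. En n (t - s) x z * (ennreal n * hk s z y)) = 0" by (simp only:) simp
   then show ?thesis using False by (auto simp: indicator_def)
  qed
 qed
 also have "\<dots> = (ennreal (n * exp (- n * t)) * hk t x y) * ennreal ((exp (n * t) - 1) / n)"
  using exp_time_integral[of n t] n t by (subst nn_integral_cmult) auto
 also have "\<dots> = ennreal (1 - exp (- n * t)) * hk t x y"
 proof -
  have "n * exp (- n * t) * ((exp (n * t) - 1) / n) = 1 - exp (- n * t)"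
  proof -
   have "exp (- n * t) * exp (n * t) = 1" by (simp flip: exp_add)
   then have "exp (- n * t) * (exp (n * t) - 1) = 1 - exp (- n * t)" by (simp add: right_diff_distrib)
   moreover have "n * A * (B / n) = A * B" for A B using n by simp
   ultimately show ?thesis by (simp only:)
  qed
  moreover have "ennreal (n * exp (- n * t)) * ennreal ((exp (n * t) - 1) / n) = ennreal (n * exp (- n * t) * ((exp (n * t) - 1) / n))"
   using n t by (intro ennreal_mult[symmetric]) auto
  ultimately show ?thesis by (metis mult.assoc mult.commute)
 qed
 finally have "En n t x y + ck (En n) (\<lambda>_. ennreal n) hk t x y = (ennreal (exp (- n * t)) + ennreal (1 - exp (- n * t))) * hk t x y"
  by (simp add: En_def distrib_right)
 also have "ennreal (exp (- n * t)) + ennreal (1 - exp (- n * t)) = 1"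
  using n t by (simp flip: ennreal_plus)
 finally show ?thesis by simp
qed

lemma cv_SUP:
 assumes A: "kmeas A" and X: "\<And>k. fmeas (X k)" and [measurable]: "w \<in> borel_measurable borel"
  and inc: "\<And>t x. incseq (\<lambda>k. X k t x)"
 shows "cv A w (\<lambda>t x. SUP k. X k t x) t x = (SUP k. cv A w (X k) t x)"
proof -
 note [measurable] = kmeasD[OF A] fmeasD[OF X]
 have inc': "incseq (\<lambda>k z. A (t - s) x z * (w z * X k s z))" for s
  using inc by (auto simp: incseq_def le_fun_def intro!: mult_left_mono)
 have "cv A w (\<lambda>t x. SUP k. X k t x) t x = (NN s. NN z. (SUP k. A (t - s) x z * (w z * X k s z)))"
  unfolding cv_def by (simp add: SUP_mult_left_ennreal)
 also have "\<dots> = (NN s. (SUP k. NN z. A (t - s) x z * (w z * X k s z)))"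
  by (intro nn_integral_cong nn_integral_monotone_convergence_SUP inc') measurable
 also have "\<dots> = (SUP k. NN s. NN z. A (t - s) x z * (w z * X k s z))"
 proof (intro nn_integral_monotone_convergence_SUP)
  show "incseq (\<lambda>k s. NN z. A (t - s) x z * (w z * X k s z))"
   using inc' by (auto simp: incseq_def le_fun_def intro!: nn_integral_mono)
 qed measurable
 finally show ?thesis by (simp add: cv_def)
qed

text \<open>The counterpart of \<open>cv_unique_add\<close> when the convolution stands on the right
  with a plus sign. Since \<open>En\<close> lies below \<open>hk\<close>, the same halving argument
  applies to the difference.\<close>

lemma cv_unique_fix:
 fixes X Y :: "real \<Rightarrow> 'a::euclidean_space \<Rightarrow> ennreal"
 assumes G: "excessive G" and n: "n > 0" and c: "c \<ge> 0"
  and X: "fmeas X" "\<And>t x. X t x \<le> ennreal (c * exp (2 * n * t)) * G t x"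
  and Y: "fmeas Y" "\<And>t x. Y t x \<le> ennreal (c * exp (2 * n * t)) * G t x"
  and eqX: "\<And>t x. X t x = E t x + cv (En n) (\<lambda>_. ennreal n) X t x"
  and eqY: "\<And>t x. Y t x = E t x + cv (En n) (\<lambda>_. ennreal n) Y t x"
 shows "X t x = Y t x"
proof -
 note [measurable] = fmeasD[OF X(1)] fmeasD[OF Y(1)]
 define D where "D t x = max (X t x - Y t x) (Y t x - X t x)" for t x
 have Dm: "fmeas D" unfolding D_def by (rule fmeasI) measurable
 have half: "U t x - U' t x \<le> cv hk (\<lambda>_. ennreal n) D t x"
  if U: "\<And>t x. U t x \<le> ennreal (c * exp (2 * n * t)) * G t x"
   "fmeas U'" "\<And>t x. U t x \<le> U' t x + D t x"
   "\<And>t x. U t x = E t x + cv (En n) (\<lambda>_. ennreal n) U t x" "\<And>t x. U' t x = E t x + cv (En n) (\<lambda>_. ennreal n) U' t x" for U U' t x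
 proof -
  have "U t x \<le> E t x + cv (En n) (\<lambda>_. ennreal n) (\<lambda>t x. U' t x + D t x) t x"
   by (subst U(4)) (intro add_left_mono cv_mono U(3) order_refl)
  also have "\<dots> = (E t x + cv (En n) (\<lambda>_. ennreal n) U' t x) + cv (En n) (\<lambda>_. ennreal n) D t x"
   by (subst cv_add_right) (auto intro: kmeas_En U(2) Dm simp: add.assoc)
  also have "\<dots> \<le> U' t x + cv hk (\<lambda>_. ennreal n) D t x"
   unfolding U(5)[symmetric] using n by (intro add_left_mono cv_mono En_le) auto
  finally have "U t x \<le> U' t x + cv hk (\<lambda>_. ennreal n) D t x" .
  moreover have "U t x \<noteq> top"
  proof -
   have "U t x \<le> ennreal (c * exp (2 * n * t)) * G t x" by (rule U(1))
   also have "\<dots> < top" using G by (simp add: excessive_def ennreal_mult_less_top)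
   finally show ?thesis by simp
  qed
  ultimately show ?thesis by (simp add: ennreal_minus_le_iff)
 qed
 have "D t x = 0" for t x
 proof (rule excessive_imp_zero[OF G n _ c])
  fix t x
  show "D t x \<le> ennreal (c * exp (2 * n * t)) * G t x"
   unfolding D_def using X(2)[of t x] Y(2)[of t x] by (auto intro: order_trans[OF diff_le_self_ennreal])
  have "X t x - Y t x \<le> cv hk (\<lambda>_. ennreal n) D t x"
  proof (rule half[OF X(2) Y(1) _ eqX eqY])
   show "X t x \<le> Y t x + D t x" for t x
    by (rule order_trans[OF ennreal_le_add_diff[of _ "Y t x"]]) (auto simp: D_def intro!: add_left_mono)
  qed
  moreover have "Y t x - X t x \<le> cv hk (\<lambda>_. ennreal n) D t x"
  proof (rule half[OF Y(2) X(1) _ eqY eqX])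
   show "Y t x \<le> X t x + D t x" for t x
    by (rule order_trans[OF ennreal_le_add_diff[of _ "X t x"]]) (auto simp: D_def intro!: add_left_mono)
  qed
  ultimately show "D t x \<le> cv hk (\<lambda>_. ennreal n) D t x" by (simp add: D_def)
 qed simp
 from this[of t x] have "X t x - Y t x = 0" "Y t x - X t x = 0" unfolding D_def
  by (metis max.cobounded1 max.cobounded2 le_zero_eq)+
 then show ?thesis
  by (metis add.right_neutral antisym ennreal_le_add_diff)
qed

definition is_bk :: "('a::euclidean_space \<Rightarrow> ennreal) \<Rightarrow> 'a kernel \<Rightarrow> bool" where
 "is_bk w K \<longleftrightarrow> kmeas K \<and> (\<forall>t x y. K t x y \<le> hk t x y) \<and> (\<forall>t x y. K t x y + ck hk w K t x y = hk t x y)"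

text \<open>With \<open>e\<^bsup>-nt\<^esup> P\<^sub>t\<close> in place of \<open>P\<^sub>t\<close> the potential \<open>w\<close> becomes \<open>n - w \<ge> 0\<close> with the opposite sign, so that
 the Duhamel series has nonnegative terms.\<close>
primrec duhamel_iter :: "real \<Rightarrow> ('a::euclidean_space \<Rightarrow> ennreal) \<Rightarrow> nat \<Rightarrow> 'a kernel" where
 "duhamel_iter n u 0 = (\<lambda>t x y. 0)"
| "duhamel_iter n u (Suc k) = (\<lambda>t x y. En n t x y + ck (En n) u (duhamel_iter n u k) t x y)"

lemma kmeas_add: "kmeas A \<Longrightarrow> kmeas B \<Longrightarrow> kmeas (\<lambda>t x y. A t x y + B t x y)"
 unfolding kmeas_def case_prod_unfold by measurable

lemma kmeas_duhamel_iter: "u \<in> borel_measurable borel \<Longrightarrow> kmeas (duhamel_iter n u k)"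
proof (induction k)
 case 0 show ?case by (simp, rule kmeasI) measurable
next
 case (Suc k) then show ?case by (simp add: kmeas_add kmeas_En kmeas_ck)
qed

lemma ck_mono:
 assumes "\<And>t x z. A t x z \<le> A' t x z" "\<And>z. w z \<le> w' z" "\<And>t z y. B t z y \<le> B' t z y"
 shows "ck A w B t x y \<le> ck A' w' B' t x y"
 unfolding ck_def by (intro cv_mono assms)

lemma duhamel_iter_mono: "(\<And>z. u z \<le> u' z) \<Longrightarrow> duhamel_iter n u k t x y \<le> duhamel_iter n u' k t x y"
 by (induction k arbitrary: t x y) (auto intro!: add_left_mono ck_mono)

lemma duhamel_iter_Suc: "duhamel_iter n u k t x y \<le> duhamel_iter n u (Suc k) t x y"
proof (induction k arbitrary: t x y)
 case (Suc k)
 show ?case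
  by (subst (1 2) duhamel_iter.simps(2)) (intro add_left_mono ck_mono order_refl Suc)
qed simp

lemma incseq_duhamel_iter: "incseq (\<lambda>k. duhamel_iter n u k t x y)"
 by (rule incseq_SucI) (rule duhamel_iter_Suc)

lemma duhamel_iter_le:
 assumes n: "n > 0" and u: "\<And>z. u z \<le> ennreal n"
 shows "duhamel_iter n u k t x y \<le> hk t x y"
proof (induction k arbitrary: t x y)
 case (Suc k)
 have "duhamel_iter n u (Suc k) t x y \<le> En n t x y + ck (En n) (\<lambda>_. ennreal n) hk t x y"
  unfolding duhamel_iter.simps by (intro add_left_mono ck_mono order_refl Suc u)
 then show ?case using hk_En[OF n, of t x y] by simp
qed simp

text \<open>For fixed n the iterates increase with k and decrease when the potential grows; this
  makes the kernel monotone in the potential.\<close>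

definition bker :: "real \<Rightarrow> ('a::euclidean_space \<Rightarrow> ennreal) \<Rightarrow> 'a kernel" where
 "bker n w t x y = (SUP k. duhamel_iter n (\<lambda>z. ennreal n - w z) k t x y)"

lemma bker_antimono: "(\<And>z. w z \<le> w' z) \<Longrightarrow> bker n w' t x y \<le> bker n w t x y"
 unfolding bker_def by (intro SUP_mono') (auto intro!: duhamel_iter_mono ennreal_minus_mono)

text \<open>Monotone convergence gives K = E + E (n - w) K with E = \<open>En n\<close>. To recover
  K + P w K = P, one checks that the left side solves X = E + n E X, using P = E + n E P; as P
  solves the same equation, uniqueness applies.\<close>

lemma is_bk_bker:
 assumes n: "n > 0" and w: "\<And>z. w z \<le> ennreal n" and wm [measurable]: "w \<in> borel_measurable borel"
 shows "is_bk w (bker n w)"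
proof -
 define u where "u z = ennreal n - w z" for z
 have um [measurable]: "u \<in> borel_measurable borel" unfolding u_def by measurable
 have wu: "w z + u z = ennreal n" for z using w[of z] by (simp add: u_def add_diff_inverse_ennreal)
 define K where "K = bker n w"
 have K: "K t x y = (SUP k. duhamel_iter n u k t x y)" for t x y by (simp add: K_def bker_def u_def[abs_def])
 note [measurable] = kmeasD[OF kmeas_duhamel_iter[OF um]]
 have Km: "kmeas K" unfolding K by (rule kmeasI) measurable
 have Kle: "K t x y \<le> hk t x y" for t x y
  unfolding K by (intro SUP_least duhamel_iter_le n) (auto simp: u_def)
 have Kfix: "En n t x y + ck (En n) u K t x y = K t x y" for t x y
 proof -
  have "ck (En n) u K t x y = (SUP k. ck (En n) u (duhamel_iter n u k) t x y)"
   unfolding ck_def K by (intro cv_SUP kmeas_En fmeas_slice kmeas_duhamel_iter um incseq_duhamel_iter)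
  then have "En n t x y + ck (En n) u K t x y = (SUP k. duhamel_iter n u (Suc k) t x y)"
   by (simp add: ennreal_SUP_add_right)
  also have "\<dots> = K t x y"
   unfolding K
  proof (rule antisym)
   show "(SUP k. duhamel_iter n u (Suc k) t x y) \<le> (SUP k. duhamel_iter n u k t x y)"
    by (intro SUP_least) (rule SUP_upper, simp)
   show "(SUP k. duhamel_iter n u k t x y) \<le> (SUP k. duhamel_iter n u (Suc k) t x y)"
    by (intro SUP_mono' duhamel_iter_Suc)
  qed
  finally show ?thesis .
 qed
 have "K t x y + ck hk w K t x y = hk t x y" for t x y
 \<comment> \<open>The constant c = 2 leaves room for both summands: 1 for \<open>K\<close> itself
   and 1/2 for its convolution by \<open>cv_exp_bound\<close>.\<close>
 proof (rule cv_unique_fix[where G = "\<lambda>t x. hk t x y" and c = 2 and E = "\<lambda>t x. En n t x y"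
   and X = "\<lambda>t x. K t x y + ck hk w K t x y" and Y = "\<lambda>t x. hk t x y", OF excessive_hk n])
  let ?X = "\<lambda>t x. K t x y + ck hk w K t x y"
  have ckm: "kmeas (ck hk w K)" by (intro kmeas_ck kmeas_hk Km) measurable
  have Xm: "kmeas (\<lambda>t x y. K t x y + ck hk w K t x y)"
   by (intro kmeas_add ckm Km)
  then show "fmeas ?X" by (rule fmeas_slice)
  show "fmeas (\<lambda>t x. hk t x y)" by (intro fmeas_slice kmeas_hk)
  show "hk t x y \<le> ennreal (2 * exp (2 * n * t)) * hk t x y" for t x
   using n by (intro hk_exp_le) auto
  show "?X t x \<le> ennreal (2 * exp (2 * n * t)) * hk t x y" for t x
  proof -
   have "K t x y \<le> ennreal (1 * exp (2 * n * t)) * hk t x y" for t x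
    using n by (intro order_trans[OF Kle hk_exp_le]) auto
   moreover from cv_exp_bound[OF excessive_hk n w, of 1, OF _ this]
   have "ck hk w K t x y \<le> ennreal (1 / 2 * exp (2 * n * t)) * hk t x y" unfolding ck_def by simp
   ultimately have "?X t x \<le> ennreal (1 * exp (2 * n * t)) * hk t x y + ennreal (1 / 2 * exp (2 * n * t)) * hk t x y"
    by (intro add_mono) auto
   also have "\<dots> = ennreal (1 * exp (2 * n * t) + 1 / 2 * exp (2 * n * t)) * hk t x y"
    by (subst ennreal_plus, simp, simp, simp only: distrib_right)
   also have "\<dots> \<le> ennreal (2 * exp (2 * n * t)) * hk t x y"
    by (intro mult_right_mono ennreal_leI) auto
   finally show ?thesis .
  qed
  show "hk t x y = En n t x y + cv (En n) (\<lambda>_. ennreal n) (\<lambda>t x. hk t x y) t x" for t x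
   using hk_En[OF n, of t x y] by (simp add: ck_def)
  show "?X t x = En n t x y + cv (En n) (\<lambda>_. ennreal n) ?X t x" for t x
  proof -
   have "cv (En n) (\<lambda>_. ennreal n) ?X t x = cv (En n) (\<lambda>_. ennreal n) (\<lambda>t x. K t x y) t x + cv (En n) (\<lambda>_. ennreal n) (\<lambda>t x. ck hk w K t x y) t x"
    by (intro cv_add_right kmeas_En fmeas_slice Km ckm) measurable
   also have "cv (En n) (\<lambda>_. ennreal n) (\<lambda>t x. K t x y) t x = cv (En n) w (\<lambda>t x. K t x y) t x + cv (En n) u (\<lambda>t x. K t x y) t x"
   proof -
    have wu': "(\<lambda>_. ennreal n) = (\<lambda>z. w z + u z)" by (simp only: wu)
    show ?thesis by (subst wu') (intro cv_add_weight kmeas_En fmeas_slice Km wm um)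
   qed
   also have "cv (En n) (\<lambda>_. ennreal n) (\<lambda>t x. ck hk w K t x y) t x = cv (ck (En n) (\<lambda>_. ennreal n) hk) w (\<lambda>t x. K t x y) t x"
    unfolding ck_def[of hk w K] by (intro cv_assoc kmeas_En kmeas_hk fmeas_slice Km) measurable
   finally have "En n t x y + cv (En n) (\<lambda>_. ennreal n) ?X t x
    = (En n t x y + ck (En n) u K t x y) + (cv (En n) w (\<lambda>t x. K t x y) t x + cv (ck (En n) (\<lambda>_. ennreal n) hk) w (\<lambda>t x. K t x y) t x)"
    by (simp add: ck_def add_ac)
   also have "cv (En n) w (\<lambda>t x. K t x y) t x + cv (ck (En n) (\<lambda>_. ennreal n) hk) w (\<lambda>t x. K t x y) t x
     = cv (\<lambda>t x y. En n t x y + ck (En n) (\<lambda>_. ennreal n) hk t x y) w (\<lambda>t x. K t x y) t x"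
    by (intro cv_add_left[symmetric] kmeas_En kmeas_ck kmeas_hk fmeas_slice Km) measurable
   also have "\<dots> = ck hk w K t x y"
    unfolding hk_En[OF n, symmetric] by (simp only: ck_def)
   finally show ?thesis unfolding Kfix by simp
  qed
 qed simp
 then show ?thesis using Km Kle by (simp add: is_bk_def K_def)
qed

lemma is_bk_unique:
 assumes n: "n > 0" and w: "\<And>z. w z \<le> ennreal n" and [measurable]: "w \<in> borel_measurable borel"
  and K: "is_bk w K" and X: "fmeas X" "\<And>t x. X t x \<le> hk t x y" "\<And>t x. X t x + cv hk w X t x = hk t x y"
 shows "X t x = K t x y"
proof (rule cv_unique_add[where G = "\<lambda>t x. hk t x y" and c = 1 and X = X and Y = "\<lambda>t x. K t x y", OF excessive_hk n w])
 show "X t x \<le> ennreal (1 * exp (2 * n * t)) * hk t x y" for t x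
  using n by (intro order_trans[OF X(2) hk_exp_le]) auto
 show "K t x y \<le> ennreal (1 * exp (2 * n * t)) * hk t x y" for t x
  using n K unfolding is_bk_def by (intro order_trans[OF _ hk_exp_le]) auto
 show "X t x + cv hk w X t x = K t x y + cv hk w (\<lambda>t x. K t x y) t x" for t x
  using X(3)[of t x] K by (simp add: is_bk_def ck_def)
 show "fmeas (\<lambda>t x. K t x y)" using K by (simp add: is_bk_def fmeas_slice)
qed (use X in auto)

text \<open>Both P w K and K w P solve Z + P w Z = P w P: in the first case by grouping P w (K + P w
  K), in the second by grouping (K + P w K) w P. Uniqueness makes them equal.\<close>

lemma is_bk_right:
 assumes n: "n > 0" and w: "\<And>z. w z \<le> ennreal n" and wm [measurable]: "w \<in> borel_measurable borel"
  and K: "is_bk w K"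
 shows "K t x y + ck K w hk t x y = hk t x y"
proof -
 have Km: "kmeas K" and Kle: "\<And>t x y. K t x y \<le> hk t x y" and Keq: "\<And>t x y. K t x y + ck hk w K t x y = hk t x y"
  using K by (auto simp: is_bk_def)
 have PP: "ck hk w hk t x y \<le> ennreal (1 * exp (2 * n * t)) * hk t x y" for t x
 proof -
  have "ck hk w hk t x y \<le> ennreal (1 / 2 * exp (2 * n * t)) * hk t x y"
   unfolding ck_def using n by (intro cv_exp_bound[OF excessive_hk n w] hk_exp_le) auto
  also have "\<dots> \<le> ennreal (1 * exp (2 * n * t)) * hk t x y"
   by (intro mult_right_mono ennreal_leI) auto
  finally show ?thesis .
 qed
 have "ck hk w K t x y = ck K w hk t x y"
 proof (rule cv_unique_add[where G = "\<lambda>t x. hk t x y" and c = 1 and X = "\<lambda>t x. ck hk w K t x y" and Y = "\<lambda>t x. ck K w hk t x y", OF excessive_hk n w])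
  show "fmeas (\<lambda>t x. ck hk w K t x y)" "fmeas (\<lambda>t x. ck K w hk t x y)"
   by (intro fmeas_slice kmeas_ck kmeas_hk Km wm)+
  show "ck hk w K t x y \<le> ennreal (1 * exp (2 * n * t)) * hk t x y" for t x
   by (rule order_trans[OF ck_mono PP]) (auto intro: Kle)
  show "ck K w hk t x y \<le> ennreal (1 * exp (2 * n * t)) * hk t x y" for t x
   by (rule order_trans[OF ck_mono PP]) (auto intro: Kle)
  show "ck hk w K t x y + cv hk w (\<lambda>t x. ck hk w K t x y) t x = ck K w hk t x y + cv hk w (\<lambda>t x. ck K w hk t x y) t x" for t x
  proof -
   have "ck hk w K t x y + cv hk w (\<lambda>t x. ck hk w K t x y) t x = cv hk w (\<lambda>t x. K t x y + ck hk w K t x y) t x"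
    unfolding ck_def[of hk w K t x y]
    by (intro cv_add_right[symmetric] kmeas_hk fmeas_slice Km kmeas_ck wm)
   also have "\<dots> = cv hk w (\<lambda>t x. hk t x y) t x" by (simp only: Keq)
   also have "\<dots> = cv (\<lambda>t x y. K t x y + ck hk w K t x y) w (\<lambda>t x. hk t x y) t x" by (simp only: Keq)
   also have "\<dots> = cv K w (\<lambda>t x. hk t x y) t x + cv (ck hk w K) w (\<lambda>t x. hk t x y) t x"
    by (intro cv_add_left kmeas_hk fmeas_slice Km kmeas_ck wm)
   also have "cv (ck hk w K) w (\<lambda>t x. hk t x y) t x = cv hk w (cv K w (\<lambda>t x. hk t x y)) t x"
    by (intro cv_assoc[symmetric] kmeas_hk fmeas_slice Km wm)
   finally show ?thesis by (simp add: ck_def)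
  qed
 qed (auto simp: wm)
 then show ?thesis using Keq[of t x y] by simp
qed

section \<open>The semigroup property for a bounded potential\<close>

definition kprod :: "('a::euclidean_space \<Rightarrow> 'a \<Rightarrow> ennreal) \<Rightarrow> ('a \<Rightarrow> 'a \<Rightarrow> ennreal) \<Rightarrow> 'a \<Rightarrow> 'a \<Rightarrow> ennreal" where
 "kprod A B x y = (NN z. A x z * B z y)"

lemma cv_kprod:
 assumes A: "kmeas A" and B: "kmeas B" and [measurable]: "w \<in> borel_measurable borel" "g \<in> borel_measurable borel"
 shows "cv A w (\<lambda>r z. NN z'. B r z z' * g z') t x = (NN z'. ck A w B t x z' * g z')"
proof -
 note [measurable] = kmeasD[OF A] kmeasD[OF B]
 have "cv A w (\<lambda>r z. NN z'. B r z z' * g z') t x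
   = (NN s. NN z. NN z'. A (t - s) x z * (w z * (B s z z' * g z')))"
  unfolding cv_def by (simp add: nn_integral_cmult)
 also have "\<dots> = (NN s. NN z'. NN z. A (t - s) x z * (w z * (B s z z' * g z')))"
  by (rule nn_integral_cong) (rule nn_integral_swap, measurable)
 also have "\<dots> = (NN z'. NN s. NN z. A (t - s) x z * (w z * (B s z z' * g z')))"
  by (rule nn_integral_swap) measurable
 also have "\<dots> = (NN z'. (NN s. NN z. A (t - s) x z * (w z * B s z z')) * g z')"
  by (simp add: nn_integral_multc[symmetric] mult.assoc)
 finally show ?thesis by (simp add: ck_def cv_def)
qed

text \<open>With s fixed, K_t K_s and K_{t+s} both solve Z + P w Z = R, where R is P_t K_s, as
  functions of t > 0; uniqueness identifies them.\<close>

lemma is_bk_semigroup: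
 assumes n: "n > 0" and w: "\<And>z. w z \<le> ennreal n" and wm [measurable]: "w \<in> borel_measurable borel"
  and K: "is_bk w K" and t: "t > 0" and s: "s > 0"
 shows "(NN z. K t x z * K s z y) = K (t + s) x y"
proof -
 have Km: "kmeas K" and Kle: "\<And>t x y. K t x y \<le> hk t x y" and Keq: "\<And>t x y. K t x y + ck hk w K t x y = hk t x y"
  using K by (auto simp: is_bk_def)
 have K0: "K t x y = 0" if "t \<le> 0" for t x y using Kle[of t x y] that by (simp add: hk_def)
 note [measurable] = kmeasD[OF Km] kmeasD[OF kmeas_ck[OF kmeas_hk Km wm]]
 define G where "G t x = (if t > 0 then hk (t + s) x y else 0)" for t x
 define X where "X t x = (if t > 0 then K (t + s) x y else 0)" for t x
 define Y where "Y t x = (NN z. K t x z * K s z y)" for t x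
 define R where "R t x = (NN z. hk t x z * K s z y)" for t x
 have G: "excessive G" unfolding G_def by (rule excessive_hk_shift[OF s])
 have Gexp: "U \<le> ennreal (1 * exp (2 * n * t)) * G t x" if "U \<le> G t x" for U t x
 proof (cases "t > 0")
  case True
  then have "1 * G t x \<le> ennreal (1 * exp (2 * n * t)) * G t x" using n by (intro mult_right_mono) auto
  then show ?thesis using that by simp
 qed (use that in \<open>simp add: G_def\<close>)
 have YG: "Y t x \<le> G t x" for t x
 proof (cases "t > 0")
  case True
  have "Y t x \<le> (NN z. hk t x z * hk s z y)" unfolding Y_def by (intro nn_integral_mono mult_mono Kle) auto
  then show ?thesis using hk_semigroup[OF True s, of x y] True by (simp add: G_def)
 qed (simp add: Y_def K0)
 have eqY: "Y t x + cv hk w Y t x = R t x" for t x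
 proof -
  have "cv hk w Y t x = (NN z. ck hk w K t x z * K s z y)"
   unfolding Y_def[abs_def] by (rule cv_kprod) (use kmeas_hk Km in measurable)
  then have "Y t x + cv hk w Y t x = (NN z. K t x z * K s z y + ck hk w K t x z * K s z y)"
   unfolding Y_def by (subst nn_integral_add) measurable
  also have "\<dots> = R t x" unfolding R_def distrib_right[symmetric] Keq ..
  finally show ?thesis .
 qed
 have eqX: "X t x + cv hk w X t x = R t x" for t x
 proof (cases "t > 0")
  case False
  have "cv hk w X t x = 0"
  proof -
   have "hk (t - r) x z * (w z * X r z) = 0" for r z using False by (auto simp: X_def hk_def)
   then show ?thesis unfolding cv_def by (simp only:) simp
  qed
  then show ?thesis using False by (simp add: R_def X_def hk_def)
 next
  case True
  let ?h = "\<lambda>r. NN z. hk (t + s - r) x z * (w z * K r z y)" and ?J = "\<lambda>r z z'. hk t x z * (hk (s - r) z z' * (w z' * K r z' y))"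
  define F where "F = (NN r. ?h r * indicator {..s} r)"
  \<comment> \<open>The Duhamel integral at time t + s is cut at time s. Its part beyond s,
    translated by s, is the convolution for \<open>X\<close>.\<close>
  have split: "ck hk w K (t + s) x y = F + cv hk w X t x"
  proof -
   have "ck hk w K (t + s) x y = (NN r. ?h r * indicator {..s} r
     + ?h r * indicator {s<..} r)"
    unfolding ck_def cv_def by (intro nn_integral_cong) (auto simp: indicator_def)
   also have "\<dots> = F + (NN r. ?h r * indicator {s<..} r)"
    unfolding F_def by (intro nn_integral_add) measurable
   also have "(NN r. ?h r * indicator {s<..} r)
     = (NN r. (\<lambda>r. ?h r * indicator {s<..} r) (r + s))"
    by (intro nn_integral_shift(2)[symmetric]) measurable
   also have "\<dots> = cv hk w X t x"
    unfolding cv_def X_def by (intro nn_integral_cong) (auto simp: indicator_def)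
   finally show ?thesis .
  qed
  \<comment> \<open>P_t applied to the Duhamel equation at time s turns the earlier part of the cut
    integral into exactly the remainder \<open>F\<close>, which is finite and can be
    cancelled.\<close>
  have RF: "hk (t + s) x y = R t x + F"
  proof -
   have "hk (t + s) x y = (NN z. hk t x z * (K s z y + ck hk w K s z y))"
    unfolding Keq hk_semigroup[OF True s] ..
   also have "\<dots> = R t x + (NN z. hk t x z * ck hk w K s z y)"
    unfolding R_def distrib_left by (intro nn_integral_add) measurable
   also have "(NN z. hk t x z * ck hk w K s z y) = F"
   proof -
    have "(NN z. hk t x z * ck hk w K s z y)
     = (NN z. NN r. NN z'. ?J r z z')"
     unfolding ck_def cv_def by (simp add: nn_integral_cmult)
    also have "\<dots> = (NN r. NN z. NN z'. ?J r z z')"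
     by (rule nn_integral_swap) measurable
    also have "\<dots> = (NN r. NN z'. NN z. ?J r z z')"
     by (rule nn_integral_cong) (rule nn_integral_swap, measurable)
    also have "\<dots> = F" unfolding F_def
    proof (rule nn_integral_cong_AE, use AE_neq_lborel[of s] in eventually_elim)
     fix r assume ne: "r \<noteq> s"
     have "(NN z. ?J r z z') = (NN z. hk t x z * hk (s - r) z z') * (w z' * K r z' y)" for z'
      by (simp add: nn_integral_multc[symmetric] mult.assoc)
     moreover have "(NN z. hk t x z * hk (s - r) z z') = hk (t + s - r) x z' * indicator {..s} r" for z'
      using ne hk_semigroup[of t "s - r" x z'] True
      by (cases "r < s") (auto simp: indicator_def hk_def[of "s - r"] add_diff_eq)
     ultimately have "(NN z'. NN z. ?J r z z')
      = (NN z'. hk (t + s - r) x z' * indicator {..s} r * (w z' * K r z' y))"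
      by (simp only:)
     also have "\<dots> = (NN z. (hk (t + s - r) x z * (w z * K r z y)) * indicator {..s} r)"
      by (simp only: mult_ac)
     also have "\<dots> = ?h r * indicator {..s} r"
      by (intro nn_integral_multc) measurable
     finally show "(NN z'. NN z. ?J r z z')
      = ?h r * indicator {..s} r" .
    qed
    finally show ?thesis .
   qed
   finally show ?thesis .
  qed
  have Ffin: "F \<noteq> top" using RF hk_finite(2)[of "t + s" x y] by auto
  have "F + (X t x + cv hk w X t x) = F + R t x"
   using Keq[of "t + s" x y] True unfolding split RF by (simp add: X_def add_ac)
  then show ?thesis using Ffin by (simp add: ennreal_add_left_cancel)
 qed
 have "Y t x = X t x"
 proof (rule cv_unique_add[where G = G and c = 1 and X = Y and Y = X, OF G n w wm])
  show "fmeas X" unfolding X_def by (rule fmeasI) measurable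
  show "fmeas Y" unfolding Y_def by (rule fmeasI) measurable
  show "X t x \<le> ennreal (1 * exp (2 * n * t)) * G t x" for t x
   by (rule Gexp) (auto simp: X_def G_def Kle)
  show "Y t x \<le> ennreal (1 * exp (2 * n * t)) * G t x" for t x
   by (rule Gexp[OF YG])
  show "Y t x + cv hk w Y t x = X t x + cv hk w X t x" for t x
   unfolding eqX eqY ..
 qed simp
 then show ?thesis using t by (simp add: X_def Y_def)
qed

section \<open>Identification with the kernels defined through real integrals\<close>

lemma nn_integral_bounded_hk:
 assumes n: "n > 0" and w: "\<And>z. w z \<le> ennreal n" and X: "\<And>t x. X t x \<le> hk t x y"
 shows "(NN z. hk (t - s) x z * (w z * X s z)) \<le> ennreal n * hk t x y * indicator {0<..<t} s"
proof (cases "0 < s \<and> s < t")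
 case True
 have "(NN z. hk (t - s) x z * (w z * X s z)) \<le> (NN z. ennreal n * (hk (t - s) x z * hk s z y))"
 proof (intro nn_integral_mono)
  fix z
  have "hk (t - s) x z * (w z * X s z) \<le> hk (t - s) x z * (ennreal n * hk s z y)"
   by (intro mult_mono w X) auto
  then show "hk (t - s) x z * (w z * X s z) \<le> ennreal n * (hk (t - s) x z * hk s z y)"
   by (simp only: mult.left_commute)
 qed
 also have "\<dots> = ennreal n * hk t x y"
  using hk_semigroup[of "t - s" s x y] True by (simp add: nn_integral_cmult)
 finally show ?thesis using True by simp
next
 case False
 have "hk (t - s) x z * (w z * X s z) = 0" for z
  using X[of s z] False by (auto simp: hk_def)
 then show ?thesis by (simp only:) simp
qed

text \<open>The space integral is at most n P_t(x,y) and vanishes unless 0 < s < t. Hence all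
  integrals are finite, and the real integrals of the definition agree with the convolution in
  [0, \<infinity>].\<close>

lemma duhamel_real:
 fixes X :: "real \<Rightarrow> 'a::euclidean_space \<Rightarrow> real"
 assumes n: "n > 0" and W: "\<And>z. 0 \<le> W z" "\<And>z. W z \<le> n" and [measurable]: "W \<in> borel_measurable borel"
  and Xm: "fmeas (\<lambda>t x. ennreal (X t x))" and X0: "\<And>t x. 0 \<le> X t x" and Xle: "\<And>t x. ennreal (X t x) \<le> hk t x y"
 shows "ennreal (LINT s:{0<..<t}|lborel. LINT z|lborel. heat (t - s) (x - z) * W z * X s z)
   = cv hk (\<lambda>z. ennreal (W z)) (\<lambda>s z. ennreal (X s z)) t x"
  "0 \<le> (LINT s:{0<..<t}|lborel. LINT z|lborel. heat (t - s) (x - z) * W z * X s z)"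
proof -
 note [measurable] = fmeasD[OF Xm]
 have [measurable]: "(\<lambda>z. X (f z) (g z)) \<in> borel_measurable M" if [measurable]: "f \<in> borel_measurable M" "g \<in> borel_measurable M" for f g and M :: "'c measure"
 proof -
  have "(\<lambda>z. enn2real (ennreal (X (f z) (g z)))) \<in> borel_measurable M" by measurable
  then show ?thesis using X0 by simp
 qed
 define h where "h s = (NN z. hk (t - s) x z * (ennreal (W z) * ennreal (X s z)))" for s
 have hle: "h s \<le> ennreal n * hk t x y * indicator {0<..<t} s" for s
  unfolding h_def by (intro nn_integral_bounded_hk n Xle ennreal_leI W(2))
 have hfin: "h s < top" for s
  by (rule order_le_less_trans[OF hle]) (auto simp: ennreal_mult_less_top indicator_def)
 have hint: "(NN s. h s) < top"
 proof (rule order_le_less_trans[OF nn_integral_mono[OF hle]])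
  have "(NN s. ennreal n * hk t x y * indicator {0<..<t} s) = ennreal n * hk t x y * emeasure lborel {0<..<t}"
   by (intro nn_integral_cmult_indicator) auto
  then show "(NN s. ennreal n * hk t x y * indicator {0<..<t} s) < top"
   by (cases "0 < t") (auto simp: ennreal_mult_less_top)
 qed
 have inner: "(LINT z|lborel. heat (t - s) (x - z) * W z * X s z) = enn2real (h s)" if "s < t" for s
 proof -
  have "(LINT z|lborel. heat (t - s) (x - z) * W z * X s z) = enn2real (NN z. ennreal (heat (t - s) (x - z) * W z * X s z))"
   using W X0 by (intro integral_eq_nn_integral) auto
  also have "(NN z. ennreal (heat (t - s) (x - z) * W z * X s z)) = h s"
   unfolding h_def using that W X0 by (intro nn_integral_cong) (simp add: hk_def ennreal_mult mult.assoc)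
  finally show ?thesis .
 qed
 have eq: "(LINT s:{0<..<t}|lborel. LINT z|lborel. heat (t - s) (x - z) * W z * X s z) = (LINT s|lborel. enn2real (h s))"
  unfolding set_lebesgue_integral_def
 proof (intro Bochner_Integration.integral_cong refl)
  fix s :: real
  show "indicator {0<..<t} s *\<^sub>R (LINT z|lborel. heat (t - s) (x - z) * W z * X s z) = enn2real (h s)"
  proof (cases "0 < s \<and> s < t")
   case True then show ?thesis using inner[of s] by simp
  next
   case False
   then have "h s = 0" using hle[of s] by (auto simp: indicator_def)
   then show ?thesis using False by auto
  qed
 qed
 have hm [measurable]: "h \<in> borel_measurable borel" unfolding h_def by measurable
 have "(LINT s|lborel. enn2real (h s)) = enn2real (NN s. ennreal (enn2real (h s)))"
  by (intro integral_eq_nn_integral) auto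
 also have "(NN s. ennreal (enn2real (h s))) = (NN s. h s)"
  using hfin by (intro nn_integral_cong) simp
 finally have I: "(LINT s|lborel. enn2real (h s)) = enn2real (NN s. h s)" .
 show "ennreal (LINT s:{0<..<t}|lborel. LINT z|lborel. heat (t - s) (x - z) * W z * X s z)
   = cv hk (\<lambda>z. ennreal (W z)) (\<lambda>s z. ennreal (X s z)) t x"
 proof -
  have "cv hk (\<lambda>z. ennreal (W z)) (\<lambda>s z. ennreal (X s z)) t x = (NN s. h s)" by (simp add: cv_def h_def)
  then show ?thesis unfolding eq I using hint by simp
 qed
 show "0 \<le> (LINT s:{0<..<t}|lborel. LINT z|lborel. heat (t - s) (x - z) * W z * X s z)"
  unfolding eq I by simp
qed

text \<open>The definite description is resolved by existence, from \<open>bker\<close>, and by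
  uniqueness, from \<open>is_bk_unique\<close>, applied for each second argument y
  separately.\<close>

lemma bdd_schr_kernel_eq:
 fixes W :: "'a::euclidean_space \<Rightarrow> real"
 assumes n: "n > 0" and W: "\<And>z. 0 \<le> W z" "\<And>z. W z \<le> n" and Wm [measurable]: "W \<in> borel_measurable borel"
 shows "ennreal (bdd_schr_kernel W t x y) = bker n (\<lambda>z. ennreal (W z)) t x y"
  "0 \<le> bdd_schr_kernel W t x y"
proof -
 let ?w = "\<lambda>z. ennreal (W z)"
 let ?I = "\<lambda>k t x y. LINT s:{0<..<t}|lborel. LINT z|lborel. heat (t - s) (x - z) * W z * k s z y"
 define K where "K = bker n ?w"
 have w: "?w z \<le> ennreal n" for z by (intro ennreal_leI W(2))
 have bk: "is_bk ?w K" unfolding K_def by (rule is_bk_bker[OF n w]) measurable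
 then have Km: "kmeas K" and Kle: "\<And>t x y. K t x y \<le> hk t x y" and Keq: "\<And>t x y. K t x y + ck hk ?w K t x y = hk t x y"
  by (auto simp: is_bk_def)
 note [measurable] = kmeasD[OF Km]
 have Kfin: "K t x y < top" for t x y using Kle[of t x y] hk_finite(1)[of t x y] by (rule order_le_less_trans)
 define Kr where "Kr t x y = enn2real (K t x y)" for t x y
 have KrK: "ennreal (Kr t x y) = K t x y" for t x y using Kfin by (simp add: Kr_def)
 have Kr: "duhamel_kernel W Kr"
  unfolding duhamel_kernel_def
 proof (intro conjI allI impI)
  fix t x y assume "t \<le> (0::real)"
  then show "Kr t x y = 0" using Kle[of t x y] by (simp add: Kr_def hk_def)
 next
  fix y
  have "(\<lambda>p. Kr (fst p) (snd p) y) \<in> borel_measurable (borel \<Otimes>\<^sub>M borel)" unfolding Kr_def by measurable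
  then show "(\<lambda>p. Kr (fst p) (snd p) y) \<in> borel_measurable borel" by (simp add: borel_prod)
 next
  fix t x y assume t: "0 < (t::real)"
  show "0 \<le> Kr t x y" by (simp add: Kr_def)
  show "Kr t x y \<le> heat t (x - y)"
   using Kle[of t x y] t KrK[of t x y] by (simp add: hk_def) (metis ennreal_le_iff heat_nonneg)
  have e: "ennreal (?I Kr t x y) = ck hk ?w K t x y"
   "0 \<le> ?I Kr t x y"
   using duhamel_real[OF n W Wm, of "\<lambda>s z. Kr s z y" y t x] fmeas_slice[OF Km, of y] Kle
   by (simp_all add: KrK ck_def) (simp_all add: Kr_def)
  have "ennreal (Kr t x y + ?I Kr t x y) = ennreal (heat t (x - y))"
  proof -
   have "0 \<le> Kr t x y" by (simp add: Kr_def)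
   then show ?thesis using Keq[of t x y] t by (subst ennreal_plus[OF _ e(2)]) (simp_all only: KrK e(1) hk_def if_True)
  qed
  then have "Kr t x y + ?I Kr t x y = heat t (x - y)"
   using e(2) by (subst (asm) ennreal_inj) (auto simp: Kr_def)
  then show "Kr t x y = heat t (x - y) - ?I Kr t x y"
   by simp
 qed
 have uniq: "K' = Kr" if K': "duhamel_kernel W K'" for K'
 proof (intro ext)
  fix t x y
  have K'0: "K' t x y = 0" if "t \<le> 0" for t x y using K' that unfolding duhamel_kernel_def by auto
  have pos: "0 \<le> K' t x y" "K' t x y \<le> heat t (x - y)"
   "K' t x y = heat t (x - y) - ?I K' t x y"
   if "t > 0" for t x y
   using K' that unfolding duhamel_kernel_def by blast+
  have K'nn: "0 \<le> K' t x y" for t x y using pos(1)[of t x y] K'0[of t x y] by (cases "t > 0") auto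
  have K'le: "ennreal (K' t x y) \<le> hk t x y" for t x y
   using pos(2)[of t x y] K'0[of t x y] by (cases "t > 0") (auto simp: hk_def intro: ennreal_leI)
  have m: "(\<lambda>p. K' (fst p) (snd p) y) \<in> borel_measurable borel" for y
   using K' unfolding duhamel_kernel_def by blast
  have fm: "fmeas (\<lambda>t x. ennreal (K' t x y))" for y
  proof (rule fmeasI)
   have "(\<lambda>p. ennreal (K' (fst p) (snd p) y)) \<in> borel_measurable borel" using m[of y] by measurable
   then show "(\<lambda>p. ennreal (K' (fst p) (snd p) y)) \<in> borel_measurable (borel \<Otimes>\<^sub>M borel)" by (simp add: borel_prod)
  qed
  have "ennreal (K' t x y) = K t x y"
  proof (rule is_bk_unique[OF n w _ bk fm K'le])
   fix t x
   have e: "ennreal (?I K' t x y) = cv hk ?w (\<lambda>s z. ennreal (K' s z y)) t x"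
    "0 \<le> ?I K' t x y"
    using duhamel_real[OF n W Wm fm K'nn K'le] by auto
   show "ennreal (K' t x y) + cv hk ?w (\<lambda>t x. ennreal (K' t x y)) t x = hk t x y"
   proof (cases "t > 0")
    case True
    then have "K' t x y + ?I K' t x y = heat t (x - y)"
     using pos(3)[OF True, of x y] by linarith
    then have "ennreal (heat t (x - y)) = ennreal (K' t x y + ?I K' t x y)"
     by (simp only:)
    also have "\<dots> = ennreal (K' t x y) + cv hk ?w (\<lambda>s z. ennreal (K' s z y)) t x"
     by (simp only: ennreal_plus[OF K'nn e(2)] e(1))
    finally show ?thesis using True by (simp add: hk_def)
   next
    case False
    have "hk (t - s) x z * (?w z * ennreal (K' s z y)) = 0" for s z
     using False K'0[of s z y] by (cases "s > 0") (auto simp: hk_def)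
    then have "cv hk ?w (\<lambda>t x. ennreal (K' t x y)) t x = 0" unfolding cv_def by (simp only:) simp
    then show ?thesis using False K'0[of t x y] by (simp add: hk_def)
   qed
  qed measurable
  then show "K' t x y = Kr t x y" using K'nn[of t x y] by (metis Kr_def enn2real_ennreal)
 qed
 have "bdd_schr_kernel W = Kr"
  unfolding bdd_schr_kernel_def using Kr uniq by (rule the_equality)
 then show "ennreal (bdd_schr_kernel W t x y) = bker n ?w t x y" "0 \<le> bdd_schr_kernel W t x y"
  using KrK[of t x y] by (simp_all add: K_def) (simp add: Kr_def)
qed

section \<open>The Schroedinger kernel and the perturbation kernels\<close>

text \<open>\<open>V_bound\<close> is the hypothesis on the Newton potential in the form in which it
  is used: the heat flow of V, integrated over all times, is bounded at every point.\<close>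

locale schr =
 fixes V :: "'a::euclidean_space \<Rightarrow> real" and M :: real
 assumes dim: "DIM('a) \<ge> 3"
  and V_nonneg: "\<And>x. 0 \<le> V x"
  and V_meas [measurable]: "V \<in> borel_measurable borel"
  and M_nonneg: "0 \<le> M"
  and V_bound: "\<And>y. (NN t. NN z. ennreal (V z) * hk t z y) \<le> ennreal M"
begin

abbreviation v :: "'a \<Rightarrow> ennreal" where "v z \<equiv> ennreal (V z)"

definition K :: "'a kernel" where "K t x y = ennreal (schr_kernel V t x y)"

definition Kn :: "nat \<Rightarrow> 'a kernel" where
 "Kn k t x y = ennreal (bdd_schr_kernel (\<lambda>z. min (V z) (real k)) t x y)"

definition vn :: "nat \<Rightarrow> 'a \<Rightarrow> ennreal" where "vn k z = ennreal (min (V z) (real k))"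

lemma vn_measurable [measurable]: "vn k \<in> borel_measurable borel"
 unfolding vn_def by measurable

text \<open>The bound n is kept independent of the truncation level k, so that two consecutive
  truncations can be built with the same n and compared by \<open>bker_antimono\<close>.\<close>

lemma Kn_eq:
 assumes "real k \<le> n" "n > 0"
 shows "Kn k t x y = bker n (vn k) t x y" "0 \<le> bdd_schr_kernel (\<lambda>z. min (V z) (real k)) t x y"
proof -
 have W: "\<And>z. 0 \<le> min (V z) (real k)" "\<And>z. min (V z) (real k) \<le> n"
  using V_nonneg assms(1) by (auto simp: min_def)
 have m: "(\<lambda>z. min (V z) (real k)) \<in> borel_measurable borel" by measurable
 show "Kn k t x y = bker n (vn k) t x y" "0 \<le> bdd_schr_kernel (\<lambda>z. min (V z) (real k)) t x y"
  using bdd_schr_kernel_eq[OF assms(2) W m, of t x y] by (simp_all add: Kn_def vn_def[abs_def])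
qed

lemma vn_le: "vn k z \<le> ennreal (real (Suc k))"
 unfolding vn_def by (intro ennreal_leI) auto

lemma is_bk_Kn: "is_bk (vn k) (Kn k)"
proof -
 have "Kn k = bker (real (Suc k)) (vn k)" by (intro ext Kn_eq(1)) auto
 then show ?thesis using is_bk_bker[of "real (Suc k)" "vn k"] vn_le by simp
qed

lemma decseq_Kn: "decseq (\<lambda>k. Kn k t x y)"
proof (rule decseq_SucI)
 fix k
 have "Kn (Suc k) t x y = bker (real (Suc k)) (vn (Suc k)) t x y" by (intro Kn_eq(1)) auto
 also have "\<dots> \<le> bker (real (Suc k)) (vn k) t x y"
  by (intro bker_antimono) (auto simp: vn_def intro!: ennreal_leI)
 also have "\<dots> = Kn k t x y" by (intro Kn_eq(1)[symmetric]) auto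
 finally show "Kn (Suc k) t x y \<le> Kn k t x y" .
qed

lemma K_lim: "(\<lambda>k. Kn k t x y) \<longlonglongrightarrow> K t x y" and schr_kernel_nonneg: "0 \<le> schr_kernel V t x y"
proof -
 let ?b = "\<lambda>k. bdd_schr_kernel (\<lambda>z. min (V z) (real k)) t x y"
 have nn: "0 \<le> ?b k" for k using Kn_eq(2)[of k "real (Suc k)" t x y] by simp
 have "decseq ?b"
  using decseq_Kn[of t x y] nn unfolding decseq_def Kn_def by (auto simp: ennreal_le_iff)
 then obtain L where L: "?b \<longlonglongrightarrow> L" "\<And>k. L \<le> ?b k"
  using decseq_convergent[of ?b 0] nn by blast
 then have eq: "schr_kernel V t x y = L" unfolding schr_kernel_def by (intro limI)
 show "(\<lambda>k. Kn k t x y) \<longlonglongrightarrow> K t x y"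
  unfolding Kn_def K_def eq by (intro tendsto_ennrealI L)
 show "0 \<le> schr_kernel V t x y" unfolding eq using nn by (intro LIMSEQ_le_const[OF L(1)]) auto
qed

lemma Kn_le: "Kn k t x y \<le> hk t x y" and kmeas_Kn: "kmeas (Kn k)"
 and Kn_left: "Kn k t x y + ck hk (vn k) (Kn k) t x y = hk t x y"
 using is_bk_Kn[of k] by (auto simp: is_bk_def)

lemma K_le: "K t x y \<le> hk t x y"
 by (rule LIMSEQ_le_const2[OF K_lim]) (auto simp: Kn_le)

lemma K_nonpos: "t \<le> 0 \<Longrightarrow> K t x y = 0"
 using K_le[of t x y] by (simp add: hk_def)

lemma K_finite: "K t x y < top" "K t x y \<noteq> top"
 by (simp_all add: K_def)

lemma kmeas_K: "kmeas K"
proof (rule kmeasI)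
 note [measurable] = kmeasD[OF kmeas_Kn]
 have "K t x y = (INF k. Kn k t x y)" for t x y
  using LIMSEQ_unique[OF K_lim LIMSEQ_INF[OF decseq_Kn]] .
 then show "(\<lambda>w. K (fst w) (fst (snd w)) (snd (snd w))) \<in> borel_measurable (borel \<Otimes>\<^sub>M borel \<Otimes>\<^sub>M borel)"
  by (simp only:) measurable
qed

lemma hk_sup:
 assumes t: "t > 0"
 obtains C where "C \<ge> 0" "\<And>\<tau> x y::'a. t \<le> \<tau> \<Longrightarrow> hk \<tau> x y \<le> ennreal C"
proof
 show "(4 * pi * t) powr (- real DIM('a) / 2) \<ge> 0" by simp
 fix \<tau> and x y :: 'a assume \<tau>: "t \<le> \<tau>"
 have "heat \<tau> (x - y) \<le> (4 * pi * \<tau>) powr (- real DIM('a) / 2) * 1"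
  unfolding heat_def using \<tau> t by (intro mult_left_mono) auto
 also have "\<dots> \<le> (4 * pi * t) powr (- real DIM('a) / 2)"
  using \<tau> t by (simp, intro powr_mono2') auto
 finally show "hk \<tau> x y \<le> ennreal ((4 * pi * t) powr (- real DIM('a) / 2))"
  using \<tau> t by (auto simp: hk_def intro: ennreal_leI)
qed

lemma V_bound': "(NN t. NN z. hk t x z * v z) \<le> ennreal M"
 using V_bound[of x] by (simp add: hk_commute[of _ x] mult.commute)

text \<open>For s \<ge> t/2 the right factor is bounded, otherwise the left one; the other factor
  together with V integrates to at most M. This finite integral is the dominating function for the
  limit in the truncation.\<close>

lemma ck_hk_finite: "ck hk v hk t x y < top"
proof (cases "t > 0")
 case False
 have "hk (t - s) x z * (v z * hk s z y) = 0" for s z using False by (auto simp: hk_def)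
 then have "ck hk v hk t x y = 0" unfolding ck_def cv_def by (simp only:) simp
 then show ?thesis by simp
next
 case True
 then obtain C where C: "C \<ge> 0" "\<And>\<tau> x y::'a. t / 2 \<le> \<tau> \<Longrightarrow> hk \<tau> x y \<le> ennreal C"
  using hk_sup[of "t/2"] by auto
 have "ck hk v hk t x y \<le> (NN s. NN z. ennreal C * (hk (t - s) x z * v z) + ennreal C * (v z * hk s z y))"
  unfolding ck_def cv_def
 proof (intro nn_integral_mono)
  fix s z
  show "hk (t - s) x z * (v z * hk s z y) \<le> ennreal C * (hk (t - s) x z * v z) + ennreal C * (v z * hk s z y)"
  proof (cases "s \<ge> t / 2")
   case True
   have "hk (t - s) x z * (v z * hk s z y) \<le> hk (t - s) x z * (v z * ennreal C)"
    using C(2)[OF True, of z y] by (intro mult_left_mono) auto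
   then show ?thesis by (intro add_increasing2) (simp_all add: mult_ac)
  next
   case False
   have "hk (t - s) x z * (v z * hk s z y) \<le> ennreal C * (v z * hk s z y)"
    using C(2)[of "t - s" x z] False by (intro mult_right_mono) auto
   then show ?thesis by (intro add_increasing) simp_all
  qed
 qed
 also have "\<dots> = ennreal C * (NN s. NN z. hk (t - s) x z * v z) + ennreal C * (NN s. NN z. v z * hk s z y)"
  by (simp add: nn_integral_add nn_integral_cmult)
 also have "(NN s. NN z. hk (t - s) x z * v z) = (NN s. NN z. hk s x z * v z)"
  by (rule nn_integral_reflect[where f = "\<lambda>s. (NN z. hk s x z * v z)"]) measurable
 also have "ennreal C * (NN s. NN z. hk s x z * v z) + ennreal C * (NN s. NN z. v z * hk s z y)
   \<le> ennreal C * ennreal M + ennreal C * ennreal M"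
  by (intro add_mono mult_left_mono V_bound V_bound') auto
 also have "\<dots> < top" by (simp add: ennreal_mult_less_top)
 finally show ?thesis .
qed

lemma vn_lim: "(\<lambda>k. vn k z) \<longlonglongrightarrow> v z"
proof -
 obtain N where N: "V z \<le> real N" using real_arch_simple by blast
 have "vn k z = v z" if "k \<ge> N" for k
 proof -
  have "V z \<le> real k" using N that by (meson of_nat_le_iff order_trans)
  then show ?thesis by (simp add: vn_def)
 qed
 then have "eventually (\<lambda>k. vn k z = v z) sequentially" unfolding eventually_sequentially by blast
 then show ?thesis by (rule tendsto_eventually)
qed

lemma ck_pair:
 assumes A: "kmeas A" and B: "kmeas B" and [measurable]: "w \<in> borel_measurable borel"
 shows "ck A w B t x y = (\<integral>\<^sup>+p. A (t - fst p) x (snd p) * (w (snd p) * B (fst p) (snd p) y) \<partial>(lborel \<Otimes>\<^sub>M lborel))"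
proof -
 note [measurable] = kmeasD[OF A] kmeasD[OF B]
 show ?thesis unfolding ck_def cv_def
  by (subst lborel.nn_integral_fst[symmetric]) auto
qed

lemma ck_tendsto:
 assumes A: "\<And>k. kmeas (A k)" "\<And>k t x y. A k t x y \<le> hk t x y" "\<And>t x y. (\<lambda>k. A k t x y) \<longlonglongrightarrow> A' t x y" "kmeas A'"
  and B: "\<And>k. kmeas (B k)" "\<And>k t x y. B k t x y \<le> hk t x y" "\<And>t x y. (\<lambda>k. B k t x y) \<longlonglongrightarrow> B' t x y" "kmeas B'"
 shows "(\<lambda>k. ck (A k) (vn k) (B k) t x y) \<longlonglongrightarrow> ck A' v B' t x y"
proof -
 note [measurable] = kmeasD[OF A(1)] kmeasD[OF B(1)] kmeasD[OF A(4)] kmeasD[OF B(4)]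
 have vm: "v \<in> borel_measurable borel" by measurable
 have A'le: "A' t x y \<le> hk t x y" for t x y by (rule LIMSEQ_le_const2[OF A(3)]) (auto simp: A)
 have B'le: "B' t x y \<le> hk t x y" for t x y by (rule LIMSEQ_le_const2[OF B(3)]) (auto simp: B)
 have A'fin: "A' t x y \<noteq> top" for t x y using A'le[of t x y] hk_finite[of t x y] by (metis neq_top_trans)
 have B'fin: "B' t x y \<noteq> top" for t x y using B'le[of t x y] hk_finite[of t x y] by (metis neq_top_trans)
 show ?thesis
  unfolding ck_pair[OF A(1) B(1) vn_measurable] ck_pair[OF A(4) B(4) vm]
 proof (rule nn_integral_dominated_convergence[where w = "\<lambda>p. hk (t - fst p) x (snd p) * (v (snd p) * hk (fst p) (snd p) y)"])
  show "(\<integral>\<^sup>+p. hk (t - fst p) x (snd p) * (v (snd p) * hk (fst p) (snd p) y) \<partial>(lborel \<Otimes>\<^sub>M lborel)) < \<infinity>"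
   using ck_hk_finite[of t x y] unfolding ck_pair[OF kmeas_hk kmeas_hk vm] by simp
  show "AE p in lborel \<Otimes>\<^sub>M lborel. A k (t - fst p) x (snd p) * (vn k (snd p) * B k (fst p) (snd p) y) \<le> hk (t - fst p) x (snd p) * (v (snd p) * hk (fst p) (snd p) y)" for k
   by (intro AE_I2 mult_mono A B) (auto simp: vn_def intro: ennreal_leI)
  show "AE p in lborel \<Otimes>\<^sub>M lborel. (\<lambda>k. A k (t - fst p) x (snd p) * (vn k (snd p) * B k (fst p) (snd p) y)) \<longlonglongrightarrow> A' (t - fst p) x (snd p) * (v (snd p) * B' (fst p) (snd p) y)"
   by (intro AE_I2 tendsto_mult_ennreal A B vn_lim) (auto simp: A'fin B'fin ennreal_mult_eq_top_iff)
 qed measurable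
qed

lemma K_left: "K t x y + ck hk v K t x y = hk t x y"
proof -
 have "(\<lambda>k. Kn k t x y + ck hk (vn k) (Kn k) t x y) \<longlonglongrightarrow> K t x y + ck hk v K t x y"
  by (intro tendsto_add K_lim ck_tendsto kmeas_hk kmeas_Kn kmeas_K Kn_le) auto
 then show ?thesis unfolding Kn_left by (simp add: LIMSEQ_const_iff)
qed

lemma K_right: "K t x y + ck K v hk t x y = hk t x y"
proof -
 have r: "Kn k t x y + ck (Kn k) (vn k) hk t x y = hk t x y" for k
  by (rule is_bk_right[OF _ vn_le _ is_bk_Kn]) auto
 have "(\<lambda>k. Kn k t x y + ck (Kn k) (vn k) hk t x y) \<longlonglongrightarrow> K t x y + ck K v hk t x y"
  by (intro tendsto_add K_lim ck_tendsto kmeas_hk kmeas_Kn kmeas_K Kn_le) auto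
 then show ?thesis unfolding r by (simp add: LIMSEQ_const_iff)
qed

lemma K_semigroup:
 assumes t: "t > 0" and s: "s > 0"
 shows "(NN z. K t x z * K s z y) = K (t + s) x y"
proof -
 note [measurable] = kmeasD[OF kmeas_K] kmeasD[OF kmeas_Kn]
 have r: "(NN z. Kn k t x z * Kn k s z y) = Kn k (t + s) x y" for k
  by (rule is_bk_semigroup[OF _ vn_le _ is_bk_Kn t s]) auto
 have "(\<lambda>k. NN z. Kn k t x z * Kn k s z y) \<longlonglongrightarrow> (NN z. K t x z * K s z y)"
 proof (rule nn_integral_dominated_convergence[where w = "\<lambda>z. hk t x z * hk s z y"])
  show "(NN z. hk t x z * hk s z y) < \<infinity>" unfolding hk_semigroup[OF t s] by simp
  show "AE z in lborel. Kn k t x z * Kn k s z y \<le> hk t x z * hk s z y" for k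
   by (intro AE_I2 mult_mono Kn_le) auto
  show "AE z in lborel. (\<lambda>k. Kn k t x z * Kn k s z y) \<longlonglongrightarrow> K t x z * K s z y"
   by (intro AE_I2 tendsto_mult_ennreal K_lim) (auto simp: K_finite)
 qed measurable
 then show ?thesis unfolding r using K_lim[of "t + s" x y] LIMSEQ_unique by blast
qed

section \<open>The perturbation kernels and their algebra\<close>

definition sw :: "'a kernel \<Rightarrow> 'a kernel \<Rightarrow> real \<Rightarrow> real \<Rightarrow> 'a \<Rightarrow> 'a \<Rightarrow> ennreal" where
 "sw A B s u x y = (NN z. A s x z * (v z * B u z y))"

text \<open>The triple product A_a V B_b V C_c. Keeping the three times separate reduces every
  identity between the operators to an identity between scalar weights.\<close>

definition RR :: "'a kernel \<Rightarrow> 'a kernel \<Rightarrow> 'a kernel \<Rightarrow> real \<Rightarrow> real \<Rightarrow> real \<Rightarrow> 'a \<Rightarrow> 'a \<Rightarrow> ennreal" where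
 "RR A B C a b c x y = (NN z. A a x z * (v z * sw B C b c z y))"

definition TT :: "'a kernel \<Rightarrow> 'a kernel \<Rightarrow> 'a \<Rightarrow> 'a \<Rightarrow> ennreal" where
 "TT A B x y = (NN s. NN u. ennreal (kw s u) * sw A B s u x y)"

lemma sw_measurable:
 assumes A: "kmeas A" and B: "kmeas B"
  and [measurable]: "f \<in> borel_measurable N" "g \<in> borel_measurable N" "h \<in> borel_measurable N" "k \<in> borel_measurable N"
 shows "(\<lambda>w. sw A B (f w) (g w) (h w) (k w)) \<in> borel_measurable N"
proof -
 note [measurable] = kmeasD[OF A] kmeasD[OF B]
 show ?thesis unfolding sw_def by measurable
qed

lemma RR_measurable:
 assumes A: "kmeas A" and B: "kmeas B" and C: "kmeas C"
  and [measurable]: "f \<in> borel_measurable N" "g \<in> borel_measurable N" "l \<in> borel_measurable N" "h \<in> borel_measurable N" "k \<in> borel_measurable N"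
 shows "(\<lambda>w. RR A B C (f w) (g w) (l w) (h w) (k w)) \<in> borel_measurable N"
proof -
 note [measurable] = kmeasD[OF A] sw_measurable[OF B C]
 show ?thesis unfolding RR_def by measurable
qed

lemma TT_measurable:
 assumes A: "kmeas A" and B: "kmeas B"
  and [measurable]: "h \<in> borel_measurable N" "k \<in> borel_measurable N"
 shows "(\<lambda>w. TT A B (h w) (k w)) \<in> borel_measurable N"
proof -
 note [measurable] = sw_measurable[OF A B]
 show ?thesis unfolding TT_def by measurable
qed

lemma sw_mono: "(\<And>x z. A s x z \<le> A' s x z) \<Longrightarrow> (\<And>z y. B u z y \<le> B' u z y) \<Longrightarrow> sw A B s u x y \<le> sw A' B' s u x y"
 unfolding sw_def by (intro nn_integral_mono mult_mono) auto

lemma TT_mono: "(\<And>t x z. A t x z \<le> A' t x z) \<Longrightarrow> (\<And>t z y. B t z y \<le> B' t z y) \<Longrightarrow> TT A B x y \<le> TT A' B' x y"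
 unfolding TT_def by (intro nn_integral_mono mult_left_mono sw_mono) auto

lemma TT_column_hk: "(NN x. TT hk hk x y) \<le> ennreal M"
proof -
 have "(NN x. TT hk hk x y) = (NN x. NN s. NN u. NN z. ennreal (kw s u) * (hk s x z * (v z * hk u z y)))"
  unfolding TT_def sw_def by (simp add: nn_integral_cmult)
 also have "\<dots> = (NN s. NN x. NN u. NN z. ennreal (kw s u) * (hk s x z * (v z * hk u z y)))"
  by (rule nn_integral_swap) measurable
 also have "\<dots> = (NN s. NN u. NN x. NN z. ennreal (kw s u) * (hk s x z * (v z * hk u z y)))"
  by (rule nn_integral_cong) (rule nn_integral_swap, measurable)
 also have "\<dots> = (NN u. NN s. NN x. NN z. ennreal (kw s u) * (hk s x z * (v z * hk u z y)))"
  by (rule nn_integral_swap) measurable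
 also have "\<dots> \<le> (NN u. NN z. v z * hk u z y)"
 proof (rule nn_integral_mono)
  fix u :: real
  have "(NN x. NN z. ennreal (kw s u) * (hk s x z * (v z * hk u z y))) = ennreal (kw s u) * (NN z. v z * hk u z y)" for s
  proof -
   have "(NN x. NN z. ennreal (kw s u) * (hk s x z * (v z * hk u z y)))
     = (NN z. NN x. ennreal (kw s u) * (hk s x z * (v z * hk u z y)))"
    by (rule nn_integral_swap) measurable
   also have "\<dots> = (NN z. ennreal (kw s u) * (v z * hk u z y))"
   proof (rule nn_integral_cong)
    fix z
    have "(NN x. ennreal (kw s u) * (hk s x z * (v z * hk u z y))) = ennreal (kw s u) * ((NN x. hk s x z) * (v z * hk u z y))"
     by (simp add: nn_integral_cmult nn_integral_multc)
    then show "(NN x. ennreal (kw s u) * (hk s x z * (v z * hk u z y))) = ennreal (kw s u) * (v z * hk u z y)"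
     using nn_integral_hk(1)[of s z] by (cases "s > 0") (simp_all add: kw_def)
   qed
   also have "\<dots> = ennreal (kw s u) * (NN z. v z * hk u z y)"
    by (intro nn_integral_cmult) measurable
   finally show ?thesis .
  qed
  then have "(NN s. NN x. NN z. ennreal (kw s u) * (hk s x z * (v z * hk u z y)))
    = (NN s. ennreal (kw s u)) * (NN z. v z * hk u z y)"
   by (simp add: nn_integral_multc)
  also have "\<dots> \<le> (NN z. v z * hk u z y)"
   using kw_integral[of u] by (cases "u > 0") (simp_all add: kw_def)
  finally show "(NN s. NN x. NN z. ennreal (kw s u) * (hk s x z * (v z * hk u z y))) \<le> (NN z. v z * hk u z y)" .
 qed
 also have "\<dots> \<le> ennreal M" by (rule V_bound)
 finally show ?thesis .
qed

lemma TT_column: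
 assumes "\<And>t x z. A t x z \<le> hk t x z" "\<And>t z y. B t z y \<le> hk t z y"
 shows "(NN x. TT A B x y) \<le> ennreal M"
 by (rule order_trans[OF nn_integral_mono[OF TT_mono] TT_column_hk]) (rule assms)+

lemma sw_add_left:
 assumes A: "kmeas A" and A': "kmeas A'" and B: "kmeas B"
 shows "sw (\<lambda>t x y. A t x y + A' t x y) B s u x y = sw A B s u x y + sw A' B s u x y"
proof -
 note [measurable] = kmeasD[OF A] kmeasD[OF B] kmeasD[OF A']
 show ?thesis unfolding sw_def distrib_right by (rule nn_integral_add) measurable
qed

lemma sw_add_right:
 assumes A: "kmeas A" and B': "kmeas B'" and B: "kmeas B"
 shows "sw A (\<lambda>t x y. B t x y + B' t x y) s u x y = sw A B s u x y + sw A B' s u x y"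
proof -
 note [measurable] = kmeasD[OF A] kmeasD[OF B] kmeasD[OF B']
 show ?thesis unfolding sw_def distrib_left by (rule nn_integral_add) measurable
qed

lemma sw_ck_left:
 assumes C: "kmeas C" and D: "kmeas D" and B: "kmeas B"
 shows "sw (ck C v D) B s u x y = (NN b. RR C D B (s - b) b u x y)"
proof -
 note [measurable] = kmeasD[OF B]
 have "sw (ck C v D) B s u x y = cv C v (\<lambda>r z. NN z'. D r z z' * (v z' * B u z' y)) s x"
  unfolding sw_def by (rule cv_kprod[OF C D, symmetric]) measurable
 then show ?thesis by (simp add: cv_def RR_def sw_def)
qed

lemma sw_ck_right:
 assumes A: "kmeas A" and C: "kmeas C" and D: "kmeas D"
 shows "sw A (ck C v D) s u x y = (NN c. RR A C D s (u - c) c x y)"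
proof -
 note [measurable] = kmeasD[OF A] kmeasD[OF C] kmeasD[OF D]
 have "sw A (ck C v D) s u x y = (NN z. NN c. A s x z * (v z * sw C D (u - c) c z y))"
  unfolding sw_def ck_def cv_def by (simp add: nn_integral_cmult)
 also have "\<dots> = (NN c. NN z. A s x z * (v z * sw C D (u - c) c z y))"
  unfolding sw_def by (rule nn_integral_swap) measurable
 finally show ?thesis by (simp add: RR_def)
qed

text \<open>Replacing a left factor by its Duhamel expansion splits its time as s = a + b, so the
  triple product appears with the weight kw(a + b, c).\<close>

lemma expand_left:
 assumes A: "kmeas A" and C: "kmeas C" and D: "kmeas D" and B: "kmeas B"
  and eq: "\<And>t x y. A t x y + ck C v D t x y = A' t x y"
 shows "TT A' B x y = TT A B x y + (NN a. NN b. NN c. ennreal (kw (a + b) c) * RR C D B a b c x y)"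
proof -
 have ckm: "kmeas (ck C v D)" by (intro kmeas_ck C D) measurable
 note [measurable] = sw_measurable[OF A B] sw_measurable[OF ckm B] RR_measurable[OF C D B]
 have A': "A' = (\<lambda>t x y. A t x y + ck C v D t x y)" by (intro ext eq[symmetric])
 have "TT A' B x y = TT A B x y + (NN s. NN u. ennreal (kw s u) * sw (ck C v D) B s u x y)"
  unfolding TT_def A' sw_add_left[OF A ckm B] by (simp add: distrib_left nn_integral_add)
 also have "(NN s. NN u. ennreal (kw s u) * sw (ck C v D) B s u x y)
   = (NN s. NN u. NN b. ennreal (kw s u) * RR C D B (s - b) b u x y)"
  unfolding sw_ck_left[OF C D B] by (simp add: nn_integral_cmult)
 also have "\<dots> = (NN s. NN b. NN u. ennreal (kw s u) * RR C D B (s - b) b u x y)"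
  by (rule nn_integral_cong) (rule nn_integral_swap, measurable)
 also have "\<dots> = (NN b. NN s. NN u. ennreal (kw s u) * RR C D B (s - b) b u x y)"
  by (rule nn_integral_swap) measurable
 also have "\<dots> = (NN b. NN a. NN u. ennreal (kw (a + b) u) * RR C D B a b u x y)"
 proof (rule nn_integral_cong)
  fix b :: real
  have "(NN a. (\<lambda>s. NN u. ennreal (kw s u) * RR C D B (s - b) b u x y) (a + b))
    = (NN s. NN u. ennreal (kw s u) * RR C D B (s - b) b u x y)"
   by (rule nn_integral_shift(2)) measurable
  then show "(NN s. NN u. ennreal (kw s u) * RR C D B (s - b) b u x y)
    = (NN a. NN u. ennreal (kw (a + b) u) * RR C D B a b u x y)"
   by simp
 qed
 also have "\<dots> = (NN a. NN b. NN c. ennreal (kw (a + b) c) * RR C D B a b c x y)"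
  by (rule nn_integral_swap) measurable
 finally show ?thesis .
qed

text \<open>On the right the time splits as u = b + c and the weight becomes kw(a, b + c).
  \<open>kw_conv\<close> evaluates exactly the discrepancy with the weight in
  \<open>expand_left\<close>.\<close>

lemma expand_right:
 assumes A: "kmeas A" and C: "kmeas C" and D: "kmeas D" and B: "kmeas B"
  and eq: "\<And>t x y. B t x y + ck C v D t x y = B' t x y"
 shows "TT A B' x y = TT A B x y + (NN a. NN b. NN c. ennreal (kw a (b + c)) * RR A C D a b c x y)"
proof -
 have ckm: "kmeas (ck C v D)" by (intro kmeas_ck C D) measurable
 note [measurable] = sw_measurable[OF A B] sw_measurable[OF A ckm] RR_measurable[OF A C D]
 have B': "B' = (\<lambda>t x y. B t x y + ck C v D t x y)" by (intro ext eq[symmetric])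
 have "TT A B' x y = TT A B x y + (NN s. NN u. ennreal (kw s u) * sw A (ck C v D) s u x y)"
  unfolding TT_def B' sw_add_right[OF A ckm B] by (simp add: distrib_left nn_integral_add)
 also have "(NN s. NN u. ennreal (kw s u) * sw A (ck C v D) s u x y)
   = (NN s. NN u. NN c. ennreal (kw s u) * RR A C D s (u - c) c x y)"
  unfolding sw_ck_right[OF A C D] by (simp add: nn_integral_cmult)
 also have "\<dots> = (NN s. NN b. NN c. ennreal (kw s (b + c)) * RR A C D s b c x y)"
 proof (rule nn_integral_cong)
  fix s :: real
  have "(NN u. NN c. ennreal (kw s u) * RR A C D s (u - c) c x y)
    = (NN c. NN u. ennreal (kw s u) * RR A C D s (u - c) c x y)"
   by (rule nn_integral_swap) measurable
  also have "\<dots> = (NN c. NN b. ennreal (kw s (b + c)) * RR A C D s b c x y)"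
  proof (rule nn_integral_cong)
   fix c :: real
   have "(NN b. (\<lambda>u. ennreal (kw s u) * RR A C D s (u - c) c x y) (b + c))
     = (NN u. ennreal (kw s u) * RR A C D s (u - c) c x y)"
    by (rule nn_integral_shift(2)) measurable
   then show "(NN u. ennreal (kw s u) * RR A C D s (u - c) c x y)
     = (NN b. ennreal (kw s (b + c)) * RR A C D s b c x y)"
    by simp
  qed
  also have "\<dots> = (NN b. NN c. ennreal (kw s (b + c)) * RR A C D s b c x y)"
   by (rule nn_integral_swap) measurable
  finally show "(NN u. NN c. ennreal (kw s u) * RR A C D s (u - c) c x y)
    = (NN b. NN c. ennreal (kw s (b + c)) * RR A C D s b c x y)" .
 qed
 finally show ?thesis .
qed

lemma sw_sw:
 assumes A: "kmeas A" and B: "kmeas B" and A': "kmeas A'" and B': "kmeas B'"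
  and semi: "\<And>z z'. (NN w. B u z w * A' s' w z') = C (u + s') z z'"
 shows "(NN w. sw A B s u x w * sw A' B' s' u' w y) = RR A C B' s (u + s') u' x y"
proof -
 note [measurable] = kmeasD[OF A] kmeasD[OF B] kmeasD[OF A'] kmeasD[OF B'] sw_measurable[OF A' B']
 have inner: "(NN w. B u z w * sw A' B' s' u' w y) = sw C B' (u + s') u' z y" for z
 proof -
  have "(NN w. B u z w * sw A' B' s' u' w y) = (NN w. NN z'. B u z w * (A' s' w z' * (v z' * B' u' z' y)))"
   unfolding sw_def by (simp add: nn_integral_cmult)
  also have "\<dots> = (NN z'. NN w. B u z w * (A' s' w z' * (v z' * B' u' z' y)))"
   by (rule nn_integral_swap) measurable
  also have "\<dots> = (NN z'. (NN w. B u z w * A' s' w z') * (v z' * B' u' z' y))"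
   by (simp add: nn_integral_multc[symmetric] mult.assoc)
  finally show ?thesis unfolding semi by (simp add: sw_def)
 qed
 have "(NN w. sw A B s u x w * sw A' B' s' u' w y) = (NN w. NN z. A s x z * (v z * (B u z w * sw A' B' s' u' w y)))"
  unfolding sw_def[of A B] by (simp add: nn_integral_multc[symmetric] mult.assoc)
 also have "\<dots> = (NN z. NN w. A s x z * (v z * (B u z w * sw A' B' s' u' w y)))"
  by (rule nn_integral_swap) measurable
 also have "\<dots> = (NN z. A s x z * (v z * (NN w. B u z w * sw A' B' s' u' w y)))"
  by (simp add: nn_integral_cmult)
 finally show ?thesis unfolding inner RR_def .
qed

text \<open>In the composition the adjacent kernels at times u and s' merge by the semigroup
  property into one at b = u + s'. The two weights then form the convolution that
  \<open>kw_conv\<close> evaluates.\<close>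

lemma TT_comp:
 assumes A: "kmeas A" and B: "kmeas B" and A': "kmeas A'" and B': "kmeas B'" and C: "kmeas C"
  and semi: "\<And>u s' z z'. 0 < u \<Longrightarrow> 0 < s' \<Longrightarrow> (NN w. B u z w * A' s' w z') = C (u + s') z z'"
 shows "kprod (TT A B) (TT A' B') x y = (NN a. NN b. NN c. (NN u. ennreal (kw a u) * ennreal (kw (b - u) c)) * RR A C B' a b c x y)"
proof -
 note [measurable] = sw_measurable[OF A B] sw_measurable[OF A' B'] TT_measurable[OF A' B'] RR_measurable[OF A C B']
 have "kprod (TT A B) (TT A' B') x y = (NN w. NN s. NN u. ennreal (kw s u) * (sw A B s u x w * TT A' B' w y))"
  unfolding kprod_def TT_def[of A B] by (simp add: nn_integral_multc[symmetric] mult.assoc)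
 also have "\<dots> = (NN s. NN w. NN u. ennreal (kw s u) * (sw A B s u x w * TT A' B' w y))"
  by (rule nn_integral_swap) measurable
 also have "\<dots> = (NN s. NN u. NN w. ennreal (kw s u) * (sw A B s u x w * TT A' B' w y))"
  by (rule nn_integral_cong) (rule nn_integral_swap, measurable)
 also have "\<dots> = (NN s. NN u. NN b. NN u'. ennreal (kw s u) * (ennreal (kw (b - u) u') * RR A C B' s b u' x y))"
 proof (intro nn_integral_cong)
  fix s u :: real
  show "(NN w. ennreal (kw s u) * (sw A B s u x w * TT A' B' w y))
   = (NN b. NN u'. ennreal (kw s u) * (ennreal (kw (b - u) u') * RR A C B' s b u' x y))"
  proof (cases "u > 0")
   case False then show ?thesis by (simp add: kw_def)
  next
   case u: True
   have "(NN w. sw A B s u x w * TT A' B' w y) = (NN w. NN s'. NN u'. ennreal (kw s' u') * (sw A B s u x w * sw A' B' s' u' w y))"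
    unfolding TT_def by (simp add: nn_integral_cmult[symmetric] mult.left_commute)
   also have "\<dots> = (NN s'. NN w. NN u'. ennreal (kw s' u') * (sw A B s u x w * sw A' B' s' u' w y))"
    by (rule nn_integral_swap) measurable
   also have "\<dots> = (NN s'. NN u'. NN w. ennreal (kw s' u') * (sw A B s u x w * sw A' B' s' u' w y))"
    by (rule nn_integral_cong) (rule nn_integral_swap, measurable)
   also have "\<dots> = (NN s'. NN u'. ennreal (kw s' u') * RR A C B' s (u + s') u' x y)"
   proof (intro nn_integral_cong)
    fix s' u' :: real
    show "(NN w. ennreal (kw s' u') * (sw A B s u x w * sw A' B' s' u' w y)) = ennreal (kw s' u') * RR A C B' s (u + s') u' x y"
    proof (cases "s' > 0")
     case False then show ?thesis by (simp add: kw_def)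
    next
     case True
     then show ?thesis
      using sw_sw[OF A B A' B', of u s' C s x u' y] semi[OF u True] by (simp add: nn_integral_cmult)
    qed
   qed
   also have "\<dots> = (NN b. NN u'. ennreal (kw (b - u) u') * RR A C B' s b u' x y)"
   proof -
    have "(NN s'. (\<lambda>b. NN u'. ennreal (kw (b - u) u') * RR A C B' s b u' x y) (s' + u))
     = (NN b. NN u'. ennreal (kw (b - u) u') * RR A C B' s b u' x y)"
     by (rule nn_integral_shift(2)) measurable
    then show ?thesis by (simp add: add.commute)
   qed
   finally show ?thesis by (simp add: nn_integral_cmult)
  qed
 qed
 also have "\<dots> = (NN s. NN b. NN u. NN u'. ennreal (kw s u) * (ennreal (kw (b - u) u') * RR A C B' s b u' x y))"
  by (rule nn_integral_cong) (rule nn_integral_swap, measurable)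
 also have "\<dots> = (NN s. NN b. NN u'. NN u. ennreal (kw s u) * (ennreal (kw (b - u) u') * RR A C B' s b u' x y))"
  by (rule nn_integral_cong, rule nn_integral_cong) (rule nn_integral_swap, measurable)
 also have "\<dots> = (NN a. NN b. NN c. (NN u. ennreal (kw a u) * ennreal (kw (b - u) c)) * RR A C B' a b c x y)"
  by (simp add: nn_integral_multc[symmetric] mult.assoc)
 finally show ?thesis .
qed

lemma RR_nonpos:
 assumes "\<And>t x z. A t x z \<le> hk t x z" "\<And>t x z. B t x z \<le> hk t x z" "\<And>t z y. C t z y \<le> hk t z y" "\<not> (0 < a \<and> 0 < b \<and> 0 < c)"
 shows "RR A B C a b c x y = 0"
proof -
 have z: "A t x z = 0" "B t x z = 0" "C t x z = 0" if "t \<le> 0" for t x z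
  using assms(1-3)[of t x z] that by (simp_all add: hk_def)
 consider "a \<le> 0" | "b \<le> 0" | "c \<le> 0" using assms(4) by linarith
 then show ?thesis
  by cases (simp_all add: RR_def sw_def z)
qed

lemma kw_conv_RR:
 assumes "\<And>t x z. A t x z \<le> hk t x z" "\<And>t x z. B t x z \<le> hk t x z" "\<And>t z y. C t z y \<le> hk t z y"
  and m: "kmeas A" "kmeas B" "kmeas C"
 shows "(NN a. NN b. NN c. ennreal (kw a (b + c)) * RR A B C a b c x y)
  = (NN a. NN b. NN c. ennreal (kw (a + b) c) * RR A B C a b c x y)
   + (NN a. NN b. NN c. (NN u. ennreal (kw a u) * ennreal (kw (b - u) c)) * RR A B C a b c x y)"
proof -
 note [measurable] = RR_measurable[OF m]
 have "ennreal (kw a (b + c)) * RR A B C a b c x y = ennreal (kw (a + b) c) * RR A B C a b c x y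
   + (NN u. ennreal (kw a u) * ennreal (kw (b - u) c)) * RR A B C a b c x y" for a b c
 proof (cases "0 < a \<and> 0 < b \<and> 0 < c")
  case True then show ?thesis using kw_conv[of a b c] by (simp flip: distrib_right)
 next
  case False then show ?thesis using RR_nonpos[OF assms(1-3) False] by simp
 qed
 then show ?thesis by (simp add: nn_integral_add)
qed

text \<open>Expanding P = K + P V K on the right and splitting the weight by \<open>kw_conv\<close>
  gives three terms. The first two recombine to T(P,K) by P = K + K V P, and the convolution of the
  weights is the product of the two operators. Nothing is subtracted, so the identity holds
  everywhere.\<close>

lemma TT_inverse1: "TT K hk x y = TT hk K x y + kprod (TT K hk) (TT hk K) x y"
proof -
 have "TT K hk x y = TT K K x y + (NN a. NN b. NN c. ennreal (kw a (b + c)) * RR K hk K a b c x y)"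
  by (intro expand_right kmeas_K kmeas_hk K_left)
 also have "\<dots> = TT K K x y + (NN a. NN b. NN c. ennreal (kw (a + b) c) * RR K hk K a b c x y)
   + (NN a. NN b. NN c. (NN u. ennreal (kw a u) * ennreal (kw (b - u) c)) * RR K hk K a b c x y)"
  by (subst kw_conv_RR[OF K_le order_refl K_le kmeas_K kmeas_hk kmeas_K]) (simp add: add.assoc)
 also have "TT K K x y + (NN a. NN b. NN c. ennreal (kw (a + b) c) * RR K hk K a b c x y) = TT hk K x y"
  by (intro expand_left[symmetric] kmeas_K kmeas_hk K_right)
 also have "(NN a. NN b. NN c. (NN u. ennreal (kw a u) * ennreal (kw (b - u) c)) * RR K hk K a b c x y)
   = kprod (TT K hk) (TT hk K) x y"
  by (intro TT_comp[symmetric] kmeas_K kmeas_hk hk_semigroup)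
 finally show ?thesis .
qed

text \<open>In the opposite order K is the middle factor of the triple product. T(P,P) is expanded
  once on each side, and the common triple integral is cancelled.\<close>

lemma TT_inverse2: "AE x in lborel. TT K hk x y = TT hk K x y + kprod (TT hk K) (TT K hk) x y"
proof -
 let ?Y = "\<lambda>x. (NN a. NN b. NN c. ennreal (kw (a + b) c) * RR hk K hk a b c x y)"
 have PP1: "TT hk hk x y = TT K hk x y + ?Y x" for x
  by (intro expand_left kmeas_K kmeas_hk K_left)
 have PP0: "TT hk hk x y = TT hk K x y + (NN a. NN b. NN c. ennreal (kw a (b + c)) * RR hk K hk a b c x y)" for x
  by (intro expand_right kmeas_K kmeas_hk K_right)
 have "TT hk hk x y = TT hk K x y + (?Y x
   + (NN a. NN b. NN c. (NN u. ennreal (kw a u) * ennreal (kw (b - u) c)) * RR hk K hk a b c x y))" for x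
  using PP0[of x] by (subst (asm) kw_conv_RR[OF order_refl K_le order_refl kmeas_hk kmeas_K kmeas_hk])
 moreover have "(NN a. NN b. NN c. (NN u. ennreal (kw a u) * ennreal (kw (b - u) c)) * RR hk K hk a b c x y)
   = kprod (TT hk K) (TT K hk) x y" for x
  by (intro TT_comp[symmetric] kmeas_K kmeas_hk K_semigroup)
 ultimately have PP2: "TT hk hk x y = TT hk K x y + (?Y x + kprod (TT hk K) (TT K hk) x y)" for x by simp
 \<comment> \<open>Finiteness, needed for the cancellation, follows from the bounded column integral
   and therefore holds only almost everywhere in x.\<close>
 have "AE x in lborel. TT hk hk x y \<noteq> top"
 proof (rule nn_integral_noteq_infinite[unfolded infinity_ennreal_def])
  show "(\<lambda>x. TT hk hk x y) \<in> borel_measurable lborel" by (intro TT_measurable kmeas_hk) auto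
  show "(NN x. TT hk hk x y) \<noteq> top"
   using TT_column_hk[of y] by (metis ennreal_less_top le_less_trans less_irrefl)
 qed
 then show ?thesis
 proof eventually_elim
  fix x assume fin: "TT hk hk x y \<noteq> top"
  then have "?Y x \<noteq> top" using PP1[of x] by auto
  moreover have "?Y x + TT K hk x y = ?Y x + (TT hk K x y + kprod (TT hk K) (TT K hk) x y)"
   using trans[OF PP1[of x, symmetric] PP2[of x]] by (simp only: add_ac)
  ultimately show "TT K hk x y = TT hk K x y + kprod (TT hk K) (TT K hk) x y"
   by (simp add: ennreal_add_left_cancel)
 qed
qed

end

section \<open>Operators on integrable functions and the maximal comparison\<close>

definition l1k :: "('a::euclidean_space \<Rightarrow> 'a \<Rightarrow> ennreal) \<Rightarrow> real \<Rightarrow> bool" where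
 "l1k T C \<longleftrightarrow> (\<lambda>(x, y). T x y) \<in> borel_measurable (borel \<Otimes>\<^sub>M borel) \<and> 0 \<le> C
   \<and> (\<forall>y. (NN x. T x y) \<le> ennreal C)"

text \<open>\<open>enn2real\<close> replaces the value \<infinity> by 0. In a column with finite
  integral this alters the kernel only on a null set.\<close>

definition opk :: "('a::euclidean_space \<Rightarrow> 'a \<Rightarrow> ennreal) \<Rightarrow> ('a \<Rightarrow> real) \<Rightarrow> 'a \<Rightarrow> real" where
 "opk T f x = (LINT y|lborel. enn2real (T x y) * f y)"

lemma l1k_measurable:
 fixes T :: "'a::euclidean_space \<Rightarrow> 'a \<Rightarrow> ennreal"
 assumes "l1k T C" and "f \<in> borel_measurable M" "g \<in> borel_measurable M"
 shows "(\<lambda>w. T (f w) (g w)) \<in> borel_measurable M"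
proof -
 have "(\<lambda>w. (f w, g w)) \<in> M \<rightarrow>\<^sub>M (borel \<Otimes>\<^sub>M borel)" using assms by measurable
 from measurable_compose[OF this, of "\<lambda>(x, y). T x y"] assms(1) show ?thesis by (simp add: l1k_def)
qed

lemma l1kI:
 fixes T :: "'a::euclidean_space \<Rightarrow> 'a \<Rightarrow> ennreal"
 assumes "(\<lambda>w. T (fst w) (snd w)) \<in> borel_measurable (borel \<Otimes>\<^sub>M borel)" "0 \<le> C" "\<And>y. (NN x. T x y) \<le> ennreal C"
 shows "l1k T C"
 using assms by (simp add: l1k_def case_prod_unfold)

lemma l1k_nonneg: "l1k T C \<Longrightarrow> 0 \<le> C" by (simp add: l1k_def)

lemma integral_norm_le_nn: "ennreal \<bar>LINT x|M. f x\<bar> \<le> (\<integral>\<^sup>+x. ennreal \<bar>f x\<bar> \<partial>M)" for f :: "'b \<Rightarrow> real"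
proof (cases "integrable M f")
 case True
 then show ?thesis using integral_norm_bound_ennreal[OF True] by simp
qed (simp add: not_integrable_integral_eq)

lemma integrable_nn:
 assumes "integrable M (f :: 'b \<Rightarrow> real)"
 shows "(\<integral>\<^sup>+x. ennreal \<bar>f x\<bar> \<partial>M) = ennreal (LINT x|M. \<bar>f x\<bar>)" "(\<integral>\<^sup>+x. ennreal \<bar>f x\<bar> \<partial>M) < top"
 using assms by (simp_all add: nn_integral_eq_integral)

lemma integrableI_nn:
 assumes "f \<in> borel_measurable M" "(\<integral>\<^sup>+x. ennreal \<bar>f x\<bar> \<partial>M) < top"
 shows "integrable M (f :: 'b \<Rightarrow> real)"
 using assms by (intro integrableI_bounded) auto

lemma l1k_L1_bound:
 fixes T :: "'a::euclidean_space \<Rightarrow> 'a \<Rightarrow> ennreal"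
 assumes T: "l1k T C" and [measurable]: "g \<in> borel_measurable borel"
 shows "(NN x. NN y. T x y * g y) \<le> ennreal C * (NN y. g y)"
proof -
 note [measurable] = l1k_measurable[OF T]
 have "(NN x. NN y. T x y * g y) = (NN y. NN x. T x y * g y)"
  by (rule nn_integral_swap) measurable
 also have "\<dots> = (NN y. (NN x. T x y) * g y)" by (simp add: nn_integral_multc)
 also have "\<dots> \<le> (NN y. ennreal C * g y)"
  using T by (intro nn_integral_mono mult_right_mono) (auto simp: l1k_def)
 also have "\<dots> = ennreal C * (NN y. g y)" by (simp add: nn_integral_cmult)
 finally show ?thesis .
qed

lemma l1k_AE_finite:
 fixes T :: "'a::euclidean_space \<Rightarrow> 'a \<Rightarrow> ennreal"
 assumes T: "l1k T C" and f: "integrable lborel f"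
 shows "AE x in lborel. (NN y. T x y * ennreal \<bar>f y\<bar>) < top"
proof -
 note [measurable] = l1k_measurable[OF T] borel_measurable_integrable[OF f]
 have "(NN x. NN y. T x y * ennreal \<bar>f y\<bar>) \<le> ennreal C * (NN y. ennreal \<bar>f y\<bar>)"
  by (rule l1k_L1_bound[OF T]) measurable
 also have "\<dots> < top" using integrable_nn(2)[OF f] by (simp add: ennreal_mult_less_top)
 finally have "(NN x. NN y. T x y * ennreal \<bar>f y\<bar>) \<noteq> \<infinity>" by simp
 from nn_integral_noteq_infinite[OF _ this] show ?thesis
  by (simp add: less_top)
qed

lemma ennreal_enn2real_le: "ennreal (enn2real a) \<le> a"
 using ennreal_enn2real_if[of a] by (cases "a = top") simp_all

lemma abs_enn2real_mult_le: "ennreal \<bar>enn2real a * r\<bar> \<le> a * ennreal \<bar>r\<bar>"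
proof -
 have "ennreal \<bar>enn2real a * r\<bar> = ennreal (enn2real a) * ennreal \<bar>r\<bar>"
  unfolding abs_mult by (subst ennreal_mult) auto
 also have "\<dots> \<le> a * ennreal \<bar>r\<bar>"
  by (rule mult_right_mono[OF ennreal_enn2real_le]) simp
 finally show ?thesis .
qed

lemma opk_integrable_at:
 fixes T :: "'a::euclidean_space \<Rightarrow> 'a \<Rightarrow> ennreal"
 assumes m: "T x \<in> borel_measurable borel" and f: "f \<in> borel_measurable borel"
  and fin: "(NN y. T x y * ennreal \<bar>f y\<bar>) < top"
 shows "integrable lborel (\<lambda>y. enn2real (T x y) * f y)"
  "ennreal \<bar>opk T f x\<bar> \<le> (NN y. T x y * ennreal \<bar>f y\<bar>)"
proof -
 define g where "g = T x"
 note [measurable] = m[folded g_def] f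
 have le: "(NN y. ennreal \<bar>enn2real (T x y) * f y\<bar>) \<le> (NN y. T x y * ennreal \<bar>f y\<bar>)"
  by (intro nn_integral_mono abs_enn2real_mult_le)
 show "integrable lborel (\<lambda>y. enn2real (T x y) * f y)"
 proof (rule integrableI_nn)
  show "(\<lambda>y. enn2real (T x y) * f y) \<in> borel_measurable lborel" unfolding g_def[symmetric] by measurable
  show "(NN y. ennreal \<bar>enn2real (T x y) * f y\<bar>) < top" by (rule order_le_less_trans[OF le fin])
 qed
 show "ennreal \<bar>opk T f x\<bar> \<le> (NN y. T x y * ennreal \<bar>f y\<bar>)"
  unfolding opk_def by (rule order_trans[OF integral_norm_le_nn le])
qed

lemma opk_abs_le:
 fixes T :: "'a::euclidean_space \<Rightarrow> 'a \<Rightarrow> ennreal"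
 shows "ennreal \<bar>opk T f x\<bar> \<le> (NN y. T x y * ennreal \<bar>f y\<bar>)"
 unfolding opk_def
 by (rule order_trans[OF integral_norm_le_nn]) (intro nn_integral_mono abs_enn2real_mult_le)

lemma l1k_slice:
 fixes T :: "'a::euclidean_space \<Rightarrow> 'a \<Rightarrow> ennreal"
 assumes T: "l1k T C"
 shows "T x \<in> borel_measurable borel"
 by (rule l1k_measurable[OF T, of "\<lambda>_. x" borel "\<lambda>y. y"]) measurable

lemma opk_measurable:
 fixes T :: "'a::euclidean_space \<Rightarrow> 'a \<Rightarrow> ennreal"
 assumes T: "l1k T C" and [measurable]: "f \<in> borel_measurable borel"
 shows "opk T f \<in> borel_measurable borel"
proof -
 note [measurable] = l1k_measurable[OF T]
 have "(\<lambda>x. LINT y|lborel. enn2real (T x y) * f y) \<in> borel_measurable borel" by measurable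
 then show ?thesis by (simp add: opk_def[abs_def])
qed

lemma opk_integrable:
 fixes T :: "'a::euclidean_space \<Rightarrow> 'a \<Rightarrow> ennreal"
 assumes T: "l1k T C" and f: "integrable lborel f"
 shows "integrable lborel (opk T f)" "(LINT x|lborel. \<bar>opk T f x\<bar>) \<le> C * (LINT x|lborel. \<bar>f x\<bar>)"
  "(NN x. ennreal \<bar>opk T f x\<bar>) \<le> ennreal C * (NN x. ennreal \<bar>f x\<bar>)"
proof -
 note fm [measurable] = borel_measurable_integrable[OF f, simplified]
 have "(NN x. ennreal \<bar>opk T f x\<bar>) \<le> (NN x. NN y. T x y * ennreal \<bar>f y\<bar>)"
  by (intro nn_integral_mono opk_abs_le)
 also have "\<dots> \<le> ennreal C * (NN y. ennreal \<bar>f y\<bar>)"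
  by (rule l1k_L1_bound[OF T]) measurable
 finally show le: "(NN x. ennreal \<bar>opk T f x\<bar>) \<le> ennreal C * (NN y. ennreal \<bar>f y\<bar>)" .
 show int: "integrable lborel (opk T f)"
 proof (rule integrableI_nn)
  show "opk T f \<in> borel_measurable lborel" using opk_measurable[OF T fm] by simp
  show "(NN x. ennreal \<bar>opk T f x\<bar>) < top"
   by (rule order_le_less_trans[OF le]) (use integrable_nn(2)[OF f] in \<open>simp add: ennreal_mult_less_top\<close>)
 qed
 show "(LINT x|lborel. \<bar>opk T f x\<bar>) \<le> C * (LINT x|lborel. \<bar>f x\<bar>)"
  using le unfolding integrable_nn(1)[OF int] integrable_nn(1)[OF f] using l1k_nonneg[OF T]
  by (simp add: ennreal_mult[symmetric])
qed

lemma opk_cong_AE: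
 fixes T :: "'a::euclidean_space \<Rightarrow> 'a \<Rightarrow> ennreal"
 assumes "T x \<in> borel_measurable borel" "f \<in> borel_measurable borel" "g \<in> borel_measurable borel" "AE y in lborel. f y = g y"
 shows "opk T f x = opk T g x"
 unfolding opk_def using assms by (intro integral_cong_AE) auto

lemma opk_diff_at:
 fixes T :: "'a::euclidean_space \<Rightarrow> 'a \<Rightarrow> ennreal"
 assumes "integrable lborel (\<lambda>y. enn2real (T x y) * f y)" "integrable lborel (\<lambda>y. enn2real (T x y) * g y)"
 shows "opk T (\<lambda>y. f y - g y) x = opk T f x - opk T g x" "opk T (\<lambda>y. f y + g y) x = opk T f x + opk T g x"
 unfolding opk_def right_diff_distrib distrib_left using assms by simp_all

lemma opk_AE_integrable:
 fixes T :: "'a::euclidean_space \<Rightarrow> 'a \<Rightarrow> ennreal"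
 assumes T: "l1k T C" and f: "integrable lborel f"
 shows "AE x in lborel. integrable lborel (\<lambda>y. enn2real (T x y) * f y)"
 using l1k_AE_finite[OF T f] by eventually_elim
  (rule opk_integrable_at[OF l1k_slice[OF T]], use f in auto)

lemma opk_diff_AE:
 fixes T :: "'a::euclidean_space \<Rightarrow> 'a \<Rightarrow> ennreal"
 assumes T: "l1k T C" and f: "integrable lborel f" and g: "integrable lborel g"
 shows "AE x in lborel. opk T (\<lambda>y. f y - g y) x = opk T f x - opk T g x"
  "AE x in lborel. opk T (\<lambda>y. f y + g y) x = opk T f x + opk T g x"
proof -
 show "AE x in lborel. opk T (\<lambda>y. f y - g y) x = opk T f x - opk T g x"
  using opk_AE_integrable[OF T f] opk_AE_integrable[OF T g] by eventually_elim (rule opk_diff_at)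
 show "AE x in lborel. opk T (\<lambda>y. f y + g y) x = opk T f x + opk T g x"
  using opk_AE_integrable[OF T f] opk_AE_integrable[OF T g] by eventually_elim (rule opk_diff_at)
qed

text \<open>Fubini for a family of kernels mixed over a parameter t, under absolute convergence.
  Where \<open>w p\<close> is not 0, the mixed kernel is finite for almost every p and so is N t p
  for almost every t, so \<open>enn2real\<close> commutes with the mixing there.\<close>

lemma nn_mix:
 fixes N :: "'c::euclidean_space \<Rightarrow> 'b::euclidean_space \<Rightarrow> ennreal"
 assumes N [measurable]: "(\<lambda>p. N (fst p) (snd p)) \<in> borel_measurable (lborel \<Otimes>\<^sub>M lborel)"
  and w [measurable]: "w \<in> borel_measurable borel"
  and fin: "(NN t. NN p. N t p * ennreal \<bar>w p\<bar>) < top"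
 shows "integrable lborel (\<lambda>t. LINT p|lborel. enn2real (N t p) * w p)"
  "(LINT t|lborel. LINT p|lborel. enn2real (N t p) * w p) = (LINT p|lborel. enn2real (NN t. N t p) * w p)"
proof -
 have Nm [measurable (raw)]: "(\<lambda>q. N (g q) (h q)) \<in> borel_measurable Q"
  if "g \<in> borel_measurable Q" "h \<in> borel_measurable Q" for g h and Q :: "'d measure"
 proof -
  have "(\<lambda>q. (g q, h q)) \<in> Q \<rightarrow>\<^sub>M (lborel \<Otimes>\<^sub>M lborel)" using that by measurable
  from measurable_compose[OF this N] show ?thesis by simp
 qed
 define F where "F t p = enn2real (N t p) * w p" for t p
 have Fm [measurable]: "case_prod F \<in> borel_measurable (lborel \<Otimes>\<^sub>M lborel)"
  unfolding F_def case_prod_unfold by measurable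
 have int: "integrable (lborel \<Otimes>\<^sub>M lborel) (case_prod F)"
 proof (rule integrableI_nn)
  have "(\<integral>\<^sup>+p. ennreal \<bar>case_prod F p\<bar> \<partial>(lborel \<Otimes>\<^sub>M lborel)) = (NN t. NN p. ennreal \<bar>F t p\<bar>)"
   using Fm by (subst lborel.nn_integral_fst[symmetric]) (simp_all add: case_prod_unfold)
  also have "\<dots> \<le> (NN t. NN p. N t p * ennreal \<bar>w p\<bar>)"
   unfolding F_def by (intro nn_integral_mono abs_enn2real_mult_le)
  finally show "(\<integral>\<^sup>+p. ennreal \<bar>case_prod F p\<bar> \<partial>(lborel \<Otimes>\<^sub>M lborel)) < top" using fin by simp
 qed (rule Fm)
 show "integrable lborel (\<lambda>t. LINT p|lborel. enn2real (N t p) * w p)"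
  using lborel_pair.integrable_fst[OF int] by (simp add: F_def)
 have sw: "(NN t. NN p. N t p * ennreal \<bar>w p\<bar>) = (NN p. NN t. N t p * ennreal \<bar>w p\<bar>)"
  by (rule nn_integral_swap) (simp add: case_prod_unfold)
 have "(LINT t|lborel. LINT p|lborel. F t p) = (LINT p|lborel. LINT t|lborel. F t p)"
  by (rule lborel_pair.Fubini_integral[OF int, symmetric])
 also have "\<dots> = (LINT p|lborel. enn2real (NN t. N t p) * w p)"
 proof (rule integral_cong_AE)
  show "(\<lambda>p. LINT t|lborel. F t p) \<in> borel_measurable lborel"
   using lborel_pair.integrable_snd[OF int] by (rule borel_measurable_integrable)
  have "AE p in lborel. (NN t. N t p * ennreal \<bar>w p\<bar>) \<noteq> \<infinity>"

  proof (rule nn_integral_noteq_infinite)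
   show "(NN p. NN t. N t p * ennreal \<bar>w p\<bar>) \<noteq> \<infinity>" using fin sw by simp
  qed measurable
  then show "AE p in lborel. (LINT t|lborel. F t p) = enn2real (NN t. N t p) * w p"
  proof eventually_elim
   case (elim p)
   have m [measurable]: "(\<lambda>t. N t p) \<in> borel_measurable lborel" by measurable
   have "(NN t. N t p * ennreal \<bar>w p\<bar>) = (NN t. N t p) * ennreal \<bar>w p\<bar>"
    by (rule nn_integral_multc) measurable
   with elim have el: "(NN t. N t p) * ennreal \<bar>w p\<bar> \<noteq> \<infinity>" by simp
   show ?case
   proof (cases "w p = 0")
    case True then show ?thesis by (simp add: F_def)
   next
    case False
    then have fin: "(NN t. N t p) \<noteq> \<infinity>" using el by (auto simp: ennreal_top_mult)
    have "(LINT t|lborel. enn2real (N t p)) = enn2real (NN t. ennreal (enn2real (N t p)))"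
     by (intro integral_eq_nn_integral) auto
    also have "(NN t. ennreal (enn2real (N t p))) = (NN t. N t p)"
     by (rule nn_integral_cong_AE, use nn_integral_noteq_infinite[OF m fin] in eventually_elim) (simp add: less_top)
    finally show ?thesis by (simp add: F_def)
   qed
  qed
  show "(\<lambda>p. enn2real (NN t. N t p) * w p) \<in> borel_measurable lborel" by measurable
 qed
 finally show "(LINT t|lborel. LINT p|lborel. enn2real (N t p) * w p) = (LINT p|lborel. enn2real (NN t. N t p) * w p)"
  by (simp add: F_def)
qed

lemma opk_comp_at:
 fixes T S :: "'a::euclidean_space \<Rightarrow> 'a \<Rightarrow> ennreal"
 assumes [measurable]: "T x \<in> borel_measurable borel" and S: "(\<lambda>p. S (fst p) (snd p)) \<in> borel_measurable (lborel \<Otimes>\<^sub>M lborel)"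
  and f: "f \<in> borel_measurable borel" and fin: "(NN z. NN y. T x z * (S z y * ennreal \<bar>f y\<bar>)) < top"
 shows "opk T (opk S f) x = opk (kprod T S) f x"
proof -
 define g where "g = T x"
 note [measurable] = S assms(1)[folded g_def]
 have m: "(\<lambda>p. T x (fst p) * S (fst p) (snd p)) \<in> borel_measurable (lborel \<Otimes>\<^sub>M lborel)"
  unfolding g_def[symmetric] by measurable
 have "opk T (opk S f) x = (LINT z|lborel. LINT y|lborel. enn2real (T x z * S z y) * f y)"
  by (simp add: opk_def enn2real_mult mult.assoc)
 also have "\<dots> = opk (kprod T S) f x"
  unfolding nn_mix(2)[OF m f fin[unfolded mult.assoc[symmetric]]] by (simp add: opk_def kprod_def)
 finally show ?thesis .
qed

lemma l1k_kprod:
 fixes T S :: "'a::euclidean_space \<Rightarrow> 'a \<Rightarrow> ennreal"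
 assumes T: "l1k T C" and S: "l1k S D"
 shows "l1k (kprod T S) (C * D)"
proof (rule l1kI)
 note [measurable] = l1k_measurable[OF S] l1k_measurable[OF T]
 show "(\<lambda>w. kprod T S (fst w) (snd w)) \<in> borel_measurable (borel \<Otimes>\<^sub>M borel)" unfolding kprod_def by measurable
 show "0 \<le> C * D" using l1k_nonneg[OF T] l1k_nonneg[OF S] by simp
 fix y
 have "(NN x. kprod T S x y) \<le> ennreal C * (NN z. S z y)"
  unfolding kprod_def by (rule l1k_L1_bound[OF T]) measurable
 also have "\<dots> \<le> ennreal C * ennreal D" using S by (intro mult_left_mono) (auto simp: l1k_def)
 finally show "(NN x. kprod T S x y) \<le> ennreal (C * D)"
  using l1k_nonneg[OF T] l1k_nonneg[OF S] by (simp add: ennreal_mult)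
qed

lemma AE_swap:
 fixes P :: "'a::euclidean_space \<Rightarrow> 'b::euclidean_space \<Rightarrow> bool"
 assumes m: "Measurable.pred (lborel \<Otimes>\<^sub>M lborel) (\<lambda>w. P (fst w) (snd w))" and ae: "\<And>y. AE x in lborel. P x y"
 shows "AE x in lborel. AE y in lborel. P x y"
proof -
 have "{w \<in> space (lborel \<Otimes>\<^sub>M lborel). P (fst w) (snd w)} \<in> sets (lborel \<Otimes>\<^sub>M lborel)"
  using m by (simp only: pred_def)
 then show ?thesis using ae by (subst lborel_pair.AE_commute) auto
qed

lemma opk_comp:
 fixes T S :: "'a::euclidean_space \<Rightarrow> 'a \<Rightarrow> ennreal"
 assumes T: "l1k T C" and S: "l1k S D" and f: "integrable lborel f"
 shows "AE x in lborel. opk T (opk S f) x = opk (kprod T S) f x"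
proof -
 note [measurable] = l1k_measurable[OF S] l1k_measurable[OF T] borel_measurable_integrable[OF f, simplified]
 have "AE x in lborel. (NN z. NN y. T x z * (S z y * ennreal \<bar>f y\<bar>)) < top"
 proof -
  have "(NN x. NN z. NN y. T x z * (S z y * ennreal \<bar>f y\<bar>))
    = (NN x. NN z. T x z * (NN y. S z y * ennreal \<bar>f y\<bar>))"
   by (simp add: nn_integral_cmult)
  also have "\<dots> \<le> ennreal C * (NN z. NN y. S z y * ennreal \<bar>f y\<bar>)"
   by (rule l1k_L1_bound[OF T]) measurable
  also have "\<dots> \<le> ennreal C * (ennreal D * (NN y. ennreal \<bar>f y\<bar>))"
   by (intro mult_left_mono l1k_L1_bound[OF S]) auto
  also have "\<dots> < top" using integrable_nn(2)[OF f] by (simp add: ennreal_mult_less_top)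
  finally have "(NN x. NN z. NN y. T x z * (S z y * ennreal \<bar>f y\<bar>)) \<noteq> \<infinity>" by simp
  from nn_integral_noteq_infinite[OF _ this] show ?thesis by (simp add: less_top)
 qed
 then show ?thesis
  by eventually_elim (rule opk_comp_at[OF l1k_slice[OF T]], measurable)
qed

text \<open>The identity of kernels is known for each y and almost every x, while the operator at x
  integrates over y; \<open>AE_swap\<close> exchanges the two quantifiers.\<close>

lemma opk_add_kernel:
 fixes T S U :: "'a::euclidean_space \<Rightarrow> 'a \<Rightarrow> ennreal"
 assumes T: "l1k T C" and S: "l1k S D" and U: "l1k U E" and f: "integrable lborel f"
  and eq: "\<And>y. AE x in lborel. T x y = S x y + U x y"
 shows "AE x in lborel. opk T f x = opk S f x + opk U f x"
proof -
 note [measurable] = l1k_measurable[OF S] l1k_measurable[OF T] l1k_measurable[OF U] borel_measurable_integrable[OF f, simplified]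
 have Tfin: "AE x in lborel. T x y < top" for y
 proof -
  have "(NN x. T x y) \<noteq> \<infinity>" using T unfolding l1k_def
   by (metis ennreal_less_top infinity_ennreal_def le_less_trans less_irrefl)
  from nn_integral_noteq_infinite[OF _ this] show ?thesis by (simp add: less_top)
 qed
 have "AE x in lborel. T x y = S x y + U x y \<and> T x y < top" for y using eq[of y] Tfin[of y] by eventually_elim simp
 then have "AE x in lborel. AE y in lborel. T x y = S x y + U x y \<and> T x y < top"
  by (intro AE_swap) measurable
 then show ?thesis using opk_AE_integrable[OF S f] opk_AE_integrable[OF U f]
 proof eventually_elim
  fix x assume ae: "AE y in lborel. T x y = S x y + U x y \<and> T x y < top"
   and i: "integrable lborel (\<lambda>y. enn2real (S x y) * f y)" "integrable lborel (\<lambda>y. enn2real (U x y) * f y)"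
  have "opk T f x = (LINT y|lborel. enn2real (S x y) * f y + enn2real (U x y) * f y)"
   unfolding opk_def
  proof (rule integral_cong_AE)
   show "AE y in lborel. enn2real (T x y) * f y = enn2real (S x y) * f y + enn2real (U x y) * f y"
    using ae
   proof eventually_elim
    fix y assume h: "T x y = S x y + U x y \<and> T x y < top"
    then have "enn2real (T x y) = enn2real (S x y) + enn2real (U x y)"
     by (cases "S x y"; cases "U x y") (auto simp flip: ennreal_plus)
    then show "enn2real (T x y) * f y = enn2real (S x y) * f y + enn2real (U x y) * f y" by (simp add: distrib_right)
   qed
  qed measurable
  then show "opk T f x = opk S f x + opk U f x" using i by (simp add: opk_def)
 qed
qed

lemma (in schr) l1k_TT:
 assumes "\<And>t x z. A t x z \<le> hk t x z" "\<And>t z y. B t z y \<le> hk t z y" "kmeas A" "kmeas B"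
 shows "l1k (TT A B) M"
proof (rule l1kI)
 show "(\<lambda>w. TT A B (fst w) (snd w)) \<in> borel_measurable (borel \<Otimes>\<^sub>M borel)"
  by (rule TT_measurable[OF assms(3,4)]) measurable
 show "(NN x. TT A B x y) \<le> ennreal M" for y
  using assms(1,2) by (rule TT_column)
qed (rule M_nonneg)

lemma (in schr) l1k_TT_PK: "l1k (TT hk K) M" and l1k_TT_KP: "l1k (TT K hk) M"
 by (intro l1k_TT K_le order_refl kmeas_hk kmeas_K)+

text \<open>With T = T(P,K) and S = T(K,P) the kernel identities read S = T + S T and S = T + T S;
  these are (I + S)(I - T) = I and (I - T)(I + S) = I.\<close>

lemma (in schr) inverse_ops:
 assumes f: "integrable lborel f"
 shows "AE x in lborel. f x = (f x - opk (TT hk K) f x) + opk (TT K hk) (\<lambda>y. f y - opk (TT hk K) f y) x"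
  "AE x in lborel. f x = (f x + opk (TT K hk) f x) - opk (TT hk K) (\<lambda>y. f y + opk (TT K hk) f y) x"
proof -
 note P = l1k_TT_PK and Q = l1k_TT_KP
 have iP: "integrable lborel (opk (TT hk K) f)" by (rule opk_integrable[OF P f])
 have iQ: "integrable lborel (opk (TT K hk) f)" by (rule opk_integrable[OF Q f])
 have a1: "AE x in lborel. opk (TT K hk) f x = opk (TT hk K) f x + opk (kprod (TT K hk) (TT hk K)) f x"
  by (rule opk_add_kernel[OF Q P l1k_kprod[OF Q P] f]) (intro AE_I2 TT_inverse1)
 have a2: "AE x in lborel. opk (TT K hk) f x = opk (TT hk K) f x + opk (kprod (TT hk K) (TT K hk)) f x"
  by (rule opk_add_kernel[OF Q P l1k_kprod[OF P Q] f TT_inverse2])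
 show "AE x in lborel. f x = (f x - opk (TT hk K) f x) + opk (TT K hk) (\<lambda>y. f y - opk (TT hk K) f y) x"
  using a1 opk_comp[OF Q P f] opk_diff_AE(1)[OF Q f iP] by eventually_elim simp
 show "AE x in lborel. f x = (f x + opk (TT K hk) f x) - opk (TT hk K) (\<lambda>y. f y + opk (TT K hk) f y) x"
  using a2 opk_comp[OF P Q f] opk_diff_AE(2)[OF P f iQ] by eventually_elim simp
qed

section \<open>Comparison of the two semigroups uniformly in time\<close>

context schr
begin

definition gg :: "'a \<Rightarrow> 'a \<Rightarrow> ennreal" where
 "gg x y = (NN u. NN z. ennreal (GG u (x - z)) * (v z * hk u z y))"

text \<open>The majorant from \<open>heat_conv_late\<close> for the late times t/2 \<le> u < t,
  integrated against V; \<open>gg\<close> is the majorant where the difference of heat kernels is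
  used.\<close>

definition ll :: "'a \<Rightarrow> 'a \<Rightarrow> ennreal" where
 "ll x y = (NN z. ennreal (norm (z - y) powr (2 - real DIM('a)) * GG ((norm (z - y))\<^sup>2) (x - z)) * v z)"

lemma gg_column: obtains C where "C \<ge> 0" "\<And>y. (NN x. gg x y) \<le> ennreal C"
proof -
 obtain C where C: "C > 0" "\<And>u. 0 < u \<Longrightarrow> (NN x. ennreal (GG u (x::'a))) \<le> ennreal C"
  using GG_integral[where 'a = 'a] by blast
 have CG: "(NN x. ennreal (GG u (x - z))) \<le> ennreal C" if "u > 0" for u and z :: 'a
  using nn_integral_lborel_plus[of "\<lambda>x. ennreal (GG u x)" "- z"] C(2)[OF that] by simp
 show ?thesis
 proof
  show "C * M \<ge> 0" using C M_nonneg by simp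
  fix y
  have "(NN x. gg x y) = (NN u. NN x. NN z. ennreal (GG u (x - z)) * (v z * hk u z y))"
   unfolding gg_def by (rule nn_integral_swap) measurable
  also have "\<dots> = (NN u. NN z. NN x. ennreal (GG u (x - z)) * (v z * hk u z y))"
   by (rule nn_integral_cong) (rule nn_integral_swap, measurable)
  also have "\<dots> \<le> (NN u. NN z. ennreal C * (v z * hk u z y))"
  proof (intro nn_integral_mono)
   fix u :: real and z
   have "(NN x. ennreal (GG u (x - z)) * (v z * hk u z y)) = (NN x. ennreal (GG u (x - z))) * (v z * hk u z y)"
    by (rule nn_integral_multc) measurable
   also have "\<dots> \<le> ennreal C * (v z * hk u z y)"
   proof (cases "u > 0")
    case True then show ?thesis by (intro mult_right_mono CG) auto
   qed (simp add: hk_def)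
   finally show "(NN x. ennreal (GG u (x - z)) * (v z * hk u z y)) \<le> ennreal C * (v z * hk u z y)" .
  qed
  also have "\<dots> = ennreal C * (NN u. NN z. v z * hk u z y)" by (simp add: nn_integral_cmult)
  also have "\<dots> \<le> ennreal C * ennreal M" by (intro mult_left_mono V_bound) simp
  finally show "(NN x. gg x y) \<le> ennreal (C * M)" using C M_nonneg by (simp add: ennreal_mult)
 qed
qed

text \<open>Integrating \<open>GG\<close> over x leaves the Newton kernel in z - y, which
  \<open>hk_time_integral_lower\<close> turns back into a time integral of heat kernels, so that
  \<open>V_bound\<close> applies.\<close>

lemma ll_column: obtains C where "C \<ge> 0" "\<And>y. (NN x. ll x y) \<le> ennreal C"
proof -
 obtain C where C: "C > 0" "\<And>u. 0 < u \<Longrightarrow> (NN x. ennreal (GG u (x::'a))) \<le> ennreal C"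
  using GG_integral[where 'a = 'a] by blast
 have CG: "(NN x. ennreal (GG u (x - z))) \<le> ennreal C" if "u > 0" for u and z :: 'a
  using nn_integral_lborel_plus[of "\<lambda>x. ennreal (GG u x)" "- z"] C(2)[OF that] by simp
 obtain c where c: "c > 0" "\<And>x y::'a. x \<noteq> y \<Longrightarrow> ennreal (c * norm (x - y) powr (2 - real DIM('a))) \<le> (NN t. hk t x y)"
  using hk_time_integral_lower[where 'a = 'a] by blast
 show ?thesis
 proof
  show "C / c * M \<ge> 0" using C c M_nonneg by simp
  fix y
  have "(NN x. ll x y) = (NN z. NN x. ennreal (norm (z - y) powr (2 - real DIM('a)) * GG ((norm (z - y))\<^sup>2) (x - z)) * v z)"
   unfolding ll_def by (rule nn_integral_swap) measurable
  also have "\<dots> \<le> (NN z. ennreal (C / c) * (NN u. v z * hk u z y))"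
  proof (rule nn_integral_mono_AE, use AE_neq_lborel[of y] in eventually_elim)
   fix z assume zy: "z \<noteq> y"
   let ?n = "norm (z - y) powr (2 - real DIM('a))"
   have "(NN x. ennreal (?n * GG ((norm (z - y))\<^sup>2) (x - z)) * v z)
     = ennreal ?n * (NN x. ennreal (GG ((norm (z - y))\<^sup>2) (x - z))) * v z"
    by (simp add: ennreal_mult nn_integral_cmult nn_integral_multc)
   also have "\<dots> \<le> ennreal ?n * ennreal C * v z"
    using zy by (intro mult_right_mono mult_left_mono CG) auto
   also have "ennreal ?n * ennreal C = ennreal (C / c) * ennreal (c * ?n)"
    using C c by (simp flip: ennreal_mult)
   also have "ennreal (C / c) * ennreal (c * ?n) * v z \<le> ennreal (C / c) * (NN t. hk t z y) * v z"
    by (intro mult_right_mono mult_left_mono c zy) auto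
   also have "\<dots> = ennreal (C / c) * (NN u. v z * hk u z y)"
    by (simp add: nn_integral_cmult mult_ac)
   finally show "(NN x. ennreal (?n * GG ((norm (z - y))\<^sup>2) (x - z)) * v z) \<le> ennreal (C / c) * (NN u. v z * hk u z y)" .
  qed
  also have "\<dots> = ennreal (C / c) * (NN z. NN u. v z * hk u z y)" by (rule nn_integral_cmult) measurable
  also have "(NN z. NN u. v z * hk u z y) = (NN u. NN z. v z * hk u z y)"
   by (rule nn_integral_swap) measurable
  also have "ennreal (C / c) * \<dots> \<le> ennreal (C / c) * ennreal M" by (intro mult_left_mono V_bound) simp
  also have "\<dots> = ennreal (C / c * M)" using C(1) c(1) M_nonneg by (intro ennreal_mult[symmetric]) auto
  finally show "(NN x. ll x y) \<le> ennreal (C / c * M)" .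
 qed
qed

lemma hk_TT:
 assumes t: "t > 0"
 shows "kprod (hk t) (TT hk K) x y = (NN u. NN s. NN z. ennreal (kw s u) * (hk (t + s) x z * (v z * K u z y)))"
proof -
 note [measurable] = sw_measurable[OF kmeas_hk kmeas_K] kmeasD[OF kmeas_K]
 have inner: "(NN w. hk t x w * sw hk K s u w y) = sw hk K (t + s) u x y" if s: "s > 0" for s u
 proof -
  have "(NN w. hk t x w * sw hk K s u w y) = (NN w. NN z. hk t x w * (hk s w z * (v z * K u z y)))"
   unfolding sw_def by (simp add: nn_integral_cmult)
  also have "\<dots> = (NN z. NN w. hk t x w * (hk s w z * (v z * K u z y)))"
   by (rule nn_integral_swap) measurable
  also have "\<dots> = (NN z. (NN w. hk t x w * hk s w z) * (v z * K u z y))"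
   by (simp add: nn_integral_multc[symmetric] mult.assoc)
  finally show ?thesis unfolding hk_semigroup[OF t s] sw_def .
 qed
 have "kprod (hk t) (TT hk K) x y = (NN w. NN s. NN u. hk t x w * (ennreal (kw s u) * sw hk K s u w y))"
  unfolding kprod_def TT_def by (simp add: nn_integral_cmult)
 also have "\<dots> = (NN s. NN w. NN u. hk t x w * (ennreal (kw s u) * sw hk K s u w y))"
  by (rule nn_integral_swap) measurable
 also have "\<dots> = (NN s. NN u. NN w. hk t x w * (ennreal (kw s u) * sw hk K s u w y))"
  by (rule nn_integral_cong) (rule nn_integral_swap, measurable)
 also have "\<dots> = (NN s. NN u. ennreal (kw s u) * sw hk K (t + s) u x y)"
 proof (intro nn_integral_cong)
  fix s u :: real
  have "(NN w. hk t x w * (ennreal (kw s u) * sw hk K s u w y)) = ennreal (kw s u) * (NN w. hk t x w * sw hk K s u w y)"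
   by (subst nn_integral_cmult[symmetric]) (auto simp: mult.left_commute)
  then show "(NN w. hk t x w * (ennreal (kw s u) * sw hk K s u w y)) = ennreal (kw s u) * sw hk K (t + s) u x y"
   using inner[of s u] by (cases "s > 0") (simp_all add: kw_def)
 qed
 also have "\<dots> = (NN s. NN u. NN z. ennreal (kw s u) * (hk (t + s) x z * (v z * K u z y)))"
  unfolding sw_def by (simp add: nn_integral_cmult)
 also have "\<dots> = (NN u. NN s. NN z. ennreal (kw s u) * (hk (t + s) x z * (v z * K u z y)))"
  by (rule nn_integral_swap) measurable
 finally show ?thesis .
qed

text \<open>Inserting the integral 1 of \<open>kw\<close> over s puts P V K into the form of
  \<open>hk_TT\<close>: the two integrands then differ only in the time t - u or t + s of the left
  heat kernel.\<close>

lemma ck_as_kw: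
 "ck hk v K t x y = (NN u. NN s. NN z. ennreal (kw s u) * (hk (t - u) x z * (v z * K u z y)))"
 unfolding ck_def cv_def
proof (rule nn_integral_cong)
 fix u :: real
 note [measurable] = kmeasD[OF kmeas_K]
 show "(NN z. hk (t - u) x z * (v z * K u z y)) = (NN s. NN z. ennreal (kw s u) * (hk (t - u) x z * (v z * K u z y)))"
 proof (cases "u > 0")
  case True
  then show ?thesis by (simp add: nn_integral_cmult nn_integral_multc kw_integral)
 qed (simp add: K_nonpos)
qed

text \<open>The integrands of \<open>ck_as_kw\<close> and \<open>hk_TT\<close> are compared
  pointwise; every error is bounded independently of t, either by \<open>HH\<close>, whose average
  over s is controlled by \<open>GG\<close>, or by a late convolution. Two one-sided inequalities
  replace the absolute difference.\<close>

lemma maximal_compare: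
 obtains Q C where "l1k Q C"
  "\<And>t x y. 0 < t \<Longrightarrow> ck hk v K t x y \<le> kprod (hk t) (TT hk K) x y + Q x y"
  "\<And>t x y. 0 < t \<Longrightarrow> kprod (hk t) (TT hk K) x y \<le> ck hk v K t x y + Q x y"
proof -
 note [measurable] = kmeasD[OF kmeas_K]
 let ?L = "\<lambda>t x y u z. indicator {t/2..<t} u * hk (t - u) x z * (v z * hk u z y)"
 obtain C1 where C1: "C1 > 0"
  "\<And>t s u x::'a::euclidean_space. 0 < u \<Longrightarrow> 0 < s \<Longrightarrow> 2 * u < t \<Longrightarrow> x \<noteq> 0 \<Longrightarrow> \<bar>heat (t - u) x - heat (t + s) x\<bar> \<le> C1 * HH s u x"
  "\<And>t s u x::'a::euclidean_space. 0 < t \<Longrightarrow> 0 < s \<Longrightarrow> t \<le> 2 * u \<Longrightarrow> x \<noteq> 0 \<Longrightarrow> heat (t + s) x \<le> C1 * HH s u x"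
  using heat_HH[where 'a = 'a] by blast
 let ?E = "\<lambda>x y u s z. ennreal (C1 * HH s u (x - z)) * (v z * hk u z y)"
 obtain C2 where C2: "C2 > 0" "\<And>t (x::'a) (y::'a). 0 < t \<Longrightarrow> x \<noteq> 0 \<Longrightarrow> y \<noteq> 0 \<Longrightarrow>
  (NN u. ennreal (heat (t - u) x) * ennreal (heat u y) * indicator {t/2..<t} u)
   \<le> ennreal (C2 * norm y powr (2 - real DIM('a)) * GG ((norm y)\<^sup>2) x)"
  using heat_conv_late[OF dim] by blast
 obtain D1 where D1: "D1 \<ge> 0" "\<And>y. (NN x. gg x y) \<le> ennreal D1" using gg_column by blast
 obtain D2 where D2: "D2 \<ge> 0" "\<And>y. (NN x. ll x y) \<le> ennreal D2" using ll_column by blast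
 define Q where "Q x y = ennreal (7 * C1) * gg x y + ennreal C2 * ll x y" for x y
 have ggm [measurable]: "(\<lambda>w. gg (f w) (g w)) \<in> borel_measurable N" if [measurable]: "f \<in> borel_measurable N" "g \<in> borel_measurable N" for f g and N :: "'b measure"
  unfolding gg_def by measurable
 have llm [measurable]: "(\<lambda>w. ll (f w) (g w)) \<in> borel_measurable N" if [measurable]: "f \<in> borel_measurable N" "g \<in> borel_measurable N" for f g and N :: "'b measure"
  unfolding ll_def by measurable
 have Q: "l1k Q (7 * C1 * D1 + C2 * D2)"
 proof (rule l1kI)
  show "(\<lambda>w. Q (fst w) (snd w)) \<in> borel_measurable (borel \<Otimes>\<^sub>M borel)" unfolding Q_def by measurable
  show "0 \<le> 7 * C1 * D1 + C2 * D2" using C1 C2 D1 D2 by simp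
  fix y
  have "(NN x. Q x y) = ennreal (7 * C1) * (NN x. gg x y) + ennreal C2 * (NN x. ll x y)"
   unfolding Q_def by (simp add: nn_integral_add nn_integral_cmult)
  also have "\<dots> \<le> ennreal (7 * C1) * ennreal D1 + ennreal C2 * ennreal D2"
   by (intro add_mono mult_left_mono D1 D2) auto
  also have "\<dots> = ennreal (7 * C1 * D1 + C2 * D2)" using C1 C2 D1 D2 by (intro ennreal_lincomb) auto
  finally show "(NN x. Q x y) \<le> ennreal (7 * C1 * D1 + C2 * D2)" .
 qed
 have I1: "(NN u. NN s. NN z. ennreal (kw s u) * ?E x y u s z) \<le> ennreal (7 * C1) * gg x y" for x y
 proof -
  have I: "(NN s. NN z. ennreal (kw s u) * ?E x y u s z)
    \<le> (NN z. ennreal (7 * C1) * (ennreal (GG u (x - z)) * (v z * hk u z y)))" for u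
  proof -
   have "(NN s. NN z. ennreal (kw s u) * ?E x y u s z)
    = (NN z. NN s. ennreal (kw s u) * ?E x y u s z)"
    by (rule nn_integral_swap) measurable
   also have "\<dots> = (NN z. ennreal C1 * (NN s. ennreal (kw s u) * ennreal (HH s u (x - z))) * (v z * hk u z y))"
   proof (rule nn_integral_cong)
    fix z
    have "(NN s. ennreal (kw s u) * ?E x y u s z)
      = (NN s. ennreal C1 * (ennreal (kw s u) * ennreal (HH s u (x - z))) * (v z * hk u z y))"
     using C1(1) by (intro nn_integral_cong) (simp add: ennreal_mult mult_ac)
    also have "\<dots> = ennreal C1 * (NN s. ennreal (kw s u) * ennreal (HH s u (x - z))) * (v z * hk u z y)"
     by (simp add: nn_integral_multc nn_integral_cmult)
    finally show "(NN s. ennreal (kw s u) * ?E x y u s z)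
      = ennreal C1 * (NN s. ennreal (kw s u) * ennreal (HH s u (x - z))) * (v z * hk u z y)" .
   qed
   also have "\<dots> \<le> (NN z. ennreal (7 * C1) * (ennreal (GG u (x - z)) * (v z * hk u z y)))"
   proof (rule nn_integral_mono)
    fix z
    show "ennreal C1 * (NN s. ennreal (kw s u) * ennreal (HH s u (x - z))) * (v z * hk u z y) \<le> ennreal (7 * C1) * (ennreal (GG u (x - z)) * (v z * hk u z y))"
    proof (cases "u > 0")
     case True
     have "ennreal C1 * (NN s. ennreal (kw s u) * ennreal (HH s u (x - z))) * (v z * hk u z y) \<le> ennreal C1 * ennreal (7 * GG u (x - z)) * (v z * hk u z y)"
      by (intro mult_right_mono mult_left_mono kw_HH_integral[OF True]) auto
     also have "ennreal C1 * ennreal (7 * GG u (x - z)) = ennreal (7 * C1) * ennreal (GG u (x - z))"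
      using C1(1) by (simp add: mult_ac flip: ennreal_mult)
     finally show ?thesis by (simp add: mult.assoc)
    qed (simp add: hk_def)
   qed
   finally show ?thesis .
  qed
  have "(NN u. NN s. NN z. ennreal (kw s u) * ?E x y u s z)
    \<le> (NN u. NN z. ennreal (7 * C1) * (ennreal (GG u (x - z)) * (v z * hk u z y)))"
   by (intro nn_integral_mono I)
  then show ?thesis by (simp add: gg_def nn_integral_cmult)
 qed
 have I2: "(NN u. NN s. NN z. ennreal (kw s u) * ?L t x y u z) \<le> ennreal C2 * ll x y"
  if t: "t > 0" for t x y
 proof -
  have "(NN u. NN s. NN z. ennreal (kw s u) * ?L t x y u z)
    \<le> (NN u. NN z. ?L t x y u z)"
  proof (rule nn_integral_mono)
   fix u :: real
   have "(NN s. ennreal (kw s u)) \<le> 1" using kw_integral[of u] by (cases "u > 0") (simp_all add: kw_def)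
   then have "(NN s. ennreal (kw s u)) * (NN z. ?L t x y u z)
     \<le> 1 * (NN z. ?L t x y u z)"
    by (intro mult_right_mono) auto
   then show "(NN s. NN z. ennreal (kw s u) * ?L t x y u z)
    \<le> (NN z. ?L t x y u z)"
    by (subst nn_integral_cmult, measurable) (subst nn_integral_multc, auto)
  qed
  also have "\<dots> = (NN z. NN u. ?L t x y u z)"
   by (rule nn_integral_swap) measurable
  also have "\<dots> \<le> (NN z. ennreal C2 * (ennreal (norm (z - y) powr (2 - real DIM('a)) * GG ((norm (z - y))\<^sup>2) (x - z)) * v z))"
  proof (rule nn_integral_mono_AE, use AE_neq_lborel[of y] AE_neq_lborel[of x] in eventually_elim)
   fix z assume z: "z \<noteq> y" "z \<noteq> x"
   have "(NN u. ?L t x y u z)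
     = (NN u. (ennreal (heat (t - u) (x - z)) * ennreal (heat u (z - y)) * indicator {t/2..<t} u) * v z)"
    using t by (intro nn_integral_cong) (auto simp: hk_def indicator_def mult_ac)
   also have "\<dots> = (NN u. ennreal (heat (t - u) (x - z)) * ennreal (heat u (z - y)) * indicator {t/2..<t} u) * v z"
    by (rule nn_integral_multc) measurable
   also have "\<dots> \<le> ennreal (C2 * norm (z - y) powr (2 - real DIM('a)) * GG ((norm (z - y))\<^sup>2) (x - z)) * v z"
    using z by (intro mult_right_mono C2(2) t) auto
   also have "\<dots> = ennreal C2 * (ennreal (norm (z - y) powr (2 - real DIM('a)) * GG ((norm (z - y))\<^sup>2) (x - z)) * v z)"
    using C2(1) by (simp add: ennreal_mult mult_ac)
   finally show "(NN u. ?L t x y u z)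
     \<le> ennreal C2 * (ennreal (norm (z - y) powr (2 - real DIM('a)) * GG ((norm (z - y))\<^sup>2) (x - z)) * v z)" .
  qed
  also have "\<dots> = ennreal C2 * ll x y" unfolding ll_def by (rule nn_integral_cmult) measurable
  finally show ?thesis .
 qed
 show ?thesis
 proof (rule that[OF Q])
  fix t :: real and x y :: 'a assume t: "0 < t"
  have "ck hk v K t x y \<le> (NN u. NN s. NN z. ennreal (kw s u) * (hk (t + s) x z * (v z * K u z y))
    + ennreal (kw s u) * ?E x y u s z
    + ennreal (kw s u) * ?L t x y u z)"
   unfolding ck_as_kw
  proof (rule nn_integral_mono, rule nn_integral_mono, rule nn_integral_mono_AE, use AE_neq_lborel[of x] in eventually_elim)
   fix u s :: real and z assume z: "z \<noteq> x"
   show "ennreal (kw s u) * (hk (t - u) x z * (v z * K u z y)) \<le> ennreal (kw s u) * (hk (t + s) x z * (v z * K u z y))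
    + ennreal (kw s u) * ?E x y u s z
    + ennreal (kw s u) * ?L t x y u z"
   proof (cases "s > 0 \<and> u > 0")
    case False
    then have "kw s u = 0" by (auto simp: kw_def)
    then show ?thesis by simp
   next
    case su: True
    have Kh: "v z * K u z y \<le> v z * hk u z y" by (intro mult_left_mono K_le) simp
    have "hk (t - u) x z * (v z * K u z y) \<le> hk (t + s) x z * (v z * K u z y) + ennreal (C1 * HH s u (x - z)) * (v z * hk u z y)
     + indicator {t/2..<t} u * hk (t - u) x z * (v z * hk u z y)"
    proof -
     \<comment> \<open>For u < t/2 the difference of heat kernels is at most a multiple of
       \<open>HH\<close>; for t/2 \<le> u < t the whole product goes into the late term; for u \<ge>
       t the kernel at time t - u vanishes.\<close>
     consider "2 * u < t" | "t/2 \<le> u" "u < t" | "t \<le> u" by linarith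
     then show ?thesis
     proof cases
      case 1
      have "heat (t - u) (x - z) \<le> heat (t + s) (x - z) + C1 * HH s u (x - z)"
       using C1(2)[of u s t "x - z"] su 1 z by auto
      then have "hk (t - u) x z \<le> hk (t + s) x z + ennreal (C1 * HH s u (x - z))"
       using 1 su C1(1) by (simp add: hk_def ennreal_leI flip: ennreal_plus)
      then have "hk (t - u) x z * (v z * K u z y) \<le> (hk (t + s) x z + ennreal (C1 * HH s u (x - z))) * (v z * K u z y)"
       by (rule mult_right_mono) simp
      also have "\<dots> \<le> hk (t + s) x z * (v z * K u z y) + ennreal (C1 * HH s u (x - z)) * (v z * hk u z y)"
       unfolding distrib_right by (rule add_left_mono, rule mult_left_mono[OF Kh], simp)
      finally show ?thesis by (rule add_increasing2[rotated]) simp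
     next
      case 2
      then have "hk (t - u) x z * (v z * K u z y) \<le> indicator {t/2..<t} u * hk (t - u) x z * (v z * hk u z y)"
       using Kh by (simp add: mult_left_mono)
      then show ?thesis by (rule add_increasing[rotated]) simp
     qed (simp add: hk_def)
    qed
    from mult_left_mono[OF this, of "ennreal (kw s u)"] show ?thesis by (simp add: distrib_left)
   qed
  qed
  also have "\<dots> = (NN u. NN s. NN z. ennreal (kw s u) * (hk (t + s) x z * (v z * K u z y)))
    + (NN u. NN s. NN z. ennreal (kw s u) * ?E x y u s z)
    + (NN u. NN s. NN z. ennreal (kw s u) * ?L t x y u z)"
   by (simp add: nn_integral_add)
  also have "\<dots> \<le> kprod (hk t) (TT hk K) x y + ennreal (7 * C1) * gg x y + ennreal C2 * ll x y"
   unfolding hk_TT[OF t] by (intro add_mono I1 I2 t order_refl)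
  finally show "ck hk v K t x y \<le> kprod (hk t) (TT hk K) x y + Q x y" by (simp add: Q_def add.assoc)
  have "kprod (hk t) (TT hk K) x y \<le> (NN u. NN s. NN z. ennreal (kw s u) * (hk (t - u) x z * (v z * K u z y))
    + ennreal (kw s u) * ?E x y u s z)"
   unfolding hk_TT[OF t]
  proof (rule nn_integral_mono, rule nn_integral_mono, rule nn_integral_mono_AE, use AE_neq_lborel[of x] in eventually_elim)
   fix u s :: real and z assume z: "z \<noteq> x"
   show "ennreal (kw s u) * (hk (t + s) x z * (v z * K u z y)) \<le> ennreal (kw s u) * (hk (t - u) x z * (v z * K u z y))
    + ennreal (kw s u) * ?E x y u s z"
   proof (cases "s > 0 \<and> u > 0")
    case False
    then have "kw s u = 0" by (auto simp: kw_def)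
    then show ?thesis by simp
   next
    case su: True
    have Kh: "v z * K u z y \<le> v z * hk u z y" by (intro mult_left_mono K_le) simp
    have "hk (t + s) x z \<le> hk (t - u) x z + ennreal (C1 * HH s u (x - z))"
    \<comment> \<open>In this direction no late term arises: for t \<le> 2u the kernel at time t + s
      is by itself at most a multiple of \<open>HH\<close>.\<close>
    proof (cases "2 * u < t")
     case True
     have "heat (t + s) (x - z) \<le> heat (t - u) (x - z) + C1 * HH s u (x - z)"
      using C1(2)[of u s t "x - z"] su True z by auto
     then show ?thesis
      using True su C1(1) by (simp add: hk_def ennreal_leI flip: ennreal_plus)
    next
     case False
     have "heat (t + s) (x - z) \<le> C1 * HH s u (x - z)"
      using C1(3)[of t s u "x - z"] su False z t by auto
     then have "hk (t + s) x z \<le> ennreal (C1 * HH s u (x - z))"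
      using t su by (simp add: hk_def ennreal_leI)
     then show ?thesis by (rule add_increasing[rotated]) simp
    qed
    then have "hk (t + s) x z * (v z * K u z y) \<le> (hk (t - u) x z + ennreal (C1 * HH s u (x - z))) * (v z * K u z y)"
     by (rule mult_right_mono) simp
    also have "\<dots> \<le> hk (t - u) x z * (v z * K u z y) + ennreal (C1 * HH s u (x - z)) * (v z * hk u z y)"
     unfolding distrib_right by (rule add_left_mono, rule mult_left_mono[OF Kh], simp)
    finally have "hk (t + s) x z * (v z * K u z y) \<le> hk (t - u) x z * (v z * K u z y) + ennreal (C1 * HH s u (x - z)) * (v z * hk u z y)" .
    from mult_left_mono[OF this, of "ennreal (kw s u)"] show ?thesis by (simp add: distrib_left)
   qed
  qed
  also have "\<dots> = ck hk v K t x y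
    + (NN u. NN s. NN z. ennreal (kw s u) * ?E x y u s z)"
   unfolding ck_as_kw by (simp add: nn_integral_add)
  also have "\<dots> \<le> ck hk v K t x y + ennreal (7 * C1) * gg x y"
   by (intro add_mono I1 order_refl)
  also have "\<dots> \<le> ck hk v K t x y + Q x y"
   unfolding Q_def by (intro add_left_mono) simp
  finally show "kprod (hk t) (TT hk K) x y \<le> ck hk v K t x y + Q x y" .
 qed
qed

end

section \<open>Test functions\<close>

text \<open>Differentiating exp (-1/t) produces powers of 1/t. With the index m the family is
  closed: the derivative of \<open>theta m\<close> combines \<open>theta (m + 2)\<close> and
  \<open>theta (m + 1)\<close>.\<close>

definition theta :: "nat \<Rightarrow> real \<Rightarrow> real" where
 "theta m t = (if 0 < t then exp (- 1 / t) / t ^ m else 0)"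

lemma theta_nonneg [simp]: "0 \<le> theta m t"
 by (simp add: theta_def)

text \<open>The term of order m + 1 in the series of exp (1/t) beats the pole t^(-m) by one power of
  t. Applied to m + 1, this gives the derivative 0 at the origin.\<close>

lemma theta_bound: "0 < t \<Longrightarrow> theta m t \<le> fact (m + 1) * t"
proof -
 assume t: "0 < t"
 have "(1 / t) ^ (m + 1) / fact (m + 1) \<le> exp (1 / t)"
 proof -
  have "summable (\<lambda>n. (1 / t) ^ n /\<^sub>R fact n)" by (rule sums_summable[OF exp_converges])
  then have "sum (\<lambda>n. (1 / t) ^ n /\<^sub>R fact n) {m + 1} \<le> (\<Sum>n. (1 / t) ^ n /\<^sub>R fact n)"
   using t by (intro sum_le_suminf) auto
  then have "(1 / t) ^ (m + 1) /\<^sub>R fact (m + 1) \<le> exp (1 / t)" by (simp add: exp_def)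
  then show ?thesis by (simp only: scaleR_conv_of_real of_real_inverse of_real_eq_id id_apply divide_inverse mult.commute)
 qed
 then have "(1 / t) ^ (m + 1) \<le> fact (m + 1) * exp (1 / t)"
  by (simp only: pos_divide_le_eq[OF fact_gt_zero] mult.commute)
 then have "(1 / t) ^ (m + 1) * t ^ (m + 1) \<le> fact (m + 1) * exp (1 / t) * t ^ (m + 1)"
  by (rule mult_right_mono) (use t in simp)
 moreover have "(1 / t) ^ (m + 1) * t ^ (m + 1) = 1"
  unfolding power_mult_distrib[symmetric] using t by simp
 moreover have "t ^ (m + 1) = t ^ m * t" by simp
 ultimately have "1 \<le> fact (m + 1) * exp (1 / t) * (t ^ m * t)" by (simp only:)
 then have "exp (- 1 / t) * 1 \<le> exp (- 1 / t) * (fact (m + 1) * exp (1 / t) * (t ^ m * t))"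
  by (intro mult_left_mono) auto
 also have "\<dots> = fact (m + 1) * t * t ^ m"
 proof -
  have "exp (- 1 / t) * exp (1 / t) = 1" by (simp flip: exp_add)
  then have "exp (- 1 / t) * (F * exp (1 / t) * (A * t)) = F * t * A" for F A
   by (metis (no_types, opaque_lifting) mult.assoc mult.commute mult_1)
  then show ?thesis .
 qed
 finally have "exp (- 1 / t) \<le> fact (m + 1) * t * t ^ m" by simp
 then show ?thesis using t by (simp add: theta_def divide_le_eq del: fact_Suc)
qed

lemma theta_deriv: "(theta m has_real_derivative (theta (m + 2) t - real m * theta (m + 1) t)) (at t)"
proof -
 consider "t < 0" | "t = 0" | "t > 0" by linarith
 then show ?thesis
 proof cases
  case 1
  have "((\<lambda>_. 0) has_real_derivative 0) (at t)" by simp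
  moreover have "eventually (\<lambda>s. theta m s = 0) (nhds t)"
   using eventually_nhds_in_open[of "{..<0}" t] 1 by (auto elim!: eventually_mono simp: theta_def)
  ultimately have "(theta m has_real_derivative 0) (at t)"
   by (subst DERIV_cong_ev[OF refl _ refl, of _ "\<lambda>_. 0"]) auto
  then show ?thesis using 1 by (simp add: theta_def)
 next
  case 2
  have le: "\<bar>theta m h / h\<bar> \<le> fact (m + 2) * \<bar>h\<bar>" if "h \<noteq> 0" for h
  proof (cases "h > 0")
   case True
   have "theta m h / h = theta (m + 1) h" using True by (simp add: theta_def)
   also have "\<dots> \<le> fact (m + 1 + 1) * h" by (rule theta_bound[OF True])
   finally show ?thesis using True by (simp del: fact_Suc)
  next
   case False
   then have "theta m h = 0" by (simp add: theta_def)
   then show ?thesis by (simp del: fact_Suc)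
  qed
  have "((\<lambda>h. theta m h / h) \<longlongrightarrow> 0) (at 0)"
  proof (rule Lim_null_comparison)
   show "eventually (\<lambda>h. norm (theta m h / h) \<le> fact (m + 2) * \<bar>h\<bar>) (at 0)"
    unfolding eventually_at_filter by (rule always_eventually) (use le in auto)
   show "((\<lambda>h::real. fact (m + 2) * \<bar>h\<bar>) \<longlongrightarrow> 0) (at 0)" by (auto intro!: tendsto_eq_intros)
  qed
  then show ?thesis using 2 by (simp add: DERIV_def theta_def[of _ 0])
 next
  case 3
  have "((\<lambda>s. exp (- 1 / s) / s ^ m) has_real_derivative (theta (m + 2) t - real m * theta (m + 1) t)) (at t)"
  proof -
   have d1: "((\<lambda>s. exp (- 1 / s)) has_real_derivative exp (- 1 / t) * (1 / t\<^sup>2)) (at t)"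
   proof -
    have "((\<lambda>s. - 1 / s) has_real_derivative 1 / t\<^sup>2) (at t)"
     using 3 by (auto intro!: derivative_eq_intros simp: power2_eq_square)
    from DERIV_chain2[OF DERIV_exp this] show ?thesis .
   qed
   have d2: "((\<lambda>s. s ^ m) has_real_derivative real m * t ^ (m - 1)) (at t)"
    using DERIV_pow[of m t] by simp
   have "((\<lambda>s. exp (- 1 / s) / s ^ m) has_real_derivative
     (exp (- 1 / t) * (1 / t\<^sup>2) * t ^ m - exp (- 1 / t) * (real m * t ^ (m - 1))) / (t ^ m * t ^ m)) (at t)"
    using 3 by (intro DERIV_divide d1 d2) auto
   also have "(exp (- 1 / t) * (1 / t\<^sup>2) * t ^ m - exp (- 1 / t) * (real m * t ^ (m - 1))) / (t ^ m * t ^ m)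
     = theta (m + 2) t - real m * theta (m + 1) t"
   proof (cases m)
    case 0 then show ?thesis using 3 by (simp add: theta_def power2_eq_square)
   next
    case (Suc k)
    have "(E * (1 / t\<^sup>2) * P - E * (r * Q)) / (P * P) = E / (P * t\<^sup>2) - r * (E / (P * t))" if "P = Q * t" "Q > 0" for E P Q r :: real
     using 3 that by (simp add: field_simps power2_eq_square)
    from this[of "t ^ m" "t ^ (m - 1)" "exp (- 1 / t)" "real m"] show ?thesis
     using 3 Suc by (simp add: theta_def power_add power2_eq_square mult_ac)
   qed
   finally show ?thesis .
  qed
  moreover have "eventually (\<lambda>s. theta m s = exp (- 1 / s) / s ^ m) (nhds t)"
   using eventually_nhds_in_open[of "{0<..}" t] 3 by (auto elim!: eventually_mono simp: theta_def)
  ultimately show ?thesis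
   by (subst DERIV_cong_ev[OF refl _ refl, of _ "\<lambda>s. exp (- 1 / s) / s ^ m"]) auto
 qed
qed

lemma theta_0_le_1: "theta 0 t \<le> 1"
 by (simp add: theta_def)

text \<open>A class of functions closed under differentiation that contains the cut-off functions of boxes.\<close>
inductive_set SF :: "('a::euclidean_space \<Rightarrow> real) set" where
 SF_theta: "(\<lambda>x. theta m (\<alpha> + x \<bullet> u)) \<in> SF"
| SF_const: "(\<lambda>x. c) \<in> SF"
| SF_add: "f \<in> SF \<Longrightarrow> g \<in> SF \<Longrightarrow> (\<lambda>x. f x + g x) \<in> SF"
| SF_mult: "f \<in> SF \<Longrightarrow> g \<in> SF \<Longrightarrow> (\<lambda>x. f x * g x) \<in> SF"

lemma SF_has_derivative:
 "f \<in> SF \<Longrightarrow> \<exists>f'. (\<forall>x. (f has_derivative f' x) (at x)) \<and> (\<forall>v. (\<lambda>x. f' x v) \<in> SF)"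
proof (induction rule: SF.induct)
 case (SF_theta m \<alpha> u)
 let ?D = "\<lambda>x. theta (m + 2) (\<alpha> + x \<bullet> u) - real m * theta (m + 1) (\<alpha> + x \<bullet> u)"
 have A: "((\<lambda>x. theta m (\<alpha> + x \<bullet> u)) has_derivative (\<lambda>v. ?D x * (v \<bullet> u))) (at x)" for x
 proof -
  have 1: "((\<lambda>x. \<alpha> + x \<bullet> u) has_derivative (\<lambda>v. v \<bullet> u)) (at x)" by (auto intro!: derivative_eq_intros)
  have 2: "(theta m has_derivative (\<lambda>h. ?D x * h)) (at (\<alpha> + x \<bullet> u))"
   using theta_deriv[of m "\<alpha> + x \<bullet> u"] by (simp add: has_field_derivative_def)
  show ?thesis using has_derivative_compose[OF 1 2] by simp
 qed
 have B: "(\<lambda>x. ?D x * (v \<bullet> u)) \<in> SF" for v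
 proof -
  have "(\<lambda>x. (theta (m + 2) (\<alpha> + x \<bullet> u) + (- real m) * theta (m + 1) (\<alpha> + x \<bullet> u)) * (v \<bullet> u)) \<in> SF"
   by (intro SF.intros)
  then show ?thesis by simp
 qed
 show ?case by (intro exI[of _ "\<lambda>x v. ?D x * (v \<bullet> u)"] conjI allI A B)
next
 case (SF_const c)
 show ?case by (rule exI[of _ "\<lambda>x v. 0"]) (auto intro: SF.intros)
next
 case (SF_add f g)
 then obtain f' g' where "\<forall>x. (f has_derivative f' x) (at x)" "\<forall>v. (\<lambda>x. f' x v) \<in> SF"
  "\<forall>x. (g has_derivative g' x) (at x)" "\<forall>v. (\<lambda>x. g' x v) \<in> SF" by blast
 then show ?case
  by (intro exI[of _ "\<lambda>x v. f' x v + g' x v"]) (auto intro!: SF.intros has_derivative_add)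
next
 case (SF_mult f g)
 then obtain f' g' where "\<forall>x. (f has_derivative f' x) (at x)" "\<forall>v. (\<lambda>x. f' x v) \<in> SF"
  "\<forall>x. (g has_derivative g' x) (at x)" "\<forall>v. (\<lambda>x. g' x v) \<in> SF" by blast
 then show ?case using SF_mult
  by (intro exI[of _ "\<lambda>x v. f x * g' x v + f' x v * g x"]) (auto intro!: SF.intros has_derivative_mult)
qed

lemma SF_iter_deriv: "f \<in> SF \<Longrightarrow> iter_deriv vs f \<in> SF"
proof (induction vs)
 case (Cons v vs)
 then obtain f' where f': "\<forall>x. (iter_deriv vs f has_derivative f' x) (at x)" "\<forall>v. (\<lambda>x. f' x v) \<in> SF"
  using SF_has_derivative by blast
 then have "frechet_derivative (iter_deriv vs f) (at x) = f' x" for x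
  by (intro frechet_derivative_at[symmetric]) auto
 then show ?case using f' by simp
qed simp

lemma SF_smooth: "f \<in> SF \<Longrightarrow> smooth_fun f"
 unfolding smooth_fun_def differentiable_def
 using SF_iter_deriv SF_has_derivative by blast

text \<open>Smoothness in terms of iterated Frechet derivatives is awkward under sums and products;
  in \<open>SF\<close> it is built in. Density is proved for this subclass, which suffices for all
  test functions.\<close>

definition TF :: "('a::euclidean_space \<Rightarrow> real) set" where
 "TF = {f \<in> SF. compact (closure {x. f x \<noteq> 0})}"

lemma TF_test: "f \<in> TF \<Longrightarrow> test_fun f"
 by (simp add: TF_def test_fun_def SF_smooth)

lemma SF_continuous: "f \<in> SF \<Longrightarrow> continuous_on UNIV f"
 using SF_has_derivative[of f] by (auto simp: continuous_on_eq_continuous_at intro: has_derivative_continuous)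

lemma test_fun_continuous: "test_fun f \<Longrightarrow> continuous_on UNIV f"
 unfolding test_fun_def smooth_fun_def
 by (metis continuous_on_eq_continuous_at differentiable_imp_continuous_within iter_deriv.simps(1) open_UNIV)

lemma TF_add: "f \<in> TF \<Longrightarrow> g \<in> TF \<Longrightarrow> (\<lambda>x. f x + g x) \<in> TF"
proof -
 assume f: "f \<in> TF" and g: "g \<in> TF"
 have "closure {x. f x + g x \<noteq> 0} \<subseteq> closure {x. f x \<noteq> 0} \<union> closure {x. g x \<noteq> 0}"
  unfolding closure_Un[symmetric] by (intro closure_mono) auto
 moreover have "compact (closure {x. f x \<noteq> 0} \<union> closure {x. g x \<noteq> 0})"
  using f g by (intro compact_Un) (auto simp: TF_def)
 ultimately have "compact (closure {x. f x + g x \<noteq> 0})"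
  using compact_Int_closed[of "closure {x. f x \<noteq> 0} \<union> closure {x. g x \<noteq> 0}" "closure {x. f x + g x \<noteq> 0}"]
  by (simp add: Int_absorb1)
 then show ?thesis using f g by (auto simp: TF_def intro: SF.intros)
qed

lemma TF_scale: "f \<in> TF \<Longrightarrow> (\<lambda>x. c * f x) \<in> TF"
proof -
 assume f: "f \<in> TF"
 have "closure {x. c * f x \<noteq> 0} \<subseteq> closure {x. f x \<noteq> 0}"
  by (intro closure_mono) auto
 then have "compact (closure {x. c * f x \<noteq> 0})"
  using compact_Int_closed[of "closure {x. f x \<noteq> 0}" "closure {x. c * f x \<noteq> 0}"] f
  by (simp add: Int_absorb1 TF_def)
 then show ?thesis using f by (auto simp: TF_def intro: SF.intros)
qed

text \<open>As n grows each factor tends to exp 0 = 1 inside the box and stays 0 outside, so these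
  functions approximate the indicator of the open box from below.\<close>

definition chi :: "nat \<Rightarrow> 'a::euclidean_space \<Rightarrow> 'a \<Rightarrow> 'a \<Rightarrow> real" where
 "chi n a b x = (\<Prod>i\<in>Basis. theta 0 (real (Suc n) * (x \<bullet> i - a \<bullet> i)) * theta 0 (real (Suc n) * (b \<bullet> i - x \<bullet> i)))"

lemma SF_prod: "finite I \<Longrightarrow> (\<And>i. i \<in> I \<Longrightarrow> f i \<in> SF) \<Longrightarrow> (\<lambda>x. \<Prod>i\<in>I. f i x) \<in> SF"
proof (induction I rule: finite_induct)
 case empty show ?case using SF_const[of 1] by simp
next
 case (insert i I)
 then have "(\<lambda>x. f i x * (\<Prod>i\<in>I. f i x)) \<in> SF" by (intro SF_mult) auto
 then show ?case using insert by simp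
qed

lemma chi_SF: "chi n a b \<in> SF"
proof -
 have "(\<lambda>x. theta 0 (real (Suc n) * (x \<bullet> i - a \<bullet> i)) * theta 0 (real (Suc n) * (b \<bullet> i - x \<bullet> i))) \<in> SF" for i
 proof -
  have "(\<lambda>x. theta 0 (- real (Suc n) * (a \<bullet> i) + x \<bullet> (real (Suc n) *\<^sub>R i)) * theta 0 (real (Suc n) * (b \<bullet> i) + x \<bullet> ((- real (Suc n)) *\<^sub>R i))) \<in> SF"
   by (intro SF_mult SF_theta)
  then show ?thesis by (simp add: right_diff_distrib algebra_simps)
 qed
 then show ?thesis unfolding chi_def by (intro SF_prod) auto
qed

lemma chi_range: "0 \<le> chi n a b x" "chi n a b x \<le> 1"
proof -
 show "0 \<le> chi n a b x" unfolding chi_def by (intro prod_nonneg) auto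
 have "theta 0 s * theta 0 r \<le> 1" for s r
  using mult_mono[OF theta_0_le_1[of s] theta_0_le_1[of r]] by simp
 then show "chi n a b x \<le> 1" unfolding chi_def by (intro prod_le_1) auto
qed

lemma chi_outside: "x \<notin> box a b \<Longrightarrow> chi n a b x = 0"
proof -
 assume "x \<notin> box a b"
 then obtain i where i: "i \<in> Basis" "x \<bullet> i \<le> a \<bullet> i \<or> b \<bullet> i \<le> x \<bullet> i"
  by (auto simp: mem_box not_less)
 then have "theta 0 (real (Suc n) * (x \<bullet> i - a \<bullet> i)) * theta 0 (real (Suc n) * (b \<bullet> i - x \<bullet> i)) = 0"
  by (auto simp: theta_def zero_less_mult_iff)
 then show ?thesis using i(1) unfolding chi_def by (intro prod_zero) auto
qed

lemma chi_TF: "chi n a b \<in> TF"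
proof -
 have "closure {x. chi n a b x \<noteq> 0} \<subseteq> closure (box a b)"
  using chi_outside by (intro closure_mono) auto
 also have "\<dots> \<subseteq> cbox a b" by (intro closure_minimal box_subset_cbox closed_cbox)
 finally have "compact (closure {x. chi n a b x \<noteq> 0})"
  using compact_Int_closed[of "cbox a b" "closure {x. chi n a b x \<noteq> 0}"] by (simp add: Int_absorb1)
 then show ?thesis by (simp add: TF_def chi_SF)
qed

lemma lim_1_over_Suc: "(\<lambda>n. 1 / real (Suc n)) \<longlonglongrightarrow> 0"
 using LIMSEQ_inverse_real_of_nat by (simp add: inverse_eq_divide)

lemma chi_tendsto: "(\<lambda>n. chi n a b x) \<longlonglongrightarrow> indicator (box a b) x"
proof (cases "x \<in> box a b")
 case False then show ?thesis by (simp add: chi_outside)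
next
 case True
 have th: "(\<lambda>n. theta 0 (real (Suc n) * r)) \<longlonglongrightarrow> 1" if "r > 0" for r
 proof -
  have "(\<lambda>n. - 1 / (real (Suc n) * r)) \<longlonglongrightarrow> 0"
  proof -
   have "(\<lambda>n. (- 1 / r) * (1 / real (Suc n))) \<longlonglongrightarrow> (- 1 / r) * 0"
    by (intro tendsto_mult tendsto_const lim_1_over_Suc)
   then show ?thesis by (simp add: field_simps)
  qed
  from tendsto_exp[OF this] show ?thesis using that by (simp add: theta_def)
 qed
 have "(\<lambda>n. chi n a b x) \<longlonglongrightarrow> (\<Prod>i\<in>(Basis :: 'a set). 1 * 1)"
  unfolding chi_def
 proof (rule tendsto_prod)
  fix i :: 'a assume "i \<in> Basis"
  then have "x \<bullet> i - a \<bullet> i > 0" "b \<bullet> i - x \<bullet> i > 0" using True by (auto simp: mem_box)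
  then show "(\<lambda>n. theta 0 (real (Suc n) * (x \<bullet> i - a \<bullet> i)) * theta 0 (real (Suc n) * (b \<bullet> i - x \<bullet> i))) \<longlonglongrightarrow> 1 * 1"
   by (intro tendsto_mult th)
 qed
 then show ?thesis using True by simp
qed

lemma test_fun_measurable: "test_fun f \<Longrightarrow> f \<in> borel_measurable borel"
 by (intro borel_measurable_continuous_onI test_fun_continuous)

lemma test_fun_zero_outside: "test_fun f \<Longrightarrow> \<exists>R\<ge>1. \<forall>x. norm x > R \<longrightarrow> f x = 0"
proof -
 assume "test_fun f"
 then have "bounded (closure {x. f x \<noteq> 0})" by (simp add: test_fun_def compact_imp_bounded)
 then obtain B where B: "\<forall>x\<in>closure {x. f x \<noteq> 0}. norm x \<le> B" by (auto simp: bounded_iff)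
 then have "\<forall>x. norm x > max 1 B \<longrightarrow> f x = 0"
  using closure_subset[of "{x. f x \<noteq> 0}"] by (metis (mono_tags, lifting) max_less_iff_conj mem_Collect_eq not_less subset_iff)
 then show ?thesis by (intro exI[of _ "max 1 B"]) auto
qed

lemma test_fun_bounded: "test_fun f \<Longrightarrow> \<exists>B\<ge>0. \<forall>x. \<bar>f x\<bar> \<le> B"
proof -
 assume f: "test_fun f"
 have "compact (f ` closure {x. f x \<noteq> 0})"
  using f by (intro compact_continuous_image continuous_on_subset[OF test_fun_continuous]) (auto simp: test_fun_def)
 then have "bounded (f ` closure {x. f x \<noteq> 0})" by (rule compact_imp_bounded)
 then obtain B where B: "\<forall>x\<in>closure {x. f x \<noteq> 0}. \<bar>f x\<bar> \<le> B" by (auto simp: bounded_iff)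
 have "\<bar>f x\<bar> \<le> max 0 B" for x
 proof (cases "f x = 0")
  case False
  then have "x \<in> closure {x. f x \<noteq> 0}" using closure_subset[of "{x. f x \<noteq> 0}"] by auto
  then show ?thesis using B by auto
 qed simp
 then show ?thesis by (intro exI[of _ "max 0 B"]) auto
qed

lemma test_fun_integrable: "test_fun f \<Longrightarrow> integrable lborel f"
proof -
 assume f: "test_fun f"
 have "integrable lborel (\<lambda>x. indicator (closure {x. f x \<noteq> 0}) x *\<^sub>R f x)"
  using f borel_integrable_compact[of "closure {x. f x \<noteq> 0}" f] continuous_on_subset[OF test_fun_continuous[OF f]]
  by (auto simp: test_fun_def)
 moreover have eq: "indicator (closure {x. f x \<noteq> 0}) x *\<^sub>R f x = f x" for x
  using closure_subset[of "{x. f x \<noteq> 0}"] by (auto simp: indicator_def)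
 ultimately show ?thesis by (simp only: eq)
qed

lemma integrable_mult_test_fun:
 assumes g: "integrable lborel g" and \<phi>: "test_fun \<phi>"
 shows "integrable lborel (\<lambda>x. g x * \<phi> x)"
proof -
 obtain m where m: "\<And>x. \<bar>\<phi> x\<bar> \<le> m" using test_fun_bounded[OF \<phi>] by blast
 show ?thesis
  by (rule Bochner_Integration.integrable_bound[OF integrable_mult_right[OF integrable_abs[OF g], of m]])
   (use borel_measurable_integrable[OF g] test_fun_measurable[OF \<phi>] in \<open>auto simp: abs_mult mult.commute[of m] intro!: AE_I2 mult_left_mono order_trans[OF m abs_ge_self]\<close>)
qed

section \<open>Density of test functions in L^1, and separation by them\<close>

definition L1cl :: "('a::euclidean_space \<Rightarrow> real) set" where
 "L1cl = {f. integrable lborel f \<and> (\<forall>e>0. \<exists>g\<in>TF. (LINT x|lborel. \<bar>f x - g x\<bar>) < e)}"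

lemma TF_integrable: "f \<in> TF \<Longrightarrow> integrable lborel f"
 using TF_test test_fun_integrable by blast

lemma L1cl_add: "f \<in> L1cl \<Longrightarrow> g \<in> L1cl \<Longrightarrow> (\<lambda>x. f x + g x) \<in> L1cl"
proof -
 assume f: "f \<in> L1cl" and g: "g \<in> L1cl"
 then have i: "integrable lborel f" "integrable lborel g" by (auto simp: L1cl_def)
 have "\<exists>h\<in>TF. (LINT x|lborel. \<bar>f x + g x - h x\<bar>) < e" if e: "e > 0" for e
 proof -
  obtain f1 where f1: "f1 \<in> TF" "(LINT x|lborel. \<bar>f x - f1 x\<bar>) < e / 2"
   using f e unfolding L1cl_def by (auto dest!: spec[of _ "e/2"])
  obtain g1 where g1: "g1 \<in> TF" "(LINT x|lborel. \<bar>g x - g1 x\<bar>) < e / 2"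
   using g e unfolding L1cl_def by (auto dest!: spec[of _ "e/2"])
  note i' = TF_integrable[OF f1(1)] TF_integrable[OF g1(1)]
  have "(LINT x|lborel. \<bar>f x + g x - (f1 x + g1 x)\<bar>) \<le> (LINT x|lborel. \<bar>f x - f1 x\<bar> + \<bar>g x - g1 x\<bar>)"
   using i i' by (intro integral_mono) auto
  also have "\<dots> = (LINT x|lborel. \<bar>f x - f1 x\<bar>) + (LINT x|lborel. \<bar>g x - g1 x\<bar>)"
   using i i' by (intro Bochner_Integration.integral_add) auto
  also have "\<dots> < e" using f1(2) g1(2) by simp
  finally show ?thesis by (rule bexI[OF _ TF_add[OF f1(1) g1(1)]])
 qed
 then show ?thesis using i by (auto simp: L1cl_def)
qed

lemma L1cl_scale: "f \<in> L1cl \<Longrightarrow> (\<lambda>x. c * f x) \<in> L1cl"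
proof -
 assume f: "f \<in> L1cl"
 then have i: "integrable lborel f" by (auto simp: L1cl_def)
 have "\<exists>h\<in>TF. (LINT x|lborel. \<bar>c * f x - h x\<bar>) < e" if e: "e > 0" for e
 proof -
  obtain f1 where f1: "f1 \<in> TF" "(LINT x|lborel. \<bar>f x - f1 x\<bar>) < e / (\<bar>c\<bar> + 1)"
   using f e unfolding L1cl_def by (auto dest!: spec[of _ "e/(\<bar>c\<bar> + 1)"])
  have "(LINT x|lborel. \<bar>c * f x - c * f1 x\<bar>) = \<bar>c\<bar> * (LINT x|lborel. \<bar>f x - f1 x\<bar>)"
   by (simp add: abs_mult flip: right_diff_distrib)
  also have "\<dots> \<le> \<bar>c\<bar> * (e / (\<bar>c\<bar> + 1))" using f1(2) by (intro mult_left_mono) auto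
  also have "\<dots> < e" using that by (simp add: field_simps)
  finally show ?thesis by (rule bexI[OF _ TF_scale[OF f1(1)]])
 qed
 then show ?thesis using i by (auto simp: L1cl_def)
qed

lemma L1cl_limit:
 assumes f: "integrable lborel f" and s: "\<And>n. s n \<in> L1cl" and lim: "(\<lambda>n. LINT x|lborel. \<bar>f x - s n x\<bar>) \<longlonglongrightarrow> 0"
 shows "f \<in> L1cl"
proof -
 have "\<exists>h\<in>TF. (LINT x|lborel. \<bar>f x - h x\<bar>) < e" if e: "e > 0" for e
 proof -
  have "eventually (\<lambda>n. (LINT x|lborel. \<bar>f x - s n x\<bar>) < e / 2) sequentially"
   using lim that by (intro order_tendstoD(2)) auto
  then obtain n where n: "(LINT x|lborel. \<bar>f x - s n x\<bar>) < e / 2"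
   by (auto simp: eventually_sequentially)
  obtain g where g: "g \<in> TF" "(LINT x|lborel. \<bar>s n x - g x\<bar>) < e / 2"
   using s[of n] e unfolding L1cl_def by (auto dest!: spec[of _ "e/2"])
  have i: "integrable lborel (s n)" "integrable lborel g" using s[of n] TF_integrable[OF g(1)] by (auto simp: L1cl_def)
  have "(LINT x|lborel. \<bar>f x - g x\<bar>) \<le> (LINT x|lborel. \<bar>f x - s n x\<bar> + \<bar>s n x - g x\<bar>)"
   using i f by (intro integral_mono) auto
  also have "\<dots> = (LINT x|lborel. \<bar>f x - s n x\<bar>) + (LINT x|lborel. \<bar>s n x - g x\<bar>)"
   using i f by (intro Bochner_Integration.integral_add) auto
  also have "\<dots> < e" using n g(2) by simp
  finally show ?thesis using g by blast
 qed
 then show ?thesis using f by (auto simp: L1cl_def)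
qed

lemma L1_tendsto_dominated:
 fixes f w :: "'a::euclidean_space \<Rightarrow> real"
 assumes w: "integrable lborel w" and sm: "\<And>n. s n \<in> borel_measurable lborel" and fm: "f \<in> borel_measurable lborel"
  and lim: "\<And>x. (\<lambda>n. s n x) \<longlonglongrightarrow> f x" and b: "\<And>n x. \<bar>s n x\<bar> \<le> w x"
 shows "(\<lambda>n. LINT x|lborel. \<bar>f x - s n x\<bar>) \<longlonglongrightarrow> 0"
proof -
 have bf: "\<bar>f x\<bar> \<le> w x" for x
  by (rule LIMSEQ_le_const2[OF tendsto_rabs[OF lim]]) (auto simp: b)
 have "(\<lambda>n. LINT x|lborel. \<bar>f x - s n x\<bar>) \<longlonglongrightarrow> (LINT x|(lborel :: 'a measure). 0)"
 proof (rule integral_dominated_convergence[where w = "\<lambda>x. 2 * w x"])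
  show "AE x in lborel. (\<lambda>n. \<bar>f x - s n x\<bar>) \<longlonglongrightarrow> 0"
  proof (rule AE_I2)
   fix x
   have "(\<lambda>n. \<bar>f x - s n x\<bar>) \<longlonglongrightarrow> \<bar>f x - f x\<bar>" by (intro tendsto_intros lim)
   then show "(\<lambda>n. \<bar>f x - s n x\<bar>) \<longlonglongrightarrow> 0" by simp
  qed
  show "AE x in lborel. norm \<bar>f x - s n x\<bar> \<le> 2 * w x" for n
  proof (rule AE_I2)
   fix x
   show "norm \<bar>f x - s n x\<bar> \<le> 2 * w x" using bf[of x] b[of n x] by simp
  qed
 qed (use w sm fm in auto)
 then show ?thesis by simp
qed

lemma box_integrable: "integrable lborel (indicator (box a b) :: 'a::euclidean_space \<Rightarrow> real)"
 by (intro integrable_real_indicator) (auto simp: emeasure_lborel_box_eq)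

lemma L1cl_box: "(indicator (box a b) :: 'a::euclidean_space \<Rightarrow> real) \<in> L1cl"
proof (rule L1cl_limit[OF box_integrable])
 show "chi n a b \<in> L1cl" for n
  using chi_TF[of n a b] TF_integrable[OF chi_TF[of n a b]] unfolding L1cl_def by (auto intro!: bexI[of _ "chi n a b"])
 show "(\<lambda>n. LINT x|lborel. \<bar>indicator (box a b) x - chi n a b x\<bar>) \<longlonglongrightarrow> 0"
 proof (rule L1_tendsto_dominated[OF box_integrable[of a b]])
  show "\<bar>chi n a b x\<bar> \<le> indicator (box a b) x" for n x
   using chi_range[of n a b x] chi_outside[of x a b n] by (auto simp: indicator_def)
 qed (auto intro: chi_tendsto borel_measurable_continuous_onI SF_continuous chi_SF)
qed

lemma box_Int_ex: "\<exists>c d. box a b \<inter> box a' b' = box c (d::'a::euclidean_space)"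
 using box_Int_box[of a b a' b'] by blast

text \<open>Boxes are stable under intersection and generate the Borel sets, so complements and
  disjoint countable unions suffice.\<close>

lemma borel_box_induct [consumes 1, case_names box empty compl union]:
 fixes A :: "'a::euclidean_space set"
 assumes A: "A \<in> sets borel"
  and "\<And>a b. P (box a b)" "P {}" "\<And>A. A \<in> sets borel \<Longrightarrow> P A \<Longrightarrow> P (- A)"
  "\<And>F. disjoint_family F \<Longrightarrow> range F \<subseteq> sets borel \<Longrightarrow> (\<And>i::nat. P (F i)) \<Longrightarrow> P (\<Union>i. F i)"
 shows "P A"
proof -
 let ?G = "range (\<lambda>(a, b). box a b :: 'a set)"
 have s: "sets borel = sigma_sets UNIV ?G" by (subst borel_eq_box) simp
 have "Int_stable ?G"
  unfolding Int_stable_def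
 proof (intro ballI)
  fix X Y assume "X \<in> ?G" "Y \<in> ?G"
  then obtain a b a' b' where "X = box a b" "Y = box a' b'" by auto
  then obtain c d where "X \<inter> Y = box c d" using box_Int_ex by metis
  then show "X \<inter> Y \<in> ?G" by (auto intro: image_eqI[of _ _ "(c, d)"])
 qed
 moreover have "?G \<subseteq> Pow UNIV" by simp
 moreover have "A \<in> sigma_sets UNIV ?G" using A s by simp
 ultimately show ?thesis
 proof (induction rule: sigma_sets_induct_disjoint)
  case (compl A) then show ?case using assms(4)[of A] s by (simp add: Compl_eq_Diff_UNIV)
 next
  case (union F) then show ?case using assms(5)[of F] s by auto
 qed (use assms in auto)
qed

text \<open>Intersecting with a fixed box keeps all indicators integrable, so that the complement
  step is a difference of two integrable functions; the box is removed later by exhausting the space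
  with cubes.\<close>

lemma L1cl_indicator_Int_box:
 assumes "A \<in> sets borel"
 shows "(indicator (A \<inter> box c d) :: 'a::euclidean_space \<Rightarrow> real) \<in> L1cl"
 using assms
proof (induction rule: borel_box_induct)
 case (box a b)
 obtain a' b' where "box a b \<inter> box c d = box a' b'" using box_Int_ex by blast
 then show ?case using L1cl_box[of a' b'] by simp
next
 case empty
 show ?case using L1cl_scale[OF L1cl_box[of c d], of 0] by (simp add: indicator_def)
next
 case (compl A)
 have "(\<lambda>x. indicator (box c d) x + (-1) * indicator (A \<inter> box c d) x) \<in> (L1cl :: ('a \<Rightarrow> real) set)"
  by (intro L1cl_add L1cl_scale L1cl_box compl)
 moreover have "indicator (box c d) x + (-1) * indicator (A \<inter> box c d) x = (indicator (- A \<inter> box c d) x :: real)" for x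
  by (auto simp: indicator_def)
 ultimately show ?case by simp
next
 case (union F)
 define s where "s n x = (\<Sum>i<n. indicator (F i \<inter> box c d) x :: real)" for n x
 have s: "s n x = indicator ((\<Union>i<n. F i) \<inter> box c d) x" for n x
 proof -
  have "disjoint_family_on (\<lambda>i. F i \<inter> box c d) {..<n}" using union(1) by (auto simp: disjoint_family_on_def)
  then have "s n x = indicator (\<Union>i<n. F i \<inter> box c d) x"
   unfolding s_def by (intro indicator_UN_disjoint[symmetric]) auto
  moreover have "(\<Union>i<n. F i \<inter> box c d) = (\<Union>i<n. F i) \<inter> box c d" by auto
  ultimately show ?thesis by simp
 qed
 have sL: "s n \<in> L1cl" for n
 proof (induction n)
  case 0 show ?case using L1cl_scale[OF L1cl_box[of c d], of 0] by (simp add: s_def[abs_def])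
 next
  case (Suc n)
  then have "(\<lambda>x. s n x + indicator (F n \<inter> box c d) x) \<in> L1cl" by (intro L1cl_add union)
  then show ?case by (simp add: s_def[abs_def])
 qed
 have m: "(\<Union>i. F i) \<in> sets borel" using union(2) by auto
 show ?case
 proof (rule L1cl_limit)
  show "integrable lborel (indicator ((\<Union>i. F i) \<inter> box c d) :: 'a \<Rightarrow> real)"
   by (rule Bochner_Integration.integrable_bound[OF box_integrable[of c d]]) (use m in \<open>auto simp: indicator_def\<close>)
  show "(\<lambda>n. LINT x|lborel. \<bar>indicator ((\<Union>i. F i) \<inter> box c d) x - s n x\<bar>) \<longlonglongrightarrow> 0"
  proof (rule L1_tendsto_dominated[OF box_integrable[of c d]])
   show "s n \<in> borel_measurable lborel" for n unfolding s_def using union(2) by (intro borel_measurable_sum) auto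
   show "(\<lambda>n. s n x) \<longlonglongrightarrow> indicator ((\<Union>i. F i) \<inter> box c d) x" for x
   proof -
    have "(\<lambda>n. indicator (\<Union>i<n. F i) x :: real) \<longlonglongrightarrow> indicator (\<Union>i. F i) x"
     by (rule LIMSEQ_indicator_UN)
    from tendsto_mult[OF this tendsto_const[of "indicator (box c d) x"]] show ?thesis
     unfolding s by (simp add: indicator_inter_arith)
   qed
   show "\<bar>s n x\<bar> \<le> indicator (box c d) x" for n x unfolding s by (auto simp: indicator_def)
  qed (use m in auto)
 qed (rule sL)
qed

definition cube :: "nat \<Rightarrow> 'a::euclidean_space set" where "cube k = box (- (real k *\<^sub>R One)) (real k *\<^sub>R One)"

lemma cube_lim: "(\<lambda>k. indicator (cube k) x :: real) \<longlonglongrightarrow> 1"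
proof -
 obtain N :: nat where N: "norm (x::'a) < real N" using reals_Archimedean2 by blast
 have "x \<in> cube k" if "k \<ge> N" for k
 proof -
  have "\<bar>x \<bullet> i\<bar> < real k" if "i \<in> Basis" for i
   using Basis_le_norm[OF that, of x] N \<open>k \<ge> N\<close> by linarith
  then show ?thesis by (auto simp: cube_def mem_box) (smt (verit))+
 qed
 then have "eventually (\<lambda>k. indicator (cube k) x = (1::real)) sequentially"
  unfolding eventually_sequentially by (intro exI[of _ N]) auto
 then show ?thesis by (rule tendsto_eventually)
qed

lemma L1_dense: "integrable lborel f \<Longrightarrow> f \<in> (L1cl :: ('a::euclidean_space \<Rightarrow> real) set)"
proof (induction rule: integrable_induct)
 case (base A c)
 have i: "integrable lborel (indicator A :: 'a \<Rightarrow> real)" using base by (intro integrable_real_indicator) auto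
 have "(indicator A :: 'a \<Rightarrow> real) \<in> L1cl"
 proof (rule L1cl_limit[OF i])
  show "(indicator (A \<inter> cube k) :: 'a \<Rightarrow> real) \<in> L1cl" for k unfolding cube_def using base by (intro L1cl_indicator_Int_box) auto
  show "(\<lambda>k. LINT x|lborel. \<bar>indicator A x - indicator (A \<inter> cube k) x\<bar>) \<longlonglongrightarrow> (0::real)"
  proof (rule L1_tendsto_dominated[OF i])
   show "(indicator (A \<inter> cube k) :: 'a \<Rightarrow> real) \<in> borel_measurable lborel" for k using base by (auto simp: cube_def)
   show "(\<lambda>k. indicator (A \<inter> cube k) x :: real) \<longlonglongrightarrow> indicator A x" for x
    using tendsto_mult[OF tendsto_const[of "indicator A x"] cube_lim[of x]] by (simp add: indicator_inter_arith)
   show "\<bar>indicator (A \<inter> cube k) x :: real\<bar> \<le> indicator A x" for k x by (auto simp: indicator_def)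
  qed (use base in auto)
 qed
 from L1cl_scale[OF this, of c] show ?case by (simp add: mult.commute)
next
 case (add f g)
 then show ?case by (intro L1cl_add)
next
 case (lim f s)
 show ?case
 proof (rule L1cl_limit[OF lim(4)])
  show "(\<lambda>n. LINT x|lborel. \<bar>f x - s n x\<bar>) \<longlonglongrightarrow> 0"
  proof (rule L1_tendsto_dominated[where w = "\<lambda>x. 2 * \<bar>f x\<bar>"])
   show "(\<lambda>n. s n x) \<longlonglongrightarrow> f x" for x using lim(2)[of x] by simp
   show "\<bar>s n x\<bar> \<le> 2 * \<bar>f x\<bar>" for n x using lim(3)[of x n] by simp
  qed (use lim in auto)
 qed (rule lim)
qed

lemma test_fun_dense:
 assumes "integrable lborel (f :: 'a::euclidean_space \<Rightarrow> real)"
 obtains g where "\<And>n. test_fun (g n)" "(\<lambda>n. LINT x|lborel. \<bar>g n x - f x\<bar>) \<longlonglongrightarrow> 0"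
proof -
 have "\<exists>g\<in>TF. (LINT x|lborel. \<bar>f x - g x\<bar>) < 1 / real (Suc n)" for n
  using L1_dense[OF assms] unfolding L1cl_def by auto
 then obtain g where g: "\<And>n. g n \<in> TF" "\<And>n. (LINT x|lborel. \<bar>f x - g n x\<bar>) < 1 / real (Suc n)" by metis
 have "(\<lambda>n. LINT x|lborel. \<bar>g n x - f x\<bar>) \<longlonglongrightarrow> 0"
 proof (rule tendsto_sandwich[OF _ _ tendsto_const])
  show "eventually (\<lambda>n. 0 \<le> (LINT x|lborel. \<bar>g n x - f x\<bar>)) sequentially" by simp
  show "eventually (\<lambda>n. (LINT x|lborel. \<bar>g n x - f x\<bar>) \<le> 1 / real (Suc n)) sequentially"
   using g(2) by (intro always_eventually allI) (metis (no_types, lifting) abs_minus_commute Bochner_Integration.integral_cong less_imp_le)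
  show "(\<lambda>n. 1 / real (Suc n)) \<longlonglongrightarrow> 0" by (rule lim_1_over_Suc)
 qed
 then show ?thesis using that TF_test g(1) by blast
qed

text \<open>Cut-off functions give the integral 0 over every box, induction over boxes gives it over
  every Borel set, and the sets where h is positive or negative finish the argument. It shows that a
  distribution has at most one integrable representative up to null sets.\<close>

lemma test_fun_separating:
 fixes h :: "'a::euclidean_space \<Rightarrow> real"
 assumes h: "integrable lborel h" and z: "\<And>\<phi>. test_fun \<phi> \<Longrightarrow> (LINT x|lborel. h x * \<phi> x) = 0"
 shows "AE x in lborel. h x = 0"
proof -
 note hm [measurable] = borel_measurable_integrable[OF h]
 have hi: "integrable lborel (\<lambda>x. h x * indicator A x)" if "A \<in> sets borel" for A
  using that by (intro integrable_real_mult_indicator h) auto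
 have lim: "(\<lambda>n. LINT x|lborel. h x * s n x) \<longlonglongrightarrow> (LINT x|lborel. h x * g x)"
  if "\<And>n. s n \<in> borel_measurable lborel" "g \<in> borel_measurable lborel" "\<And>x. (\<lambda>n. s n x) \<longlonglongrightarrow> g x" "\<And>n x. \<bar>s n x\<bar> \<le> 1" for s g
 proof (rule integral_dominated_convergence[where w = "\<lambda>x. \<bar>h x\<bar>"])
  show "AE x in lborel. (\<lambda>n. h x * s n x) \<longlonglongrightarrow> h x * g x" by (intro AE_I2 tendsto_intros that)
  show "AE x in lborel. norm (h x * s n x) \<le> \<bar>h x\<bar>" for n
   using that(4)[of n] by (intro AE_I2) (simp add: abs_mult mult_left_le)
 qed (use that h in auto)
 have box: "(LINT x|lborel. h x * indicator (box a b) x) = 0" for a b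
 proof -
  have "(\<lambda>n. LINT x|lborel. h x * chi n a b x) \<longlonglongrightarrow> (LINT x|lborel. h x * indicator (box a b) x)"
  proof (rule lim)
   show "\<bar>chi n a b x\<bar> \<le> 1" for n x using chi_range[of n a b x] by simp
  qed (auto intro: chi_tendsto borel_measurable_continuous_onI SF_continuous chi_SF)
  moreover have "(LINT x|lborel. h x * chi n a b x) = 0" for n by (intro z TF_test chi_TF)
  ultimately show ?thesis by (simp add: LIMSEQ_const_iff)
 qed
 have all: "(LINT x|lborel. h x) = 0"
 proof -
  have "(\<lambda>k. LINT x|lborel. h x * indicator (cube k) x) \<longlonglongrightarrow> (LINT x|lborel. h x * 1)"
  proof (rule lim)
   show "(\<lambda>k. indicator (cube k) x :: real) \<longlonglongrightarrow> 1" for x :: 'a by (rule cube_lim)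
  qed (auto simp: cube_def)
  then show ?thesis by (simp add: cube_def box LIMSEQ_const_iff)
 qed
 have sets: "(LINT x|lborel. h x * indicator A x) = 0" if "A \<in> sets borel" for A
  using that
 proof (induction rule: borel_box_induct)
  case (box a b) show ?case by fact
 next
  case (compl A)
  have "(LINT x|lborel. h x * indicator (- A) x) = (LINT x|lborel. h x - h x * indicator A x)"
   by (intro Bochner_Integration.integral_cong) (auto simp: indicator_def)
  also have "\<dots> = 0" using compl all by (subst Bochner_Integration.integral_diff) (auto intro: h hi)
  finally show ?case .
 next
  case (union F)
  have "(LINT x|lborel. h x * indicator (\<Union>i<n. F i) x) = 0" for n
  proof -
   have "(LINT x|lborel. h x * indicator (\<Union>i<n. F i) x) = (LINT x|lborel. (\<Sum>i<n. h x * indicator (F i) x))"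
   proof (intro Bochner_Integration.integral_cong refl)
    fix x
    have "disjoint_family_on F {..<n}" using union(1) by (auto simp: disjoint_family_on_def)
    then have "indicator (\<Union>i<n. F i) x = (\<Sum>i<n. indicator (F i) x :: real)"
     by (intro indicator_UN_disjoint) auto
    then show "h x * indicator (\<Union>i<n. F i) x = (\<Sum>i<n. h x * indicator (F i) x)" by (simp add: sum_distrib_left)
   qed
   also have "\<dots> = (\<Sum>i<n. LINT x|lborel. h x * indicator (F i) x)"
    using union(2) by (intro Bochner_Integration.integral_sum hi) auto
   finally show ?thesis by (simp add: union)
  qed
  moreover have "(\<lambda>n. LINT x|lborel. h x * indicator (\<Union>i<n. F i) x) \<longlonglongrightarrow> (LINT x|lborel. h x * indicator (\<Union>i. F i) x)"
  proof (rule lim)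
   show "(\<lambda>n. indicator (\<Union>i<n. F i) x :: real) \<longlonglongrightarrow> indicator (\<Union>i. F i) x" for x :: 'a
    by (rule LIMSEQ_indicator_UN)
  qed (use union(2) in auto)
  ultimately show ?case by (simp add: LIMSEQ_const_iff)
 qed simp
 have "AE x in lborel. h x * indicator {x. h x > 0} x = 0"
 proof -
  have A: "{x. h x > 0} \<in> sets borel" by measurable
  have "AE x in lborel. 0 \<le> h x * indicator {x. h x > 0} x" by (auto simp: indicator_def)
  from integral_nonneg_eq_0_iff_AE[OF hi[OF A] this] sets[OF A] show ?thesis by simp
 qed
 moreover have "AE x in lborel. - (h x * indicator {x. h x < 0} x) = 0"
 proof -
  have A: "{x. h x < 0} \<in> sets borel" by measurable
  have "AE x in lborel. 0 \<le> - (h x * indicator {x. h x < 0} x)" by (auto simp: indicator_def)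
  from integral_nonneg_eq_0_iff_AE[OF Bochner_Integration.integrable_minus[OF hi[OF A]] this] sets[OF A]
  show ?thesis by simp
 qed
 ultimately show ?thesis by eventually_elim (auto simp: indicator_def split: if_splits)
qed

section \<open>Test functions under the heat flow at small times\<close>

lemma test_fun_iter_zero:
 assumes "test_fun f" "x \<notin> closure {x. f x \<noteq> 0}"
 shows "iter_deriv vs f x = 0"
 using assms(2)
proof (induction vs arbitrary: x)
 case Nil
 then show ?case using closure_subset[of "{x. f x \<noteq> 0}"] by auto
next
 case (Cons v vs)
 have o: "open (- closure {x. f x \<noteq> 0})" by auto
 have "((\<lambda>_. 0) has_derivative (\<lambda>_. 0)) (at x)" by simp
 then have "(iter_deriv vs f has_derivative (\<lambda>_. 0)) (at x)"
  by (rule has_derivative_transform_within_open[OF _ o]) (use Cons in auto)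
 then have "(\<lambda>_. 0) = frechet_derivative (iter_deriv vs f) (at x)" by (rule frechet_derivative_at)
 then show ?case by (metis iter_deriv.simps(2))
qed

lemma test_fun_iter_bounded:
 assumes f: "test_fun f"
 shows "\<exists>B\<ge>0. \<forall>x. \<bar>iter_deriv vs f x\<bar> \<le> B"
proof -
 have "continuous_on UNIV (iter_deriv vs f)"
  using f unfolding test_fun_def smooth_fun_def
  by (intro differentiable_imp_continuous_on) (auto simp: differentiable_on_def)
 then have "compact (iter_deriv vs f ` closure {x. f x \<noteq> 0})"
  using f by (intro compact_continuous_image) (auto simp: test_fun_def intro: continuous_on_subset)
 then have "bounded (iter_deriv vs f ` closure {x. f x \<noteq> 0})" by (rule compact_imp_bounded)
 then obtain B where B: "\<forall>x\<in>closure {x. f x \<noteq> 0}. \<bar>iter_deriv vs f x\<bar> \<le> B" by (auto simp: bounded_iff)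
 have "\<bar>iter_deriv vs f x\<bar> \<le> max 0 B" for x
 proof (cases "x \<in> closure {x. f x \<noteq> 0}")
  case True then show ?thesis using B by auto
 next
  case False then show ?thesis using test_fun_iter_zero[OF f False] by simp
 qed
 then show ?thesis by (intro exI[of _ "max 0 B"]) auto
qed

lemma test_fun_iter_has_derivative:
 assumes f: "test_fun f"
 shows "(iter_deriv vs f has_derivative (\<lambda>v. \<Sum>b\<in>Basis. (v \<bullet> b) * iter_deriv (b # vs) f x)) (at x)"
proof -
 have d: "(iter_deriv vs f has_derivative frechet_derivative (iter_deriv vs f) (at x)) (at x)"
  using f unfolding test_fun_def smooth_fun_def by (simp add: frechet_derivative_works)
 interpret bounded_linear "frechet_derivative (iter_deriv vs f) (at x)"
  using d by (rule has_derivative_bounded_linear)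
 have "frechet_derivative (iter_deriv vs f) (at x) v = (\<Sum>b\<in>Basis. (v \<bullet> b) * iter_deriv (b # vs) f x)" for v
 proof -
  have "frechet_derivative (iter_deriv vs f) (at x) (\<Sum>b\<in>Basis. (v \<bullet> b) *\<^sub>R b) = (\<Sum>b\<in>Basis. (v \<bullet> b) * iter_deriv (b # vs) f x)"
   by (simp add: sum scaleR)
  then show ?thesis by (simp add: euclidean_representation)
 qed
 then have "frechet_derivative (iter_deriv vs f) (at x) = (\<lambda>v. \<Sum>b\<in>Basis. (v \<bullet> b) * iter_deriv (b # vs) f x)" by blast
 then show ?thesis using d by (simp only:)
qed

lemma test_fun_deriv_Lipschitz:
 assumes f: "test_fun (f :: 'a::euclidean_space \<Rightarrow> real)"
 shows "\<exists>B\<ge>0. \<forall>b\<in>Basis. \<forall>x y. \<bar>iter_deriv [b] f x - iter_deriv [b] f y\<bar> \<le> B * norm (x - y)"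
proof -
 obtain B where B: "\<And>vs. B vs \<ge> 0" "\<And>vs x. \<bar>iter_deriv vs f x\<bar> \<le> B vs"
  using test_fun_iter_bounded[OF f] by metis
 define L where "L = (\<Sum>b\<in>(Basis::'a set). \<Sum>c\<in>(Basis::'a set). B [c, b])"
 have "\<bar>iter_deriv [b] f x - iter_deriv [b] f y\<bar> \<le> L * norm (x - y)" if b: "b \<in> Basis" for b x y
 proof -
  have "norm (iter_deriv [b] f x - iter_deriv [b] f y) \<le> L * norm (x - y)"
  proof (rule differentiable_bound[where S = UNIV and f' = "\<lambda>x v. \<Sum>c\<in>Basis. (v \<bullet> c) * iter_deriv [c, b] f x"])
   show "(iter_deriv [b] f has_derivative (\<lambda>v. \<Sum>c\<in>Basis. (v \<bullet> c) * iter_deriv [c, b] f x)) (at x within UNIV)" for x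
    using test_fun_iter_has_derivative[OF f, of "[b]" x] by simp
   show "onorm (\<lambda>v. \<Sum>c\<in>Basis. (v \<bullet> c) * iter_deriv [c, b] f x) \<le> L" for x
   proof (rule onorm_le)
    fix v :: 'a
    have "norm (\<Sum>c\<in>Basis. (v \<bullet> c) * iter_deriv [c, b] f x) \<le> (\<Sum>c\<in>(Basis::'a set). norm v * B [c, b])"
    proof (rule order_trans[OF norm_sum], rule sum_mono)
     fix c :: 'a assume c: "c \<in> Basis"
     show "norm ((v \<bullet> c) * iter_deriv [c, b] f x) \<le> norm v * B [c, b]"
      unfolding real_norm_def abs_mult using Basis_le_norm[OF c, of v] B(2)[of "[c, b]" x] B(1)[of "[c, b]"]
      by (intro mult_mono) auto
    qed
    also have "\<dots> = (\<Sum>c\<in>(Basis::'a set). B [c, b]) * norm v"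
     by (simp only: sum_distrib_right mult.commute[of "norm v"])
    also have "\<dots> \<le> L * norm v"
     unfolding L_def using b B(1)
     by (intro mult_right_mono member_le_sum[of b Basis "\<lambda>b. \<Sum>c\<in>Basis. B [c, b]"] sum_nonneg) auto
    finally show "norm (\<Sum>c\<in>Basis. (v \<bullet> c) * iter_deriv [c, b] f x) \<le> L * norm v" .
   qed
  qed auto
  then show ?thesis by simp
 qed
 moreover have "L \<ge> 0" unfolding L_def using B(1) by (intro sum_nonneg) auto
 ultimately show ?thesis by blast
qed

text \<open>The symmetric combination cancels the first-order term. The mean value theorem along s *
  w leaves a difference of first derivatives, which are Lipschitz.\<close>

lemma test_fun_second_difference:
 assumes f: "test_fun (f :: 'a::euclidean_space \<Rightarrow> real)"
 shows "\<exists>C\<ge>0. \<forall>x w. \<bar>f (x + w) + f (x - w) - 2 * f x\<bar> \<le> C * (norm w)\<^sup>2"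
proof -
 obtain B where B: "B \<ge> 0" "\<And>b x y. b \<in> Basis \<Longrightarrow> \<bar>iter_deriv [b] f x - iter_deriv [b] f y\<bar> \<le> B * norm (x - y)"
  using test_fun_deriv_Lipschitz[OF f] by blast
 define C where "C = 2 * B * real DIM('a)"
 have df: "(f has_derivative (\<lambda>v. \<Sum>b\<in>Basis. (v \<bullet> b) * iter_deriv [b] f x)) (at x)" for x
  using test_fun_iter_has_derivative[OF f, of "[]" x] by simp
 have "\<bar>f (x + w) + f (x - w) - 2 * f x\<bar> \<le> C * (norm w)\<^sup>2" for x w
 proof -
  define h where "h s = f (x + s *\<^sub>R w) + f (x - s *\<^sub>R w)" for s :: real
  define h' where "h' s = (\<Sum>b\<in>Basis. (w \<bullet> b) * (iter_deriv [b] f (x + s *\<^sub>R w) - iter_deriv [b] f (x - s *\<^sub>R w)))" for s :: real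
  have dh: "(h has_real_derivative h' s) (at s)" for s
  proof -
   have 1: "((\<lambda>s. x + s *\<^sub>R w) has_derivative (\<lambda>t. t *\<^sub>R w)) (at s)" by (auto intro!: derivative_eq_intros)
   have 2: "((\<lambda>s. x - s *\<^sub>R w) has_derivative (\<lambda>t. - (t *\<^sub>R w))) (at s)" by (auto intro!: derivative_eq_intros)
   have "(h has_derivative (\<lambda>t. (\<Sum>b\<in>Basis. ((t *\<^sub>R w) \<bullet> b) * iter_deriv [b] f (x + s *\<^sub>R w)) + (\<Sum>b\<in>Basis. ((- (t *\<^sub>R w)) \<bullet> b) * iter_deriv [b] f (x - s *\<^sub>R w)))) (at s)"
    unfolding h_def by (intro has_derivative_add has_derivative_compose[OF 1 df] has_derivative_compose[OF 2 df])
   moreover have "(\<lambda>t. (\<Sum>b\<in>Basis. ((t *\<^sub>R w) \<bullet> b) * iter_deriv [b] f (x + s *\<^sub>R w)) + (\<Sum>b\<in>Basis. ((- (t *\<^sub>R w)) \<bullet> b) * iter_deriv [b] f (x - s *\<^sub>R w))) = (*) (h' s)"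
    unfolding h'_def sum.distrib[symmetric] sum_distrib_right
    by (intro ext sum.cong refl) (simp add: algebra_simps)
   ultimately show ?thesis by (simp add: has_field_derivative_def)
  qed
  have "\<exists>z>0. z < 1 \<and> h 1 - h 0 = (1 - 0) * h' z" by (rule MVT2) (auto intro: dh)
  then obtain z where z: "0 < z" "z < 1" "h 1 - h 0 = h' z" by auto
  have "\<bar>h' z\<bar> \<le> (\<Sum>b\<in>(Basis::'a set). norm w * (B * (2 * norm w)))"
   unfolding h'_def
  proof (rule order_trans[OF sum_abs], rule sum_mono)
   fix b :: 'a assume b: "b \<in> Basis"
   have "\<bar>iter_deriv [b] f (x + z *\<^sub>R w) - iter_deriv [b] f (x - z *\<^sub>R w)\<bar> \<le> B * norm ((x + z *\<^sub>R w) - (x - z *\<^sub>R w))"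
    by (rule B(2)[OF b])
   also have "(x + z *\<^sub>R w) - (x - z *\<^sub>R w) = (2 * z) *\<^sub>R w"
   proof -
    have "(x + z *\<^sub>R w) - (x - z *\<^sub>R w) = z *\<^sub>R w + z *\<^sub>R w" by simp
    then show ?thesis by (metis mult_2 scaleR_add_left)
   qed
   also have "B * norm ((2 * z) *\<^sub>R w) \<le> B * (2 * norm w)"
    using z B(1) by (intro mult_left_mono) (auto intro: mult_left_le_one_le)
   finally have "\<bar>iter_deriv [b] f (x + z *\<^sub>R w) - iter_deriv [b] f (x - z *\<^sub>R w)\<bar> \<le> B * (2 * norm w)" .
   then show "\<bar>(w \<bullet> b) * (iter_deriv [b] f (x + z *\<^sub>R w) - iter_deriv [b] f (x - z *\<^sub>R w))\<bar> \<le> norm w * (B * (2 * norm w))"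
    unfolding abs_mult using Basis_le_norm[OF b, of w] by (intro mult_mono) auto
  qed
  also have "\<dots> = C * (norm w)\<^sup>2" by (simp add: C_def power2_eq_square)
  finally show ?thesis using z(3) by (simp add: h_def)
 qed
 moreover have "C \<ge> 0" using B(1) by (simp add: C_def)
 ultimately show ?thesis by blast
qed

text \<open>Replacing a test function by a multiple of P_1(x,0) makes the semigroup law available:
  P_s maps this majorant to P_{s+1}.\<close>

lemma test_fun_le_heat:
 assumes f: "test_fun (f :: 'a::euclidean_space \<Rightarrow> real)"
 shows "\<exists>C\<ge>0. \<forall>x. ennreal \<bar>f x\<bar> \<le> ennreal C * hk 1 x 0"
proof -
 obtain B where B: "B \<ge> 0" "\<And>x. \<bar>f x\<bar> \<le> B" using test_fun_bounded[OF f] by blast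
 obtain R where R: "R \<ge> 1" "\<And>x. norm x > R \<Longrightarrow> f x = 0" using test_fun_zero_outside[OF f] by blast
 define c where "c = (4 * pi * 1) powr (- real DIM('a) / 2) * exp (- R\<^sup>2 / 4)"
 have c: "c > 0" by (simp add: c_def)
 have "\<bar>f x\<bar> \<le> B / c * heat 1 x" for x
 proof (cases "norm x > R")
  case True then show ?thesis using R(2)[OF True] B c by simp
 next
  case False
  have "exp (- R\<^sup>2 / 4) \<le> exp (- (norm x)\<^sup>2 / 4)" using False R by (simp add: power_mono)
  then have "c \<le> heat 1 x" unfolding c_def heat_def by (intro mult_left_mono) auto
  then have "B / c * c \<le> B / c * heat 1 x" using B c by (intro mult_left_mono) auto
  then show ?thesis using B(2)[of x] c by simp
 qed
 then have "ennreal \<bar>f x\<bar> \<le> ennreal (B / c) * hk 1 x 0" for x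
  using B c by (simp add: hk_def ennreal_leI flip: ennreal_mult)
 moreover have "B / c \<ge> 0" using B c by simp
 ultimately show ?thesis by blast
qed

text \<open>Half of the Gaussian exponent absorbs |w|^2 / t through r exp (-r) \<le> 1, and the
  other half is the heat kernel at time 2t.\<close>

lemma heat_second_moment:
 assumes t: "t > 0"
 shows "heat t w * (norm w)\<^sup>2 \<le> 8 * 2 powr (real DIM('a) / 2) * t * heat (2 * t) (w :: 'a::euclidean_space)"
proof -
 define r where "r = (norm w)\<^sup>2 / (8 * t)"
 have "r \<le> exp r" using exp_ge_add_one_self[of r] by linarith
 then have "r * exp (- r) \<le> exp r * exp (- r)" by (intro mult_right_mono) auto
 then have 1: "r * exp (- r) \<le> 1" by (simp flip: exp_add)
 have e: "exp (- (norm w)\<^sup>2 / (4 * t)) = exp (- r) * exp (- r)" using t by (simp add: r_def flip: exp_add)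
 have e2: "exp (- (norm w)\<^sup>2 / (4 * (2 * t))) = exp (- r)" by (simp add: r_def)
 have p: "(4 * pi * t) powr (- real DIM('a) / 2) = 2 powr (real DIM('a) / 2) * (4 * pi * (2 * t)) powr (- real DIM('a) / 2)"
 proof -
  have "(4 * pi * (2 * t)) powr (- real DIM('a) / 2) = (2 * (4 * pi * t)) powr (- real DIM('a) / 2)" by (simp add: mult_ac)
  also have "\<dots> = 2 powr (- real DIM('a) / 2) * (4 * pi * t) powr (- real DIM('a) / 2)" by (rule powr_mult)
  finally have "2 powr (real DIM('a) / 2) * (4 * pi * (2 * t)) powr (- real DIM('a) / 2)
   = (2 powr (real DIM('a) / 2) * 2 powr (- real DIM('a) / 2)) * (4 * pi * t) powr (- real DIM('a) / 2)" by simp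
  also have "2 powr (real DIM('a) / 2) * 2 powr (- real DIM('a) / 2) = (1::real)" by (simp only: powr_add[symmetric]) simp
  finally show ?thesis by simp
 qed
 have "(norm w)\<^sup>2 = 8 * t * r" using t by (simp add: r_def)
 then have "heat t w * (norm w)\<^sup>2 = (8 * t * 2 powr (real DIM('a) / 2) * (4 * pi * (2 * t)) powr (- real DIM('a) / 2) * exp (- r)) * (r * exp (- r))"
  unfolding heat_def e p by (simp only: mult_ac)
 also have "\<dots> \<le> (8 * t * 2 powr (real DIM('a) / 2) * (4 * pi * (2 * t)) powr (- real DIM('a) / 2) * exp (- r)) * 1"
  using t by (intro mult_left_mono 1) auto
 also have "\<dots> = 8 * 2 powr (real DIM('a) / 2) * t * heat (2 * t) w"
  unfolding heat_def e2 by (simp only: mult_ac mult_1_right)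
 finally show ?thesis .
qed

lemma distr_uminus_lborel: "distr lborel borel uminus = (lborel :: 'a::euclidean_space measure)"
 using lborel_affine[of "-1" "0::'a"] by (simp add: density_1)

text \<open>For |w| \<le> 1 the second difference lives in a fixed ball and the pointwise bound
  applies; for |w| > 1 its L^1 norm is at most four times that of f, and |w|^2 > 1 is
  inserted.\<close>

lemma test_fun_second_difference_L1:
 assumes f: "test_fun (f :: 'a::euclidean_space \<Rightarrow> real)"
 shows "\<exists>C\<ge>0. \<forall>w. (NN x. ennreal \<bar>f (x + w) + f (x - w) - 2 * f x\<bar>) \<le> ennreal (C * (norm w)\<^sup>2)"
proof -
 note [measurable] = test_fun_measurable[OF f]
 obtain R where R: "R \<ge> 1" "\<And>x. norm x > R \<Longrightarrow> f x = 0" using test_fun_zero_outside[OF f] by blast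
 obtain C where C: "C \<ge> 0" "\<And>x w. \<bar>f (x + w) + f (x - w) - 2 * f x\<bar> \<le> C * (norm w)\<^sup>2"
  using test_fun_second_difference[OF f] by blast
 define N where "N = (LINT x|lborel. \<bar>f x\<bar>)"
 define vol where "vol = measure lborel (cball (0::'a) (R + 1))"
 have N: "N \<ge> 0" "(NN x. ennreal \<bar>f x\<bar>) = ennreal N"
  using integrable_nn(1)[OF test_fun_integrable[OF f]] by (simp_all add: N_def)
 have vol: "vol \<ge> 0" "emeasure lborel (cball (0::'a) (R + 1)) = ennreal vol"
  using emeasure_bounded_finite[of "cball (0::'a) (R + 1)"] by (simp_all add: vol_def emeasure_eq_ennreal_measure)
 have "(NN x. ennreal \<bar>f (x + w) + f (x - w) - 2 * f x\<bar>) \<le> ennreal ((C * vol + 4 * N) * (norm w)\<^sup>2)" for w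
 proof (cases "norm w \<le> 1")
  case True
  have "(NN x. ennreal \<bar>f (x + w) + f (x - w) - 2 * f x\<bar>) \<le> (NN x. ennreal (C * (norm w)\<^sup>2) * indicator (cball (0::'a) (R + 1)) x)"
  proof (rule nn_integral_mono)
   fix x
   show "ennreal \<bar>f (x + w) + f (x - w) - 2 * f x\<bar> \<le> ennreal (C * (norm w)\<^sup>2) * indicator (cball 0 (R + 1)) x"
   proof (cases "norm x \<le> R + 1")
    case False
    then have "f (x + w) = 0" "f (x - w) = 0" "f x = 0"
     using True norm_triangle_ineq2[of x "- w"] norm_triangle_ineq2[of x w] by (auto intro!: R(2))
    then show ?thesis by simp
   qed (use C(2)[of x w] in \<open>auto intro: ennreal_leI\<close>)
  qed
  also have "\<dots> = ennreal (C * (norm w)\<^sup>2) * emeasure lborel (cball (0::'a) (R + 1))"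
   by (rule nn_integral_cmult_indicator) simp
  also have "\<dots> = ennreal (C * vol * (norm w)\<^sup>2)" using C vol by (simp add: mult_ac flip: ennreal_mult)
  also have "\<dots> \<le> ennreal ((C * vol + 4 * N) * (norm w)\<^sup>2)"
   using N by (intro ennreal_leI mult_right_mono) auto
  finally show ?thesis .
 next
  case False
  have "(NN x. ennreal \<bar>f (x + w) + f (x - w) - 2 * f x\<bar>)
    \<le> (NN x. ennreal \<bar>f (x + w)\<bar> + ennreal \<bar>f (x + - w)\<bar> + 2 * ennreal \<bar>f x\<bar>)"
   by (intro nn_integral_mono) (simp flip: ennreal_plus ennreal_numeral ennreal_mult)
  also have "\<dots> = (NN x. ennreal \<bar>f (x + w)\<bar>) + (NN x. ennreal \<bar>f (x + - w)\<bar>) + 2 * (NN x. ennreal \<bar>f x\<bar>)"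
   by (simp add: nn_integral_add nn_integral_cmult del: add_uminus_conv_diff)
  also have "\<dots> = ennreal (4 * N * 1)"
   using nn_integral_lborel_plus[of "\<lambda>x. ennreal \<bar>f x\<bar>" w] nn_integral_lborel_plus[of "\<lambda>x. ennreal \<bar>f x\<bar>" "- w"] N
   by (simp flip: ennreal_plus ennreal_numeral ennreal_mult)
  also have "\<dots> \<le> ennreal ((C * vol + 4 * N) * (norm w)\<^sup>2)"
   using False N C vol by (intro ennreal_leI mult_mono) auto
  finally show ?thesis .
 qed
 moreover have "C * vol + 4 * N \<ge> 0" using C vol N by simp
 ultimately show ?thesis by blast
qed

text \<open>By evenness of the heat kernel, P_t f - f is half the average of second differences of
  f, so only the second moment of the kernel enters, which is of order t.\<close>

lemma heat_approx_test_fun: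
 assumes f: "test_fun (f :: 'a::euclidean_space \<Rightarrow> real)"
 shows "\<exists>C\<ge>0. \<forall>t>0. (NN x. ennreal \<bar>opk (hk t) f x - f x\<bar>) \<le> ennreal (C * t)"
proof -
 note [measurable] = test_fun_measurable[OF f]
 obtain B where B: "B \<ge> 0" "\<And>x. \<bar>f x\<bar> \<le> B" using test_fun_bounded[OF f] by blast
 let ?D = "\<lambda>x w. f (x + w) + f (x - w) - 2 * f x"
 obtain C where C: "C \<ge> 0" "\<And>w. (NN x. ennreal \<bar>?D x w\<bar>) \<le> ennreal (C * (norm w)\<^sup>2)"
  using test_fun_second_difference_L1[OF f] by blast
 define K where "K = C * (4 * 2 powr (real DIM('a) / 2))"
 have "(NN x. ennreal \<bar>opk (hk t) f x - f x\<bar>) \<le> ennreal (K * t)" if t: "t > 0" for t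
 proof -
  have hi: "integrable lborel (\<lambda>w::'a. heat t w)"
   using nn_integral_heat[OF t, of "0::'a"] by (intro integrableI_nn) auto
  have h1: "(LINT w|lborel. heat t (w::'a)) = 1"
   using nn_integral_heat[OF t, of "0::'a"] hi by (simp add: nn_integral_eq_integral flip: ennreal_1)
  have "ennreal \<bar>opk (hk t) f x - f x\<bar> \<le> (NN w. ennreal (1/2 * heat t w) * ennreal \<bar>?D x w\<bar>)" for x
  proof -
   have fb: "integrable lborel (\<lambda>w. heat t w * f (x + w))" "integrable lborel (\<lambda>w. heat t w * f (x - w))"
    by (rule Bochner_Integration.integrable_bound[where f = "\<lambda>w. B * heat t (w::'a)"];
      use hi B in \<open>auto intro!: AE_I2 simp: abs_mult mult.commute[of B] mult_left_mono\<close>)+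
   have "opk (hk t) f x = (LINT y|distr lborel borel ((+) x). heat t (y - x) * f y)"
    using t by (simp add: opk_def hk_def heat_commute[of t x] lborel_distr_plus)
   also have "\<dots> = (LINT w|lborel. heat t w * f (x + w))" by (subst integral_distr) auto
   finally have A: "opk (hk t) f x = (LINT w|lborel. heat t w * f (x + w))" .
   also have "\<dots> = (LINT w|distr lborel borel uminus. heat t w * f (x + w))" by (simp only: distr_uminus_lborel)
   also have "\<dots> = (LINT w|lborel. heat t w * f (x - w))" by (subst integral_distr) auto
   \<comment> \<open>The two representations with x + w and x - w are averaged, and f(x) is written
     as the integral of P_t(w) f(x).\<close>
   finally have "opk (hk t) f x - f x = (LINT w|lborel. 1/2 * (heat t w * f (x + w)) + 1/2 * (heat t w * f (x - w)) - heat t w * f x)"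
    using fb hi A h1 by simp
   also have "\<dots> = (LINT w|lborel. 1/2 * heat t w * ?D x w)"
    by (intro Bochner_Integration.integral_cong refl) (simp add: algebra_simps)
   finally have eq: "opk (hk t) f x - f x = (LINT w|lborel. 1/2 * heat t w * ?D x w)" .
   have "ennreal \<bar>1/2 * heat t w * ?D x w\<bar> = ennreal (1/2 * heat t w) * ennreal \<bar>?D x w\<bar>" for w
    unfolding abs_mult[of "1/2 * heat t w"] by (simp flip: ennreal_mult)
   then show ?thesis
    using integral_norm_le_nn[where M = lborel and f = "\<lambda>w. 1/2 * heat t w * ?D x w"] unfolding eq by simp
  qed
  then have "(NN x. ennreal \<bar>opk (hk t) f x - f x\<bar>) \<le> (NN x. NN w. ennreal (1/2 * heat t w) * ennreal \<bar>?D x w\<bar>)"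
   by (intro nn_integral_mono)
  also have "\<dots> = (NN w. NN x. ennreal (1/2 * heat t w) * ennreal \<bar>?D x w\<bar>)"
   by (rule nn_integral_swap) measurable
  also have "\<dots> = (NN w. ennreal (1/2 * heat t w) * (NN x. ennreal \<bar>?D x w\<bar>))"
   by (simp add: nn_integral_cmult)
  also have "\<dots> \<le> (NN w. ennreal (K * t) * ennreal (heat (2 * t) (w - 0 :: 'a)))"
  proof (intro nn_integral_mono)
   fix w :: 'a
   have "ennreal (1/2 * heat t w) * (NN x. ennreal \<bar>?D x w\<bar>) \<le> ennreal (1/2 * heat t w) * ennreal (C * (norm w)\<^sup>2)"
    by (intro mult_left_mono C) simp
   also have "\<dots> = ennreal (C / 2 * (heat t w * (norm w)\<^sup>2))" using C(1) by (simp add: mult_ac flip: ennreal_mult)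
   also have "\<dots> \<le> ennreal (C / 2 * (8 * 2 powr (real DIM('a) / 2) * t * heat (2 * t) w))"
    using C(1) by (intro ennreal_leI mult_left_mono heat_second_moment[OF t]) auto
   also have "\<dots> = ennreal (K * t) * ennreal (heat (2 * t) (w - 0))"
    using C(1) t by (simp add: K_def mult_ac flip: ennreal_mult)
   finally show "ennreal (1/2 * heat t w) * (NN x. ennreal \<bar>?D x w\<bar>) \<le> ennreal (K * t) * ennreal (heat (2 * t) (w - 0))" .
  qed
  also have "\<dots> = ennreal (K * t)"
   using nn_integral_heat[of "2 * t" "0::'a"] t by (subst nn_integral_cmult) auto
  finally show ?thesis .
 qed
 moreover have "K \<ge> 0" using C by (simp add: K_def)
 ultimately show ?thesis by blast
qed

section \<open>The half derivative\<close>

lemma c1_eq: "c1 = 1 / sqrt pi"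
 using Gamma_one_half_real by (simp add: c1_def inverse_eq_divide)

lemma c2_eq: "c2 = - 1 / (2 * sqrt pi)"
proof -
 have "(- 1 / 2 :: real) \<notin> \<int>\<^sub>\<le>\<^sub>0"
 proof
  assume "(- 1 / 2 :: real) \<in> \<int>\<^sub>\<le>\<^sub>0"
  then obtain n :: int where "(- 1 / 2 :: real) = of_int n" by (auto elim!: nonpos_Ints_cases)
  then have "real_of_int (2 * n) = real_of_int (- 1)" by simp
  then have "2 * n = - 1" unfolding of_int_eq_iff .
  then show False by presburger
 qed
 from Gamma_plus1[OF this] have "Gamma (-1/2 :: real) = - 2 * sqrt pi" using Gamma_one_half_real by simp
 then show ?thesis by (simp add: c2_def inverse_eq_divide)
qed

text \<open>The factor that compensates the 2 \<pi> arising in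
  \<open>half_derivative_pairing\<close> and in \<open>pair_kernel_integral\<close>.\<close>

lemma c1_c2: "c1 * c2 = - 1 / (2 * pi)"
 unfolding c1_eq c2_eq by simp

text \<open>\<open>rho\<close> and \<open>tau\<close> are the weights of the inverse half power and
  of the half derivative, extended by 0. \<open>bb\<close> is the decay min (1, r^(-3/2)) of the
  heat flow of a test function in dimension at least 3.\<close>

definition rho :: "real \<Rightarrow> real" where "rho r = (if 0 < r then 1 / sqrt r else 0)"
definition tau :: "real \<Rightarrow> real" where "tau t = (if 0 < t then 1 / (t * sqrt t) else 0)"
definition bb :: "real \<Rightarrow> real" where "bb r = min 1 (tau r)"

lemma rho_tau_measurable [measurable]:
 "rho \<in> borel_measurable borel" "tau \<in> borel_measurable borel" "bb \<in> borel_measurable borel"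
 unfolding rho_def[abs_def] tau_def[abs_def] bb_def[abs_def] by measurable

lemma rho_tau_nonneg [simp]: "0 \<le> rho r" "0 \<le> tau r" "0 \<le> bb r"
 by (auto simp: rho_def tau_def bb_def)

lemma bb_eq: "0 < r \<Longrightarrow> bb r = min 1 (r powr (-3/2))"
 using powr_mult_base[of r "1/2"] by (simp add: bb_def tau_def powr_minus_divide powr_half_sqrt)

lemma tau_times: "t * tau t = rho t"
 by (simp add: rho_def tau_def)

lemma bb_mono:
 assumes "0 < r" "0 \<le> t"
 shows "bb (t + r) \<le> bb r"
proof -
 have "1 / ((t + r) * sqrt (t + r)) \<le> 1 / (r * sqrt r)"
  using assms by (intro divide_left_mono mult_mono mult_pos_pos) auto
 then show ?thesis using assms by (auto simp: bb_def tau_def)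
qed

lemma tau_integral:
 assumes e: "0 < e"
 shows "(NN t. ennreal (tau t) * indicator {e<..} t) = ennreal (2 / sqrt e)"
proof -
 have "(NN t. ennreal (tau t) * indicator {e<..} t) = (NN t. ennreal (1 / (t * sqrt t)) * indicator {e<..} t)"
  using e by (intro nn_integral_cong) (auto simp: tau_def indicator_def)
 also have "\<dots> = ennreal (0 - (- 2 / sqrt e))"
 proof (rule nn_integral_FTC_greaterThan[where F = "\<lambda>t. - 2 / sqrt t"])
  fix t assume t: "e < t"
  have "((\<lambda>t. - 2 / sqrt t) has_real_derivative (0 * sqrt t - (- 2) * (inverse (sqrt t) / 2)) / (sqrt t * sqrt t)) (at t)"
   using t e by (intro DERIV_divide DERIV_const DERIV_real_sqrt) auto
  moreover have "(0 * sqrt t - (- 2) * (inverse (sqrt t) / 2)) / (sqrt t * sqrt t) = 1 / (t * sqrt t)"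
   using t e by (simp add: inverse_eq_divide mult.commute)
  ultimately show "((\<lambda>t. - 2 / sqrt t) has_real_derivative 1 / (t * sqrt t)) (at t)" by simp
  show "isCont (\<lambda>t. 1 / (t * sqrt t)) t" using t e by (auto intro!: continuous_intros)
  show "0 \<le> 1 / (t * sqrt t)" using t e by simp
 next
  show "((\<lambda>t. - 2 / sqrt t) \<longlongrightarrow> - 2 / sqrt e) (at_right e)" using e by (intro tendsto_intros) auto
  show "((\<lambda>t::real. - 2 / sqrt t) \<longlongrightarrow> 0) at_top" by real_asymp
 qed
 finally show ?thesis by simp
qed

lemma rho_tau_dominated_integral:
 assumes "\<And>r. 0 < r \<Longrightarrow> r < 1 \<Longrightarrow> h r \<le> rho r" "\<And>r. 1 < r \<Longrightarrow> h r \<le> tau r" "\<And>r. r \<le> 0 \<Longrightarrow> h r = 0"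
 shows "(NN r. ennreal (h r)) < top"
proof -
 have s: "rho r = r powr (-1/2)" if "0 < r" for r
  using that powr_minus_divide[of r "1/2"] powr_half_sqrt[of r] by (simp add: rho_def)
 have "(NN r. ennreal (h r)) \<le> (NN r. ennreal (r powr (-1/2)) * indicator {0<..<1} r + ennreal (tau r) * indicator {1<..} r)"
 proof (rule nn_integral_mono_AE, use AE_neq_lborel[of "1::real"] in eventually_elim)
  fix r :: real assume "r \<noteq> 1"
  then consider "r \<le> 0" | "0 < r" "r < 1" | "1 < r" by linarith
  then show "ennreal (h r) \<le> ennreal (r powr (-1/2)) * indicator {0<..<1} r + ennreal (tau r) * indicator {1<..} r"
   by cases (use assms[of r] s[of r] in \<open>auto intro!: ennreal_leI\<close>)
 qed
 also have "\<dots> < top"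
  using nn_integral_powr_0[of "-1/2" 1] tau_integral[of 1] by (subst nn_integral_add) auto
 finally show ?thesis .
qed

lemma bb_integral: "(NN r. ennreal (bb r)) < top"
 and rho_bb_integral: "(NN r. ennreal (rho r * bb r)) < top"
 and tau_min_integral: "(NN t. ennreal (tau t * min 1 t)) < top"
proof -
 have r1: "1 \<le> rho r" if "0 < r" "r < 1" for r using that by (simp add: rho_def)
 have r2: "rho r \<le> 1" if "1 < r" for r using that by (simp add: rho_def)
 have b: "bb r \<le> 1" "bb r \<le> tau r" for r by (simp_all add: bb_def)
 show "(NN r. ennreal (bb r)) < top"
  by (rule rho_tau_dominated_integral) (use r1 b in \<open>auto intro: order_trans\<close>, simp add: bb_def tau_def)
 show "(NN r. ennreal (rho r * bb r)) < top"
 proof (rule rho_tau_dominated_integral)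
  show "rho r * bb r \<le> rho r" for r using mult_left_mono[OF b(1), of "rho r"] by simp
  show "rho r * bb r \<le> tau r" if "1 < r" for r using mult_mono[OF r2[OF that] b(2)[of r]] by simp
 qed (simp add: rho_def)
 show "(NN t. ennreal (tau t * min 1 t)) < top"
  by (rule rho_tau_dominated_integral) (auto simp: tau_times[symmetric] mult.commute tau_def)
qed

text \<open>The weight with which a derivative at s enters when F(t + r) - F(r) is written as an
  integral over [r, r + t] and then integrated against \<open>tau t * rho r\<close>; here q = (t,
  r).\<close>

definition ramp :: "real \<times> real \<Rightarrow> real \<Rightarrow> ennreal" where
 "ramp q s = (if snd q \<le> s \<and> s \<le> snd q + fst q then ennreal (tau (fst q) * rho (snd q)) else 0)"

lemma ramp_measurable: "(\<lambda>p. ramp (fst p) (snd p)) \<in> borel_measurable ((borel \<Otimes>\<^sub>M borel) \<Otimes>\<^sub>M borel)"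
 unfolding ramp_def by measurable

text \<open>The integral of t^(-3/2) over t > s - r is 2 / sqrt (s - r), and what remains in r is
  the arcsine integral. Its independence of s makes the half powers of the same semigroup
  cancel.\<close>

lemma ramp_integral:
 assumes s: "0 < s"
 shows "(NN q. ramp q s) = ennreal (2 * pi)"
proof -
 have "(NN q. ramp q s) = (NN t. NN r. ramp (t, r) s)"
  unfolding lborel_prod[symmetric] by (subst lborel.nn_integral_fst[symmetric]) (auto simp: ramp_def)
 also have "\<dots> = (NN r. NN t. ramp (t, r) s)"
  unfolding ramp_def by (rule nn_integral_swap) measurable
 also have "\<dots> = (NN r. ennreal 2 * (ennreal (1 / (sqrt r * sqrt (s - r))) * indicator {0<..<s} r))"
 proof (rule nn_integral_cong_AE, use AE_neq_lborel[of s] in eventually_elim)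
  fix r assume r: "r \<noteq> s"
  show "(NN t. ramp (t, r) s) = ennreal 2 * (ennreal (1 / (sqrt r * sqrt (s - r))) * indicator {0<..<s} r)"
  proof (cases "0 < r \<and> r < s")
   case True
   have "(NN t. ramp (t, r) s) = (NN t. ennreal (rho r) * (ennreal (tau t) * indicator {s - r<..} t))"
    by (rule nn_integral_cong_AE, use AE_neq_lborel[of "s - r"] in eventually_elim)
      (use True in \<open>auto simp: ramp_def indicator_def ennreal_mult mult.commute\<close>)
   also have "\<dots> = ennreal (rho r) * ennreal (2 / sqrt (s - r))"
    using True by (simp add: nn_integral_cmult tau_integral)
   also have "\<dots> = ennreal (rho r * (2 / sqrt (s - r)))" using True by (intro ennreal_mult[symmetric]) auto
   also have "rho r * (2 / sqrt (s - r)) = 2 * (1 / (sqrt r * sqrt (s - r)))" using True by (simp add: rho_def)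
   also have "ennreal \<dots> = ennreal 2 * ennreal (1 / (sqrt r * sqrt (s - r)))" using True by (intro ennreal_mult) auto
   finally show ?thesis using True by simp
  next
   case False
   then have "ramp (t, r) s = 0" for t using r by (auto simp: ramp_def rho_def tau_def)
   then show ?thesis using False by auto
  qed
 qed
 also have "\<dots> = ennreal 2 * ennreal pi" unfolding arcsine_integral[OF s, symmetric] by (rule nn_integral_cmult) measurable
 also have "\<dots> = ennreal (2 * pi)" by (rule ennreal_mult[symmetric]) auto
 finally show ?thesis .
qed

text \<open>\<open>F\<close> is replaced by its averages over intervals of length \<open>h\<close>, which have the bounded derivative
 \<open>G\<close>; the averaged difference is an integral of \<open>G\<close>, and Fubini leaves \<open>2 \<pi> \<integral>G\<close>.\<close>
lemma half_derivative_pairing: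
 fixes F :: "real \<Rightarrow> real"
 assumes c: "\<And>r. isCont F r" and F0: "(F \<longlongrightarrow> 0) at_top"
  and d: "\<And>t r. 0 < t \<Longrightarrow> 0 < r \<Longrightarrow> \<bar>F (t + r) - F r\<bar> \<le> C * (min 1 t * bb r)"
 shows "integrable lborel (\<lambda>q. tau (fst q) * rho (snd q) * (F (fst q + snd q) - F (snd q)))" (is "integrable _ ?w")
  "(LINT q|lborel. tau (fst q) * rho (snd q) * (F (fst q + snd q) - F (snd q))) = - (2 * pi) * F 0"
proof -
 have C: "0 \<le> C" using d[of 1 1] by (simp add: bb_def tau_def)
 obtain A where A: "\<And>x. DERIV A x :> F x"
  using einterval_antiderivative[of "-\<infinity>" \<infinity> F] c by (auto simp: has_real_derivative_iff_has_vector_derivative)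
 define \<Phi> where "\<Phi> h r = (A (r + h) - A r) / h" for h r
 define G where "G h s = (F (s + h) - F s) / h" for h s
 have [measurable]: "F \<in> borel_measurable borel"
  using c by (intro borel_measurable_continuous_onI) (simp add: continuous_at_imp_continuous_on)
 have A_shift: "((\<lambda>x. A (x + c)) has_real_derivative F (x + c)) (at x)" for c x
  using A[of "x + c"] by (simp add: DERIV_shift)
 have d\<Phi>: "(\<Phi> h has_real_derivative G h s) (at s)" for h s
  unfolding \<Phi>_def[abs_def] G_def by (intro DERIV_cdivide DERIV_diff A A_shift)
 have G_cont: "isCont (G h) s" for h s
  unfolding G_def[abs_def] divide_inverse
  by (intro continuous_mult continuous_diff continuous_const c isCont_o2[of s "\<lambda>s. s + h" F] continuous_add continuous_ident)
 have [measurable]: "G h \<in> borel_measurable borel" for h unfolding G_def by measurable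
 have mvt: "\<exists>z>r. z < r + h \<and> \<Phi> h r = F z" if "0 < h" for h r
  using MVT2[of r "r + h" A F] A that by (auto simp: \<Phi>_def)
 \<comment> \<open>By the mean value theorem an increment of the averages is an increment of
   \<open>F\<close> at some z > r, and \<open>bb\<close> is decreasing on positive arguments, so the
   hypothesis carries over with the same constant.\<close>
 have \<Phi>_bound: "\<bar>\<Phi> h (t + r) - \<Phi> h r\<bar> \<le> C * (min 1 t * bb r)" if "0 < h" "0 < t" "0 < r" for h t r
 proof -
  have "((\<lambda>x. A (t + x) - A x) has_real_derivative F (t + x) - F x) (at x)" for x
   using A_shift[of t x] by (intro DERIV_diff A) (simp add: add.commute)
  with MVT2[of r "r + h" "\<lambda>x. A (t + x) - A x" "\<lambda>x. F (t + x) - F x"] that(1)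
  obtain z where z: "r < z" "A (t + (r + h)) - A (r + h) - (A (t + r) - A r) = h * (F (t + z) - F z)" by auto
  have "\<Phi> h (t + r) - \<Phi> h r = (A (t + (r + h)) - A (r + h) - (A (t + r) - A r)) / h"
   by (simp add: \<Phi>_def add.assoc diff_divide_distrib)
  also have "\<dots> = F (t + z) - F z" unfolding z(2) using that(1) by simp
  finally have \<Phi>z: "\<Phi> h (t + r) - \<Phi> h r = F (t + z) - F z" .
  have "\<bar>\<Phi> h (t + r) - \<Phi> h r\<bar> \<le> C * (min 1 t * bb z)" unfolding \<Phi>z using d[of t z] that z by simp
  also have "\<dots> \<le> C * (min 1 t * bb r)"
   using bb_mono[of r "z - r"] z that C by (intro mult_left_mono) auto
  finally show ?thesis .
 qed
 have G_bound: "\<bar>G h s * indicator {0<..} s\<bar> \<le> C * bb s" if "0 < h" "h \<le> 1" for h s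
 proof (cases "0 < s")
  case True
  then have "\<bar>F (h + s) - F s\<bar> \<le> C * (h * bb s)" using d[of h s] that by simp
  then show ?thesis using True that by (simp add: G_def abs_divide pos_divide_le_eq add.commute mult_ac)
 qed (use C in simp)
 have bbi: "(NN s. ennreal (C * bb s)) < top"
  using bb_integral C by (simp add: ennreal_mult nn_integral_cmult ennreal_mult_less_top)
 have \<Phi>_pairing: "(LINT q|lborel. tau (fst q) * rho (snd q) * (\<Phi> h (fst q + snd q) - \<Phi> h (snd q))) = - (2 * pi) * \<Phi> h 0"
  if h: "0 < h" "h \<le> 1" for h
 proof -
  let ?g = "\<lambda>s. G h s * indicator {0<..} s"
  have Nm: "(\<lambda>p. ramp (fst p) (snd p)) \<in> borel_measurable (lborel \<Otimes>\<^sub>M lborel)"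
   using ramp_measurable unfolding borel_prod by (simp cong: measurable_cong_sets, simp only: borel_prod)
  have Ns: "(NN q. ramp q s) * ennreal \<bar>?g s\<bar> = ennreal (2 * pi) * ennreal \<bar>?g s\<bar>" for s
   by (cases "0 < s") (simp_all add: ramp_integral)
  have g: "(NN s. ennreal \<bar>?g s\<bar>) < top"
   by (rule le_less_trans[OF nn_integral_mono bbi]) (use G_bound[OF h] in \<open>auto intro: ennreal_leI\<close>)
  have "(NN q. NN s. ramp q s * ennreal \<bar>?g s\<bar>) = (NN s. NN q. ramp q s * ennreal \<bar>?g s\<bar>)"
   using Nm by (intro nn_integral_swap) (simp add: case_prod_unfold)
  also have "\<dots> = (NN s. ennreal (2 * pi) * ennreal \<bar>?g s\<bar>)"
   unfolding Ns[symmetric] by (intro nn_integral_cong nn_integral_multc) (simp add: ramp_def borel_prod[symmetric])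
  also have "\<dots> < top" using g by (simp add: nn_integral_cmult ennreal_mult_less_top)
  finally have fin: "(NN q. NN s. ramp q s * ennreal \<bar>?g s\<bar>) < top" .
  have "tau (fst q) * rho (snd q) * (\<Phi> h (fst q + snd q) - \<Phi> h (snd q)) = (LINT s|lborel. enn2real (ramp q s) * ?g s)" for q
  proof (cases "0 < fst q \<and> 0 < snd q")
   case True
   have "(LINT s|lborel. G h s * indicator {snd q..snd q + fst q} s) = \<Phi> h (snd q + fst q) - \<Phi> h (snd q)"
    using True by (intro integral_FTC_Icc_real d\<Phi> G_cont) auto
   moreover have eq: "enn2real (ramp q s) * ?g s = tau (fst q) * rho (snd q) * (G h s * indicator {snd q..snd q + fst q} s)" for s
    using True by (auto simp: ramp_def indicator_def)
   ultimately show ?thesis unfolding eq by (simp add: add.commute)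
  next
   case False
   then have "ramp q s = 0" for s by (auto simp: ramp_def rho_def tau_def)
   then show ?thesis using False by (auto simp: rho_def tau_def)
  qed
  then have "(LINT q|lborel. tau (fst q) * rho (snd q) * (\<Phi> h (fst q + snd q) - \<Phi> h (snd q)))
    = (LINT s|lborel. enn2real (NN q. ramp q s) * ?g s)"
   using nn_mix(2)[OF Nm _ fin] by simp
  also have "\<dots> = (LINT s|lborel. 2 * pi * ?g s)"
  proof (intro Bochner_Integration.integral_cong refl)
   show "enn2real (NN q. ramp q s) * ?g s = 2 * pi * ?g s" for s
    by (cases "0 < s") (simp_all add: ramp_integral)
  qed
  also have "\<dots> = 2 * pi * (LBINT s=ereal 0..\<infinity>. G h s)"
   by (simp add: interval_lebesgue_integral_def set_lebesgue_integral_def mult.commute einterval_def greaterThan_def)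
  also have "(LBINT s=ereal 0..\<infinity>. G h s) = 0 - \<Phi> h 0"
  proof (rule interval_integral_FTC_integrable)
   have "integrable lborel ?g" by (rule integrableI_nn[OF _ g]) measurable
   then show "set_integrable lborel (einterval (ereal 0) \<infinity>) (G h)"
    by (simp add: set_integrable_def einterval_def greaterThan_def mult.commute)
   have "(\<Phi> h \<longlongrightarrow> 0) at_top"
   proof (rule tendstoI)
    fix e :: real assume "0 < e"
    from tendstoD[OF F0 this] obtain a where "\<And>y. a \<le> y \<Longrightarrow> dist (F y) 0 < e"
     unfolding eventually_at_top_linorder by blast
    then show "eventually (\<lambda>x. dist (\<Phi> h x) 0 < e) at_top"
     unfolding eventually_at_top_linorder using mvt[OF h(1)] by (metis less_imp_le order_trans)
   qed
   then show "((\<Phi> h \<circ> real_of_ereal) \<longlongrightarrow> 0) (at_left \<infinity>)" by (simp add: ereal_tendsto_simps)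
   have "isCont (\<Phi> h) 0" using d\<Phi> by (rule DERIV_isCont)
   then show "((\<Phi> h \<circ> real_of_ereal) \<longlongrightarrow> \<Phi> h 0) (at_right (ereal 0))"
    by (simp add: ereal_tendsto_simps isCont_def filterlim_at_split)
  qed (use d\<Phi> G_cont in \<open>auto simp: has_real_derivative_iff_has_vector_derivative\<close>)
  finally show ?thesis by simp
 qed
 define e where "e n = 1 / real (Suc n)" for n
 have e: "0 < e n" "e n \<le> 1" for n by (auto simp: e_def)
 have lim: "(\<lambda>n. \<Phi> (e n) r) \<longlonglongrightarrow> F r" for r
 proof -
  have "filterlim e (at 0) sequentially"
   unfolding filterlim_at using lim_1_over_Suc e(1) by (auto simp: e_def[abs_def])
  from filterlim_compose[OF A[of r, unfolded DERIV_def] this] show ?thesis by (simp add: \<Phi>_def)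
 qed
 \<comment> \<open>The majorant factorises: min (1, t) makes t^(-3/2) integrable at 0, and
   \<open>bb\<close> makes r^(-1/2) integrable at infinity.\<close>
 let ?D = "\<lambda>q. C * ((tau (fst q) * min 1 (fst q)) * (rho (snd q) * bb (snd q)))"
 have D: "integrable lborel ?D"
 proof (rule integrable_mult_right, rule integrableI_nn)
  let ?f = "\<lambda>t. ennreal (tau t * min 1 t)" and ?k = "\<lambda>r. ennreal (rho r * bb r)"
  have 0: "0 \<le> tau t * min 1 t" for t by (cases "0 < t") (auto simp: tau_def)
  have "(NN q. ennreal \<bar>tau (fst q) * min 1 (fst q) * (rho (snd q) * bb (snd q))\<bar>) = (NN q. ?f (fst q) * ?k (snd q))"
   unfolding abs_of_nonneg[OF mult_nonneg_nonneg[OF 0 mult_nonneg_nonneg[OF rho_tau_nonneg(1,3)]]]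
   using 0 by (intro nn_integral_cong ennreal_mult) auto
  also have "\<dots> = (NN t. NN r. ?f t * ?k r)"
   unfolding lborel_prod[symmetric] by (subst lborel.nn_integral_fst[symmetric]) auto
  also have "\<dots> < top" using tau_min_integral rho_bb_integral
   by (simp add: nn_integral_cmult nn_integral_multc ennreal_mult_less_top)
  finally show "(NN q. ennreal \<bar>tau (fst q) * min 1 (fst q) * (rho (snd q) * bb (snd q))\<bar>) < top" .
 qed (simp add: borel_prod[symmetric])
 have D_bound: "norm (tau (fst q) * rho (snd q) * X) \<le> ?D q"
  if "0 < fst q \<Longrightarrow> 0 < snd q \<Longrightarrow> \<bar>X\<bar> \<le> C * (min 1 (fst q) * bb (snd q))" for q and X :: real
 proof (cases "0 < fst q \<and> 0 < snd q")
  case True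
  then have "\<bar>tau (fst q) * rho (snd q) * X\<bar> \<le> tau (fst q) * rho (snd q) * (C * (min 1 (fst q) * bb (snd q)))"
   using that by (simp add: abs_mult mult_left_mono)
  then show ?thesis by (simp add: mult_ac)
 qed (auto simp: rho_def tau_def)
 have A_meas [measurable]: "A \<in> borel_measurable borel"
  using A by (intro borel_measurable_continuous_onI) (meson DERIV_isCont continuous_at_imp_continuous_on)
 have wm: "?w \<in> borel_measurable lborel" by (simp add: borel_prod[symmetric])
 show "integrable lborel ?w"
  by (rule Bochner_Integration.integrable_bound[OF D wm]) (use D_bound d in \<open>auto intro!: AE_I2 order_trans[OF _ abs_ge_self]\<close>)
 have "(\<lambda>n. LINT q|lborel. tau (fst q) * rho (snd q) * (\<Phi> (e n) (fst q + snd q) - \<Phi> (e n) (snd q))) \<longlonglongrightarrow> (LINT q|lborel. ?w q)"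
 proof (rule integral_dominated_convergence[OF wm _ D])
  show "(\<lambda>q. tau (fst q) * rho (snd q) * (\<Phi> (e n) (fst q + snd q) - \<Phi> (e n) (snd q))) \<in> borel_measurable lborel" for n
   unfolding \<Phi>_def by (simp add: borel_prod[symmetric])
 qed (use D_bound \<Phi>_bound[OF e(1)] in \<open>auto intro!: AE_I2 tendsto_intros lim\<close>)
 moreover have "(\<lambda>n. - (2 * pi) * \<Phi> (e n) 0) \<longlonglongrightarrow> - (2 * pi) * F 0" by (intro tendsto_intros lim)
 ultimately show "(LINT q|lborel. ?w q) = - (2 * pi) * F 0"
  unfolding \<Phi>_pairing[OF e] by (rule LIMSEQ_unique)
qed

section \<open>Pairings with test functions\<close>

definition pint :: "('a::euclidean_space \<Rightarrow> 'a \<Rightarrow> ennreal) \<Rightarrow> ('a \<Rightarrow> real) \<Rightarrow> ('a \<Rightarrow> real) \<Rightarrow> real" where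
 "pint T f \<phi> = (LINT p|lborel. enn2real (T (fst p) (snd p)) * (f (snd p) * \<phi> (fst p)))"

definition pfin :: "('a::euclidean_space \<Rightarrow> 'a \<Rightarrow> ennreal) \<Rightarrow> ('a \<Rightarrow> real) \<Rightarrow> ('a \<Rightarrow> real) \<Rightarrow> ennreal" where
 "pfin T f \<phi> = (NN x. NN y. T x y * ennreal \<bar>f y * \<phi> x\<bar>)"

abbreviation jmeas :: "('a::euclidean_space \<Rightarrow> 'a \<Rightarrow> ennreal) \<Rightarrow> bool" where
 "jmeas T \<equiv> (\<lambda>p. T (fst p) (snd p)) \<in> borel_measurable (lborel \<Otimes>\<^sub>M lborel)"

lemma pfin_mono: "(\<And>x y. T x y \<le> S x y) \<Longrightarrow> pfin T f \<phi> \<le> pfin S f \<phi>"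
 unfolding pfin_def by (intro nn_integral_mono mult_right_mono) auto

lemma pfin_pair:
 assumes T [measurable]: "jmeas T" and f [measurable]: "f \<in> borel_measurable borel" and \<phi> [measurable]: "\<phi> \<in> borel_measurable borel"
 shows "pfin T f \<phi> = (NN p. T (fst p) (snd p) * ennreal \<bar>f (snd p) * \<phi> (fst p)\<bar>)"
 unfolding pfin_def lborel_prod[symmetric] by (subst lborel.nn_integral_fst[symmetric]) simp_all

text \<open>Fubini on the product space: the same number arises by applying \<open>T\<close> to f or
  its transpose to \<phi>. The second form allows estimates in which f is merely bounded.\<close>

lemma pint_iter:
 assumes T [measurable]: "jmeas T" and f [measurable]: "f \<in> borel_measurable borel" and \<phi> [measurable]: "\<phi> \<in> borel_measurable borel"
  and fin: "pfin T f \<phi> < top"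
 shows "integrable lborel (\<lambda>p. enn2real (T (fst p) (snd p)) * (f (snd p) * \<phi> (fst p)))"
  "integrable lborel (\<lambda>x. opk T f x * \<phi> x)" "(LINT x|lborel. opk T f x * \<phi> x) = pint T f \<phi>"
  "integrable lborel (\<lambda>y. opk (\<lambda>y x. T x y) \<phi> y * f y)" "(LINT y|lborel. opk (\<lambda>y x. T x y) \<phi> y * f y) = pint T f \<phi>"
  "ennreal \<bar>pint T f \<phi>\<bar> \<le> pfin T f \<phi>"
proof -
 let ?H = "\<lambda>p. enn2real (T (fst p) (snd p)) * (f (snd p) * \<phi> (fst p))"
 define h where "h x y = enn2real (T x y) * (f y * \<phi> x)" for x y
 have eq: "case_prod h = ?H" by (auto simp: h_def)
 have le: "(NN p. ennreal \<bar>enn2real (T (fst p) (snd p)) * (f (snd p) * \<phi> (fst p))\<bar>) \<le> pfin T f \<phi>"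
  unfolding pfin_pair[OF T f \<phi>] by (intro nn_integral_mono abs_enn2real_mult_le)
 show i: "integrable lborel ?H"
 proof (rule integrableI_nn)
  have "?H \<in> borel_measurable (lborel \<Otimes>\<^sub>M lborel)" by measurable
  then show "?H \<in> borel_measurable lborel" by (simp add: lborel_prod)
 qed (rule order_le_less_trans[OF le fin])
 then have int: "integrable (lborel \<Otimes>\<^sub>M lborel) (case_prod h)" by (simp add: eq lborel_prod)
 have p: "pint T f \<phi> = (LINT p|(lborel \<Otimes>\<^sub>M lborel). case_prod h p)" unfolding pint_def eq lborel_prod ..
 have 1: "(LINT y|lborel. h x y) = opk T f x * \<phi> x" for x unfolding h_def opk_def by (simp flip: mult.assoc)
 have 2: "(LINT x|lborel. h x y) = opk (\<lambda>y x. T x y) \<phi> y * f y" for y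
 proof -
  have "h x y = enn2real (T x y) * \<phi> x * f y" for x by (simp add: h_def)
  then show ?thesis unfolding opk_def by simp
 qed
 show "integrable lborel (\<lambda>x. opk T f x * \<phi> x)" using lborel_pair.integrable_fst[OF int] unfolding 1 .
 show "(LINT x|lborel. opk T f x * \<phi> x) = pint T f \<phi>" using lborel_pair.integral_fst[OF int] unfolding 1 p by simp
 show "integrable lborel (\<lambda>y. opk (\<lambda>y x. T x y) \<phi> y * f y)" using lborel_pair.integrable_snd[OF int] unfolding 2 .
 show "(LINT y|lborel. opk (\<lambda>y x. T x y) \<phi> y * f y) = pint T f \<phi>" using lborel_pair.integral_snd[OF int] unfolding 2 p by simp
 show "ennreal \<bar>pint T f \<phi>\<bar> \<le> pfin T f \<phi>" unfolding pint_def by (rule order_trans[OF integral_norm_le_nn le])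
qed

lemma pint_cmult: "0 \<le> c \<Longrightarrow> pint (\<lambda>x y. ennreal c * T x y) f \<phi> = c * pint T f \<phi>"
 by (simp add: pint_def enn2real_mult mult.assoc)

lemma pfin_cmult:
 assumes T [measurable]: "jmeas T" and f [measurable]: "f \<in> borel_measurable borel" and \<phi> [measurable]: "\<phi> \<in> borel_measurable borel"
 shows "pfin (\<lambda>x y. c * T x y) f \<phi> = c * pfin T f \<phi>"
proof -
 have cm: "jmeas (\<lambda>x y. c * T x y)" by measurable
 have m: "(\<lambda>p. T (fst p) (snd p) * ennreal \<bar>f (snd p) * \<phi> (fst p)\<bar>) \<in> borel_measurable lborel"
  unfolding lborel_prod[symmetric] by measurable
 show ?thesis unfolding pfin_pair[OF cm f \<phi>] pfin_pair[OF T f \<phi>] mult.assoc by (rule nn_integral_cmult[OF m])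
qed

lemma pint_add:
 assumes T: "jmeas T" and S: "jmeas S" and f [measurable]: "f \<in> borel_measurable borel" and \<phi> [measurable]: "\<phi> \<in> borel_measurable borel"
  and finT: "pfin T f \<phi> < top" and finS: "pfin S f \<phi> < top"
 shows "pint (\<lambda>x y. T x y + S x y) f \<phi> = pint T f \<phi> + pint S f \<phi>"
proof -
 note [measurable] = T S
 have ae: "AE p in lborel. U (fst p) (snd p) * ennreal \<bar>f (snd p) * \<phi> (fst p)\<bar> \<noteq> \<infinity>" if [measurable]: "jmeas U" and "pfin U f \<phi> < top" for U
 proof (rule nn_integral_noteq_infinite)
  show "(\<lambda>p. U (fst p) (snd p) * ennreal \<bar>f (snd p) * \<phi> (fst p)\<bar>) \<in> borel_measurable lborel"
   unfolding lborel_prod[symmetric] by measurable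
  show "(NN p. U (fst p) (snd p) * ennreal \<bar>f (snd p) * \<phi> (fst p)\<bar>) \<noteq> \<infinity>"
   using that(2) unfolding pfin_pair[OF that(1) f \<phi>] by simp
 qed
 have "pint (\<lambda>x y. T x y + S x y) f \<phi> = (LINT p|lborel. enn2real (T (fst p) (snd p)) * (f (snd p) * \<phi> (fst p)) + enn2real (S (fst p) (snd p)) * (f (snd p) * \<phi> (fst p)))"
  unfolding pint_def
 proof (rule integral_cong_AE)
  show "(\<lambda>p. enn2real (T (fst p) (snd p) + S (fst p) (snd p)) * (f (snd p) * \<phi> (fst p))) \<in> borel_measurable lborel"
   unfolding lborel_prod[symmetric] by measurable
  show "(\<lambda>p. enn2real (T (fst p) (snd p)) * (f (snd p) * \<phi> (fst p)) + enn2real (S (fst p) (snd p)) * (f (snd p) * \<phi> (fst p))) \<in> borel_measurable lborel"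
   unfolding lborel_prod[symmetric] by measurable
  show "AE p in lborel. enn2real (T (fst p) (snd p) + S (fst p) (snd p)) * (f (snd p) * \<phi> (fst p)) =
    enn2real (T (fst p) (snd p)) * (f (snd p) * \<phi> (fst p)) + enn2real (S (fst p) (snd p)) * (f (snd p) * \<phi> (fst p))"
   using ae[OF T finT] ae[OF S finS]
  proof eventually_elim
   case (elim p)
   show ?case
   proof (cases "f (snd p) * \<phi> (fst p) = 0")
    case False
    have "u < top" if "u * ennreal \<bar>r\<bar> \<noteq> \<infinity>" "r \<noteq> 0" for u :: ennreal and r :: real
     using that by (cases u) (auto simp: ennreal_top_mult)
    from this[OF _ False] elim have "T (fst p) (snd p) < top" "S (fst p) (snd p) < top" by auto
    then show ?thesis by (simp only: enn2real_plus distrib_right)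
   qed (simp only: mult_zero_right add_0)
  qed
 qed
 also have "\<dots> = pint T f \<phi> + pint S f \<phi>" unfolding pint_def
  by (rule Bochner_Integration.integral_add[OF pint_iter(1)[OF T f \<phi> finT] pint_iter(1)[OF S f \<phi> finS]])
 finally show ?thesis .
qed

lemma pint_mix:
 fixes N :: "real \<Rightarrow> 'a::euclidean_space \<Rightarrow> 'a \<Rightarrow> ennreal"
 assumes N: "kmeas N" and f [measurable]: "f \<in> borel_measurable borel" and \<phi> [measurable]: "\<phi> \<in> borel_measurable borel"
  and fin: "(NN t. pfin (N t) f \<phi>) < top"
 shows "integrable lborel (\<lambda>t. pint (N t) f \<phi>)" "(LINT t|lborel. pint (N t) f \<phi>) = pint (\<lambda>x y. NN t. N t x y) f \<phi>"
proof -
 note [measurable] = kmeasD[OF N]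
 have j: "jmeas (N t)" for t by measurable
 have w: "(\<lambda>p. f (snd p) * \<phi> (fst p)) \<in> borel_measurable borel" by (simp add: borel_prod[symmetric])
 have m: "(\<lambda>q. N (fst q) (fst (snd q)) (snd (snd q))) \<in> borel_measurable (lborel \<Otimes>\<^sub>M lborel)"
  by (rule kmeasD[OF N]) (simp_all add: borel_prod[symmetric] cong: measurable_cong_sets)
 have fin': "(NN t. NN p. N t (fst p) (snd p) * ennreal \<bar>f (snd p) * \<phi> (fst p)\<bar>) < top"
  using fin unfolding pfin_pair[OF j f \<phi>] .
 show "integrable lborel (\<lambda>t. pint (N t) f \<phi>)" "(LINT t|lborel. pint (N t) f \<phi>) = pint (\<lambda>x y. NN t. N t x y) f \<phi>"
  unfolding pint_def using nn_mix[where N = "\<lambda>t p. N t (fst p) (snd p)", OF m w fin'] by simp_all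
qed

section \<open>Small times for kernels close to the heat kernel\<close>

context schr
begin

text \<open>Reversing time by s -> t - s together with the symmetry of the heat kernel. Bounds by P
  V P therefore also hold for transposed kernels.\<close>

lemma ck_hk_commute: "ck hk v hk t x y = ck hk v hk t y x"
proof -
 have "(NN s. (\<lambda>s. NN z. hk (t - s) x z * (v z * hk s z y)) (t - s)) = ck hk v hk t x y"
  unfolding ck_def cv_def by (rule nn_integral_reflect) measurable
 moreover have "hk (t - (t - s)) x z * (v z * hk (t - s) z y) = hk (t - s) y z * (v z * hk s z x)" for s z
  by (simp add: hk_commute[of s x z] hk_commute[of "t - s" z y] mult_ac)
 ultimately show ?thesis unfolding ck_def cv_def by (simp only:)
qed

end

lemma hk_time_compare:
 fixes x y :: "'a::euclidean_space"
 assumes a: "0 < a" and b: "a \<le> b"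
 shows "hk a x y \<le> ennreal ((b / a) powr (real DIM('a) / 2)) * hk b x y"
proof -
 define p where "p = real DIM('a) / 2"
 have "(b / a) powr p * (4 * pi * b) powr (- p) = (b / a) powr p * ((b / a) * (4 * pi * a)) powr (- p)"
  using a by (simp add: mult.commute)
 also have "\<dots> = ((b / a) powr p * (b / a) powr (- p)) * (4 * pi * a) powr (- p)"
  using a b by (subst powr_mult) auto
 also have "(b / a) powr p * (b / a) powr (- p) = 1"
  using a b by (simp only: powr_add[symmetric]) simp
 finally have c: "(b / a) powr p * (4 * pi * b) powr (- p) = (4 * pi * a) powr (- p)" by simp
 have "(norm (x - y))\<^sup>2 / (4 * b) \<le> (norm (x - y))\<^sup>2 / (4 * a)" using a b by (intro divide_left_mono) auto
 then have "exp (- (norm (x - y))\<^sup>2 / (4 * a)) \<le> exp (- (norm (x - y))\<^sup>2 / (4 * b))" by simp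
 then have "(4 * pi * a) powr (- p) * exp (- (norm (x - y))\<^sup>2 / (4 * a)) \<le> (4 * pi * a) powr (- p) * exp (- (norm (x - y))\<^sup>2 / (4 * b))"
  by (rule mult_left_mono) simp
 also have "\<dots> = (b / a) powr p * ((4 * pi * b) powr (- p) * exp (- (norm (x - y))\<^sup>2 / (4 * b)))"
  unfolding c[symmetric] by (rule mult.assoc)
 finally have "heat a (x - y) \<le> (b / a) powr p * heat b (x - y)"
  by (simp add: heat_def p_def)
 then have "ennreal (heat a (x - y)) \<le> ennreal ((b / a) powr p) * ennreal (heat b (x - y))"
  by (subst ennreal_mult[symmetric]) (auto intro: ennreal_leI)
 then show ?thesis using a b by (simp add: hk_def p_def)
qed

context schr
begin

text \<open>The hypothesis bounds only a time integral of the heat flow of V. Since P_\<tau> \<le>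
  (\<sigma>/\<tau>)^(d/2) P_\<sigma> for \<tau> \<le> \<sigma>, the value at \<tau> is bounded by
  the average over \<sigma> in [2, 3], and 3 bounds \<sigma>/\<tau>.\<close>

lemma v_hk_bounded: "\<exists>C\<ge>0. \<forall>\<tau> x. 1 \<le> \<tau> \<longrightarrow> \<tau> \<le> 2 \<longrightarrow> (NN w. v w * hk \<tau> w x) \<le> ennreal C"
proof (intro exI conjI allI impI)
 define c where "c = (3::real) powr (real DIM('a) / 2)"
 have c0: "c \<ge> 0" by (simp add: c_def)
 show "0 \<le> c * M" using M_nonneg c0 by simp
 fix \<tau> :: real and x assume \<tau>: "1 \<le> \<tau>" "\<tau> \<le> 2"
 have "(NN w. v w * hk \<tau> w x) = (NN \<sigma>. (NN w. v w * hk \<tau> w x) * indicator {2..3::real} \<sigma>)"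
  by (simp add: nn_integral_cmult)
 also have "\<dots> \<le> (NN \<sigma>. NN w. ennreal c * (v w * hk \<sigma> w x))"
 proof (rule nn_integral_mono)
  fix \<sigma> :: real
  show "(NN w. v w * hk \<tau> w x) * indicator {2..3} \<sigma> \<le> (NN w. ennreal c * (v w * hk \<sigma> w x))"
  proof (cases "\<sigma> \<in> {2..3}")
   case True
   have "v w * hk \<tau> w x \<le> ennreal c * (v w * hk \<sigma> w x)" for w
   proof -
    have "hk \<tau> w x \<le> ennreal ((\<sigma> / \<tau>) powr (real DIM('a) / 2)) * hk \<sigma> w x"
     by (rule hk_time_compare) (use True \<tau> in auto)
    also have "\<dots> \<le> ennreal c * hk \<sigma> w x" unfolding c_def
    proof (intro mult_right_mono ennreal_leI powr_mono2)
     have "\<sigma> / \<tau> \<le> \<sigma> / 1" using True \<tau> by (intro divide_left_mono) auto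
     then show "\<sigma> / \<tau> \<le> 3" using True by simp
    qed (use True \<tau> in auto)
    finally have "v w * hk \<tau> w x \<le> v w * (ennreal c * hk \<sigma> w x)" by (rule mult_left_mono) simp
    then show ?thesis by (simp add: mult_ac)
   qed
   then show ?thesis using True by (simp add: nn_integral_mono)
  qed simp
 qed
 also have "\<dots> = ennreal c * (NN \<sigma>. NN w. v w * hk \<sigma> w x)"
  by (simp add: nn_integral_cmult)
 also have "\<dots> \<le> ennreal c * ennreal M" by (intro mult_left_mono V_bound) simp
 also have "\<dots> = ennreal (c * M)" using c0 M_nonneg by (simp add: ennreal_mult)
 finally show "(NN w. v w * hk \<tau> w x) \<le> ennreal (c * M)" .
qed

text \<open>The left kernel has mass 1 and the right one turns P_1 into P_{s+1}. What remains is V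
  integrated against P_{s+1} with s + 1 in [1, 2], so the integrand in s is bounded on (0,
  t).\<close>

lemma ck_hk_small_time:
 "\<exists>C\<ge>0. \<forall>t. 0 < t \<longrightarrow> t \<le> 1 \<longrightarrow> (NN x. NN y. ck hk v hk t x y * hk 1 y 0) \<le> ennreal (C * t)"
proof -
 obtain C where C: "C \<ge> 0" "\<And>\<tau> x. 1 \<le> \<tau> \<Longrightarrow> \<tau> \<le> 2 \<Longrightarrow> (NN w. v w * hk \<tau> w x) \<le> ennreal C"
  using v_hk_bounded by blast
 define G :: "real \<Rightarrow> 'a \<Rightarrow> ennreal" where "G s z = (NN y. hk s z y * hk 1 y 0)" for s z
 have [measurable]: "(\<lambda>q. G (f q) (g q)) \<in> borel_measurable N"
  if [measurable]: "f \<in> borel_measurable N" "g \<in> borel_measurable N" for f g and N :: "'b measure"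
  unfolding G_def by measurable
 have "(NN x. NN y. ck hk v hk t x y * hk 1 y 0) \<le> ennreal (C * t)" if t: "0 < t" "t \<le> 1" for t
 proof -
  have "(NN y. ck hk v hk t x y * hk 1 y 0) = (NN s. NN z. hk (t - s) x z * (v z * G s z))" for x
   unfolding G_def by (rule trans[OF cv_kprod[OF kmeas_hk kmeas_hk, symmetric]]) (measurable, simp add: cv_def)
  then have "(NN x. NN y. ck hk v hk t x y * hk 1 y 0) = (NN x. NN s. NN z. hk (t - s) x z * (v z * G s z))" by simp
  also have "\<dots> = (NN s. NN x. NN z. hk (t - s) x z * (v z * G s z))" by (rule nn_integral_swap) measurable
  also have "\<dots> = (NN s. NN z. NN x. hk (t - s) x z * (v z * G s z))"
   by (rule nn_integral_cong) (rule nn_integral_swap, measurable)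
  also have "\<dots> \<le> (NN s. ennreal C * indicator {0<..<t} s)"
  proof (rule nn_integral_mono)
   fix s :: real
   show "(NN z. NN x. hk (t - s) x z * (v z * G s z)) \<le> ennreal C * indicator {0<..<t} s"
   proof (cases "0 < s \<and> s < t")
    case True
    then have "(NN x. hk (t - s) x z * (v z * G s z)) = v z * hk (s + 1) z 0" for z
     by (simp add: nn_integral_multc nn_integral_hk G_def hk_semigroup)
    then show ?thesis using C(2)[of "s + 1" 0] True t by simp
   next
    case False
    then have "hk (t - s) x z * (v z * G s z) = 0" for x z by (auto simp: hk_def G_def)
    then show ?thesis by (simp only:) simp
   qed
  qed
  also have "\<dots> = ennreal (C * t)" using t C(1) by (simp add: nn_integral_cmult ennreal_mult)
  finally show ?thesis .
 qed
 then show ?thesis using C(1) by blast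
qed

text \<open>The defect from the heat kernel contributes at most the rate of P V P, which is linear
  in t like that of the heat flow itself. The formulation with \<open>T\<close> and \<open>D\<close>
  covers K, P and the transposed kernels alike.\<close>

lemma approx_test_fun:
 assumes \<phi>: "test_fun (\<phi> :: 'a \<Rightarrow> real)"
 obtains C where "C \<ge> 0" "\<And>t T D. 0 < t \<Longrightarrow> t \<le> 1 \<Longrightarrow> jmeas T \<Longrightarrow> jmeas D \<Longrightarrow> (\<And>x y. T x y + D x y = hk t x y)
   \<Longrightarrow> (\<And>x y. D x y \<le> ck hk v hk t x y) \<Longrightarrow> (NN x. ennreal \<bar>opk T \<phi> x - \<phi> x\<bar>) \<le> ennreal (C * t)"
proof -
 have \<phi>m [measurable]: "\<phi> \<in> borel_measurable borel" by (rule test_fun_measurable[OF \<phi>])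
 obtain C1 where C1: "C1 \<ge> 0" "\<And>t. t > 0 \<Longrightarrow> (NN x. ennreal \<bar>opk (hk t) \<phi> x - \<phi> x\<bar>) \<le> ennreal (C1 * t)"
  using heat_approx_test_fun[OF \<phi>] by blast
 obtain C2 where C2: "C2 \<ge> 0" "\<And>t. 0 < t \<Longrightarrow> t \<le> 1 \<Longrightarrow> (NN x. NN y. ck hk v hk t x y * hk 1 y 0) \<le> ennreal (C2 * t)"
  using ck_hk_small_time by blast
 obtain C3 where C3: "C3 \<ge> 0" "\<And>x. ennreal \<bar>\<phi> x\<bar> \<le> ennreal C3 * hk 1 x 0"
  using test_fun_le_heat[OF \<phi>] by blast
 show ?thesis
 proof (rule that)
  show "0 \<le> C1 + C3 * C2" using C1 C2 C3 by simp
  fix t T D assume t: "0 < t" "t \<le> (1::real)" and T [measurable]: "jmeas T" and D [measurable]: "jmeas D"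
   and eq: "\<And>x y. T x y + D x y = hk t x y" and le: "\<And>x y. D x y \<le> ck hk v hk t x y"
  note [measurable] = kmeasD[OF kmeas_ck[OF kmeas_hk kmeas_hk, of v]]
  have sec [measurable]: "T x \<in> borel_measurable borel" "D x \<in> borel_measurable borel" for x
   using measurable_compose[OF _ T, of "\<lambda>y. (x, y)" borel] measurable_compose[OF _ D, of "\<lambda>y. (x, y)" borel] by simp_all
  have split: "opk (hk t) \<phi> x = opk T \<phi> x + opk D \<phi> x" for x
  proof -
   have hf: "(NN y. hk t x y * ennreal \<bar>\<phi> y\<bar>) < top"
   proof -
    obtain B where B: "B \<ge> 0" "\<And>x. \<bar>\<phi> x\<bar> \<le> B" using test_fun_bounded[OF \<phi>] by blast
    have "(NN y. hk t x y * ennreal \<bar>\<phi> y\<bar>) \<le> (NN y. hk t x y * ennreal B)"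
     by (intro nn_integral_mono mult_left_mono ennreal_leI B) auto
    also have "\<dots> = ennreal B" using t by (simp add: nn_integral_multc nn_integral_hk)
    finally show ?thesis by (simp add: order_le_less_trans)
   qed
   have i: "integrable lborel (\<lambda>y. enn2real (S x y) * \<phi> y)" if m: "S x \<in> borel_measurable borel" and l: "\<And>y. S x y \<le> hk t x y" for S
   proof (rule opk_integrable_at(1)[where T = S and x = x and f = \<phi>, OF m \<phi>m])
    have "(NN y. S x y * ennreal \<bar>\<phi> y\<bar>) \<le> (NN y. hk t x y * ennreal \<bar>\<phi> y\<bar>)"
     by (intro nn_integral_mono mult_right_mono l) auto
    then show "(NN y. S x y * ennreal \<bar>\<phi> y\<bar>) < top" using hf by (rule order_le_less_trans)
   qed
   have l: "T x y \<le> hk t x y" "D x y \<le> hk t x y" for y by (simp_all flip: eq)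
   have "enn2real (hk t x y) * \<phi> y = enn2real (T x y) * \<phi> y + enn2real (D x y) * \<phi> y" for y
   proof -
    have "hk t x y < top" by (simp add: hk_def)
    then have "T x y < top" "D x y < top" using l[of y] by (auto intro: order_le_less_trans)
    then show ?thesis by (simp only: eq[symmetric] enn2real_plus distrib_right)
   qed
   then show ?thesis unfolding opk_def using i[of T] i[of D] l by simp
  qed
  have Dle: "(NN x. ennreal \<bar>opk D \<phi> x\<bar>) \<le> ennreal (C3 * C2 * t)"
  proof -
   have "(NN x. ennreal \<bar>opk D \<phi> x\<bar>) \<le> (NN x. NN y. ck hk v hk t x y * (ennreal C3 * hk 1 y 0))"
    by (intro nn_integral_mono order_trans[OF opk_abs_le] mult_mono le C3) auto
   also have "\<dots> = (NN x. ennreal C3 * (NN y. ck hk v hk t x y * hk 1 y 0))"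
    unfolding mult.left_commute[of _ "ennreal C3"] by (intro nn_integral_cong nn_integral_cmult) measurable
   also have "\<dots> = ennreal C3 * (NN x. NN y. ck hk v hk t x y * hk 1 y 0)"
    by (rule nn_integral_cmult) measurable
   also have "\<dots> \<le> ennreal C3 * ennreal (C2 * t)" by (intro mult_left_mono C2 t) simp
   also have "\<dots> = ennreal (C3 * C2 * t)" using C2(1) C3(1) t by (simp add: mult.assoc flip: ennreal_mult)
   finally show ?thesis .
  qed
  have opm: "opk S \<phi> \<in> borel_measurable lborel" if [measurable]: "jmeas S" for S
  proof -
   have "(\<lambda>x. LINT y|lborel. enn2real (S x y) * \<phi> y) \<in> borel_measurable lborel"
    by (rule lborel.borel_measurable_lebesgue_integral) (simp add: case_prod_unfold)
   then show ?thesis by (simp add: opk_def[abs_def])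
  qed
  have hm: "jmeas (hk t)" by measurable
  note [measurable] = opm[OF T] opm[OF D] opm[OF hm]
  have "(NN x. ennreal \<bar>opk T \<phi> x - \<phi> x\<bar>) \<le> (NN x. ennreal \<bar>opk (hk t) \<phi> x - \<phi> x\<bar> + ennreal \<bar>opk D \<phi> x\<bar>)"
  proof (rule nn_integral_mono)
   fix x
   have "\<bar>opk T \<phi> x - \<phi> x\<bar> \<le> \<bar>opk (hk t) \<phi> x - \<phi> x\<bar> + \<bar>opk D \<phi> x\<bar>" using split[of x] by linarith
   then show "ennreal \<bar>opk T \<phi> x - \<phi> x\<bar> \<le> ennreal \<bar>opk (hk t) \<phi> x - \<phi> x\<bar> + ennreal \<bar>opk D \<phi> x\<bar>"
    by (simp add: ennreal_leI flip: ennreal_plus)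
  qed
  also have "\<dots> = (NN x. ennreal \<bar>opk (hk t) \<phi> x - \<phi> x\<bar>) + (NN x. ennreal \<bar>opk D \<phi> x\<bar>)"
   by (rule nn_integral_add) measurable
  also have "\<dots> \<le> ennreal (C1 * t) + ennreal (C3 * C2 * t)" by (intro add_mono C1 Dle t)
  also have "\<dots> = ennreal ((C1 + C3 * C2) * t)" using C1 C2 C3 t by (simp add: distrib_right flip: ennreal_plus)
  finally show "(NN x. ennreal \<bar>opk T \<phi> x - \<phi> x\<bar>) \<le> ennreal ((C1 + C3 * C2) * t)" .
 qed
qed

end

text \<open>For r \<le> 1 the mass of the kernel and sup |f| give a constant; for r > 1 the supremum
  of the kernel is at most r^(-d/2) \<le> r^(-3/2), which uses d \<ge> 3.\<close>

lemma heat_decay: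
 fixes f :: "'a::euclidean_space \<Rightarrow> real"
 assumes dim: "DIM('a) \<ge> 3" and f: "test_fun f"
 shows "\<exists>C\<ge>0. \<forall>r>0. \<forall>x. (NN y. hk r x y * ennreal \<bar>f y\<bar>) \<le> ennreal (C * bb r)"
proof -
 have [measurable]: "f \<in> borel_measurable borel" by (rule test_fun_measurable[OF f])
 obtain B where B: "B \<ge> 0" "\<And>x. \<bar>f x\<bar> \<le> B" using test_fun_bounded[OF f] by blast
 define I where "I = (LINT x|lborel. \<bar>f x\<bar>)"
 have I: "I \<ge> 0" "(NN x. ennreal \<bar>f x\<bar>) = ennreal I"
  using integrable_nn(1)[OF test_fun_integrable[OF f]] by (simp_all add: I_def)
 have "(NN y. hk r x y * ennreal \<bar>f y\<bar>) \<le> ennreal ((B + I) * bb r)" if r: "r > 0" for r x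
 proof (cases "r \<le> 1")
  case True
  have "1 \<le> r powr (-3/2)" using True r powr_mono2'[of "-3/2" r 1] by simp
  then have bb: "bb r = 1" using r by (simp add: bb_eq)
  have "(NN y. hk r x y * ennreal \<bar>f y\<bar>) \<le> (NN y. hk r x y * ennreal B)"
   by (intro nn_integral_mono mult_left_mono ennreal_leI B) auto
  also have "\<dots> = ennreal B" using r by (simp add: nn_integral_multc nn_integral_hk)
  also have "\<dots> \<le> ennreal ((B + I) * bb r)" using I(1) bb by (intro ennreal_leI) simp
  finally show ?thesis .
 next
  case False
  have "r powr (-3/2) \<le> 1 powr (-3/2)" using False by (intro powr_mono2') auto
  then have bb: "bb r = r powr (-3/2)" using r by (simp add: bb_eq)
  have h: "hk r x y \<le> ennreal (bb r)" for y
  proof -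
   have "(4 * pi * r) powr (- real DIM('a) / 2) \<le> r powr (- real DIM('a) / 2)"
   proof (rule powr_mono2')
    have "1 * 1 \<le> 4 * pi" using pi_ge_two by (intro mult_mono) auto
    then have "1 * r \<le> (4 * pi) * r" using r by (intro mult_right_mono) auto
    then show "r \<le> 4 * pi * r" by simp
   qed (use r in auto)
   also have "\<dots> \<le> r powr (-3/2)" using dim False by (intro powr_mono) auto
   finally have "(4 * pi * r) powr (- real DIM('a) / 2) * exp (- (norm (x - y))\<^sup>2 / (4 * r)) \<le> r powr (-3/2) * 1"
    using r by (intro mult_mono) auto
   then show ?thesis using r by (simp add: hk_def heat_def bb ennreal_leI)
  qed
  have "(NN y. hk r x y * ennreal \<bar>f y\<bar>) \<le> (NN y. ennreal (bb r) * ennreal \<bar>f y\<bar>)"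
   by (intro nn_integral_mono mult_right_mono h) auto
  also have "\<dots> = ennreal (bb r) * ennreal I" using I by (simp add: nn_integral_cmult)
  also have "\<dots> \<le> ennreal ((B + I) * bb r)"
   using I(1) B(1) by (simp add: ennreal_leI mult.commute distrib_left flip: ennreal_mult)
  finally show ?thesis .
 qed
 moreover have "B + I \<ge> 0" using B I by simp
 ultimately show ?thesis by blast
qed

lemma nn_integral_section_mult:
 assumes [measurable]: "jmeas T" "f \<in> borel_measurable borel"
 shows "(NN y. T x y * ennreal \<bar>f y * c\<bar>) = (NN y. T x y * ennreal \<bar>f y\<bar>) * ennreal \<bar>c\<bar>"
proof -
 have [measurable]: "T x \<in> borel_measurable borel"
  using measurable_compose[OF _ assms(1), of "\<lambda>y. (x, y)" borel] by simp
 show ?thesis by (subst nn_integral_multc[symmetric]) (auto simp: abs_mult ennreal_mult mult_ac)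
qed

lemma jmeas_hk: "jmeas (hk r)" by measurable

lemma pfin_hk:
 fixes f \<phi> :: "'a::euclidean_space \<Rightarrow> real"
 assumes dim: "DIM('a) \<ge> 3" and f: "test_fun f" and \<phi>: "test_fun \<phi>"
 shows "\<exists>C\<ge>0. \<forall>r>0. pfin (hk r) f \<phi> \<le> ennreal (C * bb r)"
proof -
 obtain C where C: "C \<ge> 0" "\<And>r x. r > 0 \<Longrightarrow> (NN y. hk r x y * ennreal \<bar>f y\<bar>) \<le> ennreal (C * bb r)"
  using heat_decay[OF dim f] by blast
 note [measurable] = test_fun_measurable[OF f] test_fun_measurable[OF \<phi>]
 define I where "I = (LINT x|lborel. \<bar>\<phi> x\<bar>)"
 have I: "I \<ge> 0" "(NN x. ennreal \<bar>\<phi> x\<bar>) = ennreal I"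
  using integrable_nn(1)[OF test_fun_integrable[OF \<phi>]] by (simp_all add: I_def)
 have "pfin (hk r) f \<phi> \<le> ennreal ((C * I) * bb r)" if r: "r > 0" for r
 proof -
  have "pfin (hk r) f \<phi> = (NN x. (NN y. hk r x y * ennreal \<bar>f y\<bar>) * ennreal \<bar>\<phi> x\<bar>)"
   unfolding pfin_def by (intro nn_integral_cong nn_integral_section_mult jmeas_hk) measurable
  also have "\<dots> \<le> (NN x. ennreal (C * bb r) * ennreal \<bar>\<phi> x\<bar>)"
   by (intro nn_integral_mono mult_right_mono C r) auto
  also have "\<dots> = ennreal (C * bb r) * ennreal I" using I by (simp add: nn_integral_cmult)
  also have "\<dots> = ennreal ((C * I) * bb r)" using C(1) I(1) by (simp add: mult_ac flip: ennreal_mult)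
  finally show ?thesis .
 qed
 moreover have "C * I \<ge> 0" using C I by simp
 ultimately show ?thesis by blast
qed

lemma pfin_mix:
 fixes N :: "real \<Rightarrow> 'a::euclidean_space \<Rightarrow> 'a \<Rightarrow> ennreal"
 assumes N: "kmeas N" and f [measurable]: "f \<in> borel_measurable borel" and \<phi> [measurable]: "\<phi> \<in> borel_measurable borel"
 shows "pfin (\<lambda>x y. NN t. N t x y) f \<phi> = (NN t. pfin (N t) f \<phi>)"
proof -
 note [measurable] = kmeasD[OF N]
 have "pfin (\<lambda>x y. NN t. N t x y) f \<phi> = (NN x. NN y. NN t. N t x y * ennreal \<bar>f y * \<phi> x\<bar>)"
  unfolding pfin_def by (intro nn_integral_cong nn_integral_multc[symmetric]) measurable
 also have "\<dots> = (NN x. NN t. NN y. N t x y * ennreal \<bar>f y * \<phi> x\<bar>)"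
  by (rule nn_integral_cong) (rule nn_integral_swap, measurable)
 also have "\<dots> = (NN t. NN x. NN y. N t x y * ennreal \<bar>f y * \<phi> x\<bar>)"
  by (rule nn_integral_swap) measurable
 finally show ?thesis by (simp add: pfin_def)
qed

lemma rho_bb: "0 \<le> t \<Longrightarrow> rho r * bb (t + r) \<le> rho r * bb r"
 by (cases "0 < r") (auto simp: bb_mono rho_def intro!: divide_right_mono)

text \<open>At t = 0 this is the kernel of the inverse square root up to the factor
  \<open>c1\<close>; for t > 0 it is that kernel preceded by the semigroup at time t, as
  \<open>kprod_res\<close> shows.\<close>

definition res :: "('a::euclidean_space) kernel \<Rightarrow> 'a kernel" where
 "res S t x y = (NN r. ennreal (rho r) * S (t + r) x y)"

lemma kmeas_res:
 assumes S: "kmeas S" shows "kmeas (res S)"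
proof (rule kmeasI)
 note [measurable] = kmeasD[OF S]
 show "(\<lambda>w. res S (fst w) (fst (snd w)) (snd (snd w))) \<in> borel_measurable (borel \<Otimes>\<^sub>M borel \<Otimes>\<^sub>M borel)"
  unfolding res_def by measurable
qed

lemma res_mono: "(\<And>t x y. A t x y \<le> B t x y) \<Longrightarrow> res A t x y \<le> res B t x y"
 unfolding res_def by (intro nn_integral_mono mult_left_mono) auto

lemma kprod_res:
 assumes S: "kmeas S" and t: "t > 0"
  and semi: "\<And>r x y. 0 < r \<Longrightarrow> (NN z. S t x z * S r z y) = S (t + r) x y"
 shows "kprod (S t) (res S 0) x y = res S t x y"
proof -
 note [measurable] = kmeasD[OF S]
 have "kprod (S t) (res S 0) x y = (NN z. NN r. S t x z * (ennreal (rho r) * S r z y))"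
  unfolding kprod_def res_def by (simp add: nn_integral_cmult)
 also have "\<dots> = (NN r. NN z. S t x z * (ennreal (rho r) * S r z y))"
  by (rule nn_integral_swap) measurable
 also have "\<dots> = (NN r. ennreal (rho r) * (NN z. S t x z * S r z y))"
  unfolding mult.left_commute[of _ "ennreal (rho _)"] by (intro nn_integral_cong nn_integral_cmult) measurable
 also have "\<dots> = res S t x y" unfolding res_def
 proof (rule nn_integral_cong)
  fix r show "ennreal (rho r) * (NN z. S t x z * S r z y) = ennreal (rho r) * S (t + r) x y"
   by (cases "r > 0") (simp_all add: semi rho_def)
 qed
 finally show ?thesis .
qed

lemma jmeas_slice: "kmeas S \<Longrightarrow> jmeas (S t)"
 by (rule kmeasD) measurable

lemma jmeas_kprod:
 fixes A B :: "'a::euclidean_space \<Rightarrow> 'a \<Rightarrow> ennreal"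
 assumes A: "jmeas A" and B: "jmeas B"
 shows "jmeas (kprod A B)"
proof -
 have gen: "(\<lambda>w. S (f w) (g w)) \<in> borel_measurable N" if "jmeas S" "f \<in> borel_measurable N" "g \<in> borel_measurable N"
  for S :: "'a \<Rightarrow> 'a \<Rightarrow> ennreal" and f g and N :: "'c measure"
 proof -
  have "(\<lambda>w. (f w, g w)) \<in> N \<rightarrow>\<^sub>M (lborel \<Otimes>\<^sub>M lborel)" using that by measurable
  from measurable_compose[OF this that(1)] show ?thesis by simp
 qed
 note [measurable (raw)] = gen[OF A] gen[OF B]
 show ?thesis unfolding kprod_def by measurable
qed

lemma pfin_res_hk:
 fixes f \<phi> :: "'a::euclidean_space \<Rightarrow> real"
 assumes dim: "DIM('a) \<ge> 3" and f: "test_fun f" and \<phi>: "test_fun \<phi>" and t: "t \<ge> 0"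
 shows "pfin (res hk t) f \<phi> < top" "(NN r. pfin (\<lambda>x y. ennreal (rho r) * hk (t + r) x y) f \<phi>) < top"
proof -
 note fm = test_fun_measurable[OF f] test_fun_measurable[OF \<phi>]
 obtain C where C: "C \<ge> 0" "\<And>r. r > 0 \<Longrightarrow> pfin (hk r) f \<phi> \<le> ennreal (C * bb r)" using pfin_hk[OF dim f \<phi>] by blast
 have "(NN r. pfin (\<lambda>x y. ennreal (rho r) * hk (t + r) x y) f \<phi>) \<le> (NN r. ennreal C * ennreal (rho r * bb r))"
 proof (rule nn_integral_mono)
  fix r :: real
  have "pfin (\<lambda>x y. ennreal (rho r) * hk (t + r) x y) f \<phi> = ennreal (rho r) * pfin (hk (t + r)) f \<phi>"
   by (rule pfin_cmult[OF jmeas_hk fm])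
  also have "\<dots> \<le> ennreal C * ennreal (rho r * bb r)"
  proof (cases "r > 0")
   case True
   have "ennreal (rho r) * pfin (hk (t + r)) f \<phi> \<le> ennreal (rho r) * ennreal (C * bb (t + r))"
    using True t by (intro mult_left_mono C) auto
   also have "\<dots> = ennreal (C * (rho r * bb (t + r)))" using C(1) by (simp add: mult_ac flip: ennreal_mult)
   also have "\<dots> \<le> ennreal (C * (rho r * bb r))" by (intro ennreal_leI mult_left_mono rho_bb t C)
   also have "\<dots> = ennreal C * ennreal (rho r * bb r)" using C(1) by (simp add: ennreal_mult')
   finally show ?thesis .
  qed (simp add: rho_def)
  finally show "pfin (\<lambda>x y. ennreal (rho r) * hk (t + r) x y) f \<phi> \<le> ennreal C * ennreal (rho r * bb r)" .
 qed
 also have "\<dots> < top" using rho_bb_integral by (simp add: nn_integral_cmult ennreal_mult_less_top)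
 finally show *: "(NN r. pfin (\<lambda>x y. ennreal (rho r) * hk (t + r) x y) f \<phi>) < top" .
 have km: "kmeas (\<lambda>r x y. ennreal (rho r) * hk (t + r) x (y :: 'a))" by (rule kmeasI) measurable
 show "pfin (res hk t) f \<phi> < top"
  unfolding res_def[abs_def] pfin_mix[OF km fm] by (rule *)
qed

section \<open>The weak formula for the compositions\<close>

text \<open>Both compositions are treated at once: (A, B, \<sigma>) is (P, K, 1) or (K, P, -1), and
  \<open>perturb\<close> says A = B + \<sigma> A V B without subtracting. \<open>B_dual\<close> says
  that B falls short of P by at most P V P, which gives the rate of approximation on test
  functions.\<close>

locale schr_pair = schr V M for V :: "'a::euclidean_space \<Rightarrow> real" and M +
 fixes A B :: "'a kernel" and \<sigma> :: real
 assumes A_le: "A t x y \<le> hk t x y" and B_le: "B t x y \<le> hk t x y"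
  and A_meas: "kmeas A" and B_meas: "kmeas B"
  and B_semigroup: "0 < t \<Longrightarrow> 0 < s \<Longrightarrow> (NN z. B t x z * B s z y) = B (t + s) x y"
  and B_dual: "\<exists>D. kmeas D \<and> (\<forall>t x y. B t x y + D t x y = hk t x y \<and> D t x y \<le> ck hk v hk t x y)"
  and perturb: "\<sigma> = 1 \<and> (\<forall>t x y. B t x y + ck A v B t x y = A t x y)
   \<or> \<sigma> = - 1 \<and> (\<forall>t x y. A t x y + ck A v B t x y = B t x y)"
begin

lemma ck_le: "ck A v B t x y \<le> hk t x y"
proof -
 have "ck A v B t x y \<le> A t x y \<or> ck A v B t x y \<le> B t x y"
  using perturb by (metis add_increasing le_cases order_refl zero_le add.commute)
 then show ?thesis using A_le B_le order_trans by blast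
qed

lemma B_nonpos: "t \<le> 0 \<Longrightarrow> B t x y = 0" and A_nonpos: "t \<le> 0 \<Longrightarrow> A t x y = 0"
 using B_le[of t x y] A_le[of t x y] by (auto simp: hk_def)

lemma l1k_B: "t > 0 \<Longrightarrow> l1k (B t) 1"
proof (rule l1kI)
 note [measurable] = kmeasD[OF B_meas]
 show "(\<lambda>w. B t (fst w) (snd w)) \<in> borel_measurable (borel \<Otimes>\<^sub>M borel)" by measurable
 assume t: "t > 0"
 show "(NN x. B t x y) \<le> ennreal 1" for y
  using nn_integral_mono[of lborel "\<lambda>x. B t x y" "\<lambda>x. hk t x y"] B_le nn_integral_hk(1)[OF t, of y] by simp
qed simp

lemma res_B_row:
 assumes f: "test_fun f"
 shows "\<exists>C\<ge>0. \<forall>x. (NN r. NN y. ennreal (rho r) * B r x y * ennreal \<bar>f y\<bar>) \<le> ennreal C"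
proof -
 note [measurable] = kmeasD[OF B_meas] test_fun_measurable[OF f]
 obtain C where C: "C \<ge> 0" "\<And>r x. r > 0 \<Longrightarrow> (NN y. hk r x y * ennreal \<bar>f y\<bar>) \<le> ennreal (C * bb r)"
  using heat_decay[OF dim f] by blast
 obtain J where J: "J \<ge> 0" "(NN r. ennreal (rho r * bb r)) = ennreal J"
  using rho_bb_integral by (cases "NN r. ennreal (rho r * bb r)") auto
 have "(NN r. NN y. ennreal (rho r) * B r x y * ennreal \<bar>f y\<bar>) \<le> ennreal (C * J)" for x
 proof -
  have "(NN r. NN y. ennreal (rho r) * B r x y * ennreal \<bar>f y\<bar>) \<le> (NN r. ennreal C * ennreal (rho r * bb r))"
  proof (rule nn_integral_mono)
   fix r :: real
   have "(NN y. ennreal (rho r) * B r x y * ennreal \<bar>f y\<bar>) = ennreal (rho r) * (NN y. B r x y * ennreal \<bar>f y\<bar>)"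
    unfolding mult.assoc by (rule nn_integral_cmult) measurable
   also have "\<dots> \<le> ennreal C * ennreal (rho r * bb r)"
   proof (cases "r > 0")
    case True
    have "(NN y. B r x y * ennreal \<bar>f y\<bar>) \<le> (NN y. hk r x y * ennreal \<bar>f y\<bar>)"
     by (intro nn_integral_mono mult_right_mono B_le) auto
    also have "\<dots> \<le> ennreal (C * bb r)" by (rule C(2)[OF True])
    finally have "ennreal (rho r) * (NN y. B r x y * ennreal \<bar>f y\<bar>) \<le> ennreal (rho r) * ennreal (C * bb r)"
     by (rule mult_left_mono) simp
    also have "\<dots> = ennreal (C * (rho r * bb (0 + r)))" using C(1) by (simp add: mult_ac flip: ennreal_mult)
    also have "\<dots> \<le> ennreal (C * (rho r * bb r))" by (intro ennreal_leI mult_left_mono rho_bb C) simp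
    also have "\<dots> = ennreal C * ennreal (rho r * bb r)" using C(1) by (simp add: ennreal_mult')
    finally show ?thesis .
   qed (simp add: rho_def)
   finally show "(NN y. ennreal (rho r) * B r x y * ennreal \<bar>f y\<bar>) \<le> ennreal C * ennreal (rho r * bb r)" .
  qed
  also have "\<dots> = ennreal (C * J)" using C(1) J by (simp add: nn_integral_cmult ennreal_mult)
  finally show ?thesis .
 qed
 moreover have "C * J \<ge> 0" using C J by simp
 ultimately show ?thesis by blast
qed

lemma neg_half_eq:
 assumes f: "test_fun f" and b: "\<And>t. 0 < t \<Longrightarrow> kop b t f = opk (B t) f"
 shows "neg_half b f x = c1 * opk (res B 0) f x"
proof -
 note [measurable] = kmeasD[OF B_meas] test_fun_measurable[OF f]
 obtain C where C: "\<And>x. (NN r. NN y. ennreal (rho r) * B r x y * ennreal \<bar>f y\<bar>) \<le> ennreal C"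
  using res_B_row[OF f] by blast
 have fin: "(NN r. NN y. ennreal (rho r) * B r x y * ennreal \<bar>f y\<bar>) < top"
  using C[of x] by (rule order_le_less_trans) simp
 have m: "(\<lambda>p. ennreal (rho (fst p)) * B (fst p) x (snd p)) \<in> borel_measurable (lborel \<Otimes>\<^sub>M lborel)" by measurable
 have "(LINT t:{0<..}|lborel. kop b t f x / sqrt t) = (LINT r|lborel. LINT y|lborel. enn2real (ennreal (rho r) * B r x y) * f y)"
  unfolding set_lebesgue_integral_def
 proof (intro Bochner_Integration.integral_cong refl)
  fix r :: real
  show "indicator {0<..} r *\<^sub>R (kop b r f x / sqrt r) = (LINT y|lborel. enn2real (ennreal (rho r) * B r x y) * f y)"
   by (cases "r > 0") (simp_all add: b opk_def rho_def enn2real_mult)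
 qed
 also have "\<dots> = opk (res B 0) f x"
  unfolding nn_mix(2)[where N = "\<lambda>r y. ennreal (rho r) * B r x y", OF m _ fin, OF test_fun_measurable[OF f]] by (simp add: opk_def res_def)
 finally show ?thesis by (simp add: neg_half_def)
qed

lemma res_B_row':
 assumes f: "test_fun f"
 shows "\<exists>C\<ge>0. \<forall>x. (NN y. res B 0 x y * ennreal \<bar>f y\<bar>) \<le> ennreal C"
proof -
 note [measurable] = kmeasD[OF B_meas] test_fun_measurable[OF f]
 have "(NN y. res B 0 x y * ennreal \<bar>f y\<bar>) = (NN y. NN r. ennreal (rho r) * B r x y * ennreal \<bar>f y\<bar>)" for x
  unfolding res_def by (simp add: nn_integral_multc)
 also have "\<dots> x = (NN r. NN y. ennreal (rho r) * B r x y * ennreal \<bar>f y\<bar>)" for x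
  by (rule nn_integral_swap) measurable
 finally show ?thesis using res_B_row[OF f] by simp
qed

lemma opk_res:
 assumes f: "test_fun f" and t: "t > 0"
 shows "opk (A t) (\<lambda>z. c * opk (res B 0) f z) x = c * opk (kprod (A t) (res B 0)) f x"
proof -
 note m [measurable] = kmeasD[OF A_meas] kmeasD[OF kmeas_res[OF B_meas]] test_fun_measurable[OF f]
 obtain C where C: "\<And>x. (NN y. res B 0 x y * ennreal \<bar>f y\<bar>) \<le> ennreal C"
  using res_B_row'[OF f] by blast
 have "opk (A t) (opk (res B 0) f) x = opk (kprod (A t) (res B 0)) f x"
 proof (rule opk_comp_at)
  have "(NN z. NN y. A t x z * (res B 0 z y * ennreal \<bar>f y\<bar>)) = (NN z. A t x z * (NN y. res B 0 z y * ennreal \<bar>f y\<bar>))"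
   by (intro nn_integral_cong nn_integral_cmult) measurable
  also have "\<dots> \<le> (NN z. hk t x z * ennreal C)" by (intro nn_integral_mono mult_mono A_le C) auto
  also have "\<dots> = ennreal C" using t by (simp add: nn_integral_multc nn_integral_hk)
  finally show "(NN z. NN y. A t x z * (res B 0 z y * ennreal \<bar>f y\<bar>)) < top" by (simp add: order_le_less_trans)
 qed measurable
 moreover have "opk (A t) (\<lambda>z. c * opk (res B 0) f z) x = c * opk (A t) (opk (res B 0) f) x"
  by (simp add: opk_def mult.left_commute[of _ c])
 ultimately show ?thesis by simp
qed

lemma sw_semigroup:
 assumes s: "0 < s" and r: "0 < r"
 shows "(NN z. sw A B a s x z * B r z y) = sw A B a (s + r) x y"
proof -
 note [measurable] = kmeasD[OF A_meas] kmeasD[OF B_meas]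
 have "(NN z. sw A B a s x z * B r z y) = (NN z. NN w. A a x w * (v w * B s w z) * B r z y)"
  unfolding sw_def by (intro nn_integral_cong nn_integral_multc[symmetric]) measurable
 also have "\<dots> = (NN w. NN z. A a x w * (v w * B s w z) * B r z y)" by (rule nn_integral_swap) measurable
 also have "\<dots> = (NN w. A a x w * (v w * (NN z. B s w z * B r z y)))"
  unfolding mult.assoc by (simp add: nn_integral_cmult)
 finally show ?thesis by (simp add: sw_def B_semigroup[OF s r])
qed

text \<open>The semigroup property merges B_s and B_r into B_{s+r}. With a = t - s and u = s + r as
  new variables, s occurs only in the scalar weights, and its integral is
  \<open>kw_eq_beta_integral\<close>.\<close>

lemma pair_kernel_integral:
 "(NN t. ennreal (tau t) * kprod (ck A v B t) (res B 0) x y) = ennreal (2 * pi) * TT A B x y"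
proof -
 note [measurable] = kmeasD[OF A_meas] kmeasD[OF B_meas] sw_measurable[OF A_meas B_meas] kmeasD[OF kmeas_res[OF B_meas]]
 \<comment> \<open>After the merging the product no longer shows that it vanished for s \<le> 0;
   this factor keeps the restriction.\<close>
 define pos :: "real \<Rightarrow> ennreal" where "pos s = (if 0 < s then 1 else 0)" for s
 have [measurable]: "pos \<in> borel_measurable borel" unfolding pos_def[abs_def] by measurable
 have kp: "kprod (ck A v B t) (res B 0) x y = (NN s. NN r. pos s * ennreal (rho r) * sw A B (t - s) (s + r) x y)" for t
 proof -
  have "kprod (ck A v B t) (res B 0) x y = (NN z. NN s. sw A B (t - s) s x z * res B 0 z y)"
   unfolding kprod_def ck_def cv_def sw_def[symmetric] by (intro nn_integral_cong nn_integral_multc[symmetric]) measurable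
  also have "\<dots> = (NN s. NN z. sw A B (t - s) s x z * res B 0 z y)" by (rule nn_integral_swap) measurable
  also have "\<dots> = (NN s. NN z. NN r. ennreal (rho r) * (sw A B (t - s) s x z * B r z y))"
   unfolding res_def by (intro nn_integral_cong) (simp add: mult.left_commute flip: nn_integral_cmult)
  also have "\<dots> = (NN s. NN r. NN z. ennreal (rho r) * (sw A B (t - s) s x z * B r z y))"
   by (rule nn_integral_cong, rule nn_integral_swap) measurable
  also have "\<dots> = (NN s. NN r. ennreal (rho r) * (NN z. sw A B (t - s) s x z * B r z y))"
   by (simp add: nn_integral_cmult)
  also have "\<dots> = (NN s. NN r. pos s * ennreal (rho r) * sw A B (t - s) (s + r) x y)"
  proof (intro nn_integral_cong)
   fix s r
   have "sw A B (t - s) s x z = 0" if "\<not> 0 < s" for z using that by (simp add: sw_def B_nonpos)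
   then show "ennreal (rho r) * (NN z. sw A B (t - s) s x z * B r z y) = pos s * ennreal (rho r) * sw A B (t - s) (s + r) x y"
    by (cases "0 < s"; cases "0 < r") (simp_all add: sw_semigroup pos_def rho_def)
  qed
  finally show ?thesis .
 qed
 have shift: "(NN t. f t) = (NN a. f (a + s))" "(NN r. f r) = (NN u. f (u - s))" if "f \<in> borel_measurable borel" for f :: "real \<Rightarrow> ennreal" and s
  using nn_integral_shift[OF that] by simp_all
 let ?X = "\<lambda>s a u. ennreal (tau (a + s)) * (pos s * ennreal (rho (u - s)) * sw A B a u x y)"
 have "(NN t. ennreal (tau t) * kprod (ck A v B t) (res B 0) x y)
   = (NN t. NN s. NN r. ennreal (tau t) * (pos s * ennreal (rho r) * sw A B (t - s) (s + r) x y))"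
  unfolding kp by (simp flip: nn_integral_cmult)
 also have "\<dots> = (NN s. NN t. NN r. ennreal (tau t) * (pos s * ennreal (rho r) * sw A B (t - s) (s + r) x y))"
  by (rule nn_integral_swap) measurable
 also have "\<dots> = (NN s. NN a. NN r. ennreal (tau (a + s)) * (pos s * ennreal (rho r) * sw A B (a + s - s) (s + r) x y))"
  by (rule nn_integral_cong, rule shift) measurable
 also have "\<dots> = (NN s. NN a. NN u. ennreal (tau (a + s)) * (pos s * ennreal (rho (u - s)) * sw A B (a + s - s) (s + (u - s)) x y))"
  by (rule nn_integral_cong, rule nn_integral_cong, rule shift) measurable
 also have "\<dots> = (NN s. NN a. NN u. ?X s a u)" by simp
 also have "\<dots> = (NN a. NN s. NN u. ?X s a u)" by (rule nn_integral_swap) measurable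
 also have "\<dots> = (NN a. NN u. NN s. ?X s a u)" by (rule nn_integral_cong, rule nn_integral_swap) measurable
 also have "\<dots> = (NN a. NN u. ennreal (2 * pi) * (ennreal (kw a u) * sw A B a u x y))"
 proof (intro nn_integral_cong)
  fix a u
  show "(NN s. ?X s a u) = ennreal (2 * pi) * (ennreal (kw a u) * sw A B a u x y)"
  proof (cases "0 < a \<and> 0 < u")
   case True
   have "(NN s. ?X s a u) = (NN s. ennreal (1 / ((a + s) * sqrt (a + s) * sqrt (u - s))) * indicator {0<..<u} s * sw A B a u x y)"
    using True by (intro nn_integral_cong) (auto simp: pos_def rho_def tau_def indicator_def simp flip: mult.assoc ennreal_mult)
   also have "\<dots> = ennreal (2 * pi * kw a u) * sw A B a u x y"
    using True by (subst nn_integral_multc) (simp_all add: kw_eq_beta_integral)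
   also have "\<dots> = ennreal (2 * pi) * (ennreal (kw a u) * sw A B a u x y)" by (simp only: ennreal_mult' mult.assoc) (simp add: ennreal_mult' mult.assoc)
   finally show ?thesis .
  next
   case False
   then have "sw A B a u x y = 0" by (auto simp: sw_def B_nonpos A_nonpos not_less)
   then show ?thesis by simp
  qed
 qed
 also have "\<dots> = ennreal (2 * pi) * TT A B x y" unfolding TT_def by (simp add: nn_integral_cmult)
 finally show ?thesis .
qed

lemma pfin_bounded:
 assumes f: "test_fun \<phi>" and g: "\<And>y. \<bar>g y\<bar> \<le> m" "g \<in> borel_measurable borel" and t: "0 < t"
 shows "pfin (B t) g \<phi> < top"
proof -
 note [measurable] = test_fun_measurable[OF f]
 have "pfin (B t) g \<phi> \<le> (NN x. NN y. hk t x y * (ennreal m * ennreal \<bar>\<phi> x\<bar>))"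
  unfolding pfin_def abs_mult using g order_trans[OF abs_ge_zero g(1)]
  by (intro nn_integral_mono mult_mono B_le) (auto simp flip: ennreal_mult intro!: ennreal_leI mult_right_mono)
 also have "\<dots> = ennreal m * (NN x. ennreal \<bar>\<phi> x\<bar>)"
  using t by (simp add: nn_integral_multc nn_integral_cmult nn_integral_hk)
 also have "\<dots> < top" using integrable_nn(2)[OF test_fun_integrable[OF f]] by (simp add: ennreal_mult_less_top)
 finally show ?thesis .
qed

text \<open>The kernel is moved to \<phi> and \<open>approx_test_fun\<close> is applied to its
  transpose. Hence g need only be bounded, and its bound m enters linearly; this is used for g = B_r
  f, where m decays in r.\<close>

lemma dual_approx:
 assumes \<phi>: "test_fun \<phi>"
 obtains C where "0 \<le> C" "\<And>(g :: 'a \<Rightarrow> real) m t. g \<in> borel_measurable borel \<Longrightarrow> (\<And>x. \<bar>g x\<bar> \<le> m) \<Longrightarrow> 0 < t \<Longrightarrow> t \<le> 1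
   \<Longrightarrow> \<bar>pint (B t) g \<phi> - (LINT x|lborel. g x * \<phi> x)\<bar> \<le> m * (C * t)"
proof -
 obtain C where C: "C \<ge> 0" "\<And>t T D. 0 < t \<Longrightarrow> t \<le> 1 \<Longrightarrow> jmeas T \<Longrightarrow> jmeas D \<Longrightarrow> (\<And>x y. T x y + D x y = hk t x y)
   \<Longrightarrow> (\<And>x y. D x y \<le> ck hk v hk t x y) \<Longrightarrow> (NN x. ennreal \<bar>opk T \<phi> x - \<phi> x\<bar>) \<le> ennreal (C * t)"
  using approx_test_fun[OF \<phi>] by blast
 obtain D where D: "kmeas D" "\<And>t x y. B t x y + D t x y = hk t x y" "\<And>t x y. D t x y \<le> ck hk v hk t x y"
  using B_dual by blast
 note [measurable] = kmeasD[OF B_meas] kmeasD[OF D(1)] test_fun_measurable[OF \<phi>]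
 show ?thesis
 proof (rule that[OF C(1)])
  fix g :: "'a \<Rightarrow> real" and m t assume g [measurable]: "g \<in> borel_measurable borel" and m: "\<And>x. \<bar>g x\<bar> \<le> m" and t: "0 < t" "t \<le> (1::real)"
  have m0: "0 \<le> m" using m[of undefined] by linarith
  let ?h = "opk (\<lambda>y x. B t x y) \<phi>"
  have jm: "jmeas (B t)" by measurable
  note p = pint_iter(4,5)[OF jm g test_fun_measurable[OF \<phi>] pfin_bounded[OF \<phi> m g t(1)]]
  have gi: "integrable lborel (\<lambda>y. g y * \<phi> y)"
   by (rule Bochner_Integration.integrable_bound[OF integrable_mult_right[OF integrable_abs[OF test_fun_integrable[OF \<phi>]], of m]])
    (use m m0 in \<open>auto simp: abs_mult intro!: AE_I2 mult_right_mono\<close>)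
  have "pint (B t) g \<phi> - (LINT x|lborel. g x * \<phi> x) = (LINT y|lborel. ?h y * g y - g y * \<phi> y)"
   using p gi by simp
  then have "ennreal \<bar>pint (B t) g \<phi> - (LINT x|lborel. g x * \<phi> x)\<bar> \<le> (NN y. ennreal \<bar>?h y * g y - g y * \<phi> y\<bar>)"
   using integral_norm_le_nn[where M = lborel and f = "\<lambda>y. ?h y * g y - g y * \<phi> y"] by simp
  also have "\<dots> \<le> (NN y. ennreal m * ennreal \<bar>?h y - \<phi> y\<bar>)"
  proof (intro nn_integral_mono)
   fix y
   have "\<bar>?h y * g y - g y * \<phi> y\<bar> = \<bar>g y\<bar> * \<bar>?h y - \<phi> y\<bar>" by (simp add: abs_mult[symmetric] right_diff_distrib mult.commute)
   also have "\<dots> \<le> m * \<bar>?h y - \<phi> y\<bar>" by (intro mult_right_mono m) simp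
   finally show "ennreal \<bar>?h y * g y - g y * \<phi> y\<bar> \<le> ennreal m * ennreal \<bar>?h y - \<phi> y\<bar>"
    using m0 by (simp add: ennreal_leI flip: ennreal_mult)
  qed
  also have "\<dots> = ennreal m * (NN y. ennreal \<bar>?h y - \<phi> y\<bar>)"
  proof (rule nn_integral_cmult)
   have "(\<lambda>y. LINT x|lborel. enn2real (B t x y) * \<phi> x) \<in> borel_measurable lborel" by measurable
   then show "(\<lambda>y. ennreal \<bar>?h y - \<phi> y\<bar>) \<in> borel_measurable lborel" unfolding opk_def by measurable
  qed
  also have "\<dots> \<le> ennreal m * ennreal (C * t)"
   using D by (intro mult_left_mono C(2)[OF t, where D = "\<lambda>y x. D t x y"])
     (auto simp: hk_commute[of t] intro: order_trans[OF D(3)] ck_hk_commute[THEN eq_refl])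
  also have "\<dots> = ennreal (m * (C * t))" using m0 C(1) t by (intro ennreal_mult[symmetric]) auto
  finally show "\<bar>pint (B t) g \<phi> - (LINT x|lborel. g x * \<phi> x)\<bar> \<le> m * (C * t)" using m0 C(1) t by simp
 qed
qed

lemma pint_step:
 assumes f: "test_fun f" and \<phi>: "test_fun \<phi>" and t: "0 < t" and r: "0 < r"
 shows "pint (B (t + r)) f \<phi> = pint (B t) (opk (B r) f) \<phi>" "(LINT x|lborel. opk (B r) f x * \<phi> x) = pint (B r) f \<phi>"
proof -
 obtain C where C: "C \<ge> 0" "\<And>r x. r > 0 \<Longrightarrow> (NN y. hk r x y * ennreal \<bar>f y\<bar>) \<le> ennreal (C * bb r)"
  using heat_decay[OF dim f] by blast
 note fm = test_fun_measurable[OF f] test_fun_measurable[OF \<phi>]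
 note [measurable] = kmeasD[OF B_meas] fm
 have row: "(NN y. B r x y * ennreal \<bar>f y\<bar>) \<le> ennreal (C * bb r)" for x
  by (rule order_trans[OF nn_integral_mono C(2)[OF r, of x]]) (simp add: mult_right_mono B_le)
 have gb: "\<bar>opk (B r) f x\<bar> \<le> C * bb r" for x
  using order_trans[OF opk_abs_le row] C(1) by simp
 have gm: "opk (B r) f \<in> borel_measurable borel" by (rule opk_measurable[OF l1k_B[OF r] fm(1)])
 obtain m where m: "\<And>x. \<bar>f x\<bar> \<le> m" using test_fun_bounded[OF f] by blast
 have j: "jmeas (B s)" for s by measurable
 have e: "(\<lambda>x y. NN z. B t x z * B r z y) = B (t + r)" by (intro ext) (rule B_semigroup[OF t r])
 have c: "opk (B t) (opk (B r) f) x = opk (B (t + r)) f x" for x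
 proof -
  have "(NN z. NN y. B t x z * (B r z y * ennreal \<bar>f y\<bar>)) = (NN z. B t x z * (NN y. B r z y * ennreal \<bar>f y\<bar>))"
   by (intro nn_integral_cong nn_integral_cmult) measurable
  also have "\<dots> \<le> (NN z. hk t x z * ennreal (C * bb r))" by (intro nn_integral_mono mult_mono B_le row) auto
  also have "\<dots> < top" using t by (simp add: nn_integral_multc nn_integral_hk)
  finally have "opk (B t) (opk (B r) f) x = opk (kprod (B t) (B r)) f x" by (intro opk_comp_at) measurable
  then show ?thesis by (simp add: kprod_def[abs_def] e)
 qed
 have "pint (B (t + r)) f \<phi> = (LINT x|lborel. opk (B (t + r)) f x * \<phi> x)"
  using t r by (intro pint_iter(3)[symmetric] j fm pfin_bounded[OF \<phi> m fm(1)]) auto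
 also have "\<dots> = pint (B t) (opk (B r) f) \<phi>"
  unfolding c[symmetric] by (intro pint_iter(3) j gm fm pfin_bounded[OF \<phi> gb gm t])
 finally show "pint (B (t + r)) f \<phi> = pint (B t) (opk (B r) f) \<phi>" .
 show "(LINT x|lborel. opk (B r) f x * \<phi> x) = pint (B r) f \<phi>"
  by (intro pint_iter(3) j fm pfin_bounded[OF \<phi> m fm(1) r])
qed

text \<open>The constant continuation to r \<le> 0 makes the pairing continuous on the whole line,
  as \<open>half_derivative_pairing\<close> requires.\<close>

definition flow_pairing :: "('a \<Rightarrow> real) \<Rightarrow> ('a \<Rightarrow> real) \<Rightarrow> real \<Rightarrow> real" where
 "flow_pairing f \<phi> r = (if 0 < r then pint (B r) f \<phi> else (LINT x|lborel. f x * \<phi> x))"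

text \<open>For t \<le> 1 the increment is B_t - I tested on B_r f, so \<open>dual_approx\<close>
  gives the factor t and \<open>heat_decay\<close> the factor \<open>bb r\<close>. For t > 1 both
  values are bounded by multiples of \<open>bb r\<close>.\<close>

lemma flow_pairing_properties:
 assumes f: "test_fun f" and \<phi>: "test_fun \<phi>"
 obtains C where "\<And>t r. 0 < t \<Longrightarrow> 0 < r \<Longrightarrow> \<bar>flow_pairing f \<phi> (t + r) - flow_pairing f \<phi> r\<bar> \<le> C * (min 1 t * bb r)"
  "\<And>r. isCont (flow_pairing f \<phi>) r" "(flow_pairing f \<phi> \<longlongrightarrow> 0) at_top"
proof -
 obtain C1 where C1: "C1 \<ge> 0" "\<And>r. 0 < r \<Longrightarrow> pfin (hk r) f \<phi> \<le> ennreal (C1 * bb r)"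
  using pfin_hk[OF dim f \<phi>] by blast
 obtain C2 where C2: "C2 \<ge> 0" "\<And>(g :: 'a \<Rightarrow> real) m t. g \<in> borel_measurable borel \<Longrightarrow> (\<And>x. \<bar>g x\<bar> \<le> m) \<Longrightarrow> 0 < t \<Longrightarrow> t \<le> 1
   \<Longrightarrow> \<bar>pint (B t) g \<phi> - (LINT x|lborel. g x * \<phi> x)\<bar> \<le> m * (C2 * t)"
  using dual_approx[OF \<phi>] by blast
 obtain C3 where C3: "C3 \<ge> 0" "\<And>r x. r > 0 \<Longrightarrow> (NN y. hk r x y * ennreal \<bar>f y\<bar>) \<le> ennreal (C3 * bb r)"
  using heat_decay[OF dim f] by blast
 obtain m where m: "m \<ge> 0" "\<And>x. \<bar>f x\<bar> \<le> m" using test_fun_bounded[OF f] by blast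
 note fm = test_fun_measurable[OF f] test_fun_measurable[OF \<phi>]
 note [measurable] = kmeasD[OF B_meas] fm
 let ?F = "flow_pairing f \<phi>"
 have j: "jmeas (B s)" for s by measurable
 have F_le: "\<bar>?F r\<bar> \<le> C1 * bb r" if "0 < r" for r
 proof -
  have "ennreal \<bar>?F r\<bar> \<le> pfin (B r) f \<phi>"
   using that pint_iter(6)[OF j fm pfin_bounded[OF \<phi> m(2) fm(1) that]] by (simp add: flow_pairing_def)
  also have "\<dots> \<le> ennreal (C1 * bb r)" by (rule order_trans[OF pfin_mono C1(2)[OF that]]) (rule B_le)
  finally show ?thesis using C1(1) by simp
 qed
 define C where "C = 2 * C1 + C3 * C2 + m * C2"
 have inc: "\<bar>?F (t + r) - ?F r\<bar> \<le> C * (min 1 t * bb r)" if t: "0 < t" and r: "0 < r" for t r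
 proof (cases "t \<le> 1")
  case True
  have gb: "\<bar>opk (B r) f x\<bar> \<le> C3 * bb r" for x
  proof -
   have "ennreal \<bar>opk (B r) f x\<bar> \<le> (NN y. hk r x y * ennreal \<bar>f y\<bar>)"
    by (rule order_trans[OF opk_abs_le nn_integral_mono]) (simp add: mult_right_mono B_le)
   also have "\<dots> \<le> ennreal (C3 * bb r)" by (rule C3(2)[OF r])
   finally show ?thesis using C3(1) by simp
  qed
  have "\<bar>?F (t + r) - ?F r\<bar> \<le> C3 * bb r * (C2 * t)"
   using C2(2)[OF opk_measurable[OF l1k_B[OF r] fm(1)] gb t True] pint_step[OF f \<phi> t r] t r by (simp add: flow_pairing_def)
  also have "\<dots> = C3 * C2 * (t * bb r)" by simp
  also have "\<dots> \<le> C * (t * bb r)" using C1 C2 m t by (intro mult_right_mono) (auto simp: C_def)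
  finally show ?thesis using True by simp
 next
  case False
  have "\<bar>?F (t + r)\<bar> \<le> C1 * bb r"
   using F_le[of "t + r"] bb_mono[OF r, of t] t r C1(1) by (meson add_pos_pos less_imp_le mult_left_mono order_trans)
  then have "\<bar>?F (t + r) - ?F r\<bar> \<le> 2 * C1 * bb r" using F_le[OF r] by simp
  also have "\<dots> \<le> C * bb r" using C2 C3 m by (intro mult_right_mono) (auto simp: C_def)
  finally show ?thesis using False by simp
 qed
 have lip: "\<bar>?F y - ?F x\<bar> \<le> C * (y - x)" if "x < y" "y \<le> x + 1" for x y
 proof -
  consider "0 < x" | "x \<le> 0" "0 < y" | "y \<le> 0" by linarith
  then show ?thesis
  proof cases
   case 1
   have "C * ((y - x) * bb x) \<le> C * ((y - x) * 1)"
    using that C1 C2 C3 m by (intro mult_left_mono) (auto simp: C_def bb_def)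
   then show ?thesis using inc[of "y - x" x] that 1 by simp
  next
   \<comment> \<open>Across the origin the value at x is that at 0, and \<open>dual_approx\<close>
     is applied to f itself.\<close>
   case 2
   have "\<bar>?F y - ?F x\<bar> \<le> m * (C2 * y)" using C2(2)[OF fm(1) m(2), of y] that 2 by (simp add: flow_pairing_def)
   also have "\<dots> \<le> m * C2 * (y - x)" using 2 m(1) C2(1) mult_left_mono[of y "y - x" "m * C2"] by (simp add: mult.assoc)
   also have "\<dots> \<le> C * (y - x)" using that C1 C2 C3 by (intro mult_right_mono) (auto simp: C_def)
   finally show ?thesis .
  qed (use that C1 C2 C3 m in \<open>auto simp: flow_pairing_def C_def\<close>)
 qed
 have cont: "isCont ?F r" for r
  unfolding continuous_at_eps_delta
 proof (intro allI impI)
  fix e :: real assume e: "0 < e"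
  have C: "0 \<le> C" using C1 C2 C3 m by (simp add: C_def)
  show "\<exists>d>0. \<forall>x. dist x r < d \<longrightarrow> dist (?F x) (?F r) < e"
  proof (intro exI conjI allI impI)
   show "0 < min 1 (e / (C + 1))" using e C by simp
   fix x assume x: "dist x r < min 1 (e / (C + 1))"
   have "\<bar>?F x - ?F r\<bar> \<le> C * \<bar>x - r\<bar>"
    using lip[of x r] lip[of r x] x by (cases x r rule: linorder_cases) (auto simp: dist_real_def abs_minus_commute)
   also have "\<dots> \<le> C * (e / (C + 1))" using x C by (intro mult_left_mono) (auto simp: dist_real_def)
   also have "\<dots> < e" using e C by (simp add: field_simps)
   finally show "dist (?F x) (?F r) < e" by (simp add: dist_real_def)
  qed
 qed
 have "(?F \<longlongrightarrow> 0) at_top"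
 proof (rule Lim_null_comparison)
  show "((\<lambda>r. C1 * (1 / (r * sqrt r))) \<longlongrightarrow> 0) at_top" by real_asymp
  show "eventually (\<lambda>r. norm (?F r) \<le> C1 * (1 / (r * sqrt r))) at_top"
   using eventually_gt_at_top[of 0]
  proof eventually_elim
   case (elim r)
   have "C1 * bb r \<le> C1 * (1 / (r * sqrt r))" using elim C1(1) by (intro mult_left_mono) (auto simp: bb_def tau_def)
   then show ?case using F_le[OF elim] by simp
  qed
 qed
 with inc cont show ?thesis by (rule that)
qed

lemma pfin_TT:
 assumes f: "test_fun f" and \<phi>: "test_fun \<phi>"
 shows "pfin (TT A B) f \<phi> < top"
proof -
 have T: "l1k (TT A B) M" by (rule l1k_TT[OF A_le B_le A_meas B_meas])
 obtain m where m: "m \<ge> 0" "\<And>x. \<bar>\<phi> x\<bar> \<le> m" using test_fun_bounded[OF \<phi>] by blast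
 note [measurable] = test_fun_measurable[OF f] l1k_measurable[OF T]
 have "pfin (TT A B) f \<phi> \<le> (NN x. NN y. TT A B x y * (ennreal \<bar>f y\<bar> * ennreal m))"
  unfolding pfin_def abs_mult using m by (intro nn_integral_mono mult_left_mono) (auto simp: mult_left_mono ennreal_leI simp flip: ennreal_mult)
 also have "\<dots> \<le> ennreal M * (NN y. ennreal \<bar>f y\<bar> * ennreal m)" by (rule l1k_L1_bound[OF T]) measurable
 also have "\<dots> < top"
  using integrable_nn(2)[OF test_fun_integrable[OF f]] by (simp add: nn_integral_multc ennreal_mult_less_top)
 finally show ?thesis .
qed

lemma kprod_res_le:
 assumes "0 < t" "\<And>x y. S x y \<le> hk t x y"
 shows "kprod S (res B 0) x y \<le> res hk t x y"
proof -
 have "kprod S (res B 0) x y \<le> kprod (hk t) (res hk 0) x y"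
  unfolding kprod_def by (intro nn_integral_mono mult_mono assms res_mono B_le) auto
 also have "\<dots> = res hk t x y" by (rule kprod_res[OF kmeas_hk assms(1) hk_semigroup[OF assms(1)]])
 finally show ?thesis .
qed

text \<open>As \<open>A = B + \<sigma> * ck A v B\<close>, the left hand side splits: the part with \<open>B\<close> is the pairing of \<open>f\<close> with
 \<open>\<phi>\<close>, and the perturbation integrates to the kernel \<open>TT\<close>.\<close>
lemma weak_formula:
 assumes f: "test_fun f" and \<phi>: "test_fun \<phi>"
  and a: "\<And>t x y. 0 < t \<Longrightarrow> a t x y = enn2real (A t x y)" and b: "\<And>t x y. 0 < t \<Longrightarrow> b t x y = enn2real (B t x y)"
 shows "pos_half_distr a (neg_half b f) \<phi> = (LINT x|lborel. f x * \<phi> x) - \<sigma> * pint (TT A B) f \<phi>"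
proof -
 let ?R = "res B 0" and ?F = "flow_pairing f \<phi>"
 define Q where "Q t = pint (kprod (ck A v B t) ?R) f \<phi>" for t
 obtain C where F: "\<And>t r. 0 < t \<Longrightarrow> 0 < r \<Longrightarrow> \<bar>?F (t + r) - ?F r\<bar> \<le> C * (min 1 t * bb r)"
  "\<And>r. isCont ?F r" "(?F \<longlongrightarrow> 0) at_top" using flow_pairing_properties[OF f \<phi>] by blast
 note half = half_derivative_pairing[OF F(2,3,1), simplified]
 note fm = test_fun_measurable[OF f] test_fun_measurable[OF \<phi>]
 note [measurable] = fm kmeasD[OF A_meas] kmeasD[OF B_meas] kmeasD[OF kmeas_ck[OF A_meas B_meas, of v]] kmeasD[OF kmeas_res[OF B_meas]]
 have [measurable]: "?F \<in> borel_measurable borel"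
  using F(2) by (intro borel_measurable_continuous_onI) (simp add: continuous_at_imp_continuous_on)
 have jR: "jmeas ?R" by measurable
 have jk: "jmeas (kprod S ?R)" if "jmeas S" for S by (rule jmeas_kprod[OF that jR])
 have fin: "pfin (kprod S ?R) f \<phi> < top" if "0 < t" "\<And>x y. S x y \<le> hk t x y" for S t
  by (rule order_le_less_trans[OF pfin_mono pfin_res_hk(1)[OF dim f \<phi>, of t]]) (use that in \<open>auto intro: kprod_res_le\<close>)
 have resB: "pint (res B t) f \<phi> = (LINT r|lborel. rho r * ?F (t + r))" "integrable lborel (\<lambda>r. rho r * ?F (t + r))" if t: "0 \<le> t" for t
 proof -
  let ?N = "\<lambda>r x y. ennreal (rho r) * B (t + r) x y"
  have km: "kmeas ?N" by (rule kmeasI) measurable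
  have "(NN r. pfin (?N r) f \<phi>) \<le> (NN r. pfin (\<lambda>x y. ennreal (rho r) * hk (t + r) x y) f \<phi>)"
   by (intro nn_integral_mono pfin_mono mult_left_mono B_le) auto
  from order_le_less_trans[OF this pfin_res_hk(2)[OF dim f \<phi> t]] have n: "(NN r. pfin (?N r) f \<phi>) < top" .
  have e: "pint (?N r) f \<phi> = rho r * ?F (t + r)" for r
   using t by (cases "0 < r") (simp_all add: pint_cmult flow_pairing_def, simp add: rho_def)
  show "pint (res B t) f \<phi> = (LINT r|lborel. rho r * ?F (t + r))" "integrable lborel (\<lambda>r. rho r * ?F (t + r))"
   using pint_mix[OF km fm n] unfolding e res_def[abs_def] by simp_all
 qed
 have Rfin: "pfin ?R f \<phi> < top"
  by (rule order_le_less_trans[OF pfin_mono pfin_res_hk(1)[OF dim f \<phi>, of 0]]) (auto intro: res_mono B_le)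
 have main: "(LINT x|lborel. (kop a t (neg_half b f) x - neg_half b f x) * \<phi> x)
   = c1 * ((LINT r|lborel. rho r * (?F (t + r) - ?F r)) + \<sigma> * Q t)" if t: "0 < t" for t
 proof -
  have g: "neg_half b f = (\<lambda>x. c1 * opk ?R f x)"
   by (intro ext neg_half_eq f) (simp add: kop_def[abs_def] opk_def[abs_def] b)
  have Ag: "kop a t (neg_half b f) x = c1 * opk (kprod (A t) ?R) f x" for x
   using opk_res[OF f t, of c1 x] t by (simp add: g kop_def opk_def a)
  have jA: "jmeas (A t)" "jmeas (B t)" "jmeas (ck A v B t)" by measurable
  note i = pint_iter(2,3)[OF jk[OF jA(1)] fm fin[OF t A_le]] pint_iter(2,3)[OF jR fm Rfin]
  have "(LINT x|lborel. (kop a t (neg_half b f) x - neg_half b f x) * \<phi> x)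
    = (LINT x|lborel. c1 * (opk (kprod (A t) ?R) f x * \<phi> x - opk ?R f x * \<phi> x))"
   unfolding Ag by (intro Bochner_Integration.integral_cong refl) (simp add: g algebra_simps)
  also have "\<dots> = c1 * (pint (kprod (A t) ?R) f \<phi> - pint ?R f \<phi>)" using i by simp
  also have "pint (kprod (A t) ?R) f \<phi> = pint (res B t) f \<phi> + \<sigma> * Q t"
  proof -
   have BR: "kprod (B t) ?R = res B t" by (intro ext kprod_res B_meas t B_semigroup)
   have add: "kprod (\<lambda>x y. S x y + S' x y) ?R = (\<lambda>x y. kprod S ?R x y + kprod S' ?R x y)" if "jmeas S" "jmeas S'" for S S'
   proof (intro ext)
    fix x y
    have [measurable]: "S x \<in> borel_measurable borel" "S' x \<in> borel_measurable borel"
     using measurable_compose[OF _ that(1), of "\<lambda>y. (x, y)" borel] measurable_compose[OF _ that(2), of "\<lambda>y. (x, y)" borel] by simp_all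
    show "kprod (\<lambda>x y. S x y + S' x y) ?R x y = kprod S ?R x y + kprod S' ?R x y"
     unfolding kprod_def distrib_right by (rule nn_integral_add) measurable
   qed
   note p = pint_add[OF jk jk fm fin[OF t] fin[OF t]]
   from perturb show ?thesis
   proof (elim disjE conjE)
    assume s: "\<sigma> = 1" "\<forall>t x y. B t x y + ck A v B t x y = A t x y"
    then have "A t = (\<lambda>x y. B t x y + ck A v B t x y)" by auto
    then show ?thesis using p[OF jA(2,3) B_le ck_le] s(1) by (simp add: add[OF jA(2,3)] BR Q_def)
   next
    assume s: "\<sigma> = - 1" "\<forall>t x y. A t x y + ck A v B t x y = B t x y"
    then have "B t = (\<lambda>x y. A t x y + ck A v B t x y)" by auto
    then have "res B t = (\<lambda>x y. kprod (A t) ?R x y + kprod (ck A v B t) ?R x y)"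
     unfolding BR[symmetric] by (simp add: add[OF jA(1,3)])
    then show ?thesis using p[OF jA(1,3) A_le ck_le] s(1) by (simp add: Q_def)
   qed
  qed
  finally show ?thesis using resB[of t] resB[of 0] t by (simp add: algebra_simps)
 qed
 have QT: "integrable lborel (\<lambda>t. tau t * Q t)" "(LINT t|lborel. tau t * Q t) = 2 * pi * pint (TT A B) f \<phi>"
 proof -
  let ?N = "\<lambda>t x y. ennreal (tau t) * kprod (ck A v B t) ?R x y"
  have km: "kmeas ?N" unfolding kprod_def by (rule kmeasI) measurable
  have jT: "jmeas (TT A B)" by (rule TT_measurable[OF A_meas B_meas]) measurable
  have e: "(\<lambda>x y. NN t. ?N t x y) = (\<lambda>x y. ennreal (2 * pi) * TT A B x y)"
   by (intro ext) (rule pair_kernel_integral)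
  have "(NN t. pfin (?N t) f \<phi>) = ennreal (2 * pi) * pfin (TT A B) f \<phi>"
   unfolding pfin_mix[OF km fm, symmetric] e by (rule pfin_cmult[OF jT fm])
  then have n: "(NN t. pfin (?N t) f \<phi>) < top" using pfin_TT[OF f \<phi>] by (simp add: ennreal_mult_less_top)
  show "integrable lborel (\<lambda>t. tau t * Q t)" "(LINT t|lborel. tau t * Q t) = 2 * pi * pint (TT A B) f \<phi>"
   using pint_mix[OF km fm n] by (simp_all add: e pint_cmult Q_def)
 qed
 have FT: "integrable lborel (\<lambda>t. LINT r|lborel. tau t * rho r * (?F (t + r) - ?F r))"
  "(LINT t|lborel. LINT r|lborel. tau t * rho r * (?F (t + r) - ?F r)) = - (2 * pi) * ?F 0"
  using lborel_pair.integrable_fst'[of "\<lambda>q. tau (fst q) * rho (snd q) * (?F (fst q + snd q) - ?F (snd q))"]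
   lborel_pair.integral_fst'[of "\<lambda>q. tau (fst q) * rho (snd q) * (?F (fst q + snd q) - ?F (snd q))"] half
  by (simp_all add: lborel_prod)
 have "pos_half_distr a (neg_half b f) \<phi> = c2 * (LINT t|lborel. c1 * ((LINT r|lborel. tau t * rho r * (?F (t + r) - ?F r)) + \<sigma> * (tau t * Q t)))"
  unfolding pos_half_distr_def set_lebesgue_integral_def
 proof (intro arg_cong[where f = "\<lambda>X. c2 * X"] Bochner_Integration.integral_cong refl)
  fix t :: real
  show "indicator {0<..} t *\<^sub>R ((LINT x|lborel. (kop a t (neg_half b f) x - neg_half b f x) * \<phi> x) / t powr (3 / 2))
    = c1 * ((LINT r|lborel. tau t * rho r * (?F (t + r) - ?F r)) + \<sigma> * (tau t * Q t))"
  proof (cases "0 < t")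
   case True
   then have "X / t powr (3/2) = tau t * X" for X
    using powr_mult_base[of t "1/2"] by (simp add: tau_def powr_half_sqrt)
   then show ?thesis using True by (simp add: main mult.assoc distrib_left mult.left_commute[of _ "tau t"])
  qed (simp add: tau_def)
 qed
 \<comment> \<open>The unperturbed part contributes -2 \<pi> times the pairing at time 0, the
   perturbation 2 \<pi> times the pairing with \<open>TT\<close>; the product of the constants
   removes both factors.\<close>
 also have "\<dots> = c1 * c2 * (- (2 * pi) * ?F 0 + \<sigma> * (2 * pi * pint (TT A B) f \<phi>))"
  using FT QT by simp
 also have "\<dots> = ?F 0 - \<sigma> * pint (TT A B) f \<phi>" unfolding c1_c2 by (simp add: field_simps)
 finally show ?thesis by (simp add: flow_pairing_def)
qed

section \<open>Extension of the compositions from test functions to L^1\<close>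

definition half_power_op :: "('a \<Rightarrow> real) \<Rightarrow> 'a \<Rightarrow> real" where "half_power_op f x = f x - \<sigma> * opk (TT A B) f x"

lemma l1k_TT_AB: "l1k (TT A B) M"
 by (rule l1k_TT[OF A_le B_le A_meas B_meas])

lemma half_power_op_integrable: "integrable lborel f \<Longrightarrow> integrable lborel (half_power_op f)"
 unfolding half_power_op_def[abs_def] by (intro Bochner_Integration.integrable_diff integrable_mult_right opk_integrable(1)[OF l1k_TT_AB])

lemma half_power_op_dist:
 assumes f: "integrable lborel f" and g: "integrable lborel g"
 shows "(LINT x|lborel. \<bar>half_power_op f x - half_power_op g x\<bar>) \<le> (1 + M) * (LINT x|lborel. \<bar>f x - g x\<bar>)"
proof -
 have fg: "integrable lborel (\<lambda>x. f x - g x)" using f g by simp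
 note o = opk_integrable[OF l1k_TT_AB fg]
 have "(LINT x|lborel. \<bar>half_power_op f x - half_power_op g x\<bar>) \<le> (LINT x|lborel. \<bar>f x - g x\<bar> + \<bar>opk (TT A B) (\<lambda>x. f x - g x) x\<bar>)"
 proof (rule integral_mono_AE)
  show "AE x in lborel. \<bar>half_power_op f x - half_power_op g x\<bar> \<le> \<bar>f x - g x\<bar> + \<bar>opk (TT A B) (\<lambda>x. f x - g x) x\<bar>"
   using opk_diff_AE(1)[OF l1k_TT_AB f g] by eventually_elim (use perturb in \<open>auto simp: half_power_op_def\<close>)
 qed (use half_power_op_integrable[OF f] half_power_op_integrable[OF g] fg o(1) in auto)
 also have "\<dots> = (LINT x|lborel. \<bar>f x - g x\<bar>) + (LINT x|lborel. \<bar>opk (TT A B) (\<lambda>x. f x - g x) x\<bar>)"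
  using fg o(1) by simp
 finally show ?thesis using o(2) by (simp add: distrib_right)
qed

lemma half_power_op_represents:
 assumes f: "test_fun f"
  and a: "\<And>t x y. 0 < t \<Longrightarrow> a t x y = enn2real (A t x y)" and b: "\<And>t x y. 0 < t \<Longrightarrow> b t x y = enn2real (B t x y)"
 shows "represents (pos_half_distr a (neg_half b f)) (half_power_op f)"
 unfolding represents_def
proof (intro allI impI)
 fix \<phi> :: "'a \<Rightarrow> real" assume \<phi>: "test_fun \<phi>"
 have "jmeas (TT A B)" by (rule TT_measurable[OF A_meas B_meas]) measurable
 note i = pint_iter(2,3)[OF this test_fun_measurable[OF f] test_fun_measurable[OF \<phi>] pfin_TT[OF f \<phi>]]
 have "integrable lborel (\<lambda>x. f x * \<phi> x)" by (rule integrable_mult_test_fun[OF test_fun_integrable[OF f] \<phi>])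
 then show "(LINT x|lborel. half_power_op f x * \<phi> x) = pos_half_distr a (neg_half b f) \<phi>"
  using i weak_formula[of f \<phi> a b, OF f \<phi> a b] by (simp add: half_power_op_def left_diff_distrib mult.assoc)
qed

text \<open>Density of test functions and boundedness of \<open>half_power_op\<close> on L^1 make
  the choice in \<open>comp_op\<close> nonvacuous. Any admissible choice agrees almost everywhere
  with \<open>half_power_op f\<close>, since the approximating functions are determined by the
  distributions they represent.\<close>

lemma comp_op_eq:
 assumes f: "integrable lborel f"
  and a: "\<And>t x y. 0 < t \<Longrightarrow> a t x y = enn2real (A t x y)" and b: "\<And>t x y. 0 < t \<Longrightarrow> b t x y = enn2real (B t x y)"
 shows "integrable lborel (comp_op a b f)" "AE x in lborel. comp_op a b f x = half_power_op f x"
proof -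
 let ?P = "\<lambda>h. integrable lborel h \<and>
     (\<exists>fs hs. (\<forall>n. test_fun (fs n) \<and> integrable lborel (hs n) \<and>
                    represents (pos_half_distr a (neg_half b (fs n))) (hs n)) \<and>
             (\<lambda>n. LINT x|lborel. \<bar>fs n x - f x\<bar>) \<longlonglongrightarrow> 0 \<and>
             (\<lambda>n. LINT x|lborel. \<bar>hs n x - h x\<bar>) \<longlonglongrightarrow> 0)"
 have lim: "(\<lambda>n. LINT x|lborel. \<bar>half_power_op (fs n) x - half_power_op f x\<bar>) \<longlonglongrightarrow> 0"
  if "\<And>n. test_fun (fs n)" "(\<lambda>n. LINT x|lborel. \<bar>fs n x - f x\<bar>) \<longlonglongrightarrow> 0" for fs :: "nat \<Rightarrow> 'a \<Rightarrow> real"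
 proof (rule tendsto_sandwich[OF _ _ tendsto_const])
  show "(\<lambda>n. (1 + M) * (LINT x|lborel. \<bar>fs n x - f x\<bar>)) \<longlonglongrightarrow> 0" by (intro tendsto_mult_right_zero that)
 qed (use half_power_op_dist[OF test_fun_integrable[OF that(1)] f] in auto)
 obtain fs where fs: "\<And>n. test_fun (fs n)" "(\<lambda>n. LINT x|lborel. \<bar>fs n x - f x\<bar>) \<longlonglongrightarrow> 0"
  using test_fun_dense[OF f] by blast
 have "?P (half_power_op f)"
  using fs lim[OF fs] half_power_op_integrable f test_fun_integrable half_power_op_represents[OF _ a b]
  by (intro conjI exI[of _ fs] exI[of _ "\<lambda>n. half_power_op (fs n)"]) auto
 then have "?P (comp_op a b f)" unfolding comp_op_def by (rule someI[of ?P])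
 then obtain fs hs where hi: "integrable lborel (comp_op a b f)"
  and fs: "\<And>n. test_fun (fs n)" "(\<lambda>n. LINT x|lborel. \<bar>fs n x - f x\<bar>) \<longlonglongrightarrow> 0"
  and hs: "\<And>n. integrable lborel (hs n)" "\<And>n. represents (pos_half_distr a (neg_half b (fs n))) (hs n)"
   "(\<lambda>n. LINT x|lborel. \<bar>hs n x - comp_op a b f x\<bar>) \<longlonglongrightarrow> 0" by blast
 show "integrable lborel (comp_op a b f)" by (rule hi)
 note fsi = test_fun_integrable[OF fs(1)]
 let ?h = "comp_op a b f"
 have ae: "AE x in lborel. hs n x = half_power_op (fs n) x" for n
 proof -
  have "AE x in lborel. hs n x - half_power_op (fs n) x = 0"
  proof (rule test_fun_separating)
   show "integrable lborel (\<lambda>x. hs n x - half_power_op (fs n) x)" using hs(1) half_power_op_integrable[OF fsi] by simp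
   fix \<phi> :: "'a \<Rightarrow> real" assume \<phi>: "test_fun \<phi>"
   show "(LINT x|lborel. (hs n x - half_power_op (fs n) x) * \<phi> x) = 0"
    using hs(1,2) half_power_op_integrable[OF fsi] half_power_op_represents[OF fs(1) a b] \<phi>
    by (simp add: integrable_mult_test_fun left_diff_distrib represents_def)
  qed
  then show ?thesis by simp
 qed
 have "(LINT x|lborel. \<bar>?h x - half_power_op f x\<bar>) \<le> (LINT x|lborel. \<bar>hs n x - ?h x\<bar>) + (LINT x|lborel. \<bar>half_power_op (fs n) x - half_power_op f x\<bar>)" for n
 proof -
  have "(LINT x|lborel. \<bar>?h x - half_power_op f x\<bar>) \<le> (LINT x|lborel. \<bar>hs n x - ?h x\<bar> + \<bar>half_power_op (fs n) x - half_power_op f x\<bar>)"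
   by (rule integral_mono_AE, use hi hs(1) half_power_op_integrable[OF f] half_power_op_integrable[OF fsi] in simp_all)
    (use ae[of n] in eventually_elim, auto)
  then show ?thesis using hi hs(1) half_power_op_integrable[OF f] half_power_op_integrable[OF fsi] by simp
 qed
 moreover have "(\<lambda>n. (LINT x|lborel. \<bar>hs n x - ?h x\<bar>) + (LINT x|lborel. \<bar>half_power_op (fs n) x - half_power_op f x\<bar>)) \<longlonglongrightarrow> 0 + 0"
  by (intro tendsto_add hs(3) lim fs)
 ultimately have "(LINT x|lborel. \<bar>?h x - half_power_op f x\<bar>) \<le> 0"
  by (intro tendsto_lowerbound[of _ _ sequentially]) auto
 then have "(LINT x|lborel. \<bar>?h x - half_power_op f x\<bar>) = 0" by (simp add: antisym)
 then show "AE x in lborel. ?h x = half_power_op f x"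
  using integral_nonneg_eq_0_iff_AE[of lborel "\<lambda>x. \<bar>?h x - half_power_op f x\<bar>"] hi half_power_op_integrable[OF f] by simp
qed

end

text \<open>Where both kernels are finite the two inequalities say |T - S| \<le> Q; where f is
  nonzero, infinite values occur only on a null set of y.\<close>

lemma opk_diff_le:
 fixes T S :: "'a::euclidean_space \<Rightarrow> 'a \<Rightarrow> ennreal"
 assumes [measurable]: "T x \<in> borel_measurable borel" "S x \<in> borel_measurable borel" and f [measurable]: "f \<in> borel_measurable borel"
  and T: "(NN y. T x y * ennreal \<bar>f y\<bar>) < top" and S: "(NN y. S x y * ennreal \<bar>f y\<bar>) < top"
  and Q: "\<And>y. T x y \<le> S x y + Q y" "\<And>y. S x y \<le> T x y + Q y"
 shows "ennreal \<bar>opk T f x - opk S f x\<bar> \<le> (NN y. Q y * ennreal \<bar>f y\<bar>)"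
proof -
 define p q where "p = T x" and "q = S x"
 note [measurable] = assms(1)[folded p_def] assms(2)[folded q_def]
 have "opk T f x - opk S f x = (LINT y|lborel. (enn2real (T x y) - enn2real (S x y)) * f y)"
  using opk_integrable_at(1)[where T = T and x = x, OF assms(1) f T] opk_integrable_at(1)[where T = S and x = x, OF assms(2) f S]
  by (simp add: opk_def left_diff_distrib)
 then have "ennreal \<bar>opk T f x - opk S f x\<bar> \<le> (NN y. ennreal \<bar>(enn2real (T x y) - enn2real (S x y)) * f y\<bar>)"
  by (simp only: integral_norm_le_nn)
 also have "\<dots> \<le> (NN y. Q y * ennreal \<bar>f y\<bar>)"
 proof (rule nn_integral_mono_AE)
  have "AE y in lborel. p y * ennreal \<bar>f y\<bar> \<noteq> \<infinity>" "AE y in lborel. q y * ennreal \<bar>f y\<bar> \<noteq> \<infinity>"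
   using T S unfolding p_def[symmetric] q_def[symmetric] by (intro nn_integral_noteq_infinite; simp)+
  then show "AE y in lborel. ennreal \<bar>(enn2real (T x y) - enn2real (S x y)) * f y\<bar> \<le> Q y * ennreal \<bar>f y\<bar>"
  proof eventually_elim
   case (elim y)
   show ?case
   proof (cases "f y = 0")
    case False
    then have "p y < top" "q y < top" using elim by (cases "p y"; cases "q y"; auto simp: ennreal_top_mult)+
    then obtain a b where ab: "0 \<le> a" "0 \<le> b" "T x y = ennreal a" "S x y = ennreal b"
     unfolding p_def q_def by (metis ennreal_cases less_irrefl)
    have "ennreal \<bar>a - b\<bar> \<le> Q y"
    proof (cases "Q y")
     case (real c)
     then have "a \<le> b + c" "b \<le> a + c" using Q[of y] ab by (simp_all flip: ennreal_plus)
     then show ?thesis using real by (auto simp: abs_if)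
    qed simp
    then show ?thesis using ab by (simp add: abs_mult ennreal_mult mult_right_mono)
   qed simp
  qed
 qed
 finally show ?thesis .
qed

text \<open>The maximal functions need not be measurable, so additivity of the integral is replaced by
 this inequality, which holds for arbitrary \<open>f\<close>.\<close>
lemma nn_integral_add_le:
 assumes g [measurable]: "g \<in> borel_measurable M"
 shows "(\<integral>\<^sup>+x. f x + g x \<partial>M) \<le> (\<integral>\<^sup>+x. f x \<partial>M) + (\<integral>\<^sup>+x. g x \<partial>M)"
proof (cases "(\<integral>\<^sup>+x. g x \<partial>M) = \<infinity>")
 case False
 show ?thesis unfolding nn_integral_def[of M "\<lambda>x. f x + g x"]
 proof (rule SUP_least)
  fix s assume "s \<in> {s. simple_function M s \<and> s \<le> (\<lambda>x. f x + g x)}"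
  then have s: "simple_function M s" "\<And>x. s x \<le> f x + g x" by (auto simp: le_fun_def)
  note [measurable] = borel_measurable_simple_function[OF s(1)]
  have "integral\<^sup>S M s = (\<integral>\<^sup>+x. s x \<partial>M)" using s(1) by (simp add: nn_integral_eq_simple_integral)
  also have "\<dots> \<le> (\<integral>\<^sup>+x. (s x - g x) + g x \<partial>M)"
   by (intro nn_integral_mono) (metis add.commute ennreal_le_add_diff)
  also have "\<dots> = (\<integral>\<^sup>+x. s x - g x \<partial>M) + (\<integral>\<^sup>+x. g x \<partial>M)" by (rule nn_integral_add) measurable
  also have "(\<integral>\<^sup>+x. s x - g x \<partial>M) \<le> (\<integral>\<^sup>+x. f x \<partial>M)"
   by (rule nn_integral_mono_AE, use nn_integral_noteq_infinite[OF g False] in eventually_elim)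
    (use s(2) in \<open>simp add: ennreal_minus_le_iff add.commute\<close>)
  finally show "integral\<^sup>S M s \<le> (\<integral>\<^sup>+x. f x \<partial>M) + (\<integral>\<^sup>+x. g x \<partial>M)" by (simp add: add_right_mono)
 qed
qed simp

section \<open>The isomorphism\<close>

text \<open>A single time t suffices: B_t f is close to f in L^1 for small t, and |B_t f| lies below
  the maximal function. The closeness is first obtained for a test function g near f and then
  transferred because B_t is a contraction on L^1.\<close>

lemma (in schr_pair) L1_le_hardy_norm:
 assumes f: "integrable lborel f" and k: "\<And>t x y. 0 < t \<Longrightarrow> k t x y = enn2real (B t x y)"
 shows "(NN x. ennreal \<bar>f x\<bar>) \<le> hardy_norm k f"
proof (rule ennreal_le_epsilon)
 fix e :: real assume e: "0 < e"
 note [measurable] = kmeasD[OF B_meas] borel_measurable_integrable[OF f, simplified]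
 obtain gs where gs: "\<And>n. test_fun (gs n)" "(\<lambda>n. LINT x|lborel. \<bar>gs n x - f x\<bar>) \<longlonglongrightarrow> 0"
  using test_fun_dense[OF f] by blast
 from order_tendstoD(2)[OF gs(2), of "e / 3"] e obtain n where n: "(LINT x|lborel. \<bar>gs n x - f x\<bar>) < e / 3"
  by (auto simp: eventually_sequentially)
 define g where "g = gs n"
 have g: "test_fun g" "integrable lborel g" "(LINT x|lborel. \<bar>g x - f x\<bar>) < e / 3"
  using gs(1) n by (auto simp: g_def intro: test_fun_integrable)
 have gf: "integrable lborel (\<lambda>x. g x - f x)" using f g(2) by simp
 obtain C where C: "C \<ge> 0" "\<And>t T D. 0 < t \<Longrightarrow> t \<le> 1 \<Longrightarrow> jmeas T \<Longrightarrow> jmeas D \<Longrightarrow> (\<And>x y. T x y + D x y = hk t x y)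
   \<Longrightarrow> (\<And>x y. D x y \<le> ck hk v hk t x y) \<Longrightarrow> (NN x. ennreal \<bar>opk T g x - g x\<bar>) \<le> ennreal (C * t)"
  using approx_test_fun[OF g(1)] by blast
 obtain D where D: "kmeas D" "\<And>t x y. B t x y + D t x y = hk t x y" "\<And>t x y. D t x y \<le> ck hk v hk t x y"
  using B_dual by blast
 \<comment> \<open>Chosen so that t \<le> 1 and C t \<le> e/3; the other two thirds of e pay for |g
   - f| and for its image under B_t.\<close>
 define t where "t = min 1 (e / (3 * (C + 1)))"
 have t: "0 < t" "t \<le> 1" using e C(1) by (auto simp: t_def)
 have "t \<le> e / (3 * (C + 1))" by (simp add: t_def)
 then have "t * (3 * (C + 1)) \<le> e" using C(1) by (simp add: pos_le_divide_eq)
 then have Ct: "C * t \<le> e / 3" using t by (simp add: algebra_simps)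
 note lB = l1k_B[OF t(1)]
 have fm: "f \<in> borel_measurable borel" by measurable
 note [measurable] = test_fun_measurable[OF g(1)] opk_measurable[OF lB test_fun_measurable[OF g(1)]] opk_measurable[OF lB fm]
 let ?d = "opk (B t) (\<lambda>x. g x - f x)"
 have [measurable]: "?d \<in> borel_measurable borel" by (rule opk_measurable[OF lB]) measurable
 have "(NN x. ennreal \<bar>f x\<bar>) \<le> (NN x. ennreal \<bar>g x - f x\<bar> + ennreal \<bar>opk (B t) g x - g x\<bar> + ennreal \<bar>?d x\<bar> + ennreal \<bar>kop k t f x\<bar>)"
 proof (rule nn_integral_mono_AE, use opk_diff_AE(1)[OF lB g(2) f] in eventually_elim)
  fix x assume x: "?d x = opk (B t) g x - opk (B t) f x"
  have "kop k t f x = opk (B t) f x" using t by (simp add: kop_def opk_def k)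
  then have "\<bar>f x\<bar> \<le> \<bar>g x - f x\<bar> + \<bar>opk (B t) g x - g x\<bar> + \<bar>?d x\<bar> + \<bar>kop k t f x\<bar>" using x by linarith
  then show "ennreal \<bar>f x\<bar> \<le> ennreal \<bar>g x - f x\<bar> + ennreal \<bar>opk (B t) g x - g x\<bar> + ennreal \<bar>?d x\<bar> + ennreal \<bar>kop k t f x\<bar>"
   by (simp add: ennreal_leI flip: ennreal_plus)
 qed
 also have "\<dots> = (NN x. ennreal \<bar>g x - f x\<bar>) + (NN x. ennreal \<bar>opk (B t) g x - g x\<bar>) + (NN x. ennreal \<bar>?d x\<bar>) + (NN x. ennreal \<bar>kop k t f x\<bar>)"
 proof -
  have "kop k t f = opk (B t) f" using t by (auto simp: kop_def opk_def k)
  then show ?thesis by (simp add: nn_integral_add)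
 qed
 also have "\<dots> \<le> ennreal (e / 3) + ennreal (e / 3) + ennreal (e / 3) + hardy_norm k f"
 proof (intro add_mono)
  show 1: "(NN x. ennreal \<bar>g x - f x\<bar>) \<le> ennreal (e / 3)"
   unfolding integrable_nn(1)[OF gf] using g(3) by (intro ennreal_leI) simp
  have "(NN x. ennreal \<bar>opk (B t) g x - g x\<bar>) \<le> ennreal (C * t)"
   by (rule C(2)[OF t, where D = "D t"]) (use D in \<open>auto intro: jmeas_slice B_meas\<close>)
  then show "(NN x. ennreal \<bar>opk (B t) g x - g x\<bar>) \<le> ennreal (e / 3)" using Ct by (meson ennreal_leI order_trans)
  show "(NN x. ennreal \<bar>?d x\<bar>) \<le> ennreal (e / 3)" using order_trans[OF opk_integrable(3)[OF lB gf]] 1 by simp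
  show "(NN x. ennreal \<bar>kop k t f x\<bar>) \<le> hardy_norm k f"
   unfolding hardy_norm_def max_fun_def using t by (intro nn_integral_mono SUP_upper) auto
 qed
 also have "\<dots> = hardy_norm k f + ennreal e" using e by (simp add: add.commute flip: ennreal_plus)
 finally show "(NN x. ennreal \<bar>f x\<bar>) \<le> hardy_norm k f + ennreal e" .
qed

context schr
begin

lemma heat_kernel_eq: "0 < t \<Longrightarrow> heat_kernel t x y = enn2real (hk t x y)"
 by (simp add: heat_kernel_def hk_def)

lemma schr_kernel_eq: "schr_kernel V t x y = enn2real (K t x y)"
 by (simp add: K_def schr_kernel_nonneg)

text \<open>By P = K + P V K, the difference P_t h - K_t f is (P V K)_t f - P_t T(P,K) f, so
  \<open>maximal_compare\<close> bounds it by one function for all t. The function h is prescribed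
  only almost everywhere, as for \<open>RL V f\<close>.\<close>

lemma hardy_norm_compare:
 obtains C where "0 \<le> C" "\<And>f h. integrable lborel f \<Longrightarrow> h \<in> borel_measurable borel \<Longrightarrow> AE x in lborel. h x = f x - opk (TT hk K) f x \<Longrightarrow>
   hardy_norm heat_kernel h \<le> hardy_norm (schr_kernel V) f + ennreal C * (NN x. ennreal \<bar>f x\<bar>) \<and>
   hardy_norm (schr_kernel V) f \<le> hardy_norm heat_kernel h + ennreal C * (NN x. ennreal \<bar>f x\<bar>)"
proof -
 obtain Q C where Q: "l1k Q C"
  "\<And>t x y. 0 < t \<Longrightarrow> ck hk v K t x y \<le> kprod (hk t) (TT hk K) x y + Q x y"
  "\<And>t x y. 0 < t \<Longrightarrow> kprod (hk t) (TT hk K) x y \<le> ck hk v K t x y + Q x y"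
  using maximal_compare by metis
 show ?thesis
 proof (rule that[OF l1k_nonneg[OF Q(1)]])
  fix f h :: "'a \<Rightarrow> real" assume f: "integrable lborel f" and hm [measurable]: "h \<in> borel_measurable borel"
   and h: "AE x in lborel. h x = f x - opk (TT hk K) f x"
  let ?T = "TT hk K"
  have ckm: "kmeas (ck hk v K)" by (rule kmeas_ck[OF kmeas_hk kmeas_K]) measurable
  have fm: "f \<in> borel_measurable borel" using borel_measurable_integrable[OF f] by simp
  note [measurable] = fm l1k_measurable[OF l1k_TT_PK] l1k_measurable[OF Q(1)] kmeasD[OF ckm] kmeasD[OF kmeas_K]
   opk_measurable[OF l1k_TT_PK fm]
  define q where "q x = (NN y. Q x y * ennreal \<bar>f y\<bar>)" for x
  have [measurable]: "q \<in> borel_measurable borel" unfolding q_def[abs_def] by measurable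
  have q: "(NN x. q x) \<le> ennreal C * (NN x. ennreal \<bar>f x\<bar>)"
   unfolding q_def by (rule l1k_L1_bound[OF Q(1)]) measurable
  have close: "ennreal \<bar>kop heat_kernel t h x - kop (schr_kernel V) t f x\<bar> \<le> q x" if t: "0 < t" for t x
  proof -
   obtain c where c: "\<And>x y :: 'a. hk t x y \<le> ennreal c" using hk_sup[OF t] by (metis order_refl)
   have fin: "(NN y. hk t x y * ennreal \<bar>u y\<bar>) < top" if "integrable lborel u" for u
   proof -
    have "(NN y. hk t x y * ennreal \<bar>u y\<bar>) \<le> (NN y. ennreal c * ennreal \<bar>u y\<bar>)"
     by (intro nn_integral_mono mult_right_mono c) simp
    also have "\<dots> < top" using integrable_nn(2)[OF that] borel_measurable_integrable[OF that]
     by (simp add: nn_integral_cmult ennreal_mult_less_top)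
    finally show ?thesis .
   qed
   have ck_le: "ck hk v K t x y \<le> hk t x y" for y
    unfolding K_left[of t x y, symmetric] by (rule add_increasing) simp_all
   have fin_le: "(NN y. S y * ennreal \<bar>f y\<bar>) < top" if "\<And>y. S y \<le> hk t x y" for S
    by (rule order_le_less_trans[OF nn_integral_mono fin[OF f]]) (simp add: mult_right_mono that)
   have Tf: "integrable lborel (opk ?T f)" by (rule opk_integrable(1)[OF l1k_TT_PK f])
   have comp: "(NN z. NN y. hk t x z * (?T z y * ennreal \<bar>f y\<bar>)) < top"
   proof -
    have "(NN z. NN y. hk t x z * (?T z y * ennreal \<bar>f y\<bar>)) \<le> (NN z. NN y. ennreal c * (?T z y * ennreal \<bar>f y\<bar>))"
     by (intro nn_integral_mono mult_right_mono c) simp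
    also have "\<dots> = ennreal c * (NN z. NN y. ?T z y * ennreal \<bar>f y\<bar>)" by (simp add: nn_integral_cmult)
    also have "\<dots> \<le> ennreal c * (ennreal M * (NN y. ennreal \<bar>f y\<bar>))"
     by (intro mult_left_mono l1k_L1_bound[OF l1k_TT_PK]) auto
    also have "\<dots> < top" using integrable_nn(2)[OF f] by (simp add: ennreal_mult_less_top)
    finally show ?thesis .
   qed
   have kfin: "(NN y. kprod (hk t) ?T x y * ennreal \<bar>f y\<bar>) < top"
   proof -
    have "(NN y. kprod (hk t) ?T x y * ennreal \<bar>f y\<bar>) = (NN y. NN z. hk t x z * ?T z y * ennreal \<bar>f y\<bar>)"
     unfolding kprod_def by (simp add: nn_integral_multc)
    also have "\<dots> = (NN z. NN y. hk t x z * ?T z y * ennreal \<bar>f y\<bar>)" by (rule nn_integral_swap) measurable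
    finally show ?thesis using comp by (simp add: mult.assoc)
   qed
   have "kop heat_kernel t h x = opk (hk t) h x" using t by (simp add: kop_def opk_def heat_kernel_eq)
   also have "\<dots> = opk (hk t) (\<lambda>y. f y - opk ?T f y) x" by (rule opk_cong_AE[OF _ _ _ h]) measurable
   also have "\<dots> = opk (hk t) f x - opk (hk t) (opk ?T f) x"
    by (intro opk_diff_at(1) opk_integrable_at(1) fin f Tf) measurable
   also have "opk (hk t) (opk ?T f) x = opk (kprod (hk t) ?T) f x"
    by (rule opk_comp_at[where T = "hk t" and S = ?T and x = x and f = f, OF _ _ _ comp]) measurable
   finally have 1: "kop heat_kernel t h x = opk (hk t) f x - opk (kprod (hk t) ?T) f x" .
   have "enn2real (hk t x y) = enn2real (K t x y) + enn2real (ck hk v K t x y)" for y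
    unfolding K_left[of t x y, symmetric] using K_finite(1) order_le_less_trans[OF ck_le hk_finite(1)] by (rule enn2real_plus)
   then have "opk (hk t) f x = opk (K t) f x + opk (ck hk v K t) f x"
    using opk_integrable_at(1)[of "K t" x f] opk_integrable_at(1)[of "ck hk v K t" x f] fin_le[OF K_le] fin_le[OF ck_le]
    by (simp add: opk_def distrib_right)
   moreover have "kop (schr_kernel V) t f x = opk (K t) f x" by (simp add: kop_def opk_def schr_kernel_eq)
   ultimately have "kop heat_kernel t h x - kop (schr_kernel V) t f x = opk (ck hk v K t) f x - opk (kprod (hk t) ?T) f x"
    using 1 by simp
   moreover have "ennreal \<bar>opk (ck hk v K t) f x - opk (kprod (hk t) ?T) f x\<bar> \<le> q x"
    unfolding q_def by (rule opk_diff_le[where T = "ck hk v K t" and S = "kprod (hk t) ?T" and x = x and Q = "Q x", OF _ _ fm fin_le[OF ck_le] kfin Q(2,3)[OF t]])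
     (measurable, simp add: kprod_def[abs_def])
   ultimately show ?thesis by simp
  qed
  have max_le: "max_fun k u x \<le> max_fun k' u' x + q x"
   if "\<And>t. 0 < t \<Longrightarrow> ennreal \<bar>kop k t u x - kop k' t u' x\<bar> \<le> q x" for k k' u u' x
   unfolding max_fun_def[of k]
  proof (rule SUP_least)
   fix t :: real assume t: "t \<in> {0<..}"
   have "ennreal \<bar>kop k t u x\<bar> \<le> ennreal \<bar>kop k' t u' x\<bar> + ennreal \<bar>kop k t u x - kop k' t u' x\<bar>"
    by (simp add: ennreal_leI flip: ennreal_plus)
   also have "\<dots> \<le> max_fun k' u' x + q x"
    unfolding max_fun_def using t that by (intro add_mono SUP_upper2[of t]) auto
   finally show "ennreal \<bar>kop k t u x\<bar> \<le> max_fun k' u' x + q x" .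
  qed
  have hardy_le: "hardy_norm k u \<le> hardy_norm k' u' + ennreal C * (NN x. ennreal \<bar>f x\<bar>)"
   if "\<And>t x. 0 < t \<Longrightarrow> ennreal \<bar>kop k t u x - kop k' t u' x\<bar> \<le> q x" for k k' :: "real \<Rightarrow> 'a \<Rightarrow> 'a \<Rightarrow> real" and u u'
  proof -
   have "hardy_norm k u \<le> (NN x. max_fun k' u' x + q x)"
    unfolding hardy_norm_def by (intro nn_integral_mono max_le that)
   also have "\<dots> \<le> hardy_norm k' u' + (NN x. q x)"
    unfolding hardy_norm_def by (rule nn_integral_add_le) measurable
   finally show ?thesis using q by (meson add_left_mono order_trans)
  qed
  show "hardy_norm heat_kernel h \<le> hardy_norm (schr_kernel V) f + ennreal C * (NN x. ennreal \<bar>f x\<bar>) \<and>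
    hardy_norm (schr_kernel V) f \<le> hardy_norm heat_kernel h + ennreal C * (NN x. ennreal \<bar>f x\<bar>)"
   using close by (intro conjI hardy_le) (simp_all add: abs_minus_commute)
 qed
qed

lemma schr_pair_PK: "schr_pair V M hk K 1"
proof
 show "\<exists>D. kmeas D \<and> (\<forall>t x y. K t x y + D t x y = hk t x y \<and> D t x y \<le> ck hk v hk t x y)"
  by (intro exI[of _ "ck hk v K"] conjI allI kmeas_ck kmeas_hk kmeas_K K_left ck_mono K_le order_refl) measurable
qed (use K_left K_le kmeas_hk kmeas_K K_semigroup in auto)

text \<open>Here \<open>perturb\<close> is \<open>K_right\<close>, that is K + K V P = P, and the
  heat kernel has defect 0.\<close>

lemma schr_pair_KP: "schr_pair V M K hk (- 1)"
proof
 show "\<exists>D. kmeas D \<and> (\<forall>t x y. hk t x y + D t x y = hk t x y \<and> D t x y \<le> ck hk v hk t x y)"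
  by (intro exI[of _ "\<lambda>t x y. 0"]) (simp add: kmeas_def)
qed (use K_right K_le kmeas_hk kmeas_K hk_semigroup in auto)

lemma RL_eq:
 assumes "integrable lborel f"
 shows "integrable lborel (RL V f)" "AE x in lborel. RL V f x = f x - opk (TT hk K) f x"
 using schr_pair.comp_op_eq[OF schr_pair_PK assms, of heat_kernel "schr_kernel V"]
 by (simp_all add: RL_def heat_kernel_eq schr_kernel_eq schr_pair.half_power_op_def[OF schr_pair_PK])

lemma LR_eq:
 assumes "integrable lborel f"
 shows "integrable lborel (LR V f)" "AE x in lborel. LR V f x = f x + opk (TT K hk) f x"
 using schr_pair.comp_op_eq[OF schr_pair_KP assms, of "schr_kernel V" heat_kernel]
 by (simp_all add: LR_def heat_kernel_eq schr_kernel_eq schr_pair.half_power_op_def[OF schr_pair_KP])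

lemma LR_RL:
 assumes f: "integrable lborel f"
 shows "AE x in lborel. LR V (RL V f) x = f x"
proof -
 have m: "f \<in> borel_measurable borel" "RL V f \<in> borel_measurable borel"
  using f RL_eq(1)[OF f] by (auto dest: borel_measurable_integrable)
 have e: "opk (TT K hk) (RL V f) x = opk (TT K hk) (\<lambda>y. f y - opk (TT hk K) f y) x" for x
  by (intro opk_cong_AE l1k_slice[OF l1k_TT_KP] RL_eq(2)[OF f] m borel_measurable_diff opk_measurable[OF l1k_TT_PK])
 show ?thesis
  using LR_eq(2)[OF RL_eq(1)[OF f]] RL_eq(2)[OF f] inverse_ops(1)[OF f] by eventually_elim (simp add: e)
qed

lemma RL_LR:
 assumes f: "integrable lborel f"
 shows "AE x in lborel. f x = LR V f x - opk (TT hk K) (LR V f) x" "AE x in lborel. RL V (LR V f) x = f x"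
proof -
 have m: "f \<in> borel_measurable borel" "LR V f \<in> borel_measurable borel"
  using f LR_eq(1)[OF f] by (auto dest: borel_measurable_integrable)
 have e: "opk (TT hk K) (LR V f) x = opk (TT hk K) (\<lambda>y. f y + opk (TT K hk) f y) x" for x
  by (intro opk_cong_AE l1k_slice[OF l1k_TT_PK] LR_eq(2)[OF f] m borel_measurable_add opk_measurable[OF l1k_TT_KP])
 show 1: "AE x in lborel. f x = LR V f x - opk (TT hk K) (LR V f) x"
  using LR_eq(2)[OF f] inverse_ops(2)[OF f] by eventually_elim (simp add: e)
 show "AE x in lborel. RL V (LR V f) x = f x"
  using 1 RL_eq(2)[OF LR_eq(1)[OF f]] by eventually_elim simp
qed

text \<open>One comparison of norms serves both directions, because it bounds each Hardy norm by the
  other plus a multiple of the L^1 norm; the latter is absorbed by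
  \<open>L1_le_hardy_norm\<close>.\<close>

lemma isomorphism:
 "\<exists>C>0. (\<forall>f \<in> H1L V. RL V f \<in> H1 \<and>
    hardy_norm heat_kernel (RL V f) \<le> ennreal C * hardy_norm (schr_kernel V) f \<and> (AE x in lborel. LR V (RL V f) x = f x)) \<and>
  (\<forall>f \<in> H1. LR V f \<in> H1L V \<and>
    hardy_norm (schr_kernel V) (LR V f) \<le> ennreal C * hardy_norm heat_kernel f \<and> (AE x in lborel. RL V (LR V f) x = f x))"
proof -
 obtain C where C: "0 \<le> C" "\<And>f h. integrable lborel f \<Longrightarrow> h \<in> borel_measurable borel \<Longrightarrow> AE x in lborel. h x = f x - opk (TT hk K) f x \<Longrightarrow>
   hardy_norm heat_kernel h \<le> hardy_norm (schr_kernel V) f + ennreal C * (NN x. ennreal \<bar>f x\<bar>) \<and>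
   hardy_norm (schr_kernel V) f \<le> hardy_norm heat_kernel h + ennreal C * (NN x. ennreal \<bar>f x\<bar>)"
  by (rule hardy_norm_compare) (rule that, assumption+)
 \<comment> \<open>The factor 1 + M is the L^1 norm bound of I + T(K,P), needed for the inverse
   direction; for the other direction 1 suffices.\<close>
 define C' where "C' = 1 + C * (1 + M)"
 have C': "0 < C'" "1 + C \<le> C'" using C(1) M_nonneg by (auto simp: C'_def distrib_left add_pos_nonneg)
 have combine: "X \<le> ennreal C' * Y" if "X \<le> Y + ennreal C * (ennreal m * Y)" "0 \<le> m" "m \<le> 1 + M" for X Y m
 proof -
  have "ennreal (1 + C * m) = 1 + ennreal C * ennreal m" using that C(1) by (simp add: ennreal_mult)
  then have "Y + ennreal C * (ennreal m * Y) = ennreal (1 + C * m) * Y" by (simp add: distrib_right mult.assoc)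
  also have "\<dots> \<le> ennreal C' * Y"
   using that C(1) by (intro mult_right_mono ennreal_leI) (auto simp: C'_def intro!: mult_left_mono)
  finally show ?thesis using that(1) by (rule order_trans[rotated])
 qed
 show ?thesis
 proof (intro exI[of _ C'] conjI ballI C'(1))
  fix f assume "f \<in> H1L V"
  then have f: "integrable lborel f" "hardy_norm (schr_kernel V) f < \<infinity>" by (auto simp: hardy_space_def)
  have n: "(NN x. ennreal \<bar>f x\<bar>) \<le> hardy_norm (schr_kernel V) f"
   by (rule schr_pair.L1_le_hardy_norm[OF schr_pair_PK f(1)]) (rule schr_kernel_eq)
  have "hardy_norm heat_kernel (RL V f) \<le> hardy_norm (schr_kernel V) f + ennreal C * (NN x. ennreal \<bar>f x\<bar>)"
   using C(2)[OF f(1) _ RL_eq(2)[OF f(1)]] borel_measurable_integrable[OF RL_eq(1)[OF f(1)]] by simp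
  also have "\<dots> \<le> hardy_norm (schr_kernel V) f + ennreal C * (ennreal 1 * hardy_norm (schr_kernel V) f)"
   using n by (intro add_left_mono mult_left_mono) auto
  finally show b: "hardy_norm heat_kernel (RL V f) \<le> ennreal C' * hardy_norm (schr_kernel V) f"
   by (rule combine) (use M_nonneg in auto)
  show "RL V f \<in> H1"
   using RL_eq(1)[OF f(1)] order_le_less_trans[OF b] f(2) by (simp add: hardy_space_def ennreal_mult_less_top)
  show "AE x in lborel. LR V (RL V f) x = f x" by (rule LR_RL[OF f(1)])
 next
  fix f :: "'a \<Rightarrow> real" assume "f \<in> H1"
  then have f: "integrable lborel f" "hardy_norm heat_kernel f < \<infinity>" by (auto simp: hardy_space_def)
  have "(NN x. ennreal \<bar>LR V f x\<bar>) \<le> (NN x. ennreal \<bar>f x\<bar> + ennreal \<bar>opk (TT K hk) f x\<bar>)"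
   by (rule nn_integral_mono_AE, use LR_eq(2)[OF f(1)] in eventually_elim) (simp add: ennreal_leI flip: ennreal_plus)
  also have "\<dots> = (NN x. ennreal \<bar>f x\<bar>) + (NN x. ennreal \<bar>opk (TT K hk) f x\<bar>)"
   using f(1) opk_integrable(1)[OF l1k_TT_KP f(1)] by (intro nn_integral_add) auto
  also have "\<dots> \<le> ennreal 1 * (NN x. ennreal \<bar>f x\<bar>) + ennreal M * (NN x. ennreal \<bar>f x\<bar>)"
   using opk_integrable(3)[OF l1k_TT_KP f(1)] by (simp add: add_left_mono)
  also have "\<dots> = ennreal (1 + M) * (NN x. ennreal \<bar>f x\<bar>)"
   using M_nonneg by (simp add: distrib_right del: ennreal_1)
  also have "\<dots> \<le> ennreal (1 + M) * hardy_norm heat_kernel f"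
   by (intro mult_left_mono schr_pair.L1_le_hardy_norm[OF schr_pair_KP f(1)] heat_kernel_eq) auto
  finally have n: "(NN x. ennreal \<bar>LR V f x\<bar>) \<le> ennreal (1 + M) * hardy_norm heat_kernel f" .
  \<comment> \<open>The comparison is read backwards, with \<open>LR V f\<close> as the function and
    f as its image; this is legitimate by \<open>RL_LR\<close>.\<close>
  have "hardy_norm (schr_kernel V) (LR V f) \<le> hardy_norm heat_kernel f + ennreal C * (NN x. ennreal \<bar>LR V f x\<bar>)"
   using C(2)[OF LR_eq(1)[OF f(1)] _ RL_LR(1)[OF f(1)]] borel_measurable_integrable[OF f(1)] by simp
  also have "\<dots> \<le> hardy_norm heat_kernel f + ennreal C * (ennreal (1 + M) * hardy_norm heat_kernel f)"
   using n by (intro add_left_mono mult_left_mono) auto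
  finally show b: "hardy_norm (schr_kernel V) (LR V f) \<le> ennreal C' * hardy_norm heat_kernel f"
   by (rule combine) (use M_nonneg in auto)
  show "LR V f \<in> H1L V"
   using LR_eq(1)[OF f(1)] order_le_less_trans[OF b] f(2) by (simp add: hardy_space_def ennreal_mult_less_top)
  show "AE x in lborel. RL V (LR V f) x = f x" by (rule RL_LR(2)[OF f(1)])
 qed
qed

end

text \<open>An essential bound on the potential \<open>V * P\<close> holds everywhere: \<open>P s\<close> averages the
 potential of \<open>V\<close> into the part of its time integral beyond \<open>s\<close>.\<close>
lemma newton_bound_everywhere:
 fixes V :: "'a::euclidean_space \<Rightarrow> real"
 assumes dim: "DIM('a) \<ge> 3" and [measurable]: "V \<in> borel_measurable borel"
  and "\<exists>M::real. AE x in lborel. ennreal (c_dim TYPE('a)) * (\<integral>\<^sup>+ y. ennreal (V y / norm (x - y) ^ (DIM('a) - 2)) \<partial>lborel) \<le> ennreal M"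
 shows "\<exists>M\<ge>0. \<forall>y. (NN t. NN z. ennreal (V z) * hk t z y) \<le> ennreal M"
proof -
 obtain M where M: "AE x in lborel. ennreal (c_dim TYPE('a)) * (NN y. ennreal (V y / norm (x - y) ^ (DIM('a) - 2))) \<le> ennreal M"
  using assms(3) by blast
 obtain C where C: "C > 0" "\<And>x y::'a. x \<noteq> y \<Longrightarrow> (NN t. hk t x y) \<le> ennreal (C * norm (x - y) powr (2 - real DIM('a)))"
  using hk_time_integral_upper[OF dim] by blast
 define c where "c = c_dim TYPE('a)"
 have c: "0 < c" using dim by (auto simp: c_def c_dim_def intro!: divide_pos_pos Gamma_real_pos)
 \<comment> \<open>Division by c undoes the factor \<open>c_dim\<close>, C compares the time
   integral of the heat kernel with |x|^(2-d), and the maximum keeps the bound nonnegative.\<close>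
 define M' where "M' = C * (max 0 M / c)"
 define N where "N x = (NN t. NN z. ennreal (V z) * hk t z x)" for x
 have Nm [measurable]: "N \<in> borel_measurable borel" unfolding N_def[abs_def] by measurable
 have "AE x in lborel. N x \<le> ennreal M'"
  using M
 proof eventually_elim
  case (elim x)
  let ?I = "NN y. ennreal (V y / norm (x - y) ^ (DIM('a) - 2))"
  have "?I = ennreal (1 / c) * (ennreal c * ?I)" using c by (simp flip: mult.assoc ennreal_mult)
  also have "\<dots> \<le> ennreal (1 / c) * ennreal (max 0 M)"
   using elim by (intro mult_left_mono order_trans[OF elim[folded c_def]] ennreal_leI) auto
  also have "\<dots> = ennreal (max 0 M / c)" using c by (simp flip: ennreal_mult)
  finally have I: "?I \<le> ennreal (max 0 M / c)" .
  have "N x = (NN z. ennreal (V z) * (NN t. hk t z x))"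
   unfolding N_def by (subst nn_integral_swap) (measurable, simp add: nn_integral_cmult)
  also have "\<dots> \<le> (NN z. ennreal C * ennreal (V z / norm (x - z) ^ (DIM('a) - 2)))"
  proof (rule nn_integral_mono_AE, use AE_neq_lborel[of x] in eventually_elim)
   fix z assume z: "z \<noteq> x"
   have p: "norm (z - x) powr (2 - real DIM('a)) = 1 / norm (x - z) ^ (DIM('a) - 2)"
   proof -
    have "norm (z - x) powr (2 - real DIM('a)) = norm (z - x) powr - real (DIM('a) - 2)" using dim by (simp add: of_nat_diff)
    also have "\<dots> = 1 / norm (z - x) ^ (DIM('a) - 2)"
     using z by (simp only: powr_minus_divide) (subst powr_realpow, auto)
    finally show ?thesis by (simp only: norm_minus_commute[of z x])
   qed
   have "ennreal (V z) * (NN t. hk t z x) \<le> ennreal (V z) * ennreal (C * norm (z - x) powr (2 - real DIM('a)))"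
    by (intro mult_left_mono C z) simp
   also have "\<dots> = ennreal (C * (V z / norm (x - z) ^ (DIM('a) - 2)))"
    unfolding p using C by (cases "0 \<le> V z") (simp_all add: mult_ac ennreal_neg divide_nonpos_nonneg mult_nonneg_nonpos flip: ennreal_mult)
   also have "\<dots> = ennreal C * ennreal (V z / norm (x - z) ^ (DIM('a) - 2))" using C(1) by (intro ennreal_mult') simp
   finally show "ennreal (V z) * (NN t. hk t z x) \<le> ennreal C * ennreal (V z / norm (x - z) ^ (DIM('a) - 2))" .
  qed
  also have "\<dots> = ennreal C * ?I" by (rule nn_integral_cmult) measurable
  also have "\<dots> \<le> ennreal C * ennreal (max 0 M / c)" by (intro mult_left_mono I) simp
  also have "\<dots> = ennreal M'" using C(1) c by (simp add: M'_def flip: ennreal_mult)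
  finally show ?case .
 qed
 then have N: "AE x in lborel. N x \<le> ennreal M'" .
 have late: "(NN t. (NN z. ennreal (V z) * hk t z y) * indicator {s<..} t) \<le> ennreal M'" if s: "0 < s" for s y
 proof -
  have "(NN t. (NN z. ennreal (V z) * hk t z y) * indicator {s<..} t)
    = (NN t. (NN z. ennreal (V z) * hk (t + s) z y) * indicator {s<..} (t + s))"
   by (rule nn_integral_shift(2)[symmetric]) measurable
  also have "\<dots> = (NN t. NN x. (NN z. ennreal (V z) * hk t z x) * hk s x y)"
  proof (rule nn_integral_cong)
   fix t
   show "(NN z. ennreal (V z) * hk (t + s) z y) * indicator {s<..} (t + s) = (NN x. (NN z. ennreal (V z) * hk t z x) * hk s x y)"
   proof (cases "0 < t")
    case True
    have "(NN x. (NN z. ennreal (V z) * hk t z x) * hk s x y) = (NN x. NN z. ennreal (V z) * hk t z x * hk s x y)"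
     by (simp add: nn_integral_multc)
    also have "\<dots> = (NN z. NN x. ennreal (V z) * hk t z x * hk s x y)" by (rule nn_integral_swap) measurable
    also have "\<dots> = (NN z. ennreal (V z) * hk (t + s) z y)"
     unfolding mult.assoc by (simp add: nn_integral_cmult hk_semigroup[OF True s])
    finally show ?thesis using True by simp
   qed (simp add: hk_def)
  qed
  also have "\<dots> = (NN x. NN t. (NN z. ennreal (V z) * hk t z x) * hk s x y)" by (rule nn_integral_swap) measurable
  also have "\<dots> = (NN x. N x * hk s x y)" unfolding N_def by (simp add: nn_integral_multc)
  also have "\<dots> \<le> (NN x. ennreal M' * hk s x y)"
   by (rule nn_integral_mono_AE, use N in eventually_elim) (simp add: mult_right_mono)
  also have "\<dots> = ennreal M'" using s by (simp add: nn_integral_cmult nn_integral_hk)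
  finally show ?thesis .
 qed
 have "N y \<le> ennreal M'" for y
 proof -
  \<comment> \<open>The cut-off times 1/(n+1) decrease to 0, so monotone convergence recovers the
    full time integral from the bounds at positive s.\<close>
  let ?g = "\<lambda>n t. (NN z. ennreal (V z) * hk t z y) * indicator {1 / real (Suc n)<..} t"
  have "N y \<le> (NN t. SUP n. ?g n t)"
   unfolding N_def
  proof (rule nn_integral_mono)
   fix t :: real
   show "(NN z. ennreal (V z) * hk t z y) \<le> (SUP n. ?g n t)"
   proof (cases "0 < t")
    case True
    then obtain n where "1 / real (Suc n) < t" using nat_approx_posE by blast
    then show ?thesis by (intro SUP_upper2[of n]) auto
   qed (simp add: hk_def)
  qed
  also have "\<dots> = (SUP n. NN t. ?g n t)"
  proof (rule nn_integral_monotone_convergence_SUP)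
   show "incseq ?g"
   proof (intro monoI le_funI mult_left_mono)
    fix m n :: nat and t :: real assume "m \<le> n"
    then have "1 / real (Suc n) \<le> 1 / real (Suc m)" by (simp add: frac_le)
    then show "indicator {1 / real (Suc m)<..} t \<le> (indicator {1 / real (Suc n)<..} t :: ennreal)" by (auto simp: indicator_def)
   qed simp
  qed measurable
  also have "\<dots> \<le> ennreal M'" by (intro SUP_least late) simp
  finally show ?thesis .
 qed
 moreover have "0 \<le> M'" using C(1) c by (simp add: M'_def)
 ultimately show ?thesis unfolding N_def by blast
qed

theorem theorem1p1:
  fixes V :: "'a::euclidean_space \<Rightarrow> real"
  assumes dim: "DIM('a) \<ge> 3"
    and nonneg: "\<forall>x. 0 \<le> V x"
    and meas: "V \<in> borel_measurable lborel"
    and loc_int: "\<forall>K. compact K \<longrightarrow> set_integrable lborel K V"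
    and newton_bdd: "\<exists>M::real. AE x in lborel.
          ennreal (c_dim TYPE('a)) * (\<integral>\<^sup>+ y. ennreal (V y / norm (x - y) ^ (DIM('a) - 2)) \<partial>lborel)
            \<le> ennreal M"
  shows "\<exists>C>0.
     (\<forall>f \<in> H1L V. RL V f \<in> H1 \<and>
        hardy_norm heat_kernel (RL V f) \<le> ennreal C * hardy_norm (schr_kernel V) f \<and>
        (AE x in lborel. LR V (RL V f) x = f x)) \<and>
     (\<forall>f \<in> H1. LR V f \<in> H1L V \<and>
        hardy_norm (schr_kernel V) (LR V f) \<le> ennreal C * hardy_norm heat_kernel f \<and>
        (AE x in lborel. RL V (LR V f) x = f x))"
proof -
 have m: "V \<in> borel_measurable borel" using meas by simp
 obtain M where "0 \<le> M" "\<And>y. (NN t. NN z. ennreal (V z) * hk t z y) \<le> ennreal M"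
  using newton_bound_everywhere[OF dim m newton_bdd] by blast
 then interpret schr V M using dim nonneg m by unfold_locales auto
 show ?thesis by (rule isomorphism)
qed

end
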